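(* Let $\tfrac13<\alpha<2$, $c>0$, and let $Q_c$ be the ground state solitary wave of the fKdV equation with speed $c$. For $k\in\mathbb{R}$ let \[ L(k)=-\partial_x\left(D^\alpha+c-Q_c\right)\partial_x+k^2\colon H^{2+\alpha}(\mathbb{R})\to L^2(\mathbb{R}),\qquad A=-\partial_x . \] Then $Q_c$ is linearly unstable with respect to transverse perturbations under the fKP-I flow, i.e. there exist $\lambda\in\mathbb{C}$ with $\operatorname{Re}\lambda>0$, $k\in\mathbb{R}\setminus\{0\}$ and a nonzero $w_k\in H^{2+\alpha}(\mathbb{R})$ such that \[ \lambda A w_k=L(k)w_k . \]
   Context: $D^\alpha$ denotes the Fourier multiplier in $x$ with symbol $|\xi|^\alpha$. For $\tfrac13<\alpha<2$, $Q$ is the unique ground state of $D^\alpha Q+Q-Q^2=0$ (the even, positive, nontrivial minimizer in $H^{\alpha/2}(\mathbb{R})\setminus\{0\}$ of the Weinstein functional $J^\alpha(u)=\left(\int|u|^3\right)^{-1}\left(\int|D^{\alpha/2}u|^2\right)^{\frac{1}{2\alpha}}\left(\int|u|^2\right)^{\frac{\alpha-1}{2\alpha+1}}$); $Q\in H^{1+\alpha}(\mathbb{R})\cap C^\infty(\mathbb{R})$. The ground state solitary wave of speed $c>0$ is $Q_c(z)=2cQ(c^{1/\alpha}z)$, solving $D^\alpha Q_c+cQ_c-\tfrac12Q_c^2=0$. The eigenvalue problem arises from linearizing $(u_t-cu_x+uu_x-D^\alpha u_x)_x-u_{yy}=0$ about $Q_c$ with the ansatz $\psi=e^{\lambda t}\partial_x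 w(x)e^{iky}$.
   Formalization: In the Weinstein functional defining the ground state, the exponent of the integral of |u|^2 is taken as (3α-1)/(2α), i.e. (α-1)/(2α)+1, instead of the printed (α-1)/(2α+1), for which the functional is not scale-invariant and has no minimizer. *)

theory Defs
  imports "HOL-Analysis.Analysis"
begin

definition L2 :: "(real \<Rightarrow> complex) \<Rightarrow> bool" where
  "L2 u \<longleftrightarrow> u \<in> borel_measurable lborel \<and> integrable lborel (\<lambda>x. (cmod (u x))\<^sup>2)"

definition smooth_real :: "(real \<Rightarrow> real) \<Rightarrow> bool" where
  "smooth_real f \<longleftrightarrow> (\<forall>n x. ((deriv ^^ n) f) differentiable (at x))"

definition test_fun :: "(real \<Rightarrow> complex) \<Rightarrow> bool" where
  "test_fun \<phi> \<longleftrightarrow> smooth_real (\<lambda>x. Re (\<phi> x)) \<and> smooth_real (\<lambda>x. Im (\<phi> x)) \<and>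
     (\<exists>R. \<forall>x. R < \<bar>x\<bar> \<longrightarrow> \<phi> x = 0)"

definition fourier :: "(real \<Rightarrow> complex) \<Rightarrow> real \<Rightarrow> complex" where
  "fourier \<phi> \<xi> = (LINT x|lborel. \<phi> x * cis (- (x * \<xi>)))"

definition is_FT :: "(real \<Rightarrow> complex) \<Rightarrow> (real \<Rightarrow> complex) \<Rightarrow> bool" where
  "is_FT u U \<longleftrightarrow> L2 u \<and> L2 U \<and>
     (\<forall>\<phi>. test_fun \<phi> \<longrightarrow> (LINT \<xi>|lborel. U \<xi> * \<phi> \<xi>) = (LINT x|lborel. u x * fourier \<phi> x))"

definition Hsob :: "real \<Rightarrow> (real \<Rightarrow> complex) \<Rightarrow> bool" where
  "Hsob s u \<longleftrightarrow> (\<exists>U. is_FT u U \<and> L2 (\<lambda>\<xi>. complex_of_real ((1 + \<xi>\<^sup>2) powr (s / 2)) * U \<xi>))"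

definition mult_op :: "(real \<Rightarrow> complex) \<Rightarrow> (real \<Rightarrow> complex) \<Rightarrow> (real \<Rightarrow> complex) \<Rightarrow> bool" where
  "mult_op m u v \<longleftrightarrow> (\<exists>U. is_FT u U \<and> is_FT v (\<lambda>\<xi>. m \<xi> * U \<xi>))"

definition dx_sym :: "real \<Rightarrow> complex" where
  "dx_sym \<xi> = \<i> * complex_of_real \<xi>"

definition Dpow_sym :: "real \<Rightarrow> real \<Rightarrow> complex" where
  "Dpow_sym a \<xi> = complex_of_real (\<bar>\<xi>\<bar> powr a)"

definition cplx :: "(real \<Rightarrow> real) \<Rightarrow> real \<Rightarrow> complex" where
  "cplx u x = complex_of_real (u x)"

definition weinstein :: "real \<Rightarrow> (real \<Rightarrow> real) \<Rightarrow> real" where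
  "weinstein a u =
     inverse (LINT x|lborel. \<bar>u x\<bar> ^ 3) *
     (LINT x|lborel. (cmod ((SOME v. mult_op (Dpow_sym (a/2)) (cplx u) v) x))\<^sup>2) powr (1 / (2*a)) *
     (LINT x|lborel. (u x)\<^sup>2) powr ((3*a - 1) / (2*a))"

definition ground_state :: "real \<Rightarrow> (real \<Rightarrow> real) \<Rightarrow> bool" where
  "ground_state a Q \<longleftrightarrow>
     Hsob (a/2) (cplx Q) \<and> continuous_on UNIV Q \<and>
     (\<forall>x. Q (-x) = Q x) \<and> (\<forall>x. 0 < Q x) \<and>
     (\<forall>u. Hsob (a/2) (cplx u) \<and> \<not> (AE x in lborel. u x = 0) \<longrightarrow> weinstein a Q \<le> weinstein a u) \<and>
     (\<exists>v. mult_op (Dpow_sym a) (cplx Q) v \<and>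
        (AE x in lborel. v x + cplx Q x - (cplx Q x)\<^sup>2 = 0))"

definition Qc :: "real \<Rightarrow> (real \<Rightarrow> real) \<Rightarrow> real \<Rightarrow> real \<Rightarrow> real" where
  "Qc a Q c z = 2 * c * Q (c powr (1/a) * z)"

definition transverse_eig ::
  "real \<Rightarrow> (real \<Rightarrow> real) \<Rightarrow> real \<Rightarrow> complex \<Rightarrow> real \<Rightarrow> (real \<Rightarrow> complex) \<Rightarrow> bool" where
  "transverse_eig a Q c lam k w \<longleftrightarrow>
     Hsob (2 + a) w \<and>
     (\<exists>w1 w2 g g'. mult_op dx_sym w w1 \<and> mult_op (Dpow_sym a) w1 w2 \<and>
        g = (\<lambda>x. w2 x + complex_of_real c * w1 x - cplx (Qc a Q c) x * w1 x) \<and>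
        mult_op dx_sym g g' \<and>
        (AE x in lborel. lam * (- w1 x) = - g' x + complex_of_real (k\<^sup>2) * w x))"

end

(*
On the Fourier side, after scaling to c = 1, the eigenvalue equation for V = FT(w') reads
  (|x|^a + 1 + k/x^2 + i lam/x) V = (1/pi) q * V,   q = FT(Q),
with k standing for the square of the transverse wave number.  Conjugating with the square root
of the symbol at k = 1, lam = 0, and encoding the Hermitian function V by a real one, turns this
into Y - N Y + k N Y + lam R Y = T Y on real L^2, with T compact and symmetric.

At lam = 0 the form is indefinite for k = 0 (in the direction of Q itself) and positive for large k,
so at the least k for which it is nonnegative there is a kernel.  The kernel is simple: in a
two-dimensional kernel some nonzero h satisfies int Q^2 h = 0, and the second variation of the
Weinstein functional at its minimizer makes the form at k = 0 nonnegative on such h, whereas the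
kernel equation makes it negative.  A simple kernel persists under small perturbations: a contraction
argument on its orthogonal complement gives, for small lam > 0, a nearby k > 0 with a nontrivial
solution.

Smoothness is decay of q.  Integrability of q comes from the self-convolution equation
(1 + |x|^a) q = q * q / (2 pi) and 3 a > 1; the decay is then improved by bootstrapping, and the
kernel equation transfers it to V.  In particular V vanishes to second order at 0, hence the
equation can be integrated back from w' to w.
*)
theory Submission
  imports Defs "HOL-Probability.Probability"
begin

section \<open>Perturbation of a simple kernel\<close>

text \<open>Fixing the conjugation at k = 1 gives one bounded weight \<open>wt\<close>, so that k
  and lam enter linearly through bounded operators on one space. The weight decays at infinity
  because the symbol grows, and this is what makes the conjugated convolution compact; it also
  vanishes at 0, so V belongs to the space only if V / \<open>wt\<close> is square integrable. That
  fails for the transform q of Q, since q 0 is not 0, and the negative direction has to be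
  approximated.

  The kernel of the operator at k = 0 is never determined: for k > 0 the extra term k |V|^2 / x^2
  makes the inequality strict, so one linear constraint from the minimization is enough for
  simplicity.

  Since |x|^a is not smooth at 0, the transforms involved need not be Schwartz functions. Only
  continuity and decay (\<open>rapid\<close>) are used on the Fourier side, a class stable under
  multiplication by |x|^a and under convolution, with inverse transforms in every Sobolev space.
  Transforms in the statement are weak, defined by duality with test functions; their uniqueness
  reduces everything to explicit integrals.\<close>

lemma kernel_vector_limit:
  fixes D T :: "'a::{real_inner,complete_space} \<Rightarrow> 'a"
  assumes D: "bounded_linear D" and T: "bounded_linear T"
    and comp: "\<forall>x :: nat \<Rightarrow> 'a. bounded (range x) \<longrightarrow> (\<exists>r l. strict_mono r \<and> (\<lambda>n. T (x (r n))) \<longlonglongrightarrow> l)"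
    and coer: "\<And>x. d * (x \<bullet> x) \<le> D x \<bullet> x" and d: "d > 0"
    and unit: "\<And>n. norm (x n) = 1"
    and lim: "(\<lambda>n. D (x n) - T (x n)) \<longlonglongrightarrow> 0"
  shows "\<exists>r l. strict_mono (r :: nat \<Rightarrow> nat) \<and> (\<lambda>n. x (r n)) \<longlonglongrightarrow> l \<and> norm l = 1 \<and> D l = T l"
proof -
  interpret D: bounded_linear D by (rule D)
  interpret T: bounded_linear T by (rule T)
  have "bounded (range x)" using unit by (auto simp: bounded_iff intro!: exI[of _ 1])
  then obtain r z where r: "strict_mono r" and Tz: "(\<lambda>n. T (x (r n))) \<longlonglongrightarrow> z" using comp by blast
  have "(\<lambda>n. D (x (r n)) - T (x (r n))) \<longlonglongrightarrow> 0"
    using LIMSEQ_subseq_LIMSEQ[OF lim r] by (simp add: o_def)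
  from tendsto_add[OF this Tz] have Dz: "(\<lambda>n. D (x (r n))) \<longlonglongrightarrow> z" by simp
  \<comment> \<open>Coercivity bounds \<open>D\<close> from below. Compactness of \<open>T\<close>
    makes the images \<open>D (x (r n))\<close> converge, and this lower bound carries the Cauchy
    property back to the vectors themselves.\<close>
  have low: "d * norm u \<le> norm (D u)" for u
  proof (cases "u = 0")
    case False
    have "d * (norm u * norm u) \<le> norm (D u) * norm u"
      using coer[of u] norm_cauchy_schwarz[of "D u" u] by (simp add: dot_square_norm power2_eq_square)
    then show ?thesis using False by (simp add: mult.assoc[symmetric])
  qed simp
  have "Cauchy (\<lambda>n. x (r n))"
  proof (rule metric_CauchyI)
    fix e :: real assume "e > 0"
    then have "e * d > 0" using d by simp
    with LIMSEQ_imp_Cauchy[OF Dz] obtain M where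
      M: "\<And>m n. m \<ge> M \<Longrightarrow> n \<ge> M \<Longrightarrow> dist (D (x (r m))) (D (x (r n))) < e * d"
      unfolding Cauchy_def by blast
    show "\<exists>M. \<forall>m\<ge>M. \<forall>n\<ge>M. dist (x (r m)) (x (r n)) < e"
    proof (intro exI allI impI)
      fix m n assume "m \<ge> M" "n \<ge> M"
      then have "d * norm (x (r m) - x (r n)) < d * e"
        using M[of m n] low[of "x (r m) - x (r n)"] by (simp add: dist_norm D.diff mult.commute)
      then show "dist (x (r m)) (x (r n)) < e" using d by (simp add: dist_norm)
    qed
  qed
  then obtain l where l: "(\<lambda>n. x (r n)) \<longlonglongrightarrow> l" using Cauchy_convergent convergent_def by blast
  have "(\<lambda>n. norm (x (r n))) \<longlonglongrightarrow> 1" by (simp add: unit)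
  then have "norm l = 1" using tendsto_norm[OF l] LIMSEQ_unique by blast
  moreover have "D l = z" using D.tendsto[OF l] Dz LIMSEQ_unique by blast
  moreover have "T l = z" using T.tendsto[OF l] Tz LIMSEQ_unique by blast
  ultimately show ?thesis using r l by metis
qed

text \<open>Nonnegativity is tested at \<open>x - (1/K) *\<^sub>R S x\<close>, one gradient step of
  length 1/K away from x. The value there is at most \<open>S x \<bullet> x\<close> minus the
  squared norm of \<open>S x\<close> divided by K. In this way a small form value yields a small
  residual.\<close>

lemma nonneg_operator_norm_le_form:
  fixes S :: "'a::real_inner \<Rightarrow> 'a"
  assumes S: "bounded_linear S" and sym: "\<And>x y. S x \<bullet> y = x \<bullet> S y"
    and pos: "\<And>x. 0 \<le> S x \<bullet> x" and K: "K > 0" "\<And>x. norm (S x) \<le> K * norm x"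
  shows "(norm (S x))\<^sup>2 \<le> K * (S x \<bullet> x)"
proof -
  interpret S: bounded_linear S by (rule S)
  define y where "y = S x"
  have Sy: "S y \<bullet> y \<le> K * (y \<bullet> y)"
    using norm_cauchy_schwarz[of "S y" y] K(2)[of y] mult_right_mono[OF K(2)[of y], of "norm y"]
    by (simp add: dot_square_norm power2_eq_square)
  have "0 \<le> S (x - (1/K) *\<^sub>R y) \<bullet> (x - (1/K) *\<^sub>R y)" by (rule pos)
  also have "\<dots> = S x \<bullet> x - (2/K) * (y \<bullet> y) + (1/K) * (1/K) * (S y \<bullet> y)"
  proof -
    have "S y \<bullet> x = y \<bullet> y" using sym[of y x] by (simp add: y_def)
    then show ?thesis
      using K(1) by (simp add: S.diff S.scaleR inner_diff_left inner_diff_right y_def[symmetric] field_simps)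
  qed
  also have "\<dots> \<le> S x \<bullet> x - (2/K) * (y \<bullet> y) + (1/K) * (1/K) * (K * (y \<bullet> y))"
    using Sy K by (intro add_left_mono mult_left_mono) auto
  also have "\<dots> = S x \<bullet> x - (y \<bullet> y) / K" using K(1) by (simp add: field_simps)
  finally have "(y \<bullet> y) / K \<le> S x \<bullet> x" by simp
  then show ?thesis using K(1) by (simp add: y_def dot_square_norm divide_le_eq mult.commute)
qed

text \<open>If no \<delta> works, there are unit vectors in \<open>V\<close> whose form values tend
  to 0. Because the form is nonnegative on the whole space, the residuals \<open>D x - T x\<close>
  tend to 0 there, not merely after projection to \<open>V\<close>, and a limit is an exact kernel
  vector. \<open>V\<close> will be the whole space or the orthogonal complement of one
  vector.\<close>

lemma spectral_gap_or_kernel: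
  fixes D T :: "'a::{real_inner,complete_space} \<Rightarrow> 'a"
  assumes D: "bounded_linear D" and T: "bounded_linear T"
    and comp: "\<forall>x :: nat \<Rightarrow> 'a. bounded (range x) \<longrightarrow> (\<exists>r l. strict_mono r \<and> (\<lambda>n. T (x (r n))) \<longlonglongrightarrow> l)"
    and coer: "\<And>x. d * (x \<bullet> x) \<le> D x \<bullet> x" and d: "d > 0"
    and sym: "\<And>x y. (D x - T x) \<bullet> y = x \<bullet> (D y - T y)"
    and pos: "\<And>x. 0 \<le> (D x - T x) \<bullet> x"
    and V: "closed V" "\<And>x c. x \<in> V \<Longrightarrow> c *\<^sub>R x \<in> V"
  shows "(\<exists>\<delta>>0. \<forall>x\<in>V. \<delta> * (x \<bullet> x) \<le> (D x - T x) \<bullet> x) \<or> (\<exists>l\<in>V. norm l = 1 \<and> D l = T l)"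
proof (rule disjCI)
  assume no: "\<not> (\<exists>l\<in>V. norm l = 1 \<and> D l = T l)"
  show "\<exists>\<delta>>0. \<forall>x\<in>V. \<delta> * (x \<bullet> x) \<le> (D x - T x) \<bullet> x"
  proof (rule ccontr)
    assume *: "\<not> ?thesis"
    define S where "S x = D x - T x" for x
    interpret S: bounded_linear S unfolding S_def by (intro bounded_linear_sub D T)
    obtain K where K: "K > 0" "\<And>x. norm (S x) \<le> norm x * K" using S.pos_bounded by blast
    have "\<exists>x\<in>V. norm x = 1 \<and> S x \<bullet> x < 1 / Suc n" for n
    proof -
      obtain x where x: "x \<in> V" "S x \<bullet> x < (1 / Suc n) * (x \<bullet> x)"
        using * unfolding S_def by (meson not_le zero_less_divide_1_iff of_nat_0_less_iff zero_less_Suc)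
      have "x \<noteq> 0" using x(2) by (auto simp: S.zero)
      define u where "u = (1 / norm x) *\<^sub>R x"
      have "S u \<bullet> u = (S x \<bullet> x) / (x \<bullet> x)"
        by (simp add: u_def S.scaleR dot_square_norm power2_eq_square)
      also have "\<dots> < 1 / Suc n" using x(2) \<open>x \<noteq> 0\<close> by (simp add: divide_less_eq)
      finally show ?thesis using x(1) V(2) \<open>x \<noteq> 0\<close> by (intro bexI[of _ u]) (auto simp: u_def)
    qed
    then obtain x where x: "\<And>n. x n \<in> V" "\<And>n. norm (x n) = 1" "\<And>n. S (x n) \<bullet> x n < 1 / Suc n" by metis
    have bd: "norm (S (x n)) \<le> sqrt (K * (1 / Suc n))" for n
    proof -
      have "(norm (S (x n)))\<^sup>2 \<le> K * (S (x n) \<bullet> x n)"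
        by (rule nonneg_operator_norm_le_form)
          (use S.bounded_linear_axioms sym pos K in \<open>auto simp: S_def[symmetric] mult.commute\<close>)
      also have "\<dots> \<le> K * (1 / Suc n)" using K(1) x(3)[of n] by (intro mult_left_mono) auto
      finally show ?thesis by (rule real_le_rsqrt)
    qed
    have "(\<lambda>n. sqrt (K * (1 / Suc n))) \<longlonglongrightarrow> sqrt (K * 0)"
      by (intro tendsto_intros) (use LIMSEQ_inverse_real_of_nat in \<open>simp add: inverse_eq_divide\<close>)
    then have "(\<lambda>n. S (x n)) \<longlonglongrightarrow> 0"
      using Lim_null_comparison[of "\<lambda>n. S (x n)" "\<lambda>n. sqrt (K * (1 / Suc n))"] bd by simp
    then obtain r l where "strict_mono (r :: nat \<Rightarrow> nat)" "(\<lambda>n. x (r n)) \<longlonglongrightarrow> l" "norm l = 1" "D l = T l"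
      using kernel_vector_limit[OF D T comp coer d, of x] x(2) unfolding S_def by blast
    moreover have "l \<in> V" using closed_sequentially[OF V(1) _ \<open>(\<lambda>n. x (r n)) \<longlonglongrightarrow> l\<close>] x(1) by blast
    ultimately show False using no by blast
  qed
qed

text \<open>Lyapunov-Schmidt reduction, with the solution sought as \<phi> + y, y orthogonal to
  \<phi>. For fixed lam the scalar s is chosen as a function of y so that the \<phi>-component of
  the equation holds, which is possible because \<open>N \<phi> \<bullet> \<phi>\<close> is
  positive. The remaining component is solved by a relaxed iteration that contracts because of the
  gap of S on the complement.\<close>

lemma simple_kernel_perturbation:
  fixes S N R :: "'a::{real_inner,complete_space} \<Rightarrow> 'a"
  assumes S: "bounded_linear S" and N: "bounded_linear N" and R: "bounded_linear R"
    and sym: "\<And>x y. S x \<bullet> y = x \<bullet> S y"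
    and ker: "S \<phi> = 0" and unit: "norm \<phi> = 1"
    and gap: "\<delta> > 0" "\<And>x. \<phi> \<bullet> x = 0 \<Longrightarrow> \<delta> * (x \<bullet> x) \<le> S x \<bullet> x"
    and n: "N \<phi> \<bullet> \<phi> > 0" and k0: "k0 > 0"
  shows "\<exists>lam>0. \<exists>s. \<exists>y. \<bar>s\<bar> < k0 \<and> y \<noteq> 0 \<and> S y + s *\<^sub>R N y + lam *\<^sub>R R y = 0"
proof -
  interpret S: bounded_linear S by (rule S)
  interpret N: bounded_linear N by (rule N)
  interpret R: bounded_linear R by (rule R)
  obtain K1 K2 K3 where KK: "\<And>x. norm (S x) \<le> norm x * K1" "\<And>x. norm (N x) \<le> norm x * K2"
    "\<And>x. norm (R x) \<le> norm x * K3" using S.bounded N.bounded R.bounded by blast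
  define K where "K = max (max K1 K2) (max K3 \<delta>)"
  have KS: "norm (S x) \<le> K * norm x" and KN: "norm (N x) \<le> K * norm x" and KR: "norm (R x) \<le> K * norm x" for x
  proof -
    have "norm x * K1 \<le> norm x * K" "norm x * K2 \<le> norm x * K" "norm x * K3 \<le> norm x * K"
      by (auto simp: K_def intro!: mult_left_mono)
    then show "norm (S x) \<le> K * norm x" "norm (N x) \<le> K * norm x" "norm (R x) \<le> K * norm x"
      using KK[of x] by (simp_all add: mult.commute)
  qed
  have K: "K > 0" "\<delta> \<le> K" using gap(1) by (auto simp: K_def)
  define m where "m = N \<phi> \<bullet> \<phi>"
  have m: "m > 0" "m \<le> K"
    using n norm_cauchy_schwarz[of "N \<phi>" \<phi>] KN[of \<phi>] unit by (auto simp: m_def)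
  \<comment> \<open>The radius keeps \<open>N (\<phi> + y) \<bullet> \<phi>\<close> at least m / 2
    on the ball, so that the denominator of s stays away from 0.\<close>
  define \<rho> where "\<rho> = m / (2 * K)"
  have \<rho>: "0 < \<rho>" "\<rho> \<le> 1" "K * \<rho> = m / 2" using m K by (auto simp: \<rho>_def field_simps)
  \<comment> \<open>t minimizes 1 - 2 t \<delta> + (t K)^2, the bound for the squared contraction
    factor of y - t S y on the complement; the minimum is 1 - e.\<close>
  define t where "t = \<delta> / K\<^sup>2"
  define e where "e = \<delta>\<^sup>2 / K\<^sup>2"
  have t: "t > 0" using gap K by (simp add: t_def)
  have e: "0 < e" "e \<le> 1" using gap K by (auto simp: e_def power_mono divide_le_eq)
  \<comment> \<open>\<open>lam * s0\<close> and \<open>lam * s1\<close> bound s and its Lipschitz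
    constant on the ball; \<open>lam * c2\<close> and \<open>lam * c1\<close> do the same for the
    perturbation \<open>E\<close>.\<close>
  define s0 where "s0 = 4 * K / m"
  define s1 where "s1 = 16 * K\<^sup>2 / m\<^sup>2"
  have s01: "s0 > 0" "s1 > 0" using K m by (auto simp: s0_def s1_def)
  define c1 where "c1 = 2 * K * s1 + s0 * K + K"
  define c2 where "c2 = 2 * K * (s0 + 1)"
  have c12: "c1 > 0" "c2 > 0" using K s01 by (auto simp: c1_def c2_def intro!: add_pos_pos mult_pos_pos)
  \<comment> \<open>The three bounds make the iteration preserve the ball, contract with factor 1 -
    e / 4, and keep s below k0 in absolute value.\<close>
  define lam where "lam = min (min (e * \<rho> / (2 * t * c2)) (e / (4 * t * c1))) (k0 / (2 * s0))"
  have lam: "lam > 0" using e \<rho> t c12 k0 s01 by (auto simp: lam_def)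
  have "lam \<le> e * \<rho> / (2 * t * c2)" "lam \<le> e / (4 * t * c1)" "lam \<le> k0 / (2 * s0)" by (auto simp: lam_def)
  then have lam_le: "t * (lam * c2) \<le> e * \<rho> / 2" "t * (lam * c1) \<le> e / 4" "lam * s0 < k0"
    using t c12 s01 k0 by (auto simp: field_simps)
  define B where "B = {y. \<phi> \<bullet> y = 0 \<and> norm y \<le> \<rho>}"
  have ball: "norm (\<phi> + y) \<le> 2" if "y \<in> B" for y
    using that norm_triangle_ineq[of \<phi> y] unit \<rho>(2) by (auto simp: B_def)
  define r where "r y = R (\<phi> + y) \<bullet> \<phi>" for y
  define g where "g y = N (\<phi> + y) \<bullet> \<phi>" for y
  have r: "\<bar>r y\<bar> \<le> 2 * K" and g: "\<bar>g y\<bar> \<le> 2 * K" "m / 2 \<le> g y" if "y \<in> B" for y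
  proof -
    have b: "K * norm (\<phi> + y) \<le> 2 * K" using ball[OF that] K by simp
    show "\<bar>r y\<bar> \<le> 2 * K" using Cauchy_Schwarz_ineq2[of "R (\<phi> + y)" \<phi>] KR[of "\<phi> + y"] b unit by (simp add: r_def)
    show "\<bar>g y\<bar> \<le> 2 * K" using Cauchy_Schwarz_ineq2[of "N (\<phi> + y)" \<phi>] KN[of "\<phi> + y"] b unit by (simp add: g_def)
    have "\<bar>N y \<bullet> \<phi>\<bar> \<le> K * norm y" using Cauchy_Schwarz_ineq2[of "N y" \<phi>] KN[of y] unit by simp
    also have "\<dots> \<le> K * \<rho>" using that K by (auto simp: B_def)
    finally show "m / 2 \<le> g y" using \<rho>(3) by (simp add: g_def N.add inner_add_left m_def)
  qed
  have dr: "\<bar>r y - r z\<bar> \<le> K * norm (y - z)" and dg: "\<bar>g y - g z\<bar> \<le> K * norm (y - z)" for y z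
    using Cauchy_Schwarz_ineq2[of "R (y - z)" \<phi>] KR[of "y - z"] Cauchy_Schwarz_ineq2[of "N (y - z)" \<phi>] KN[of "y - z"] unit
    by (auto simp: r_def g_def R.add N.add R.diff N.diff inner_add_left inner_diff_left)
  \<comment> \<open>This value makes the perturbing part \<open>E y\<close> orthogonal to \<phi>.
    The part \<open>S y\<close> is orthogonal to \<phi> already, by symmetry of S and
    \<open>S \<phi> = 0\<close>, so the iteration stays in the complement.\<close>
  define s where "s y = - lam * r y / g y" for y
  have s_le: "\<bar>s y\<bar> \<le> lam * s0" if "y \<in> B" for y
  proof -
    have "\<bar>s y\<bar> = lam * (\<bar>r y\<bar> / g y)" using lam g(2)[OF that] m by (simp add: s_def abs_mult)
    also have "\<bar>r y\<bar> / g y \<le> (2 * K) / (m / 2)" using r[OF that] g(2)[OF that] m K by (intro frac_le) auto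
    finally show ?thesis using lam by (simp add: s0_def)
  qed
  have ds: "\<bar>s y - s z\<bar> \<le> lam * s1 * norm (y - z)" if y: "y \<in> B" and z: "z \<in> B" for y z
  proof -
    have gp: "g y > 0" "g z > 0" using g(2)[OF y] g(2)[OF z] m by auto
    have "s y - s z = - lam * ((r y * (g z - g y) + g y * (r y - r z)) / (g y * g z))"
      using gp by (simp add: s_def field_simps)
    then have "\<bar>s y - s z\<bar> = lam * (\<bar>r y * (g z - g y) + g y * (r y - r z)\<bar> / (g y * g z))"
      using lam gp by (simp add: abs_mult)
    also have "\<dots> \<le> lam * (4 * K\<^sup>2 * norm (y - z) / (m / 2 * (m / 2)))"
    proof (intro mult_left_mono frac_le)
      have "\<bar>r y * (g z - g y)\<bar> \<le> (2 * K) * (K * norm (y - z))"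
        unfolding abs_mult using r[OF y] dg[of z y] K by (intro mult_mono) (auto simp: norm_minus_commute)
      moreover have "\<bar>g y * (r y - r z)\<bar> \<le> (2 * K) * (K * norm (y - z))"
        unfolding abs_mult using g(1)[OF y] dr[of y z] K by (intro mult_mono) auto
      ultimately show "\<bar>r y * (g z - g y) + g y * (r y - r z)\<bar> \<le> 4 * K\<^sup>2 * norm (y - z)"
        by (simp add: power2_eq_square)
      show "m / 2 * (m / 2) \<le> g y * g z" using g(2)[OF y] g(2)[OF z] m by (intro mult_mono) auto
    qed (use lam m K in auto)
    also have "\<dots> = lam * s1 * norm (y - z)" using m by (simp add: s1_def field_simps power2_eq_square)
    finally show ?thesis .
  qed
  define E where "E y = s y *\<^sub>R N (\<phi> + y) + lam *\<^sub>R R (\<phi> + y)" for y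
  have E_le: "norm (E y) \<le> lam * c2" if "y \<in> B" for y
  proof -
    have "K * norm (\<phi> + y) \<le> K * 2" using ball[OF that] K by simp
    then have *: "norm (N (\<phi> + y)) \<le> K * 2" "norm (R (\<phi> + y)) \<le> K * 2" using KN[of "\<phi> + y"] KR[of "\<phi> + y"] by linarith+
    have "norm (E y) \<le> \<bar>s y\<bar> * norm (N (\<phi> + y)) + lam * norm (R (\<phi> + y))"
      unfolding E_def using norm_triangle_ineq[of "s y *\<^sub>R N (\<phi> + y)" "lam *\<^sub>R R (\<phi> + y)"] lam by simp
    also have "\<dots> \<le> (lam * s0) * (K * 2) + lam * (K * 2)"
      using s_le[OF that] * lam s01 by (intro add_mono mult_mono) auto
    finally show ?thesis by (simp add: c2_def algebra_simps)
  qed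
  have dE: "norm (E y - E z) \<le> lam * c1 * norm (y - z)" if y: "y \<in> B" and z: "z \<in> B" for y z
  proof -
    have "K * norm (\<phi> + y) \<le> K * 2" using ball[OF y] K by simp
    then have *: "norm (N (\<phi> + y)) \<le> K * 2" using KN[of "\<phi> + y"] by linarith
    have "E y - E z = (s y - s z) *\<^sub>R N (\<phi> + y) + s z *\<^sub>R N (y - z) + lam *\<^sub>R R (y - z)"
      by (simp add: E_def N.add R.add N.diff R.diff algebra_simps)
    then have "norm (E y - E z) \<le> \<bar>s y - s z\<bar> * norm (N (\<phi> + y)) + \<bar>s z\<bar> * norm (N (y - z)) + lam * norm (R (y - z))"
      using norm_triangle_ineq[of "(s y - s z) *\<^sub>R N (\<phi> + y) + s z *\<^sub>R N (y - z)" "lam *\<^sub>R R (y - z)"]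
        norm_triangle_ineq[of "(s y - s z) *\<^sub>R N (\<phi> + y)" "s z *\<^sub>R N (y - z)"] lam by simp
    also have "\<dots> \<le> (lam * s1 * norm (y - z)) * (K * 2) + (lam * s0) * (K * norm (y - z)) + lam * (K * norm (y - z))"
      using ds[OF y z] s_le[OF z] * KN[of "y - z"] KR[of "y - z"] lam s01 by (intro add_mono mult_mono) auto
    finally show ?thesis by (simp add: c1_def algebra_simps)
  qed
  \<comment> \<open>A fixed point satisfies S y + E y = 0, which is the full equation for \<phi> + y
    because \<open>S \<phi> = 0\<close>.\<close>
  define F where "F y = y - t *\<^sub>R (S y + E y)" for y
  have contr: "norm (y - t *\<^sub>R S y) \<le> (1 - e / 2) * norm y" if "\<phi> \<bullet> y = 0" for y
  proof (rule power2_le_imp_le)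
    have "(norm (y - t *\<^sub>R S y))\<^sup>2 = y \<bullet> y - 2 * t * (S y \<bullet> y) + t\<^sup>2 * (norm (S y))\<^sup>2"
      unfolding dot_square_norm[symmetric]
      by (simp add: inner_diff_left inner_diff_right inner_commute power2_eq_square algebra_simps)
    also have "\<dots> \<le> y \<bullet> y - 2 * t * (\<delta> * (y \<bullet> y)) + t\<^sup>2 * (K * norm y)\<^sup>2"
      using gap(2)[OF that] t KS[of y] by (intro add_mono diff_mono mult_left_mono power_mono) auto
    also have "\<dots> = (1 - e) * (norm y)\<^sup>2"
      using K by (simp add: t_def e_def dot_square_norm field_simps power2_eq_square)
    also have "\<dots> \<le> (1 - e / 2)\<^sup>2 * (norm y)\<^sup>2"
      by (intro mult_right_mono) (auto simp: power2_eq_square algebra_simps)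
    finally show "(norm (y - t *\<^sub>R S y))\<^sup>2 \<le> ((1 - e / 2) * norm y)\<^sup>2" by (simp add: power_mult_distrib)
  qed (use e in auto)
  have "\<exists>!y\<in>B. F y = y"
  proof (rule Banach_fix[of B "1 - e / 4"])
    have "closed B" unfolding B_def by (intro closed_Collect_conj closed_Collect_eq closed_Collect_le continuous_intros)
    then show "Topological_Spaces.complete B" using complete_UNIV complete_Int_closed[of UNIV B] by (simp add: Int_commute)
    show "B \<noteq> {}" using \<rho> by (auto simp: B_def intro!: exI[of _ 0])
    show "0 \<le> 1 - e / 4" "1 - e / 4 < 1" using e by auto
    show "F ` B \<subseteq> B"
    proof safe
      fix y assume y: "y \<in> B"
      have "\<phi> \<bullet> S y = 0" using sym[of \<phi> y] ker by simp
      moreover have "\<phi> \<bullet> E y = 0"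
      proof -
        have "\<phi> \<bullet> E y = s y * g y + lam * r y"
          by (simp add: E_def inner_add_right r_def g_def inner_commute[of \<phi>])
        then show ?thesis using g(2)[OF y] m by (simp add: s_def)
      qed
      ultimately have 1: "\<phi> \<bullet> F y = 0" using y by (simp add: F_def B_def inner_diff_right inner_add_right)
      have "F y = (y - t *\<^sub>R S y) - t *\<^sub>R E y" by (simp add: F_def algebra_simps)
      then have "norm (F y) \<le> norm (y - t *\<^sub>R S y) + t * norm (E y)"
        using norm_triangle_ineq4[of "y - t *\<^sub>R S y" "t *\<^sub>R E y"] t by simp
      also have "\<dots> \<le> (1 - e / 2) * \<rho> + t * (lam * c2)"
        using contr[of y] y e E_le[OF y] t
        by (intro add_mono mult_left_mono) (auto simp: B_def intro: order_trans[OF contr mult_left_mono])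
      also have "\<dots> \<le> \<rho>" using lam_le(1) by (simp add: algebra_simps)
      finally show "F y \<in> B" using 1 by (simp add: B_def)
    qed
    show "dist (F y) (F z) \<le> (1 - e / 4) * dist y z" if y: "y \<in> B" and z: "z \<in> B" for y z
    proof -
      have "F y - F z = ((y - z) - t *\<^sub>R S (y - z)) - t *\<^sub>R (E y - E z)"
        by (simp add: F_def S.diff algebra_simps)
      then have "norm (F y - F z) \<le> norm ((y - z) - t *\<^sub>R S (y - z)) + t * norm (E y - E z)"
        using norm_triangle_ineq4[of "(y - z) - t *\<^sub>R S (y - z)" "t *\<^sub>R (E y - E z)"] t by simp
      also have "\<dots> \<le> (1 - e / 2) * norm (y - z) + t * (lam * c1 * norm (y - z))"
        using contr[of "y - z"] y z dE[OF y z] t by (intro add_mono mult_left_mono) (auto simp: B_def inner_diff_right)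
      also have "\<dots> \<le> (1 - e / 2) * norm (y - z) + e / 4 * norm (y - z)"
        using mult_right_mono[OF lam_le(2), of "norm (y - z)"] by (simp add: mult.assoc)
      also have "\<dots> = (1 - e / 4) * norm (y - z)" by (simp add: algebra_simps)
      finally show ?thesis by (simp add: dist_norm)
    qed
  qed
  then obtain y where y: "y \<in> B" "F y = y" by blast
  have "t *\<^sub>R (S y + E y) = 0" using y(2) by (simp add: F_def)
  then have "S (\<phi> + y) + s y *\<^sub>R N (\<phi> + y) + lam *\<^sub>R R (\<phi> + y) = 0"
    using t by (simp add: E_def S.add ker add.assoc)
  moreover have "\<phi> + y \<noteq> 0"
  proof
    assume "\<phi> + y = 0"
    then have "\<phi> \<bullet> (\<phi> + y) = 0" by simp
    then show False using y(1) unit by (simp add: inner_add_right B_def dot_square_norm)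
  qed
  moreover have "\<bar>s y\<bar> < k0" using s_le[OF y(1)] lam_le(3) by simp
  ultimately show ?thesis using lam by blast
qed

text \<open>The infimum of the admissible k is attained, as the defining inequalities are closed
  conditions. A gap at this k would allow lowering it, so a kernel vector exists; simplicity
  excludes a second one on its orthogonal complement, and the same dichotomy supplies there the gap
  that the perturbation argument asks for.\<close>

theorem perturbed_pencil_kernel:
  fixes T N R :: "'a::{real_inner,complete_space} \<Rightarrow> 'a"
  assumes T: "bounded_linear T" and N: "bounded_linear N" and R: "bounded_linear R"
    and comp: "\<forall>x :: nat \<Rightarrow> 'a. bounded (range x) \<longrightarrow> (\<exists>r l. strict_mono r \<and> (\<lambda>n. T (x (r n))) \<longlonglongrightarrow> l)"
    and symT: "\<And>x y. T x \<bullet> y = x \<bullet> T y" and symN: "\<And>x y. N x \<bullet> y = x \<bullet> N y"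
    and Npos: "\<And>x. x \<noteq> 0 \<Longrightarrow> 0 < N x \<bullet> x" and Nle: "\<And>x. N x \<bullet> x \<le> x \<bullet> x"
    and neg: "(y0 - N y0 - T y0) \<bullet> y0 < 0"
    and big: "kb > 0" "\<And>y. 0 \<le> (y - N y + kb *\<^sub>R N y - T y) \<bullet> y"
    and simple: "\<And>k x y. k > 0 \<Longrightarrow> x - N x + k *\<^sub>R N x = T x \<Longrightarrow> y - N y + k *\<^sub>R N y = T y
        \<Longrightarrow> x \<bullet> y = 0 \<Longrightarrow> x = 0 \<or> y = 0"
  shows "\<exists>lam>0. \<exists>k>0. \<exists>y. y \<noteq> 0 \<and> y - N y + k *\<^sub>R N y + lam *\<^sub>R R y = T y"
proof -
  interpret T: bounded_linear T by (rule T)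
  interpret N: bounded_linear N by (rule N)
  have Nge: "0 \<le> N x \<bullet> x" for x using Npos[of x] by (cases "x = 0") (auto simp: N.zero less_imp_le)
  define A where "A = {k. 0 \<le> k \<and> (\<forall>y. 0 \<le> (y - N y - T y) \<bullet> y + k * (N y \<bullet> y))}"
  have form: "(y - N y + k *\<^sub>R N y - T y) \<bullet> y = (y - N y - T y) \<bullet> y + k * (N y \<bullet> y)" for k y
    by (simp add: inner_add_left inner_diff_left)
  have A: "closed A" "A \<noteq> {}" "bdd_below A"
  proof -
    have "A = {0..} \<inter> (\<Inter>y. {k. 0 \<le> (y - N y - T y) \<bullet> y + k * (N y \<bullet> y)})" by (auto simp: A_def)
    also have "closed \<dots>" by (intro closed_Int closed_INT ballI closed_Collect_le continuous_intros closed_atLeast)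
    finally show "closed A" .
    have "kb \<in> A" using big by (auto simp: A_def form)
    then show "A \<noteq> {}" by blast
    show "bdd_below A" by (auto simp: A_def intro!: bdd_belowI[of _ 0])
  qed
  define k where "k = Inf A"
  have kA: "k \<in> A" unfolding k_def by (rule closed_contains_Inf[OF A(2,3,1)])
  have k0: "k > 0"
  proof -
    have "k \<noteq> 0" using kA neg by (auto simp: A_def not_le[symmetric])
    then show ?thesis using kA by (auto simp: A_def)
  qed
  define D where "D x = x - N x + k *\<^sub>R N x" for x
  have D: "bounded_linear D" unfolding D_def
    by (intro bounded_linear_add bounded_linear_sub bounded_linear_ident N bounded_linear_const_scaleR)
  \<comment> \<open>Both 1 - N and N are nonnegative, so (1 - N) + k N dominates the smaller of 1
    and k.\<close>
  have coer: "min 1 k * (x \<bullet> x) \<le> D x \<bullet> x" for x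
  proof -
    have "min 1 k * (x \<bullet> x) = min 1 k * (x \<bullet> x - N x \<bullet> x) + min 1 k * (N x \<bullet> x)" by (simp add: algebra_simps)
    also have "\<dots> \<le> 1 * (x \<bullet> x - N x \<bullet> x) + k * (N x \<bullet> x)"
      using Nle[of x] Nge[of x] by (intro add_mono mult_right_mono) auto
    finally show ?thesis by (simp add: D_def inner_add_left inner_diff_left)
  qed
  have d: "min 1 k > 0" using k0 by simp
  have sym: "(D x - T x) \<bullet> y = x \<bullet> (D y - T y)" for x y
    by (simp add: D_def inner_add_left inner_diff_left inner_add_right inner_diff_right symN symT)
  have DTform: "(D x - T x) \<bullet> x = (x - N x - T x) \<bullet> x + k * (N x \<bullet> x)" for x
    using form[of x k] by (simp add: D_def)
  have pos: "0 \<le> (D x - T x) \<bullet> x" for x using kA by (simp add: A_def DTform)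
  note gap = spectral_gap_or_kernel[OF D T comp coer d sym pos]
  have "\<not> (\<exists>\<delta>>0. \<forall>x\<in>UNIV. \<delta> * (x \<bullet> x) \<le> (D x - T x) \<bullet> x)"
  proof
    assume "\<exists>\<delta>>0. \<forall>x\<in>UNIV. \<delta> * (x \<bullet> x) \<le> (D x - T x) \<bullet> x"
    then obtain \<delta> where \<delta>: "\<delta> > 0" "\<And>x. \<delta> * (x \<bullet> x) \<le> (D x - T x) \<bullet> x" by blast
    \<comment> \<open>Lowering k by h costs at most h times the squared norm because N is at most 1,
      and the supposed gap \<delta> covers this; the bound by k keeps k - h nonnegative.\<close>
    define h where "h = min \<delta> k"
    have "k - h \<in> A"
      unfolding A_def
    proof (intro CollectI conjI allI)
      show "0 \<le> k - h" by (simp add: h_def)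
      fix y
      have "h * (N y \<bullet> y) \<le> h * (y \<bullet> y)" using Nle[of y] \<delta>(1) k0 by (intro mult_left_mono) (auto simp: h_def)
      also have "\<dots> \<le> \<delta> * (y \<bullet> y)" by (intro mult_right_mono) (auto simp: h_def)
      finally show "0 \<le> (y - N y - T y) \<bullet> y + (k - h) * (N y \<bullet> y)"
        using \<delta>(2)[of y] unfolding DTform left_diff_distrib by linarith
    qed
    then have "k \<le> k - h" unfolding k_def using A(3) by (rule cInf_lower)
    then show False using \<delta>(1) k0 by (simp add: h_def)
  qed
  with gap[of UNIV] obtain \<phi> where \<phi>: "norm \<phi> = 1" "D \<phi> = T \<phi>" by auto
  have "\<not> (\<exists>l\<in>{x. \<phi> \<bullet> x = 0}. norm l = 1 \<and> D l = T l)"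
    using simple[OF k0, of \<phi>] \<phi> by (fastforce simp: D_def)
  moreover have "closed {x. \<phi> \<bullet> x = 0}" by (intro closed_Collect_eq continuous_intros)
  ultimately obtain \<delta> where \<delta>: "\<delta> > 0" "\<And>x. \<phi> \<bullet> x = 0 \<Longrightarrow> \<delta> * (x \<bullet> x) \<le> (D x - T x) \<bullet> x"
    using gap[of "{x. \<phi> \<bullet> x = 0}"] by auto
  have "\<phi> \<noteq> 0" using \<phi>(1) by auto
  \<comment> \<open>Admitting only shifts s smaller than k keeps the new parameter k + s
    positive.\<close>
  obtain lam s y where *: "lam > 0" "\<bar>s\<bar> < k" "y \<noteq> 0" "(D y - T y) + s *\<^sub>R N y + lam *\<^sub>R R y = 0"
    using simple_kernel_perturbation[OF bounded_linear_sub[OF D T] N R sym _ \<phi>(1) \<delta> Npos[OF \<open>\<phi> \<noteq> 0\<close>] k0] \<phi>(2) by auto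
  have "y - N y + (k + s) *\<^sub>R N y + lam *\<^sub>R R y = T y"
    using *(4) by (simp add: D_def algebra_simps)
  moreover have "k + s > 0" using *(2) by auto
  ultimately show ?thesis using *(1,3) by blast
qed

section \<open>Square integrable functions and the Fourier integral\<close>

lemma L2_D: "L2 u \<Longrightarrow> u \<in> borel_measurable borel" "L2 u \<Longrightarrow> integrable lborel (\<lambda>x. (cmod (u x))\<^sup>2)"
  by (auto simp: L2_def)

lemma L2_mult_integrable:
  assumes "L2 f" "L2 g" shows "integrable lborel (\<lambda>x. f x * g x)"
proof (rule Bochner_Integration.integrable_bound)
  note [measurable] = L2_D(1)[OF assms(1)] L2_D(1)[OF assms(2)]
  show "integrable lborel (\<lambda>x. ((cmod (f x))\<^sup>2 + (cmod (g x))\<^sup>2) / 2)"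
    using assms by (auto simp: L2_def)
  show "(\<lambda>x. f x * g x) \<in> borel_measurable lborel" by measurable
  show "AE x in lborel. norm (f x * g x) \<le> norm (((cmod (f x))\<^sup>2 + (cmod (g x))\<^sup>2) / 2)"
  proof (intro AE_I2)
    fix x show "norm (f x * g x) \<le> norm (((cmod (f x))\<^sup>2 + (cmod (g x))\<^sup>2) / 2)"
      using sum_squares_bound[of "cmod (f x)" "cmod (g x)"] by (simp add: norm_mult)
  qed
qed

lemma L2_bound:
  assumes "L2 g" "f \<in> borel_measurable borel" "\<And>x. cmod (f x) \<le> C * cmod (g x)"
  shows "L2 f"
  unfolding L2_def
proof
  show "f \<in> borel_measurable lborel" using assms by simp
  show "integrable lborel (\<lambda>x. (cmod (f x))\<^sup>2)"
  proof (rule Bochner_Integration.integrable_bound)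
    show "integrable lborel (\<lambda>x. C\<^sup>2 * (cmod (g x))\<^sup>2)" using L2_D[OF assms(1)] by auto
    show "(\<lambda>x. (cmod (f x))\<^sup>2) \<in> borel_measurable lborel" using assms(2) by simp
    show "AE x in lborel. norm ((cmod (f x))\<^sup>2) \<le> norm (C\<^sup>2 * (cmod (g x))\<^sup>2)"
      using power_mono[OF assms(3), of _ 2] by (auto simp: power_mult_distrib)
  qed
qed

lemma L2_add: assumes "L2 f" "L2 g" shows "L2 (\<lambda>x. f x + g x)"
  unfolding L2_def
proof
  note [measurable] = L2_D(1)[OF assms(1)] L2_D(1)[OF assms(2)]
  show "(\<lambda>x. f x + g x) \<in> borel_measurable lborel" by measurable
  show "integrable lborel (\<lambda>x. (cmod (f x + g x))\<^sup>2)"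
  proof (rule Bochner_Integration.integrable_bound)
    show "integrable lborel (\<lambda>x. 2 * (cmod (f x))\<^sup>2 + 2 * (cmod (g x))\<^sup>2)" using assms by (auto simp: L2_def)
    show "AE x in lborel. norm ((cmod (f x + g x))\<^sup>2) \<le> norm (2 * (cmod (f x))\<^sup>2 + 2 * (cmod (g x))\<^sup>2)"
    proof (intro AE_I2)
      fix x
      have "(cmod (f x + g x))\<^sup>2 \<le> (cmod (f x) + cmod (g x))\<^sup>2" by (intro power_mono norm_triangle_ineq) auto
      also have "\<dots> \<le> 2 * (cmod (f x))\<^sup>2 + 2 * (cmod (g x))\<^sup>2"
        using sum_squares_bound[of "cmod (f x)" "cmod (g x)"] by (simp add: power2_sum)
      finally show "norm ((cmod (f x + g x))\<^sup>2) \<le> norm (2 * (cmod (f x))\<^sup>2 + 2 * (cmod (g x))\<^sup>2)" by simp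
    qed
  qed measurable
qed

lemma L2_scale: "L2 f \<Longrightarrow> L2 (\<lambda>x. c * f x)"
  by (rule L2_bound[where C = "cmod c" and g = f]) (auto simp: norm_mult L2_def)

lemma L2_diff: "L2 f \<Longrightarrow> L2 g \<Longrightarrow> L2 (\<lambda>x. f x - g x)"
  using L2_add[of f "\<lambda>x. -1 * g x"] L2_scale[of g "-1"] by simp

lemma borel_measurable_cnj[measurable]: "cnj \<in> borel_measurable borel"
  by (intro borel_measurable_continuous_onI continuous_intros)

lemma L2_cnj: "L2 f \<Longrightarrow> L2 (\<lambda>x. cnj (f x))"
  by (rule L2_bound[where C = 1 and g = f]) (auto simp: L2_def)

lemma lborel_integrable_uminus:
  fixes f :: "real \<Rightarrow> 'b::{banach,second_countable_topology}"
  shows "integrable lborel f \<Longrightarrow> integrable lborel (\<lambda>x. f (- x))"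
  using lborel_integrable_real_affine[of f "-1" 0] by simp

lemma lborel_integral_uminus:
  fixes f :: "real \<Rightarrow> 'b::{banach,second_countable_topology}"
  shows "(LINT x|lborel. f (- x)) = (LINT x|lborel. f x)"
  using lborel_integral_real_affine[of "-1" f 0] by simp

lemma L2_uminus: "L2 f \<Longrightarrow> L2 (\<lambda>x. f (- x))"
  unfolding L2_def using lborel_integrable_uminus[of "\<lambda>x. (cmod (f x))\<^sup>2"] by auto

lemma L2_Cauchy_Schwarz:
  assumes "L2 f" "L2 g"
  shows "(cmod (LINT x|lborel. f x * g x))\<^sup>2 \<le> (LINT x|lborel. (cmod (f x))\<^sup>2) * (LINT x|lborel. (cmod (g x))\<^sup>2)"
proof -
  note [measurable] = L2_D(1)[OF assms(1)] L2_D(1)[OF assms(2)]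
  have i: "integrable lborel (\<lambda>x. f x * g x)" by (rule L2_mult_integrable[OF assms])
  have sq: "(\<integral>\<^sup>+x. (ennreal (cmod (h x)))\<^sup>2 \<partial>lborel) = ennreal (LINT x|lborel. (cmod (h x))\<^sup>2)" if "L2 h" for h
    using that by (subst nn_integral_eq_integral[symmetric]) (auto simp: L2_def ennreal_power)
  have "ennreal ((cmod (LINT x|lborel. f x * g x))\<^sup>2) = (ennreal (cmod (LINT x|lborel. f x * g x)))\<^sup>2"
    by (simp add: ennreal_power)
  also have "\<dots> \<le> (\<integral>\<^sup>+x. ennreal (cmod (f x * g x)) \<partial>lborel)\<^sup>2"
    by (intro power_mono integral_norm_bound_ennreal i) auto
  also have "\<dots> = (\<integral>\<^sup>+x. ennreal (cmod (f x)) * ennreal (cmod (g x)) \<partial>lborel)\<^sup>2"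
    by (simp add: norm_mult ennreal_mult)
  also have "\<dots> \<le> (\<integral>\<^sup>+x. (ennreal (cmod (f x)))\<^sup>2 \<partial>lborel) * (\<integral>\<^sup>+x. (ennreal (cmod (g x)))\<^sup>2 \<partial>lborel)"
    by (rule Cauchy_Schwarz_nn_integral) auto
  also have "\<dots> = ennreal ((LINT x|lborel. (cmod (f x))\<^sup>2) * (LINT x|lborel. (cmod (g x))\<^sup>2))"
    by (simp add: sq assms ennreal_mult)
  finally show ?thesis by (subst (asm) ennreal_le_iff) auto
qed

section \<open>The Fourier integral and the multiplication formula\<close>

lemma borel_measurable_cis[measurable]: "cis \<in> borel_measurable borel"
  by (intro borel_measurable_continuous_onI continuous_on_cis continuous_on_id)

lemma integrable_mult_bounded:
  fixes f :: "'a \<Rightarrow> complex"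
  assumes "integrable M f" "h \<in> borel_measurable M" "\<And>x. cmod (h x) \<le> C"
  shows "integrable M (\<lambda>x. f x * h x)"
proof (rule Bochner_Integration.integrable_bound)
  show "integrable M (\<lambda>x. C * norm (f x))" using assms(1) by auto
  show "(\<lambda>x. f x * h x) \<in> borel_measurable M" using assms by auto
  show "AE x in M. norm (f x * h x) \<le> norm (C * norm (f x))"
  proof (intro AE_I2)
    fix x
    have "norm (f x * h x) \<le> C * norm (f x)"
      using mult_right_mono[OF assms(3)[of x], of "norm (f x)"] by (simp add: norm_mult mult.commute)
    then show "norm (f x * h x) \<le> norm (C * norm (f x))" by simp
  qed
qed

lemma integrable_fourier_kernel:
  "integrable lborel f \<Longrightarrow> integrable lborel (\<lambda>x. f x * cis (- (x * \<xi>)))"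
  by (rule integrable_mult_bounded[where C = 1]) auto

lemma norm_fourier_le: "integrable lborel f \<Longrightarrow> cmod (fourier f \<xi>) \<le> (LINT x|lborel. cmod (f x))"
  unfolding fourier_def
  using integral_norm_bound[of lborel "\<lambda>x. f x * cis (- (x * \<xi>))"] by (simp add: norm_mult)

lemma continuous_fourier:
  assumes "integrable lborel f" shows "continuous_on UNIV (fourier f)"
  unfolding continuous_on_sequentially o_def
proof (intro allI ballI impI, elim conjE)
  fix y :: "nat \<Rightarrow> real" and x
  assume y: "y \<longlonglongrightarrow> x"
  show "(\<lambda>n. fourier f (y n)) \<longlonglongrightarrow> fourier f x"
    unfolding fourier_def
  proof (rule integral_dominated_convergence[where w = "\<lambda>x. cmod (f x)"])
    show "AE t in lborel. (\<lambda>n. f t * cis (- (t * y n))) \<longlonglongrightarrow> f t * cis (- (t * x))"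
      by (intro AE_I2 tendsto_mult tendsto_const tendsto_cis tendsto_minus y)
    show "AE t in lborel. norm (f t * cis (- (t * y n))) \<le> cmod (f t)" for n by (simp add: norm_mult)
    show "integrable lborel (\<lambda>x. cmod (f x))" using assms by auto
  qed (use assms in auto)
qed

lemma borel_measurable_fourier: "integrable lborel f \<Longrightarrow> fourier f \<in> borel_measurable borel"
  by (intro borel_measurable_continuous_onI continuous_fourier)

lemma integrable_product:
  fixes f g :: "real \<Rightarrow> complex"
  assumes "integrable lborel f" "integrable lborel g" and h: "(\<lambda>(x, y). h x y) \<in> borel_measurable (borel \<Otimes>\<^sub>M borel)"
    and "\<And>x y. cmod (h x y) \<le> C"
  shows "integrable (lborel \<Otimes>\<^sub>M lborel) (\<lambda>(x, y). f x * g y * h x y)"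
proof -
  have [measurable]: "f \<in> borel_measurable borel" "g \<in> borel_measurable borel" using assms by auto
  have "integrable (lborel \<Otimes>\<^sub>M lborel) (\<lambda>(x, y). f x * g y)"
  proof (rule lborel_pair.Fubini_integrable)
    show "(\<lambda>(x, y). f x * g y) \<in> borel_measurable (lborel \<Otimes>\<^sub>M lborel)" by measurable
    show "integrable lborel (\<lambda>x. LINT y|lborel. cmod (case (x, y) of (x, y) \<Rightarrow> f x * g y))"
      using assms(1) by (simp add: norm_mult)
    show "AE x in lborel. integrable lborel (\<lambda>y. case (x, y) of (x, y) \<Rightarrow> f x * g y)" using assms(2) by simp
  qed
  from integrable_mult_bounded[OF this, of "\<lambda>(x, y). h x y" C] h assms(4)
  show ?thesis by (simp add: case_prod_beta' measurable_lborel1 cong: measurable_cong_sets)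
qed

text \<open>Fubini for the absolutely integrable function f x g y cis (- x y). With test functions
  in place of g this identity is what \<open>is_FT\<close> takes as definition; with Gaussian
  factors inside g it yields the inversion and Parseval formulas.\<close>

lemma fourier_mult_formula:
  assumes "integrable lborel f" "integrable lborel g"
  shows "(LINT \<xi>|lborel. fourier f \<xi> * g \<xi>) = (LINT x|lborel. f x * fourier g x)"
proof -
  have i: "integrable (lborel \<Otimes>\<^sub>M lborel) (\<lambda>(x, y). f x * g y * cis (- (x * y)))"
    by (rule integrable_product[where C = 1]) (use assms in auto)
  have "(LINT \<xi>|lborel. fourier f \<xi> * g \<xi>) = (LINT y|lborel. LINT x|lborel. f x * g y * cis (- (x * y)))"
  proof (intro Bochner_Integration.integral_cong refl)
    fix y
    show "fourier f y * g y = (LINT x|lborel. f x * g y * cis (- (x * y)))"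
      unfolding fourier_def by (subst integral_mult_left_zero[symmetric]) (simp add: mult_ac)
  qed
  also have "\<dots> = (LINT x|lborel. LINT y|lborel. f x * g y * cis (- (x * y)))"
    by (rule lborel_pair.Fubini_integral[OF i])
  also have "\<dots> = (LINT x|lborel. f x * fourier g x)"
  proof (intro Bochner_Integration.integral_cong refl)
    fix x
    show "(LINT y|lborel. f x * g y * cis (- (x * y))) = f x * fourier g x"
      unfolding fourier_def by (subst integral_mult_right_zero[symmetric]) (simp add: mult_ac)
  qed
  finally show ?thesis .
qed


section \<open>Gaussian regularization, Plancherel and Parseval\<close>

lemma gaussian_eq_normal_density:
  "e > 0 \<Longrightarrow> exp (- (e * x\<^sup>2 / 2)) = sqrt (2 * pi / e) * normal_density 0 (1 / sqrt e) x"
  by (simp add: normal_density_def real_sqrt_divide real_sqrt_mult power_divide field_simps)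

lemma integrable_gaussian: "e > 0 \<Longrightarrow> integrable lborel (\<lambda>x :: real. exp (- (e * x\<^sup>2 / 2)))"
  by (simp add: gaussian_eq_normal_density)

text \<open>After the substitution x = u / sqrt e this is the characteristic function of the
  standard normal distribution. As a function of z the value is 2 pi times a probability density of
  variance e, hence an approximate identity as e tends to 0.\<close>

lemma integral_gaussian_cis:
  assumes e: "e > 0"
  shows "(LINT x|lborel. complex_of_real (exp (- (e * x\<^sup>2 / 2))) * cis (x * z))
    = complex_of_real (2 * pi * normal_density 0 (sqrt e) z)"
proof -
  define t where "t = z / sqrt e"
  have "complex_of_real (exp (- (t\<^sup>2) / 2)) = (LINT x|std_normal_distribution. iexp (t * x))"
    using char_std_normal_distribution by (simp add: char_def fun_eq_iff)
  also have "\<dots> = (LINT x|lborel. std_normal_density x *\<^sub>R iexp (t * x))"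
    by (subst integral_density) auto
  finally have 1: "(LINT x|lborel. std_normal_density x *\<^sub>R iexp (t * x)) = complex_of_real (exp (- (t\<^sup>2) / 2))" by simp
  have "(LINT x|lborel. complex_of_real (exp (- (e * x\<^sup>2 / 2))) * cis (x * z))
     = \<bar>1 / sqrt e\<bar> *\<^sub>R (LINT x|lborel. complex_of_real (exp (- (e * (0 + 1 / sqrt e * x)\<^sup>2 / 2))) * cis ((0 + 1 / sqrt e * x) * z))"
    by (rule lborel_integral_real_affine) (use e in auto)
  also have "(LINT x|lborel. complex_of_real (exp (- (e * (0 + 1 / sqrt e * x)\<^sup>2 / 2))) * cis ((0 + 1 / sqrt e * x) * z))
      = (LINT x|lborel. sqrt (2 * pi) *\<^sub>R (std_normal_density x *\<^sub>R iexp (t * x)))"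
    using e by (intro Bochner_Integration.integral_cong refl)
      (simp add: std_normal_density_def power_divide cis_conv_exp t_def scaleR_conv_of_real mult_ac real_sqrt_mult)
  also have "\<dots> = sqrt (2 * pi) *\<^sub>R complex_of_real (exp (- (t\<^sup>2) / 2))"
    by (subst integral_scaleR_right) (use 1 in simp)
  also have "\<bar>1 / sqrt e\<bar> *\<^sub>R \<dots> = complex_of_real (2 * pi * normal_density 0 (sqrt e) z)"
  proof -
    have "1 / sqrt e * (sqrt (2 * pi) * exp (- (t\<^sup>2) / 2)) = 2 * pi * normal_density 0 (sqrt e) z"
      using e by (simp add: normal_density_def t_def power_divide real_sqrt_mult field_simps)
    then have "complex_of_real (1 / sqrt e * (sqrt (2 * pi) * exp (- (t\<^sup>2) / 2)))
      = complex_of_real (2 * pi * normal_density 0 (sqrt e) z)" by (rule arg_cong)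
    then show ?thesis using e by (simp add: scaleR_conv_of_real)
  qed
  finally show ?thesis .
qed

text \<open>The Gaussian factor makes the inversion integral absolutely convergent; the
  multiplication formula moves it over to f, where it acts as an average against a normal density of
  width sqrt e.\<close>

lemma fourier_inversion_gauss:
  assumes f: "integrable lborel f" and e: "e > 0"
  shows "(LINT \<xi>|lborel. fourier f \<xi> * (complex_of_real (exp (- (e * \<xi>\<^sup>2 / 2))) * cis (\<xi> * x)))
    = (LINT y|lborel. f y * complex_of_real (2 * pi * normal_density 0 (sqrt e) (x - y)))"
proof -
  have gi: "integrable lborel (\<lambda>\<xi>. complex_of_real (exp (- (e * \<xi>\<^sup>2 / 2))) * cis (\<xi> * x))"
    by (rule integrable_mult_bounded[where C = 1]) (use integrable_gaussian[OF e] in auto)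
  have "fourier (\<lambda>\<xi>. complex_of_real (exp (- (e * \<xi>\<^sup>2 / 2))) * cis (\<xi> * x)) y
     = complex_of_real (2 * pi * normal_density 0 (sqrt e) (x - y))" for y
    unfolding fourier_def integral_gaussian_cis[OF e, symmetric]
    by (intro Bochner_Integration.integral_cong refl) (simp add: mult.assoc cis_mult right_diff_distrib)
  then show ?thesis by (simp add: fourier_mult_formula[OF f gi])
qed

text \<open>Multiplication formula for f and the damped transform of g. Damping is there because
  \<open>fourier g\<close> itself is only bounded and continuous at this point.\<close>

lemma parseval_gauss:
  assumes f: "integrable lborel f" and g: "integrable lborel g" and e: "e > 0"
  shows "(LINT \<xi>|lborel. fourier f \<xi> * (fourier g (- \<xi>) * complex_of_real (exp (- (e * \<xi>\<^sup>2 / 2)))))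
    = (LINT x|lborel. f x * (LINT y|lborel. g y * complex_of_real (2 * pi * normal_density 0 (sqrt e) (x - y))))"
proof -
  let ?h = "\<lambda>\<xi>. fourier g (- \<xi>) * complex_of_real (exp (- (e * \<xi>\<^sup>2 / 2)))"
  have [measurable]: "fourier g \<in> borel_measurable borel" by (rule borel_measurable_fourier[OF g])
  have hi: "integrable lborel ?h"
    by (subst mult.commute, rule integrable_mult_bounded[where C = "LINT x|lborel. cmod (g x)"])
      (use integrable_gaussian[OF e] norm_fourier_le[OF g] in auto)
  have "fourier ?h x = (LINT y|lborel. g y * complex_of_real (2 * pi * normal_density 0 (sqrt e) (x - y)))" for x
    unfolding fourier_inversion_gauss[OF g e, symmetric] fourier_def[of ?h]
    by (subst lborel_integral_uminus[symmetric]) (simp add: mult_ac)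
  then show ?thesis by (simp add: fourier_mult_formula[OF f hi])
qed

lemma fourier_cnj: "fourier (\<lambda>x. cnj (f x)) (- \<xi>) = cnj (fourier f \<xi>)"
proof -
  have "(LINT x|lborel. cnj (f x * cis (- (x * \<xi>)))) = cnj (LINT x|lborel. f x * cis (- (x * \<xi>)))"
    by (rule integral_bounded_linear'[OF bounded_linear_cnj bounded_linear_cnj]) simp
  then show ?thesis unfolding fourier_def by (simp add: cis_cnj)
qed

lemma nn_integral_normal_density_shift:
  assumes "s > 0"
  shows "(\<integral>\<^sup>+x. ennreal (normal_density 0 s (x - y)) \<partial>lborel) = 1" "(\<integral>\<^sup>+x. ennreal (normal_density 0 s (y - x)) \<partial>lborel) = 1"
proof -
  have 1: "(\<integral>\<^sup>+x. ennreal (normal_density m s x) \<partial>lborel) = 1" for m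
    using assms by (subst nn_integral_eq_integral) auto
  have "normal_density 0 s (x - y) = normal_density y s x" "normal_density 0 s (y - x) = normal_density y s x" for x
    by (simp_all add: normal_density_def power2_commute)
  with 1[of y] show "(\<integral>\<^sup>+x. ennreal (normal_density 0 s (x - y)) \<partial>lborel) = 1" "(\<integral>\<^sup>+x. ennreal (normal_density 0 s (y - x)) \<partial>lborel) = 1"
    by simp_all
qed

lemma norm_integral_le_nn_integral:
  fixes f :: "'a \<Rightarrow> complex"
  shows "ennreal (norm (integral\<^sup>L M f)) \<le> (\<integral>\<^sup>+x. ennreal (norm (f x)) \<partial>M)"
  by (cases "integrable M f") (auto intro: integral_norm_bound_ennreal simp: not_integrable_integral_eq)

text \<open>In the damped Parseval identity with g = cnj f the product of |f x| and |f y| is split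
  by the arithmetic-geometric mean, and both marginals of the normal kernel have mass 1. This gives
  the sharp constant for arbitrary integrable f, continuous or not.\<close>

lemma plancherel_gauss_le:
  assumes f: "integrable lborel f" and e: "e > 0"
  shows "(\<integral>\<^sup>+\<xi>. ennreal ((cmod (fourier f \<xi>))\<^sup>2 * exp (- (e * \<xi>\<^sup>2 / 2))) \<partial>lborel)
    \<le> ennreal (2 * pi) * (\<integral>\<^sup>+x. ennreal ((cmod (f x))\<^sup>2) \<partial>lborel)"
proof -
  have [measurable]: "f \<in> borel_measurable borel" "fourier f \<in> borel_measurable borel"
    using f borel_measurable_fourier by auto
  let ?n = "\<lambda>x y. normal_density 0 (sqrt e) (x - y)"
  define F where "F \<xi> = (cmod (fourier f \<xi>))\<^sup>2 * exp (- (e * \<xi>\<^sup>2 / 2))" for \<xi>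
  have Fi: "integrable lborel F"
  proof (rule Bochner_Integration.integrable_bound)
    show "integrable lborel (\<lambda>\<xi>. (LINT x|lborel. cmod (f x))\<^sup>2 * exp (- (e * \<xi>\<^sup>2 / 2)))" using integrable_gaussian[OF e] by simp
    show "AE \<xi> in lborel. norm (F \<xi>) \<le> norm ((LINT x|lborel. cmod (f x))\<^sup>2 * exp (- (e * \<xi>\<^sup>2 / 2)))"
      unfolding F_def by (intro AE_I2) (auto intro!: mult_mono power_mono norm_fourier_le f)
    show "F \<in> borel_measurable lborel" unfolding F_def by measurable
  qed
  have eq: "complex_of_real (F \<xi>) = fourier f \<xi> * (fourier (\<lambda>x. cnj (f x)) (- \<xi>) * complex_of_real (exp (- (e * \<xi>\<^sup>2 / 2))))" for \<xi>
    unfolding F_def fourier_cnj by (simp add: complex_norm_square[symmetric] mult.assoc[symmetric])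
  have "(\<integral>\<^sup>+\<xi>. ennreal (F \<xi>) \<partial>lborel) = ennreal (integral\<^sup>L lborel F)"
    by (rule nn_integral_eq_integral[OF Fi]) (simp add: F_def)
  also have "\<dots> \<le> ennreal (norm (LINT \<xi>|lborel. complex_of_real (F \<xi>)))"
    by (intro ennreal_leI) simp
  also have "(LINT \<xi>|lborel. complex_of_real (F \<xi>)) =
      (LINT x|lborel. f x * (LINT y|lborel. cnj (f y) * complex_of_real (2 * pi * ?n x y)))"
    unfolding eq by (rule parseval_gauss) (use f e in auto)
  also have "ennreal (norm \<dots>) \<le> (\<integral>\<^sup>+x. ennreal (norm (f x * (LINT y|lborel. cnj (f y) * complex_of_real (2 * pi * ?n x y)))) \<partial>lborel)"
    by (rule norm_integral_le_nn_integral)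
  also have "\<dots> \<le> (\<integral>\<^sup>+x. \<integral>\<^sup>+y. ennreal (cmod (f x) * cmod (f y) * (2 * pi * ?n x y)) \<partial>lborel \<partial>lborel)"
  proof (intro nn_integral_mono)
    fix x
    have "ennreal (norm (f x * (LINT y|lborel. cnj (f y) * complex_of_real (2 * pi * ?n x y))))
      \<le> ennreal (cmod (f x)) * (\<integral>\<^sup>+y. ennreal (norm (cnj (f y) * complex_of_real (2 * pi * ?n x y))) \<partial>lborel)"
      by (simp only: norm_mult[of "f x"] ennreal_mult norm_ge_zero) (intro mult_left_mono norm_integral_le_nn_integral, simp)
    also have "\<dots> = (\<integral>\<^sup>+y. ennreal (cmod (f x) * cmod (f y) * (2 * pi * ?n x y)) \<partial>lborel)"
      by (subst nn_integral_cmult[symmetric]) (auto simp: norm_mult ennreal_mult[symmetric] mult.assoc)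
    finally show "ennreal (norm (f x * (LINT y|lborel. cnj (f y) * complex_of_real (2 * pi * ?n x y)))) \<le> \<dots>" .
  qed
  also have "\<dots> \<le> (\<integral>\<^sup>+x. \<integral>\<^sup>+y. ennreal (pi * (cmod (f x))\<^sup>2) * ennreal (?n x y) + ennreal (pi * (cmod (f y))\<^sup>2) * ennreal (?n x y) \<partial>lborel \<partial>lborel)"
  proof (intro nn_integral_mono)
    fix x y
    have "cmod (f x) * cmod (f y) * (2 * pi * ?n x y) \<le> pi * (cmod (f x))\<^sup>2 * ?n x y + pi * (cmod (f y))\<^sup>2 * ?n x y"
      using mult_right_mono[OF sum_squares_bound[of "cmod (f x)" "cmod (f y)"], of "pi * ?n x y"] by (simp add: algebra_simps)
    then show "ennreal (cmod (f x) * cmod (f y) * (2 * pi * ?n x y))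
      \<le> ennreal (pi * (cmod (f x))\<^sup>2) * ennreal (?n x y) + ennreal (pi * (cmod (f y))\<^sup>2) * ennreal (?n x y)"
      by (simp add: ennreal_mult[symmetric] ennreal_plus[symmetric] del: ennreal_plus)
  qed
  also have "\<dots> = (\<integral>\<^sup>+x. \<integral>\<^sup>+y. ennreal (pi * (cmod (f x))\<^sup>2) * ennreal (?n x y) \<partial>lborel \<partial>lborel)
      + (\<integral>\<^sup>+x. \<integral>\<^sup>+y. ennreal (pi * (cmod (f y))\<^sup>2) * ennreal (?n x y) \<partial>lborel \<partial>lborel)"
    by (subst nn_integral_add, measurable, subst nn_integral_add) auto
  also have "(\<integral>\<^sup>+x. \<integral>\<^sup>+y. ennreal (pi * (cmod (f y))\<^sup>2) * ennreal (?n x y) \<partial>lborel \<partial>lborel)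
     = (\<integral>\<^sup>+y. \<integral>\<^sup>+x. ennreal (pi * (cmod (f y))\<^sup>2) * ennreal (?n x y) \<partial>lborel \<partial>lborel)"
    by (rule lborel_pair.Fubini'[symmetric]) measurable
  also have "\<dots> = (\<integral>\<^sup>+y. ennreal (pi * (cmod (f y))\<^sup>2) \<partial>lborel)"
    using e by (subst nn_integral_cmult) (auto simp: nn_integral_normal_density_shift)
  also have "(\<integral>\<^sup>+x. \<integral>\<^sup>+y. ennreal (pi * (cmod (f x))\<^sup>2) * ennreal (?n x y) \<partial>lborel \<partial>lborel) = (\<integral>\<^sup>+x. ennreal (pi * (cmod (f x))\<^sup>2) \<partial>lborel)"
    using e by (subst nn_integral_cmult) (auto simp: nn_integral_normal_density_shift)
  also have "(\<integral>\<^sup>+x. ennreal (pi * (cmod (f x))\<^sup>2) \<partial>lborel) + (\<integral>\<^sup>+x. ennreal (pi * (cmod (f x))\<^sup>2) \<partial>lborel)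
     = ennreal (2 * pi) * (\<integral>\<^sup>+x. ennreal ((cmod (f x))\<^sup>2) \<partial>lborel)"
    by (simp add: ennreal_mult nn_integral_cmult mult_2[symmetric] mult.assoc[symmetric])
  finally show ?thesis by (simp add: F_def)
qed

text \<open>The damped bounds are uniform in e, so Fatou's lemma along e = 1 / (n + 1) removes the
  damping.\<close>

lemma plancherel_le:
  assumes f: "integrable lborel f" and f2: "L2 f"
  shows "L2 (fourier f)" "(LINT \<xi>|lborel. (cmod (fourier f \<xi>))\<^sup>2) \<le> 2 * pi * (LINT x|lborel. (cmod (f x))\<^sup>2)"
proof -
  have [measurable]: "fourier f \<in> borel_measurable borel" using f borel_measurable_fourier by auto
  let ?B = "ennreal (2 * pi) * (\<integral>\<^sup>+x. ennreal ((cmod (f x))\<^sup>2) \<partial>lborel)"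
  have "(\<integral>\<^sup>+\<xi>. ennreal ((cmod (fourier f \<xi>))\<^sup>2) \<partial>lborel)
     = (\<integral>\<^sup>+\<xi>. liminf (\<lambda>n. ennreal ((cmod (fourier f \<xi>))\<^sup>2 * exp (- (1 / Suc n * \<xi>\<^sup>2 / 2)))) \<partial>lborel)"
  proof (intro nn_integral_cong)
    fix \<xi> :: real
    have "(\<lambda>n. 1 / real (Suc n)) \<longlonglongrightarrow> 0" using LIMSEQ_inverse_real_of_nat by (simp add: inverse_eq_divide)
    then have "(\<lambda>n. (cmod (fourier f \<xi>))\<^sup>2 * exp (- (1 / Suc n * \<xi>\<^sup>2 / 2))) \<longlonglongrightarrow> (cmod (fourier f \<xi>))\<^sup>2 * exp (- (0 * \<xi>\<^sup>2 / 2))"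
      by (intro tendsto_intros) auto
    then have "(\<lambda>n. ennreal ((cmod (fourier f \<xi>))\<^sup>2 * exp (- (1 / Suc n * \<xi>\<^sup>2 / 2)))) \<longlonglongrightarrow> ennreal ((cmod (fourier f \<xi>))\<^sup>2)"
      by (intro tendsto_ennrealI) simp
    from lim_imp_Liminf[OF _ this]
    show "ennreal ((cmod (fourier f \<xi>))\<^sup>2) = liminf (\<lambda>n. ennreal ((cmod (fourier f \<xi>))\<^sup>2 * exp (- (1 / Suc n * \<xi>\<^sup>2 / 2))))"
      by simp
  qed
  also have "\<dots> \<le> liminf (\<lambda>n. \<integral>\<^sup>+\<xi>. ennreal ((cmod (fourier f \<xi>))\<^sup>2 * exp (- (1 / Suc n * \<xi>\<^sup>2 / 2))) \<partial>lborel)"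
    by (rule nn_integral_liminf) measurable
  also have "\<dots> \<le> liminf (\<lambda>n. ?B)"
    by (intro Liminf_mono always_eventually allI plancherel_gauss_le f) simp
  also have "\<dots> = ?B" by (simp add: Liminf_const)
  also have "\<dots> = ennreal (2 * pi * (LINT x|lborel. (cmod (f x))\<^sup>2))"
    using f2 by (subst nn_integral_eq_integral) (auto simp: L2_def ennreal_mult)
  finally have *: "(\<integral>\<^sup>+\<xi>. ennreal ((cmod (fourier f \<xi>))\<^sup>2) \<partial>lborel) \<le> ennreal (2 * pi * (LINT x|lborel. (cmod (f x))\<^sup>2))" .
  have i: "integrable lborel (\<lambda>\<xi>. (cmod (fourier f \<xi>))\<^sup>2)"
    by (rule integrableI_bounded) (use * in \<open>auto intro: le_less_trans\<close>)
  then show "L2 (fourier f)" by (simp add: L2_def)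
  from * show "(LINT \<xi>|lborel. (cmod (fourier f \<xi>))\<^sup>2) \<le> 2 * pi * (LINT x|lborel. (cmod (f x))\<^sup>2)"
    by (subst (asm) nn_integral_eq_integral[OF i]) (auto simp: ennreal_le_iff)
qed


text \<open>Equality asks for convergence of the Gaussian averages of f, which is pointwise when f
  is continuous and bounded. Continuity is put on this factor alone: V may be any integrable and
  square integrable function, while f will be a test function or a rapidly decreasing one.\<close>

lemma parseval_continuous:
  fixes V f :: "real \<Rightarrow> complex"
  assumes V: "integrable lborel V" "L2 V" and f: "integrable lborel f" "L2 f"
    and cont: "continuous_on UNIV f" and bdd: "\<And>x. cmod (f x) \<le> C"
  shows "(LINT \<xi>|lborel. fourier V \<xi> * fourier f (- \<xi>)) = 2 * pi * (LINT x|lborel. V x * f x)"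
proof -
  have [measurable]: "V \<in> borel_measurable borel" "f \<in> borel_measurable borel"
    "fourier V \<in> borel_measurable borel" "fourier f \<in> borel_measurable borel"
    using V f borel_measurable_fourier by auto
  have i: "integrable lborel (\<lambda>\<xi>. fourier V \<xi> * fourier f (- \<xi>))"
    by (intro L2_mult_integrable L2_uminus plancherel_le V f)
  \<comment> \<open>The square makes the width \<open>sqrt (e n)\<close> equal to 1 / (n + 1), so
    that the average becomes a standard normal average of f (x - z / (n + 1)).\<close>
  define e where "e n = 1 / (real (Suc n))\<^sup>2" for n
  have e0: "e n > 0" for n by (simp add: e_def)
  have e_sqrt: "sqrt (e n) = 1 / Suc n" for n by (simp add: e_def real_sqrt_divide)
  have lim0: "(\<lambda>n. 1 / real (Suc n)) \<longlonglongrightarrow> 0" using LIMSEQ_inverse_real_of_nat by (simp add: inverse_eq_divide)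
  have elim: "e \<longlonglongrightarrow> 0" using tendsto_power[OF lim0, of 2] by (simp add: e_def[abs_def] power_divide)
  have "(\<lambda>n. LINT \<xi>|lborel. fourier V \<xi> * (fourier f (- \<xi>) * complex_of_real (exp (- (e n * \<xi>\<^sup>2 / 2)))))
     \<longlonglongrightarrow> (LINT \<xi>|lborel. fourier V \<xi> * fourier f (- \<xi>))"
  proof (rule integral_dominated_convergence[where w = "\<lambda>\<xi>. norm (fourier V \<xi> * fourier f (- \<xi>))"])
    show "integrable lborel (\<lambda>\<xi>. norm (fourier V \<xi> * fourier f (- \<xi>)))" using i by (rule integrable_norm)
    show "AE \<xi> in lborel. (\<lambda>n. fourier V \<xi> * (fourier f (- \<xi>) * complex_of_real (exp (- (e n * \<xi>\<^sup>2 / 2)))))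
        \<longlonglongrightarrow> fourier V \<xi> * fourier f (- \<xi>)"
    proof (intro AE_I2)
      fix \<xi>
      have "(\<lambda>n. fourier V \<xi> * (fourier f (- \<xi>) * complex_of_real (exp (- (e n * \<xi>\<^sup>2 / 2)))))
        \<longlonglongrightarrow> fourier V \<xi> * (fourier f (- \<xi>) * complex_of_real (exp (- (0 * \<xi>\<^sup>2 / 2))))"
        by (intro tendsto_intros elim) auto
      then show "(\<lambda>n. fourier V \<xi> * (fourier f (- \<xi>) * complex_of_real (exp (- (e n * \<xi>\<^sup>2 / 2)))))
        \<longlonglongrightarrow> fourier V \<xi> * fourier f (- \<xi>)" by simp
    qed
    show "AE \<xi> in lborel. norm (fourier V \<xi> * (fourier f (- \<xi>) * complex_of_real (exp (- (e n * \<xi>\<^sup>2 / 2)))))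
        \<le> norm (fourier V \<xi> * fourier f (- \<xi>))" for n
    proof (intro AE_I2)
      fix \<xi>
      have "exp (- (e n * \<xi>\<^sup>2 / 2)) \<le> 1" using e0[of n] by simp
      then have "norm (fourier V \<xi> * fourier f (- \<xi>)) * exp (- (e n * \<xi>\<^sup>2 / 2)) \<le> norm (fourier V \<xi> * fourier f (- \<xi>)) * 1"
        by (intro mult_left_mono) auto
      then show "norm (fourier V \<xi> * (fourier f (- \<xi>) * complex_of_real (exp (- (e n * \<xi>\<^sup>2 / 2)))))
        \<le> norm (fourier V \<xi> * fourier f (- \<xi>))" by (simp add: norm_mult mult.assoc)
    qed
  qed measurable
  moreover have "(\<lambda>n. LINT x|lborel. V x * (LINT z|lborel. f (x - z / Suc n) * complex_of_real (2 * pi * std_normal_density z)))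
      \<longlonglongrightarrow> (LINT x|lborel. V x * (2 * pi * f x))"
  proof (rule integral_dominated_convergence[where w = "\<lambda>x. 2 * pi * C * norm (V x)"])
    have inner: "(\<lambda>n. LINT z|lborel. f (x - z / Suc n) * complex_of_real (2 * pi * std_normal_density z)) \<longlonglongrightarrow> 2 * pi * f x" for x
    proof -
      have "(\<lambda>n. LINT z|lborel. f (x - z / Suc n) * complex_of_real (2 * pi * std_normal_density z))
          \<longlonglongrightarrow> (LINT z|lborel. f x * complex_of_real (2 * pi * std_normal_density z))"
      proof (rule integral_dominated_convergence[where w = "\<lambda>z. C * (2 * pi * std_normal_density z)"])
        show "AE z in lborel. (\<lambda>n. f (x - z / Suc n) * complex_of_real (2 * pi * std_normal_density z))
            \<longlonglongrightarrow> f x * complex_of_real (2 * pi * std_normal_density z)"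
        proof (intro AE_I2 tendsto_mult tendsto_const)
          fix z
          have "(\<lambda>n. x - z * (1 / Suc n)) \<longlonglongrightarrow> x - z * 0" by (intro tendsto_intros lim0)
          then have "(\<lambda>n. x - z / Suc n) \<longlonglongrightarrow> x" by simp
          moreover have "isCont f x" using cont by (simp add: continuous_on_eq_continuous_at)
          ultimately show "(\<lambda>n. f (x - z / Suc n)) \<longlonglongrightarrow> f x" by (rule isCont_tendsto_compose[rotated])
        qed
        show "AE z in lborel. norm (f (x - z / Suc n) * complex_of_real (2 * pi * std_normal_density z)) \<le> C * (2 * pi * std_normal_density z)" for n
          using bdd by (intro AE_I2) (auto simp: norm_mult intro!: mult_right_mono)
      qed auto
      also have "(LINT z|lborel. f x * complex_of_real (2 * pi * std_normal_density z)) = 2 * pi * f x"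
      proof -
        have "(LINT z|lborel. complex_of_real (2 * pi * std_normal_density z)) = complex_of_real (2 * pi)"
          by (subst integral_complex_of_real) simp
        then show ?thesis by simp
      qed
      finally show ?thesis .
    qed
    then show "AE x in lborel. (\<lambda>n. V x * (LINT z|lborel. f (x - z / Suc n) * complex_of_real (2 * pi * std_normal_density z)))
        \<longlonglongrightarrow> V x * (2 * pi * f x)" by (intro AE_I2 tendsto_mult tendsto_const)
    show "AE x in lborel. norm (V x * (LINT z|lborel. f (x - z / Suc n) * complex_of_real (2 * pi * std_normal_density z))) \<le> 2 * pi * C * norm (V x)" for n
    proof (intro AE_I2)
      fix x
      have "norm (LINT z|lborel. f (x - z / Suc n) * complex_of_real (2 * pi * std_normal_density z))
         \<le> (LINT z|lborel. C * (2 * pi * std_normal_density z))"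
      proof (rule Bochner_Integration.integral_norm_bound_integral)
        show "integrable lborel (\<lambda>z. f (x - z / Suc n) * complex_of_real (2 * pi * std_normal_density z))"
          by (subst mult.commute, rule integrable_mult_bounded[where C = C]) (auto intro: bdd)
        show "norm (f (x - z / Suc n) * complex_of_real (2 * pi * std_normal_density z)) \<le> C * (2 * pi * std_normal_density z)" for z
          using mult_right_mono[OF bdd, of "2 * pi * std_normal_density z"] by (simp add: norm_mult)
      qed auto
      then show "norm (V x * (LINT z|lborel. f (x - z / Suc n) * complex_of_real (2 * pi * std_normal_density z))) \<le> 2 * pi * C * norm (V x)"
        by (simp add: norm_mult mult.commute mult_left_mono)
    qed
  qed (use V(1) in auto)
  moreover have "(LINT \<xi>|lborel. fourier V \<xi> * (fourier f (- \<xi>) * complex_of_real (exp (- (e n * \<xi>\<^sup>2 / 2)))))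
      = (LINT x|lborel. V x * (LINT z|lborel. f (x - z / Suc n) * complex_of_real (2 * pi * std_normal_density z)))" for n
  proof -
    have "(LINT y|lborel. f y * complex_of_real (2 * pi * normal_density 0 (sqrt (e n)) (x - y)))
        = (LINT z|lborel. f (x - z / Suc n) * complex_of_real (2 * pi * std_normal_density z))" for x
    proof -
      have "(LINT y|lborel. f y * complex_of_real (2 * pi * normal_density 0 (1 / Suc n) (x - y)))
        = \<bar>- 1 / Suc n\<bar> *\<^sub>R (LINT z|lborel. f (x + (- 1 / Suc n) * z) * complex_of_real (2 * pi * normal_density 0 (1 / Suc n) (x - (x + (- 1 / Suc n) * z))))"
        by (rule lborel_integral_real_affine) simp
      also have "\<dots> = (LINT z|lborel. f (x - z / Suc n) * complex_of_real (2 * pi * std_normal_density z))"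
        by (subst integral_scaleR_right[symmetric], intro Bochner_Integration.integral_cong refl)
          (simp add: normal_density_def scaleR_conv_of_real real_sqrt_mult real_sqrt_divide power_divide del: of_nat_Suc)
      finally show ?thesis by (simp add: e_sqrt)
    qed
    then show ?thesis by (simp only: parseval_gauss[OF V(1) f(1) e0])
  qed
  ultimately have "(LINT \<xi>|lborel. fourier V \<xi> * fourier f (- \<xi>)) = (LINT x|lborel. V x * (2 * pi * f x))"
    using LIMSEQ_unique by simp
  also have "\<dots> = 2 * pi * (LINT x|lborel. V x * f x)"
    by (subst integral_mult_right_zero[symmetric]) (simp add: mult_ac)
  finally show ?thesis .
qed

lemma plancherel_continuous:
  assumes "integrable lborel f" "L2 f" "continuous_on UNIV f" "\<And>x. cmod (f x) \<le> C"
  shows "(LINT \<xi>|lborel. (cmod (fourier f \<xi>))\<^sup>2) = 2 * pi * (LINT x|lborel. (cmod (f x))\<^sup>2)"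
proof -
  have "complex_of_real (LINT \<xi>|lborel. (cmod (fourier f \<xi>))\<^sup>2) = (LINT \<xi>|lborel. fourier f \<xi> * fourier (\<lambda>x. cnj (f x)) (- \<xi>))"
    by (simp add: fourier_cnj flip: integral_complex_of_real complex_norm_square)
  also have "\<dots> = 2 * pi * (LINT x|lborel. f x * cnj (f x))"
    by (rule parseval_continuous[where C = C]) (use assms in \<open>auto intro!: continuous_intros L2_cnj\<close>)
  also have "\<dots> = complex_of_real (2 * pi * (LINT x|lborel. (cmod (f x))\<^sup>2))"
    by (simp flip: integral_complex_of_real complex_norm_square)
  finally show ?thesis by (simp only: of_real_eq_iff)
qed

section \<open>Uniqueness of the Fourier transform\<close>

text \<open>Positive and negative parts have equal mass, by the hypothesis at frequency 0. Unless
  this mass is 0, division by it makes them probability densities with the same characteristic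
  function, and Levy's uniqueness theorem applies.\<close>

lemma integrable_fourier_unique_real:
  fixes f :: "real \<Rightarrow> real"
  assumes f: "integrable lborel f" and zero: "\<And>\<xi>. (LINT x|lborel. complex_of_real (f x) * cis (x * \<xi>)) = 0"
  shows "AE x in lborel. f x = 0"
proof -
  have [measurable]: "f \<in> borel_measurable borel" using f by auto
  define p where "p x = max 0 (f x)" for x
  define q where "q x = max 0 (- f x)" for x
  have pq: "f x = p x - q x" "\<bar>f x\<bar> = p x + q x" "0 \<le> p x" "0 \<le> q x" for x by (auto simp: p_def q_def)
  have pi: "integrable lborel p" and qi: "integrable lborel q"
    unfolding p_def q_def using f by (auto intro!: integrable_max)
  have [measurable]: "p \<in> borel_measurable borel" "q \<in> borel_measurable borel" using pi qi by auto
  have char_eq: "(LINT x|lborel. complex_of_real (p x) * cis (x * \<xi>)) = (LINT x|lborel. complex_of_real (q x) * cis (x * \<xi>))" for \<xi>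
  proof -
    have "(LINT x|lborel. complex_of_real (p x) * cis (x * \<xi>)) - (LINT x|lborel. complex_of_real (q x) * cis (x * \<xi>))
      = (LINT x|lborel. complex_of_real (p x) * cis (x * \<xi>) - complex_of_real (q x) * cis (x * \<xi>))"
      by (intro Bochner_Integration.integral_diff[symmetric] integrable_mult_bounded[where C = 1]) (use pi qi in auto)
    also have "\<dots> = 0" using zero[of \<xi>] by (simp add: pq(1) algebra_simps)
    finally show ?thesis by simp
  qed
  define m where "m = integral\<^sup>L lborel p"
  have mq: "m = integral\<^sup>L lborel q"
    using char_eq[of 0] by (simp add: m_def integral_complex_of_real)
  show ?thesis
  proof (cases "m = 0")
    case True
    then have "AE x in lborel. p x = 0" "AE x in lborel. q x = 0"
      using mq integral_nonneg_eq_0_iff_AE[OF pi] integral_nonneg_eq_0_iff_AE[OF qi] pq m_def by auto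
    then show ?thesis by eventually_elim (simp add: pq(1))
  next
    case False
    then have m: "m > 0" using integral_nonneg_AE[of p lborel] pq m_def by (auto simp: less_le)
    have dist: "real_distribution (density lborel (\<lambda>x. ennreal (h x / m)))"
      if [measurable]: "h \<in> borel_measurable borel" and h: "\<And>x. 0 \<le> h x" "integrable lborel h" "integral\<^sup>L lborel h = m" for h
    proof -
      have "emeasure (density lborel (\<lambda>x. ennreal (h x / m))) UNIV = (\<integral>\<^sup>+x. ennreal (h x / m) \<partial>lborel)"
        by (subst emeasure_density) auto
      also have "\<dots> = 1" using h m by (subst nn_integral_eq_integral) auto
      finally have "prob_space (density lborel (\<lambda>x. ennreal (h x / m)))" by (intro prob_spaceI) simp
      then show ?thesis by (simp add: real_distribution_def real_distribution_axioms_def)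
    qed
    have ch: "char (density lborel (\<lambda>x. ennreal (h x / m))) t = (LINT x|lborel. complex_of_real (h x) * cis (x * t)) / m"
      if [measurable]: "h \<in> borel_measurable borel" and h: "\<And>x. 0 \<le> h x" for h t
    proof -
      have "char (density lborel (\<lambda>x. ennreal (h x / m))) t = (LINT x|lborel. (h x / m) *\<^sub>R iexp (t * x))"
        unfolding char_def by (subst integral_density) (use h m in auto)
      also have "\<dots> = (LINT x|lborel. complex_of_real (h x) * cis (x * t) / m)"
        by (simp add: scaleR_conv_of_real cis_conv_exp mult_ac)
      finally show ?thesis by simp
    qed
    have "density lborel (\<lambda>x. ennreal (p x / m)) = density lborel (\<lambda>x. ennreal (q x / m))"
    proof (rule Levy_uniqueness)
      show "real_distribution (density lborel (\<lambda>x. ennreal (p x / m)))" by (rule dist) (use pq pi m_def in auto)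
      show "real_distribution (density lborel (\<lambda>x. ennreal (q x / m)))" by (rule dist) (use pq qi mq in auto)
      show "char (density lborel (\<lambda>x. ennreal (p x / m))) = char (density lborel (\<lambda>x. ennreal (q x / m)))"
        using pq by (intro ext) (simp add: ch char_eq)
    qed
    then have "AE x in lborel. ennreal (p x / m) = ennreal (q x / m)"
      by (subst (asm) sigma_finite_measure.density_unique_iff[OF sigma_finite_lborel]) auto
    then show ?thesis
      by eventually_elim (use m pq in \<open>auto simp: pq(1) divide_right_mono\<close>)
  qed
qed

text \<open>The transform of cnj f arises from that of f by conjugation and reflection, so it
  vanishes too, and real and imaginary parts can be treated separately.\<close>

lemma integrable_fourier_unique:
  assumes f: "integrable lborel f" and zero: "\<And>\<xi>. fourier f \<xi> = 0"
  shows "AE x in lborel. f x = 0"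
proof -
  have z: "(LINT x|lborel. f x * cis (x * \<xi>)) = 0" for \<xi>
    using zero[of "- \<xi>"] by (simp add: fourier_def)
  have zc: "(LINT x|lborel. cnj (f x) * cis (x * \<xi>)) = 0" for \<xi>
  proof -
    have "(LINT x|lborel. cnj (f x) * cis (x * \<xi>)) = cnj (LINT x|lborel. f x * cis (x * - \<xi>))"
      using fourier_cnj[of f "\<xi>"] by (simp add: fourier_def)
    then show ?thesis using z[of "- \<xi>"] by simp
  qed
  have i: "integrable lborel (\<lambda>x. f x * cis (x * \<xi>))" "integrable lborel (\<lambda>x. cnj (f x) * cis (x * \<xi>))" for \<xi>
    by (rule integrable_mult_bounded[where C = 1]; use f in auto)+
  have re: "complex_of_real (Re z) = (z + cnj z) / 2" and im: "complex_of_real (Im z) = (z - cnj z) / (2 * \<i>)" for z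
    by (simp_all add: complex_eq_iff)
  have "AE x in lborel. Re (f x) = 0"
  proof (rule integrable_fourier_unique_real)
    show "(LINT x|lborel. complex_of_real (Re (f x)) * cis (x * \<xi>)) = 0" for \<xi>
    proof -
      have "(LINT x|lborel. complex_of_real (Re (f x)) * cis (x * \<xi>)) = (LINT x|lborel. (f x * cis (x * \<xi>) + cnj (f x) * cis (x * \<xi>)) / 2)"
        unfolding re by (simp add: algebra_simps)
      also have "\<dots> = 0" using i z zc by (simp add: Bochner_Integration.integral_add)
      finally show ?thesis .
    qed
  qed (use f in auto)
  moreover have "AE x in lborel. Im (f x) = 0"
  proof (rule integrable_fourier_unique_real)
    show "(LINT x|lborel. complex_of_real (Im (f x)) * cis (x * \<xi>)) = 0" for \<xi>
    proof -
      have "(LINT x|lborel. complex_of_real (Im (f x)) * cis (x * \<xi>)) = (LINT x|lborel. (f x * cis (x * \<xi>) - cnj (f x) * cis (x * \<xi>)) / (2 * \<i>))"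
        unfolding im by (simp add: algebra_simps)
      also have "\<dots> = 0" using i z zc by (simp add: Bochner_Integration.integral_diff)
      finally show ?thesis .
    qed
  qed (use f in auto)
  ultimately show ?thesis by eventually_elim (simp add: complex_eq_iff)
qed

section \<open>Smooth compactly supported test functions\<close>

lemma smooth_realI:
  assumes "\<And>f. f \<in> S \<Longrightarrow> \<exists>g\<in>S. \<forall>x. (f has_real_derivative g x) (at x)" "f \<in> S"
  shows "smooth_real f"
proof -
  have d: "deriv f \<in> S" "f differentiable (at x)" if fS: "f \<in> S" for f x
  proof -
    obtain g where g: "g \<in> S" "\<And>x. (f has_real_derivative g x) (at x)" using assms(1)[OF fS] by blast
    have "deriv f = g" using g(2) DERIV_imp_deriv by blast
    then show "deriv f \<in> S" using g(1) by simp
    show "f differentiable (at x)" using g(2) real_differentiable_def by blast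
  qed
  have "(deriv ^^ n) f \<in> S" for n by (induction n) (use assms(2) d in auto)
  then show ?thesis unfolding smooth_real_def using d by blast
qed

lemma smooth_real_deriv:
  assumes "smooth_real f" shows "smooth_real (deriv f)" "(f has_real_derivative deriv f x) (at x)"
proof -
  show "smooth_real (deriv f)"
    using assms unfolding smooth_real_def by (metis funpow_Suc_right o_apply)
  have "((deriv ^^ 0) f) differentiable (at x)" using assms unfolding smooth_real_def by blast
  then show "(f has_real_derivative deriv f x) (at x)"
    by (metis DERIV_imp_deriv funpow_0 real_differentiable_def)
qed

lemma smooth_real_continuous: "smooth_real f \<Longrightarrow> continuous_on UNIV f"
  using smooth_real_deriv(2) by (meson DERIV_continuous_on has_field_derivative_at_within)

text \<open>Smoothness is proved through \<open>smooth_realI\<close> by naming a class of functions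
  closed under differentiation, which avoids formulas for higher derivatives. The product rule
  leaves the set of plain products, whereas sums of products form a closed class.\<close>

inductive_set smooth_products :: "(real \<Rightarrow> real) set" where
  prod: "smooth_real f \<Longrightarrow> smooth_real g \<Longrightarrow> (\<lambda>x. f x * g x) \<in> smooth_products"
| sum: "f \<in> smooth_products \<Longrightarrow> g \<in> smooth_products \<Longrightarrow> (\<lambda>x. f x + g x) \<in> smooth_products"

lemma smooth_real_mult:
  assumes "smooth_real f" "smooth_real g" shows "smooth_real (\<lambda>x. f x * g x)"
proof (rule smooth_realI[where S = smooth_products])
  fix f assume "f \<in> smooth_products"
  then show "\<exists>g\<in>smooth_products. \<forall>x. (f has_real_derivative g x) (at x)"
  proof induction
    case (prod f g)
    then show ?case
      by (intro bexI[of _ "\<lambda>x. deriv f x * g x + f x * deriv g x"])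
        (auto intro!: smooth_products.intros smooth_real_deriv derivative_eq_intros)
  next
    case (sum f g)
    then obtain f' g' where "f' \<in> smooth_products" "g' \<in> smooth_products"
      "\<And>x. (f has_real_derivative f' x) (at x)" "\<And>x. (g has_real_derivative g' x) (at x)" by blast
    then show ?case
      by (intro bexI[of _ "\<lambda>x. f' x + g' x"]) (auto intro: smooth_products.sum derivative_intros)
  qed
qed (auto intro: smooth_products.prod assms)

lemma smooth_real_affine:
  assumes "smooth_real f" shows "smooth_real (\<lambda>x. f (a * x + b))"
proof (rule smooth_realI[where S = "{\<lambda>x. c * g (a * x + b) | c g. smooth_real g}"])
  show "(\<lambda>x. f (a * x + b)) \<in> {\<lambda>x. c * g (a * x + b) | c g. smooth_real g}"
    using assms by (auto intro!: exI[of _ "1::real"] exI[of _ f])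
  fix h assume "h \<in> {\<lambda>x. c * g (a * x + b) | c g. smooth_real g}"
  then obtain c g where h: "h = (\<lambda>x. c * g (a * x + b))" and g: "smooth_real g" by blast
  have "(h has_real_derivative (c * a) * deriv g (a * x + b)) (at x)" for x
    unfolding h by (auto intro!: derivative_eq_intros DERIV_chain2[where f = g] smooth_real_deriv(2) g)
  then show "\<exists>g'\<in>{\<lambda>x. c * g (a * x + b) | c g. smooth_real g}. \<forall>x. (h has_real_derivative g' x) (at x)"
    using smooth_real_deriv(1)[OF g] by (intro bexI[of _ "\<lambda>x. (c * a) * deriv g (a * x + b)"]) auto
qed

lemma smooth_real_trig: "smooth_real (\<lambda>x. a * cos (b * x) + c * sin (b * x))"
proof (rule smooth_realI[where S = "{\<lambda>x. a * cos (b * x) + c * sin (b * x) | a c. True}"])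
  fix f :: "real \<Rightarrow> real" assume "f \<in> {\<lambda>x. a * cos (b * x) + c * sin (b * x) | a c. True}"
  then obtain a c where f: "f = (\<lambda>x. a * cos (b * x) + c * sin (b * x))" by blast
  have "(f has_real_derivative (c * b) * cos (b * x) + (- (a * b)) * sin (b * x)) (at x)" for x
    unfolding f by (auto intro!: derivative_eq_intros)
  moreover have "(\<lambda>x. (c * b) * cos (b * x) + (- (a * b)) * sin (b * x)) \<in> {\<lambda>x. a * cos (b * x) + c * sin (b * x) | a c. True}"
    by blast
  ultimately show "\<exists>g\<in>{\<lambda>x. a * cos (b * x) + c * sin (b * x) | a c. True}. \<forall>x. (f has_real_derivative g x) (at x)"
    by (rule_tac bexI) auto
qed blast

definition flat_exp :: "real \<Rightarrow> real" where
  "flat_exp x = (if x > 0 then exp (- (1 / x)) else 0)"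

lemma poly_exp_flat_tendsto:
  fixes p :: "real poly"
  shows "((\<lambda>x. poly p (1 / x) * exp (- (1 / x))) \<longlongrightarrow> 0) (at_right 0)"
proof -
  have "((\<lambda>t. poly p t / exp t) \<longlongrightarrow> 0) at_top"
  proof -
    have "((\<lambda>t. (\<Sum>i\<le>degree p. coeff p i * (t ^ i / exp t))) \<longlongrightarrow> (\<Sum>i\<le>degree p. coeff p i * 0)) at_top"
      by (intro tendsto_sum tendsto_mult tendsto_const tendsto_power_div_exp_0)
    then show ?thesis by (simp add: poly_altdef sum_divide_distrib)
  qed
  from filterlim_compose[OF this filterlim_inverse_at_top_right]
  show ?thesis by (simp add: inverse_eq_divide exp_minus divide_simps)
qed

lemma smooth_flat_exp: "smooth_real flat_exp"
proof -
  define F where "F p x = (if x > 0 then poly p (1 / x) * exp (- (1 / x)) else 0)" for p :: "real poly" and x :: real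
  \<comment> \<open>With t = 1 / x, differentiation in x is - t^2 times differentiation in t; it
    sends p(t) exp(-t) to t^2 (p - p')(t) exp(-t).\<close>
  have der: "(F p has_real_derivative F ([:0,0,1:] * (p - pderiv p)) x) (at x)" for p x
  proof -
    consider "x > 0" | "x < 0" | "x = 0" by linarith
    then show ?thesis
    proof cases
      case 1
      have "((\<lambda>x. poly p (1 / x) * exp (- (1 / x))) has_real_derivative F ([:0,0,1:] * (p - pderiv p)) x) (at x)"
        using 1 unfolding F_def
        by (auto intro!: derivative_eq_intros simp: field_simps power2_eq_square)
      then show ?thesis
        by (rule DERIV_cong_ev[THEN iffD1, rotated -1, OF _])
          (use 1 eventually_gt_at_top in \<open>auto simp: F_def eventually_nhds intro!: exI[of _ "{0<..}"]\<close>)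
    next
      case 2
      have "((\<lambda>x. 0) has_real_derivative F ([:0,0,1:] * (p - pderiv p)) x) (at x)"
        using 2 unfolding F_def by auto
      then show ?thesis
        by (rule DERIV_cong_ev[THEN iffD1, rotated -1, OF _])
          (use 2 in \<open>auto simp: F_def eventually_nhds intro!: exI[of _ "{..<0}"]\<close>)
    next
      case 3
      \<comment> \<open>Division by y multiplies the polynomial in 1 / y by its variable, so the
        difference quotient at 0 is again covered by \<open>poly_exp_flat_tendsto\<close>.\<close>
      have "((\<lambda>y. F p y / y) \<longlongrightarrow> 0) (at_right 0)"
      proof (rule Lim_transform_eventually)
        show "((\<lambda>x. poly (pCons 0 p) (1 / x) * exp (- (1 / x))) \<longlongrightarrow> 0) (at_right 0)" by (rule poly_exp_flat_tendsto)
        show "\<forall>\<^sub>F x in at_right 0. poly (pCons 0 p) (1 / x) * exp (- (1 / x)) = F p x / x"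
          unfolding eventually_at_right_field by (auto simp: F_def intro!: exI[of _ 1])
      qed
      moreover have "((\<lambda>y. F p y / y) \<longlongrightarrow> 0) (at_left 0)"
        by (rule Lim_transform_eventually[where f = "\<lambda>_. 0"])
          (auto simp: F_def eventually_at_left_field intro!: exI[of _ "-1"])
      ultimately have "((\<lambda>y. F p y / y) \<longlongrightarrow> 0) (at 0)" by (simp add: filterlim_split_at)
      then show ?thesis using 3 by (simp add: has_field_derivative_iff F_def)
    qed
  qed
  have "flat_exp = F 1" by (auto simp: flat_exp_def F_def)
  then show ?thesis
    by (intro smooth_realI[where S = "range F"]) (use der in blast)+
qed

definition bump :: "real \<Rightarrow> real" where
  "bump x = flat_exp (1 + x) * flat_exp (1 - x)"

lemma smooth_bump: "smooth_real bump"
  using smooth_real_mult[OF smooth_real_affine[OF smooth_flat_exp, of 1 1] smooth_real_affine[OF smooth_flat_exp, of "-1" 1]]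
  by (simp add: bump_def[abs_def] add.commute)

lemma bump_pos: "bump x > 0 \<longleftrightarrow> \<bar>x\<bar> < 1" and bump_nonneg: "bump x \<ge> 0" and bump_zero: "\<bar>x\<bar> \<ge> 1 \<Longrightarrow> bump x = 0"
  and bump_le: "bump x \<le> 1"
  by (auto simp: bump_def flat_exp_def zero_less_mult_iff intro!: mult_le_one)

text \<open>Testing with a windowed exponential computes the Fourier integral of the windowed
  function. This reduces uniqueness of weak transforms to uniqueness for integrable functions.
  Centre y and width R are free because translated and narrowed windows are used as well.\<close>

lemma test_fun_bump_cis:
  assumes "R > 0" shows "test_fun (\<lambda>x. complex_of_real (bump ((x - y) / R)) * cis (- (\<xi> * x)))"
  unfolding test_fun_def
proof (intro conjI exI allI impI)
  have b: "smooth_real (\<lambda>x. bump ((x - y) / R))"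
    using smooth_real_affine[OF smooth_bump, of "1 / R" "- y / R"] by (simp add: diff_divide_distrib)
  show "smooth_real (\<lambda>x. Re (complex_of_real (bump ((x - y) / R)) * cis (- (\<xi> * x))))"
    using smooth_real_mult[OF b smooth_real_trig[of 1 "\<xi>" 0]] by simp
  show "smooth_real (\<lambda>x. Im (complex_of_real (bump ((x - y) / R)) * cis (- (\<xi> * x))))"
    using smooth_real_mult[OF b smooth_real_trig[of 0 "\<xi>" "-1"]] by simp
  fix x assume "\<bar>y\<bar> + R < \<bar>x\<bar>"
  then have "\<bar>(x - y) / R\<bar> \<ge> 1" using assms by (simp add: abs_divide le_divide_eq)
  then show "complex_of_real (bump ((x - y) / R)) * cis (- (\<xi> * x)) = 0" by (simp add: bump_zero)
qed

lemma test_fun_props: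
  assumes "test_fun \<phi>"
  shows "continuous_on UNIV \<phi>" "integrable lborel \<phi>" "L2 \<phi>" "\<exists>C. \<forall>x. cmod (\<phi> x) \<le> C"
proof -
  have "continuous_on UNIV (\<lambda>x. Complex (Re (\<phi> x)) (Im (\<phi> x)))"
    using assms unfolding test_fun_def Complex_eq
    by (intro continuous_intros smooth_real_continuous) auto
  then show c: "continuous_on UNIV \<phi>" by simp
  obtain R where R: "\<And>x. R < \<bar>x\<bar> \<Longrightarrow> \<phi> x = 0" using assms unfolding test_fun_def by blast
  have "compact (\<phi> ` {-R..R})" by (intro compact_continuous_image continuous_on_subset[OF c]) auto
  then obtain C where C: "\<And>x. x \<in> {-R..R} \<Longrightarrow> cmod (\<phi> x) \<le> C" using compact_imp_bounded bounded_iff by (metis imageI)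
  have C': "cmod (\<phi> x) \<le> max C 0" for x
  proof (cases "R < \<bar>x\<bar>")
    case False then show ?thesis using C[of x] by (simp add: abs_le_iff not_less le_max_iff_disj)
  qed (simp add: R)
  then show "\<exists>C. \<forall>x. cmod (\<phi> x) \<le> C" by blast
  have [measurable]: "\<phi> \<in> borel_measurable borel" using c by (rule borel_measurable_continuous_onI)
  show i: "integrable lborel \<phi>"
  proof (rule Bochner_Integration.integrable_bound)
    show "integrable lborel (\<lambda>x. max C 0 * indicator {-R..R} x)"
      by (intro integrable_mult_right integrable_real_indicator) (auto simp: emeasure_lborel_Icc_eq)
    show "AE x in lborel. norm (\<phi> x) \<le> norm (max C 0 * indicator {-R..R} x)"
    proof (intro AE_I2)
      fix x
      show "norm (\<phi> x) \<le> norm (max C 0 * indicator {-R..R} x)"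
      proof (cases "R < \<bar>x\<bar>")
        case False then show ?thesis using C'[of x] by (auto simp: indicator_def)
      qed (simp add: R)
    qed
  qed simp
  show "L2 \<phi>" unfolding L2_def
  proof
    have "integrable lborel (\<lambda>x. \<phi> x * cnj (\<phi> x))"
      by (rule integrable_mult_bounded[where C = "max C 0"]) (use i C' in auto)
    then have "integrable lborel (\<lambda>x. complex_of_real ((cmod (\<phi> x))\<^sup>2))" by (simp only: complex_norm_square)
    then show "integrable lborel (\<lambda>x. (cmod (\<phi> x))\<^sup>2)" by (simp only: complex_of_real_integrable_eq)
  qed simp
qed


section \<open>The weak Fourier transform and its uniqueness\<close>

lemma is_FT_D: "is_FT u U \<Longrightarrow> L2 u" "is_FT u U \<Longrightarrow> L2 U"
  "is_FT u U \<Longrightarrow> test_fun \<phi> \<Longrightarrow> (LINT \<xi>|lborel. U \<xi> * \<phi> \<xi>) = (LINT x|lborel. u x * fourier \<phi> x)"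
  by (auto simp: is_FT_def)

lemma test_fun_fourier_L2: "test_fun \<phi> \<Longrightarrow> L2 (fourier \<phi>)"
  by (intro plancherel_le test_fun_props)

lemma is_FT_add_scale:
  assumes u: "is_FT u U" and v: "is_FT v V"
  shows "is_FT (\<lambda>x. u x + c * v x) (\<lambda>x. U x + c * V x)"
  unfolding is_FT_def
proof (intro conjI allI impI)
  show "L2 (\<lambda>x. u x + c * v x)" "L2 (\<lambda>x. U x + c * V x)" by (intro L2_add L2_scale is_FT_D[OF u] is_FT_D[OF v])+
  fix \<phi> assume p: "test_fun \<phi>"
  have i: "integrable lborel (\<lambda>x. U x * \<phi> x)" "integrable lborel (\<lambda>x. V x * \<phi> x)"
     "integrable lborel (\<lambda>x. u x * fourier \<phi> x)" "integrable lborel (\<lambda>x. v x * fourier \<phi> x)"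
    by (intro L2_mult_integrable is_FT_D[OF u] is_FT_D[OF v] test_fun_props[OF p] test_fun_fourier_L2[OF p])+
  show "(LINT \<xi>|lborel. (U \<xi> + c * V \<xi>) * \<phi> \<xi>) = (LINT x|lborel. (u x + c * v x) * fourier \<phi> x)"
    using i is_FT_D(3)[OF u p] is_FT_D(3)[OF v p]
    by (simp add: distrib_right mult.assoc Bochner_Integration.integral_add)
qed

lemma L2_AE_cong:
  assumes "L2 u" "AE x in lborel. u x = v x" "v \<in> borel_measurable borel"
  shows "L2 v"
proof -
  have [measurable]: "u \<in> borel_measurable borel" "v \<in> borel_measurable borel" using assms L2_D by auto
  have "integrable lborel (\<lambda>x. (cmod (v x))\<^sup>2)"
    by (rule integrable_cong_AE_imp[OF L2_D(2)[OF assms(1)]]) (use assms(2) in auto)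
  then show ?thesis by (simp add: L2_def)
qed

lemma is_FT_AE_cong:
  assumes F: "is_FT u U" and u: "AE x in lborel. u x = u' x" and U: "AE x in lborel. U x = U' x"
    and [measurable]: "u' \<in> borel_measurable borel" "U' \<in> borel_measurable borel"
  shows "is_FT u' U'"
  unfolding is_FT_def
proof (intro conjI allI impI)
  show "L2 u'" "L2 U'" using L2_AE_cong is_FT_D[OF F] u U assms(4,5) by blast+
  note [measurable] = L2_D(1)[OF is_FT_D(1)[OF F]] L2_D(1)[OF is_FT_D(2)[OF F]]
  fix \<phi> assume p: "test_fun \<phi>"
  note [measurable] = L2_D(1)[OF test_fun_props(3)[OF p]] L2_D(1)[OF test_fun_fourier_L2[OF p]]
  have "(LINT \<xi>|lborel. U' \<xi> * \<phi> \<xi>) = (LINT \<xi>|lborel. U \<xi> * \<phi> \<xi>)"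
    by (rule integral_cong_AE) (use U in auto)
  also have "\<dots> = (LINT x|lborel. u x * fourier \<phi> x)" by (rule is_FT_D(3)[OF F p])
  also have "\<dots> = (LINT x|lborel. u' x * fourier \<phi> x)"
    by (rule integral_cong_AE) (use u in auto)
  finally show "(LINT \<xi>|lborel. U' \<xi> * \<phi> \<xi>) = (LINT x|lborel. u' x * fourier \<phi> x)" .
qed

definition inv_fourier :: "(real \<Rightarrow> complex) \<Rightarrow> real \<Rightarrow> complex" where
  "inv_fourier V x = fourier V (- x) / (2 * pi)"

text \<open>Parseval with the test function as the continuous factor, which leaves V without any
  continuity requirement.\<close>

lemma is_FT_inv_fourier:
  assumes V: "integrable lborel V" "L2 V"
  shows "is_FT (inv_fourier V) V"
  unfolding is_FT_def
proof (intro conjI allI impI)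
  show "L2 (inv_fourier V)"
    using L2_scale[OF L2_uminus[OF plancherel_le(1)[OF V]], of "1 / (2 * pi)"] by (simp add: inv_fourier_def[abs_def])
  fix \<phi> assume p: "test_fun \<phi>"
  obtain C where C: "\<And>x. cmod (\<phi> x) \<le> C" using test_fun_props(4)[OF p] by blast
  have "(LINT x|lborel. inv_fourier V x * fourier \<phi> x) = (LINT x|lborel. fourier V (- x) * fourier \<phi> (- (- x)) / (2 * pi))"
    by (simp add: inv_fourier_def)
  also have "\<dots> = (LINT x|lborel. fourier V x * fourier \<phi> (- x)) / (2 * pi)"
    using lborel_integral_uminus[of "\<lambda>x. fourier V x * fourier \<phi> (- x) / (2 * pi)"] by simp
  also have "\<dots> = (LINT \<xi>|lborel. V \<xi> * \<phi> \<xi>)"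
    by (subst parseval_continuous[OF V test_fun_props(2,3,1)[OF p] C]) simp
  finally show "(LINT \<xi>|lborel. V \<xi> * \<phi> \<xi>) = (LINT x|lborel. inv_fourier V x * fourier \<phi> x)" by simp
qed (rule V)

text \<open>A window makes U integrable, and the Fourier integrals of the windowed U are weak
  pairings, hence 0. Windows of growing width are positive on sets that exhaust the line.\<close>

lemma is_FT_zero_right:
  assumes F: "is_FT u U" and z: "AE x in lborel. u x = 0"
  shows "AE x in lborel. U x = 0"
proof -
  note [measurable] = L2_D(1)[OF is_FT_D(1)[OF F]] L2_D(1)[OF is_FT_D(2)[OF F]]
  define b where "b n x = complex_of_real (bump ((x - 0) / real (Suc n)))" for n x
  have t: "test_fun (\<lambda>x. b n x * cis (- (\<xi> * x)))" for n \<xi>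
    unfolding b_def by (rule test_fun_bump_cis) simp
  have "AE x in lborel. U x * b n x = 0" for n
  proof (rule integrable_fourier_unique)
    have "test_fun (b n)" using t[of n 0] by simp
    then show "integrable lborel (\<lambda>x. U x * b n x)" by (intro L2_mult_integrable is_FT_D[OF F] test_fun_props)
    fix \<xi>
    note [measurable] = L2_D(1)[OF test_fun_fourier_L2[OF t]]
    have "fourier (\<lambda>x. U x * b n x) \<xi> = (LINT x|lborel. U x * (b n x * cis (- (\<xi> * x))))"
      by (simp add: fourier_def mult_ac)
    also have "\<dots> = (LINT x|lborel. u x * fourier (\<lambda>x. b n x * cis (- (\<xi> * x))) x)" by (rule is_FT_D(3)[OF F t])
    also have "\<dots> = 0" by (rule integral_eq_zero_AE) (use z in auto)
    finally show "fourier (\<lambda>x. U x * b n x) \<xi> = 0" .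
  qed
  then have "AE x in lborel. \<forall>n. U x * b n x = 0" unfolding AE_all_countable by blast
  then show ?thesis
  proof eventually_elim
    case (elim x)
    obtain n where n: "\<bar>x\<bar> < real n" using reals_Archimedean2 by blast
    then have "bump (x / real (Suc n)) > 0" by (simp add: bump_pos)
    then show ?case using elim[rule_format, of n] by (simp add: b_def)
  qed
qed

text \<open>Dual to the preceding argument: translating a test function modulates its transform, so
  weak pairings with translates are Fourier integrals of u times the transform of one bump. That
  transform is known to be nonzero only near 0, where it is close to the positive integral of the
  bump.\<close>

lemma is_FT_zero_left:
  assumes F: "is_FT u U" and z: "AE x in lborel. U x = 0"
  shows "AE x in lborel. u x = 0"
proof -
  note [measurable] = L2_D(1)[OF is_FT_D(1)[OF F]] L2_D(1)[OF is_FT_D(2)[OF F]]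
  define b where "b x = complex_of_real (bump x)" for x
  have tb: "test_fun (\<lambda>x. b ((x - y) / R))" if "R > 0" for R y
    using test_fun_bump_cis[OF that, of y 0] by (simp add: b_def)
  have b: "test_fun b" using tb[of 1 0] by simp
  have shift: "fourier (\<lambda>x. b ((x - y) / R)) x = R * fourier b (R * x) * cis (- (x * y))" if R: "R > 0" for R y x
  proof -
    have "fourier (\<lambda>x. b ((x - y) / R)) x = \<bar>R\<bar> *\<^sub>R (LINT t|lborel. b (((y + R * t) - y) / R) * cis (- ((y + R * t) * x)))"
      unfolding fourier_def by (rule lborel_integral_real_affine) (use R in simp)
    also have "(LINT t|lborel. b (((y + R * t) - y) / R) * cis (- ((y + R * t) * x))) = (LINT t|lborel. b t * cis (- (t * (R * x))) * cis (- (x * y)))"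
      using R by (intro Bochner_Integration.integral_cong refl) (simp add: mult.assoc cis_mult algebra_simps)
    finally show ?thesis using R by (simp add: fourier_def scaleR_conv_of_real)
  qed
  \<comment> \<open>Narrow bumps have wide transforms: for each x some R n * x falls into the
    neighbourhood of 0 where the transform of the bump does not vanish.\<close>
  define R where "R n = 1 / real (Suc n)" for n
  have R: "R n > 0" for n by (simp add: R_def)
  have "AE x in lborel. u x * (R n * fourier b (R n * x)) = 0" for n
  proof (rule integrable_fourier_unique)
    have L: "L2 (\<lambda>x. R n * fourier b (R n * x))"
    proof -
      have "fourier (\<lambda>x. b ((x - 0) / R n)) = (\<lambda>x. R n * fourier b (R n * x))"
        using shift[OF R[of n], of 0] by (intro ext) simp
      then show ?thesis using test_fun_fourier_L2[OF tb[OF R[of n], of 0]] by simp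
    qed
    then show "integrable lborel (\<lambda>x. u x * (R n * fourier b (R n * x)))" by (intro L2_mult_integrable is_FT_D[OF F])
    fix \<xi>
    note [measurable] = L2_D(1)[OF test_fun_props(3)[OF tb[OF R]]]
    have "fourier (\<lambda>x. u x * (R n * fourier b (R n * x))) \<xi> = (LINT x|lborel. u x * fourier (\<lambda>x. b ((x - \<xi>) / R n)) x)"
      by (simp add: fourier_def[of "\<lambda>x. u x * (R n * fourier b (R n * x))"] shift[OF R] mult.assoc)
    also have "\<dots> = (LINT x|lborel. U x * b ((x - \<xi>) / R n))" by (rule is_FT_D(3)[OF F tb[OF R], symmetric])
    also have "\<dots> = 0" by (rule integral_eq_zero_AE) (use z in auto)
    finally show "fourier (\<lambda>x. u x * (R n * fourier b (R n * x))) \<xi> = 0" .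
  qed
  then have AE: "AE x in lborel. \<forall>n. u x * (R n * fourier b (R n * x)) = 0" unfolding AE_all_countable by blast
  have bi: "integrable lborel bump"
    using test_fun_props(2)[OF b] by (simp add: b_def[abs_def] complex_of_real_integrable_eq)
  have "fourier b 0 \<noteq> 0"
  proof
    assume "fourier b 0 = 0"
    then have "integral\<^sup>L lborel bump = 0" by (simp add: fourier_def b_def integral_complex_of_real)
    then have "AE x in lborel. bump x = 0" using integral_nonneg_eq_0_iff_AE[OF bi] bump_nonneg by simp
    then have "AE x in lborel. x \<notin> {-1<..<1::real}"
    proof eventually_elim
      case (elim x)
      then show ?case using bump_pos[of x] by auto
    qed
    then have "emeasure lborel {-1<..<1::real} = 0" by (subst (asm) AE_iff_measurable[where N = "{-1<..<1}"]) auto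
    then show False by simp
  qed
  moreover have "isCont (fourier b) 0" using continuous_fourier[OF test_fun_props(2)[OF b]] by (simp add: continuous_on_eq_continuous_at)
  ultimately have "\<forall>\<^sub>F x in nhds 0. fourier b x \<noteq> 0"
    by (metis isCont_def tendsto_at_iff_tendsto_nhds tendsto_imp_eventually_ne)
  then obtain d where d: "d > 0" "\<And>x. \<bar>x\<bar> < d \<Longrightarrow> fourier b x \<noteq> 0" by (auto simp: eventually_nhds_metric dist_real_def)
  from AE show ?thesis
  proof eventually_elim
    case (elim x)
    obtain n where "\<bar>x\<bar> / d < real n" using reals_Archimedean2 by blast
    then have "\<bar>R n * x\<bar> < d" using d(1) by (simp add: R_def abs_mult field_simps)
    then show ?case using elim[rule_format, of n] d(2) R[of n] by simp
  qed
qed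

lemma is_FT_unique_right:
  assumes "is_FT u U" "is_FT u U'" shows "AE x in lborel. U x = U' x"
  using is_FT_zero_right[OF is_FT_add_scale[OF assms, of "-1"]] by simp

lemma is_FT_unique_left:
  assumes "is_FT u U" "is_FT u' U" shows "AE x in lborel. u x = u' x"
  using is_FT_zero_left[OF is_FT_add_scale[OF assms, of "-1"]] by simp

section \<open>The Hilbert space of square integrable functions\<close>

definition sqint :: "(real \<Rightarrow> real) \<Rightarrow> bool" where
  "sqint f \<longleftrightarrow> f \<in> borel_measurable borel \<and> integrable lborel (\<lambda>x. (f x)\<^sup>2)"

lemma sqint_iff_L2: "sqint f \<longleftrightarrow> L2 (\<lambda>x. complex_of_real (f x))"
proof
  assume "L2 (\<lambda>x. complex_of_real (f x))"
  note L = L2_D[OF this]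
  have "(\<lambda>x. Re (complex_of_real (f x))) \<in> borel_measurable borel"
    by (rule measurable_compose[OF L(1) borel_measurable_Re])
  then show "sqint f" using L(2) by (simp add: sqint_def)
next
  assume f: "sqint f"
  then have [measurable]: "f \<in> borel_measurable borel" by (simp add: sqint_def)
  have "(\<lambda>x. complex_of_real (f x)) \<in> borel_measurable borel" by measurable
  then show "L2 (\<lambda>x. complex_of_real (f x))" using f by (simp add: sqint_def L2_def)
qed

lemma sqint_mult:
  assumes "sqint f" "sqint g" shows "integrable lborel (\<lambda>x. f x * g x)"
proof -
  have "integrable lborel (\<lambda>x. complex_of_real (f x) * complex_of_real (g x))"
    by (rule L2_mult_integrable) (use assms in \<open>simp_all add: sqint_iff_L2\<close>)
  then have "integrable lborel (\<lambda>x. complex_of_real (f x * g x))" by (simp only: of_real_mult)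
  then show ?thesis by (simp only: complex_of_real_integrable_eq)
qed

lemma sqint_add: "sqint f \<Longrightarrow> sqint g \<Longrightarrow> sqint (\<lambda>x. f x + g x)"
  unfolding sqint_iff_L2 of_real_add by (rule L2_add)

lemma sqint_diff: "sqint f \<Longrightarrow> sqint g \<Longrightarrow> sqint (\<lambda>x. f x - g x)"
  unfolding sqint_iff_L2 of_real_diff by (rule L2_diff)

lemma sqint_scale: "sqint f \<Longrightarrow> sqint (\<lambda>x. c * f x)"
  unfolding sqint_iff_L2 of_real_mult by (rule L2_scale)

lemma sqint_zero: "sqint (\<lambda>x. 0)" by (simp add: sqint_def)

lemma sqint_uminus: "sqint f \<Longrightarrow> sqint (\<lambda>x. f (- x))"
  unfolding sqint_iff_L2 by (rule L2_uminus)

lemma sqint_bound: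
  assumes "sqint g" "f \<in> borel_measurable borel" "\<And>x. \<bar>f x\<bar> \<le> C * \<bar>g x\<bar>"
  shows "sqint f"
  unfolding sqint_iff_L2
proof (rule L2_bound[where C = C and g = "\<lambda>x. complex_of_real (g x)"])
  show "L2 (\<lambda>x. complex_of_real (g x))" using assms(1) by (simp only: sqint_iff_L2)
  show "(\<lambda>x. complex_of_real (f x)) \<in> borel_measurable borel" using assms(2) by simp
qed (simp add: assms(3))

lemma sqint_gauss: "sqint (\<lambda>x. exp (- x\<^sup>2))"
proof -
  have "(exp (- x\<^sup>2))\<^sup>2 = exp (- (4 * x\<^sup>2 / 2))" for x :: real
    unfolding power2_eq_square[of "exp _"] exp_add[symmetric] by simp
  then show ?thesis using integrable_gaussian[of 4] by (simp add: sqint_def)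
qed

text \<open>Riesz-Fischer. A Gaussian weight turns the Cauchy property in mean square into one in
  mean, by Cauchy-Schwarz, which provides an almost everywhere convergent subsequence; the weight is
  positive and can be divided out. Fatou's lemma shows that the pointwise limit is also the limit in
  mean square.\<close>

lemma sqint_complete:
  fixes s :: "nat \<Rightarrow> real \<Rightarrow> real"
  assumes s: "\<And>n. sqint (s n)"
    and cauchy: "\<And>e. e > 0 \<Longrightarrow> \<exists>N. \<forall>i\<ge>N. \<forall>j\<ge>N. (LINT x|lborel. (s i x - s j x)\<^sup>2) < e"
  shows "\<exists>f. sqint f \<and> (\<lambda>n. LINT x|lborel. (s n x - f x)\<^sup>2) \<longlonglongrightarrow> 0"
proof -
  have [measurable]: "s n \<in> borel_measurable borel" for n using s by (simp add: sqint_def)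
  define w where "w x = exp (- x\<^sup>2)" for x :: real
  have w: "sqint w" unfolding w_def[abs_def] by (rule sqint_gauss)
  then have [measurable]: "w \<in> borel_measurable borel" by (simp add: sqint_def)
  define W where "W = (LINT x|lborel. (w x)\<^sup>2)"
  have W: "W \<ge> 0" by (simp add: W_def)
  have d: "sqint (\<lambda>x. s i x - s j x)" for i j by (intro sqint_diff s)
  obtain r where r: "strict_mono r" and C: "AE x in lborel. Cauchy (\<lambda>i. s (r i) x * w x)"
  proof (rule cauchy_L1_AE_cauchy_subseq[where s = "\<lambda>i x. s i x * w x" and M = lborel])
    show "integrable lborel (\<lambda>x. s n x * w x)" for n by (intro sqint_mult s w)
    fix e :: real assume e: "e > 0"
    then have "e\<^sup>2 / (W + 1) > 0" using W by (simp add: add_nonneg_pos)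
    from cauchy[OF this] obtain N where N: "\<And>i j. i \<ge> N \<Longrightarrow> j \<ge> N \<Longrightarrow> (LINT x|lborel. (s i x - s j x)\<^sup>2) < e\<^sup>2 / (W + 1)" by blast
    show "\<exists>N. \<forall>i\<ge>N. \<forall>j\<ge>N. (LINT x|lborel. norm (s i x * w x - s j x * w x)) < e"
    proof (intro exI allI impI)
      fix i j assume ij: "i \<ge> N" "j \<ge> N"
      have L: "L2 (\<lambda>x. complex_of_real \<bar>s i x - s j x\<bar>)" "L2 (\<lambda>x. complex_of_real (w x))"
        using d[of i j] w sqint_bound[OF d[of i j], of "\<lambda>x. \<bar>s i x - s j x\<bar>" 1] by (simp_all add: sqint_iff_L2[symmetric] sqint_def)
      have "(LINT x|lborel. norm (s i x * w x - s j x * w x)) = (LINT x|lborel. \<bar>s i x - s j x\<bar> * w x)"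
        by (intro Bochner_Integration.integral_cong refl) (simp add: w_def abs_mult flip: left_diff_distrib)
      also have "\<dots> = cmod (LINT x|lborel. complex_of_real \<bar>s i x - s j x\<bar> * complex_of_real (w x))"
      proof -
        have "0 \<le> (LINT x|lborel. \<bar>s i x - s j x\<bar> * w x)" by (intro integral_nonneg_AE AE_I2) (simp add: w_def)
        then show ?thesis by (simp add: integral_complex_of_real flip: of_real_mult)
      qed
      finally have "(LINT x|lborel. norm (s i x * w x - s j x * w x))\<^sup>2 \<le> (LINT x|lborel. (s i x - s j x)\<^sup>2) * W"
        using L2_Cauchy_Schwarz[OF L] by (simp add: W_def)
      also have "\<dots> \<le> (LINT x|lborel. (s i x - s j x)\<^sup>2) * (W + 1)" by (intro mult_left_mono) auto
      also have "\<dots> < e\<^sup>2" using N[OF ij] W by (simp add: less_divide_eq add_nonneg_pos)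
      finally show "(LINT x|lborel. norm (s i x * w x - s j x * w x)) < e"
        using e by (auto intro: power2_less_imp_less)
    qed
  qed
  define f where "f x = lim (\<lambda>i. s (r i) x)" for x
  have [measurable]: "f \<in> borel_measurable borel" unfolding f_def by measurable
  have conv: "AE x in lborel. (\<lambda>i. s (r i) x) \<longlonglongrightarrow> f x"
    using C
  proof eventually_elim
    case (elim x)
    then obtain l where "(\<lambda>i. s (r i) x * w x) \<longlonglongrightarrow> l" using Cauchy_convergent convergent_def by blast
    from tendsto_divide[OF this tendsto_const, of "w x"] have "(\<lambda>i. s (r i) x) \<longlonglongrightarrow> l / w x" by (simp add: w_def)
    then show ?case unfolding f_def using convergent_LIMSEQ_iff convergent_def by blast
  qed
  have fatou: "(\<integral>\<^sup>+x. ennreal ((s n x - f x)\<^sup>2) \<partial>lborel) \<le> ennreal e"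
    if N: "\<And>i j. i \<ge> N \<Longrightarrow> j \<ge> N \<Longrightarrow> (LINT x|lborel. (s i x - s j x)\<^sup>2) < e" and n: "n \<ge> N" for n N e
  proof -
    have "(\<integral>\<^sup>+x. ennreal ((s n x - f x)\<^sup>2) \<partial>lborel) = (\<integral>\<^sup>+x. liminf (\<lambda>m. ennreal ((s n x - s (r m) x)\<^sup>2)) \<partial>lborel)"
    proof (rule nn_integral_cong_AE)
      show "AE x in lborel. ennreal ((s n x - f x)\<^sup>2) = liminf (\<lambda>m. ennreal ((s n x - s (r m) x)\<^sup>2))"
        using conv
      proof eventually_elim
        case (elim x)
        have "(\<lambda>m. ennreal ((s n x - s (r m) x)\<^sup>2)) \<longlonglongrightarrow> ennreal ((s n x - f x)\<^sup>2)"
          by (intro tendsto_ennrealI tendsto_intros elim)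
        from lim_imp_Liminf[OF _ this] show ?case by simp
      qed
    qed
    also have "\<dots> \<le> liminf (\<lambda>m. \<integral>\<^sup>+x. ennreal ((s n x - s (r m) x)\<^sup>2) \<partial>lborel)"
      by (rule nn_integral_liminf) measurable
    also have "\<dots> \<le> liminf (\<lambda>m. ennreal e)"
    proof (rule Liminf_mono, rule eventually_mono[OF eventually_ge_at_top[of N]])
      fix m assume "m \<ge> N"
      then have "r m \<ge> N" using seq_suble[OF r, of m] by simp
      then have "(LINT x|lborel. (s n x - s (r m) x)\<^sup>2) < e" using N n by blast
      then show "(\<integral>\<^sup>+x. ennreal ((s n x - s (r m) x)\<^sup>2) \<partial>lborel) \<le> ennreal e"
        using d[of n "r m"] by (subst nn_integral_eq_integral) (auto simp: sqint_def intro: ennreal_leI)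
    qed
    also have "\<dots> = ennreal e" by (simp add: Liminf_const)
    finally show ?thesis .
  qed
  have df: "sqint (\<lambda>x. s n x - f x)" if N: "\<And>i j. i \<ge> N \<Longrightarrow> j \<ge> N \<Longrightarrow> (LINT x|lborel. (s i x - s j x)\<^sup>2) < e" "n \<ge> N" for n N e
    unfolding sqint_def
  proof
    show "integrable lborel (\<lambda>x. (s n x - f x)\<^sup>2)"
      by (rule integrableI_bounded) (use fatou[OF N] in \<open>auto intro: le_less_trans\<close>)
  qed measurable
  obtain N1 where N1: "\<And>i j. i \<ge> N1 \<Longrightarrow> j \<ge> N1 \<Longrightarrow> (LINT x|lborel. (s i x - s j x)\<^sup>2) < 1" using cauchy[of 1] by auto
  have f: "sqint f"
  proof -
    have "sqint (\<lambda>x. s N1 x - f x)" by (rule df[OF N1]) auto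
    from sqint_diff[OF s[of N1] this] show ?thesis by simp
  qed
  have "(\<lambda>n. LINT x|lborel. (s n x - f x)\<^sup>2) \<longlonglongrightarrow> 0"
  proof (rule LIMSEQ_I)
    fix e :: real assume e: "e > 0"
    then obtain N where N: "\<And>i j. i \<ge> N \<Longrightarrow> j \<ge> N \<Longrightarrow> (LINT x|lborel. (s i x - s j x)\<^sup>2) < e / 2" using cauchy[of "e / 2"] by auto
    show "\<exists>N. \<forall>n\<ge>N. norm ((LINT x|lborel. (s n x - f x)\<^sup>2) - 0) < e"
    proof (intro exI allI impI)
      fix n assume n: "n \<ge> N"
      have "integrable lborel (\<lambda>x. (s n x - f x)\<^sup>2)" using df[OF N n] by (simp only: sqint_def)
      from nn_integral_eq_integral[OF this] fatou[OF N n]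
      have "ennreal (LINT x|lborel. (s n x - f x)\<^sup>2) \<le> ennreal (e / 2)" by simp
      then show "norm ((LINT x|lborel. (s n x - f x)\<^sup>2) - 0) < e" using e by (subst (asm) ennreal_le_iff) auto
    qed
  qed
  then show ?thesis using f by blast
qed

text \<open>Reflexive exactly at the square integrable functions, so the quotient below is a partial
  one and other functions represent no element.\<close>

definition sqrel :: "(real \<Rightarrow> real) \<Rightarrow> (real \<Rightarrow> real) \<Rightarrow> bool" where
  "sqrel f g \<longleftrightarrow> sqint f \<and> sqint g \<and> (AE x in lborel. f x = g x)"

quotient_type l2 = "real \<Rightarrow> real" / partial: sqrel
proof (rule part_equivpI)
  show "\<exists>x. sqrel x x" using sqint_zero by (auto simp: sqrel_def)
  show "symp sqrel"
  proof (rule sympI)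
    fix f g assume "sqrel f g"
    then have "sqint f" "sqint g" "AE x in lborel. f x = g x" by (simp_all add: sqrel_def)
    moreover from this(3) have "AE x in lborel. g x = f x" by eventually_elim simp
    ultimately show "sqrel g f" by (simp add: sqrel_def)
  qed
  show "transp sqrel"
  proof (rule transpI)
    fix f g h assume "sqrel f g" "sqrel g h"
    then have *: "sqint f" "sqint h" "AE x in lborel. f x = g x" "AE x in lborel. g x = h x" by (simp_all add: sqrel_def)
    moreover from *(3,4) have "AE x in lborel. f x = h x" by eventually_elim simp
    ultimately show "sqrel f h" by (simp add: sqrel_def)
  qed
qed

lemma sqint_rep: "sqint (rep_l2 x)"
  using Quotient_rep_reflp[OF Quotient_l2, of x] by (simp add: sqrel_def)

lemma rep_abs_l2: "sqint f \<Longrightarrow> AE x in lborel. rep_l2 (abs_l2 f) x = f x"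
  using Quotient_rep_abs[OF Quotient_l2, of f] by (auto simp: sqrel_def)

lemma l2_eqI: "AE t in lborel. rep_l2 x t = rep_l2 y t \<Longrightarrow> x = y"
  using Quotient_rel_rep[OF Quotient_l2, of x y] sqint_rep by (auto simp: sqrel_def)

text \<open>All operations act on chosen representatives. The representative of a sum or a multiple
  agrees with the pointwise formula only almost everywhere, so each law below combines finitely many
  exceptional null sets.\<close>

instantiation l2 :: real_inner
begin
definition "0 = abs_l2 (\<lambda>_. 0)"
definition "x + y = abs_l2 (\<lambda>t. rep_l2 x t + rep_l2 y t)"
definition "x - y = abs_l2 (\<lambda>t. rep_l2 x t - rep_l2 y t)"
definition "- x = abs_l2 (\<lambda>t. - rep_l2 x t)"
definition "c *\<^sub>R x = abs_l2 (\<lambda>t. c * rep_l2 x t)"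
definition "x \<bullet> y = (LINT t|lborel. rep_l2 x t * rep_l2 y t)"
definition "norm x = sqrt (x \<bullet> x)" for x :: l2
definition "sgn x = inverse (norm x) *\<^sub>R x" for x :: l2
definition "dist x y = norm (x - y)" for x y :: l2
definition uniformity_l2 :: "(l2 \<times> l2) filter" where "uniformity_l2 = (INF e\<in>{0<..}. principal {(x, y). dist x y < e})"
definition open_l2 :: "l2 set \<Rightarrow> bool" where "open_l2 U \<longleftrightarrow> (\<forall>x\<in>U. \<forall>\<^sub>F (x', y) in uniformity. x' = x \<longrightarrow> y \<in> U)"

lemma rep_zero: "AE t in lborel. rep_l2 0 t = 0"
  unfolding zero_l2_def by (rule rep_abs_l2[OF sqint_zero])
lemma rep_plus: "AE t in lborel. rep_l2 (x + y) t = rep_l2 x t + rep_l2 y t"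
  unfolding plus_l2_def by (intro rep_abs_l2 sqint_add sqint_rep)
lemma rep_minus: "AE t in lborel. rep_l2 (x - y) t = rep_l2 x t - rep_l2 y t"
  unfolding minus_l2_def by (intro rep_abs_l2 sqint_diff sqint_rep)
lemma rep_neg: "AE t in lborel. rep_l2 (- x) t = - rep_l2 x t"
  unfolding uminus_l2_def using rep_abs_l2[OF sqint_scale[OF sqint_rep, of "-1"]] by simp
lemma rep_scaleR: "AE t in lborel. rep_l2 (c *\<^sub>R x) t = c * rep_l2 x t"
  unfolding scaleR_l2_def by (intro rep_abs_l2 sqint_scale sqint_rep)

lemma rep_borel[measurable]: "rep_l2 x \<in> borel_measurable borel"
  using sqint_rep by (simp add: sqint_def)

instance
proof
  fix x y z :: l2 and a b :: real
  show "x + y + z = x + (y + z)"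
    by (rule l2_eqI, use rep_plus[of "x + y" z] rep_plus[of x y] rep_plus[of x "y + z"] rep_plus[of y z] in eventually_elim) simp
  show "x + y = y + x"
    by (rule l2_eqI, use rep_plus[of x y] rep_plus[of y x] in eventually_elim) simp
  show "0 + x = x" by (rule l2_eqI, use rep_plus[of 0 x] rep_zero in eventually_elim) simp
  show "- x + x = 0" by (rule l2_eqI, use rep_plus[of "- x" x] rep_zero rep_neg[of x] in eventually_elim) simp
  show "x - y = x + - y" by (rule l2_eqI, use rep_plus[of x "- y"] rep_minus[of x y] rep_neg[of y] in eventually_elim) simp
  show "a *\<^sub>R (x + y) = a *\<^sub>R x + a *\<^sub>R y"
    by (rule l2_eqI, use rep_scaleR[of a "x + y"] rep_plus[of x y] rep_plus[of "a *\<^sub>R x" "a *\<^sub>R y"] rep_scaleR[of a x] rep_scaleR[of a y] in eventually_elim)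
      (simp add: distrib_left)
  show "(a + b) *\<^sub>R x = a *\<^sub>R x + b *\<^sub>R x"
    by (rule l2_eqI, use rep_scaleR[of "a + b" x] rep_plus[of "a *\<^sub>R x" "b *\<^sub>R x"] rep_scaleR[of a x] rep_scaleR[of b x] in eventually_elim)
      (simp add: distrib_right)
  show "a *\<^sub>R b *\<^sub>R x = (a * b) *\<^sub>R x"
    by (rule l2_eqI, use rep_scaleR[of a "b *\<^sub>R x"] rep_scaleR[of b x] rep_scaleR[of "a * b" x] in eventually_elim) simp
  show "1 *\<^sub>R x = x" by (rule l2_eqI, use rep_scaleR[of 1 x] in eventually_elim) simp
  show "dist x y = norm (x - y)" by (rule dist_l2_def)
  show "sgn x = inverse (norm x) *\<^sub>R x" by (rule sgn_l2_def)
  show "uniformity = (INF e\<in>{0<..}. principal {(x, y :: l2). dist x y < e})" by (rule uniformity_l2_def)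
  show "open U \<longleftrightarrow> (\<forall>x\<in>U. \<forall>\<^sub>F (x', y) in uniformity. x' = x \<longrightarrow> y \<in> U)" for U :: "l2 set" by (rule open_l2_def)
  show "x \<bullet> y = y \<bullet> x" by (simp add: inner_l2_def mult.commute)
  show "(x + y) \<bullet> z = x \<bullet> z + y \<bullet> z"
  proof -
    have "(x + y) \<bullet> z = (LINT t|lborel. rep_l2 x t * rep_l2 z t + rep_l2 y t * rep_l2 z t)"
      unfolding inner_l2_def by (rule integral_cong_AE) (use rep_plus[of x y] in \<open>auto simp: distrib_right\<close>)
    then show ?thesis unfolding inner_l2_def by (simp add: sqint_mult sqint_rep)
  qed
  show "a *\<^sub>R x \<bullet> y = a * (x \<bullet> y)"
  proof -
    have "a *\<^sub>R x \<bullet> y = (LINT t|lborel. a * (rep_l2 x t * rep_l2 y t))"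
      unfolding inner_l2_def by (rule integral_cong_AE) (use rep_scaleR[of a x] in auto)
    then show ?thesis unfolding inner_l2_def by simp
  qed
  show "0 \<le> x \<bullet> x" by (simp add: inner_l2_def)
  show "x \<bullet> x = 0 \<longleftrightarrow> x = 0"
  proof
    assume "x \<bullet> x = 0"
    then have "AE t in lborel. rep_l2 x t * rep_l2 x t = 0"
      unfolding inner_l2_def using integral_nonneg_eq_0_iff_AE[OF sqint_mult[OF sqint_rep sqint_rep]] by auto
    then have z: "AE t in lborel. rep_l2 x t = 0" by simp
    show "x = 0" by (rule l2_eqI, use z rep_zero in eventually_elim) simp
  next
    assume "x = 0"
    then show "x \<bullet> x = 0" unfolding inner_l2_def
      by (intro integral_eq_zero_AE) (use rep_zero in auto)
  qed
  show "norm x = sqrt (x \<bullet> x)" by (rule norm_l2_def)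
qed
end

lemma norm_l2_sq: "(norm x)\<^sup>2 = (LINT t|lborel. (rep_l2 x t)\<^sup>2)"
  by (simp add: norm_eq_sqrt_inner inner_l2_def power2_eq_square)

lemma norm_l2_abs: "sqint f \<Longrightarrow> (norm (abs_l2 f))\<^sup>2 = (LINT t|lborel. (f t)\<^sup>2)"
  unfolding norm_l2_sq
  by (rule integral_cong_AE) (use rep_abs_l2[of f] in \<open>auto simp: sqint_def\<close>)

instance l2 :: complete_space
proof
  fix X :: "nat \<Rightarrow> l2" assume X: "Cauchy X"
  have dn: "(LINT t|lborel. (rep_l2 x t - rep_l2 y t)\<^sup>2) = (dist x y)\<^sup>2" for x y :: l2
    unfolding dist_norm norm_l2_sq by (rule integral_cong_AE) (use rep_minus[of x y] in auto)
  have "\<exists>f. sqint f \<and> (\<lambda>n. LINT x|lborel. (rep_l2 (X n) x - f x)\<^sup>2) \<longlonglongrightarrow> 0"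
  proof (rule sqint_complete)
    fix e :: real assume e: "e > 0"
    then obtain N where "\<And>i j. i \<ge> N \<Longrightarrow> j \<ge> N \<Longrightarrow> dist (X i) (X j) < sqrt e"
      using X unfolding Cauchy_def by (metis real_sqrt_gt_zero)
    then show "\<exists>N. \<forall>i\<ge>N. \<forall>j\<ge>N. (LINT x|lborel. (rep_l2 (X i) x - rep_l2 (X j) x)\<^sup>2) < e"
      unfolding dn by (metis abs_of_nonneg real_sqrt_abs real_sqrt_less_iff zero_le_dist)
  qed (rule sqint_rep)
  then obtain f where f: "sqint f" "(\<lambda>n. LINT x|lborel. (rep_l2 (X n) x - f x)\<^sup>2) \<longlonglongrightarrow> 0" by blast
  have [measurable]: "f \<in> borel_measurable borel" using f by (simp add: sqint_def)
  have "(LINT x|lborel. (rep_l2 (X n) x - f x)\<^sup>2) = (dist (X n) (abs_l2 f))\<^sup>2" for n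
    unfolding dn[symmetric] by (rule integral_cong_AE) (use rep_abs_l2[OF f(1)] in auto)
  with f(2) have "(\<lambda>n. (dist (X n) (abs_l2 f))\<^sup>2) \<longlonglongrightarrow> 0" by simp
  from tendsto_real_sqrt[OF this] have "(\<lambda>n. dist (X n) (abs_l2 f)) \<longlonglongrightarrow> 0" by simp
  then have "X \<longlonglongrightarrow> abs_l2 f" by (subst tendsto_dist_iff)
  then show "convergent X" by (rule convergentI)
qed

section \<open>Convolution\<close>

definition conv :: "(real \<Rightarrow> complex) \<Rightarrow> (real \<Rightarrow> complex) \<Rightarrow> real \<Rightarrow> complex" where
  "conv f g x = (LINT y|lborel. f (x - y) * g y)"

lemma nn_integral_lborel_shift:
  fixes h :: "real \<Rightarrow> ennreal"
  assumes "h \<in> borel_measurable borel"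
  shows "(\<integral>\<^sup>+y. h (x - y) \<partial>lborel) = integral\<^sup>N lborel h" "(\<integral>\<^sup>+x. h (x - y) \<partial>lborel) = integral\<^sup>N lborel h"
  using nn_integral_real_affine[OF assms, of "-1" x] nn_integral_real_affine[OF assms, of 1 "- y"]
  by simp_all

lemma nn_integral_swap:
  assumes [measurable]: "(\<lambda>(x, y). h x y) \<in> borel_measurable (lborel \<Otimes>\<^sub>M lborel)"
  shows "(\<integral>\<^sup>+x. \<integral>\<^sup>+y. h x y \<partial>lborel \<partial>lborel) = (\<integral>\<^sup>+y. \<integral>\<^sup>+x. h x y \<partial>lborel \<partial>(lborel :: real measure))"
  by (rule lborel_pair.Fubini'[symmetric]) measurable

lemma nn_integral_conv_weight:
  fixes h k :: "real \<Rightarrow> ennreal"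
  assumes [measurable]: "h \<in> borel_measurable borel" "k \<in> borel_measurable borel"
  shows "(\<integral>\<^sup>+x. \<integral>\<^sup>+y. h x * k (x - y) \<partial>lborel \<partial>lborel) = integral\<^sup>N lborel h * integral\<^sup>N lborel k"
    "(\<integral>\<^sup>+x. \<integral>\<^sup>+y. h y * k (x - y) \<partial>lborel \<partial>lborel) = integral\<^sup>N lborel h * integral\<^sup>N lborel k"
proof -
  show "(\<integral>\<^sup>+x. \<integral>\<^sup>+y. h x * k (x - y) \<partial>lborel \<partial>lborel) = integral\<^sup>N lborel h * integral\<^sup>N lborel k"
    by (simp add: nn_integral_cmult nn_integral_lborel_shift nn_integral_multc)
  have "(\<integral>\<^sup>+x. \<integral>\<^sup>+y. h y * k (x - y) \<partial>lborel \<partial>lborel) = (\<integral>\<^sup>+y. \<integral>\<^sup>+x. h y * k (x - y) \<partial>lborel \<partial>lborel)"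
    by (rule nn_integral_swap) measurable
  also have "\<dots> = integral\<^sup>N lborel h * integral\<^sup>N lborel k"
    by (simp add: nn_integral_cmult nn_integral_lborel_shift nn_integral_multc)
  finally show "(\<integral>\<^sup>+x. \<integral>\<^sup>+y. h y * k (x - y) \<partial>lborel \<partial>lborel) = integral\<^sup>N lborel h * integral\<^sup>N lborel k" .
qed

text \<open>By the arithmetic-geometric mean the integrand is at most half of (|f x|^2 + |g y|^2) |k
  (x - y)|, and each of the two summands integrates to a product of finite integrals.\<close>

lemma integrable_schur:
  fixes f g k :: "real \<Rightarrow> complex"
  assumes f: "L2 f" and g: "L2 g" and k: "integrable lborel k"
  shows "integrable (lborel \<Otimes>\<^sub>M lborel) (\<lambda>(x, y). f x * g y * k (x - y))"
proof -
  note [measurable] = L2_D(1)[OF f] L2_D(1)[OF g]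
  have [measurable]: "k \<in> borel_measurable borel" using k by auto
  let ?f = "\<lambda>x. ennreal ((cmod (f x))\<^sup>2 / 2)" and ?g = "\<lambda>x. ennreal ((cmod (g x))\<^sup>2 / 2)" and ?k = "\<lambda>x. ennreal (cmod (k x))"
  have fin: "integral\<^sup>N lborel ?f < \<infinity>" "integral\<^sup>N lborel ?g < \<infinity>" "integral\<^sup>N lborel ?k < \<infinity>"
    using L2_D(2)[OF f] L2_D(2)[OF g] k by (subst nn_integral_eq_integral; auto)+
  have m: "(\<lambda>(x, y). f x * g y * k (x - y)) \<in> borel_measurable (lborel \<Otimes>\<^sub>M lborel)" by measurable
  have "(\<integral>\<^sup>+p. ennreal (norm (case p of (x, y) \<Rightarrow> f x * g y * k (x - y))) \<partial>(lborel \<Otimes>\<^sub>M lborel))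
    = (\<integral>\<^sup>+x. \<integral>\<^sup>+y. ennreal (cmod (f x * g y * k (x - y))) \<partial>lborel \<partial>lborel)"
    by (subst lborel.nn_integral_fst[symmetric]) auto
  also have "\<dots> \<le> (\<integral>\<^sup>+x. \<integral>\<^sup>+y. ?f x * ?k (x - y) + ?g y * ?k (x - y) \<partial>lborel \<partial>lborel)"
  proof (intro nn_integral_mono)
    fix x y
    have "cmod (f x * g y * k (x - y)) \<le> (cmod (f x))\<^sup>2 / 2 * cmod (k (x - y)) + (cmod (g y))\<^sup>2 / 2 * cmod (k (x - y))"
      using mult_right_mono[OF sum_squares_bound[of "cmod (f x)" "cmod (g y)"], of "cmod (k (x - y)) / 2"]
      by (simp add: norm_mult algebra_simps)
    then show "ennreal (cmod (f x * g y * k (x - y))) \<le> ?f x * ?k (x - y) + ?g y * ?k (x - y)"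
      by (simp add: ennreal_mult[symmetric] ennreal_plus[symmetric] del: ennreal_plus)
  qed
  also have "\<dots> = (\<integral>\<^sup>+x. \<integral>\<^sup>+y. ?f x * ?k (x - y) \<partial>lborel \<partial>lborel) + (\<integral>\<^sup>+x. \<integral>\<^sup>+y. ?g y * ?k (x - y) \<partial>lborel \<partial>lborel)"
    by (subst nn_integral_add, measurable, subst nn_integral_add) auto
  also have "\<dots> = integral\<^sup>N lborel ?f * integral\<^sup>N lborel ?k + integral\<^sup>N lborel ?g * integral\<^sup>N lborel ?k"
    using nn_integral_conv_weight(1)[of ?f ?k] nn_integral_conv_weight(2)[of ?g ?k] by simp
  also have "\<dots> < \<infinity>" using fin by (simp add: ennreal_mult_less_top)
  finally show ?thesis using m by (intro integrableI_bounded)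
qed

lemma conv_borel_measurable:
  assumes [measurable]: "f \<in> borel_measurable borel" "g \<in> borel_measurable borel"
  shows "conv f g \<in> borel_measurable borel"
  unfolding conv_def[abs_def] by (simp add: lborel.borel_measurable_lebesgue_integral)

lemma L2_shift: assumes "L2 f" shows "L2 (\<lambda>y. f (x - y))"
  using assms lborel_integrable_real_affine[of "\<lambda>x. (cmod (f x))\<^sup>2" "-1" x]
  unfolding L2_def by auto

lemma conv_bound:
  assumes f: "L2 f" and g: "L2 g"
  shows "(cmod (conv f g x))\<^sup>2 \<le> (LINT x|lborel. (cmod (f x))\<^sup>2) * (LINT x|lborel. (cmod (g x))\<^sup>2)"
proof -
  have "(LINT y|lborel. (cmod (f (x - y)))\<^sup>2) = (LINT x|lborel. (cmod (f x))\<^sup>2)"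
    using lborel_integral_real_affine[of "-1" "\<lambda>x. (cmod (f x))\<^sup>2" x] by simp
  then show ?thesis using L2_Cauchy_Schwarz[OF L2_shift[OF f, of x] g] by (simp add: conv_def)
qed

text \<open>Here G is not assumed square integrable. It serves for differences such as a Fourier
  integral minus a convolution of square integrable functions, both of which are only
  bounded.\<close>

lemma test_fun_zero:
  assumes [measurable]: "G \<in> borel_measurable borel"
    and i: "\<And>\<phi>. test_fun \<phi> \<Longrightarrow> integrable lborel (\<lambda>x. G x * \<phi> x)"
    and z: "\<And>\<phi>. test_fun \<phi> \<Longrightarrow> (LINT x|lborel. G x * \<phi> x) = 0"
  shows "AE x in lborel. G x = 0"
proof -
  define b where "b n x = complex_of_real (bump ((x - 0) / real (Suc n)))" for n x
  have t: "test_fun (\<lambda>x. b n x * cis (- (\<xi> * x)))" for n \<xi>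
    unfolding b_def by (rule test_fun_bump_cis) simp
  have "AE x in lborel. G x * b n x = 0" for n
  proof (rule integrable_fourier_unique)
    have "test_fun (b n)" using t[of n 0] by simp
    then show "integrable lborel (\<lambda>x. G x * b n x)" by (rule i)
    show "fourier (\<lambda>x. G x * b n x) \<xi> = 0" for \<xi>
      using z[OF t, of n \<xi>] by (simp add: fourier_def mult_ac)
  qed
  then have "AE x in lborel. \<forall>n. G x * b n x = 0" unfolding AE_all_countable by blast
  then show ?thesis
  proof eventually_elim
    case (elim x)
    obtain n where n: "\<bar>x\<bar> < real n" using reals_Archimedean2 by blast
    then have "bump (x / real (Suc n)) > 0" by (simp add: bump_pos)
    then show ?case using elim[rule_format, of n] by (simp add: b_def)
  qed
qed

lemma test_fun_shift: "test_fun \<phi> \<Longrightarrow> test_fun (\<lambda>x. \<phi> (x + y))"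
  unfolding test_fun_def
proof (elim conjE exE, intro conjI)
  fix R assume s: "smooth_real (\<lambda>x. Re (\<phi> x))" "smooth_real (\<lambda>x. Im (\<phi> x))" and R: "\<forall>x. R < \<bar>x\<bar> \<longrightarrow> \<phi> x = 0"
  show "smooth_real (\<lambda>x. Re (\<phi> (x + y)))" "smooth_real (\<lambda>x. Im (\<phi> (x + y)))"
    using smooth_real_affine[OF s(1), of 1 y] smooth_real_affine[OF s(2), of 1 y] by simp_all
  show "\<exists>R. \<forall>x. R < \<bar>x\<bar> \<longrightarrow> \<phi> (x + y) = 0"
    using R by (intro exI[of _ "R + \<bar>y\<bar>"]) auto
qed

lemma L2_norm_triangle:
  assumes "L2 f" "L2 g"
  shows "(LINT x|lborel. (cmod (f x + g x))\<^sup>2) \<le> 2 * (LINT x|lborel. (cmod (f x))\<^sup>2) + 2 * (LINT x|lborel. (cmod (g x))\<^sup>2)"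
proof -
  have "(LINT x|lborel. (cmod (f x + g x))\<^sup>2) \<le> (LINT x|lborel. 2 * (cmod (f x))\<^sup>2 + 2 * (cmod (g x))\<^sup>2)"
  proof (rule integral_mono)
    fix x
    have "(cmod (f x + g x))\<^sup>2 \<le> (cmod (f x) + cmod (g x))\<^sup>2" by (intro power_mono norm_triangle_ineq) auto
    also have "\<dots> \<le> 2 * (cmod (f x))\<^sup>2 + 2 * (cmod (g x))\<^sup>2"
      using sum_squares_bound[of "cmod (f x)" "cmod (g x)"] by (simp add: power2_sum)
    finally show "(cmod (f x + g x))\<^sup>2 \<le> 2 * (cmod (f x))\<^sup>2 + 2 * (cmod (g x))\<^sup>2" .
  qed (use L2_D(2)[OF L2_add[OF assms]] L2_D(2)[OF assms(1)] L2_D(2)[OF assms(2)] in auto)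
  then show ?thesis using assms by (simp add: L2_D)
qed

lemma inv_fourier_le:
  assumes V: "integrable lborel V" "L2 V"
  shows "L2 (inv_fourier V)" "(LINT x|lborel. (cmod (inv_fourier V x))\<^sup>2) \<le> (LINT x|lborel. (cmod (V x))\<^sup>2)"
proof -
  show "L2 (inv_fourier V)" using is_FT_D(1)[OF is_FT_inv_fourier[OF V]] .
  have "(LINT x|lborel. (cmod (inv_fourier V x))\<^sup>2) = (LINT x|lborel. (cmod (fourier V (- x)))\<^sup>2 / (2 * pi)\<^sup>2)"
    by (simp add: inv_fourier_def norm_divide power_divide norm_mult)
  also have "\<dots> = (LINT x|lborel. (cmod (fourier V x))\<^sup>2) / (2 * pi)\<^sup>2"
    using lborel_integral_uminus[of "\<lambda>x. (cmod (fourier V x))\<^sup>2 / (2 * pi)\<^sup>2"] by simp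
  also have "\<dots> \<le> (2 * pi * (LINT x|lborel. (cmod (V x))\<^sup>2)) / (2 * pi)\<^sup>2"
    by (intro divide_right_mono plancherel_le(2)[OF V]) auto
  also have "\<dots> = (LINT x|lborel. (cmod (V x))\<^sup>2) / (2 * pi)" by (simp add: power2_eq_square)
  also have "\<dots> \<le> (LINT x|lborel. (cmod (V x))\<^sup>2) / 1"
    using pi_gt3 by (intro divide_left_mono) auto
  finally show "(LINT x|lborel. (cmod (inv_fourier V x))\<^sup>2) \<le> (LINT x|lborel. (cmod (V x))\<^sup>2)" by simp
qed

lemma L2_complete:
  fixes s :: "nat \<Rightarrow> real \<Rightarrow> complex"
  assumes s: "\<And>n. L2 (s n)"
    and cauchy: "\<And>e. e > 0 \<Longrightarrow> \<exists>N. \<forall>i\<ge>N. \<forall>j\<ge>N. (LINT x|lborel. (cmod (s i x - s j x))\<^sup>2) < e"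
  shows "\<exists>f. L2 f \<and> (\<lambda>n. LINT x|lborel. (cmod (s n x - f x))\<^sup>2) \<longlonglongrightarrow> 0"
proof -
  have part: "sqint (\<lambda>x. p (u x))" if "p = Re \<or> p = Im" "L2 u" for p u
  proof -
    note [measurable] = L2_D(1)[OF that(2)]
    have "L2 (\<lambda>x. complex_of_real (p (u x)))"
      by (rule L2_bound[OF that(2), where C = 1]) (use that(1) abs_Re_le_cmod abs_Im_le_cmod in auto)
    then show ?thesis by (simp only: sqint_iff_L2)
  qed
  have "\<exists>f. sqint f \<and> (\<lambda>n. LINT x|lborel. (p (s n x) - f x)\<^sup>2) \<longlonglongrightarrow> 0" if p: "p = Re \<or> p = Im" for p
  proof (rule sqint_complete)
    show "sqint (\<lambda>x. p (s n x))" for n by (rule part[OF p s])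
    fix e :: real assume "e > 0"
    from cauchy[OF this] obtain N where N: "\<And>i j. i \<ge> N \<Longrightarrow> j \<ge> N \<Longrightarrow> (LINT x|lborel. (cmod (s i x - s j x))\<^sup>2) < e" by blast
    show "\<exists>N. \<forall>i\<ge>N. \<forall>j\<ge>N. (LINT x|lborel. (p (s i x) - p (s j x))\<^sup>2) < e"
    proof (intro exI allI impI)
      fix i j assume ij: "i \<ge> N" "j \<ge> N"
      have d: "L2 (\<lambda>x. s i x - s j x)" by (intro L2_diff s)
      have "(LINT x|lborel. (p (s i x) - p (s j x))\<^sup>2) = (LINT x|lborel. (p (s i x - s j x))\<^sup>2)" using p by auto
      also have "\<dots> \<le> (LINT x|lborel. (cmod (s i x - s j x))\<^sup>2)"
      proof (rule integral_mono)
        show "integrable lborel (\<lambda>x. (p (s i x - s j x))\<^sup>2)" using part[OF p d] by (simp add: sqint_def)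
        show "integrable lborel (\<lambda>x. (cmod (s i x - s j x))\<^sup>2)" using L2_D(2)[OF d] .
        show "(p (s i x - s j x))\<^sup>2 \<le> (cmod (s i x - s j x))\<^sup>2" for x
          using p by (auto simp: cmod_power2)
      qed
      also have "\<dots> < e" by (rule N[OF ij])
      finally show "(LINT x|lborel. (p (s i x) - p (s j x))\<^sup>2) < e" .
    qed
  qed
  from this[of Re] this[of Im] obtain f g where fg: "sqint f" "sqint g"
    "(\<lambda>n. LINT x|lborel. (Re (s n x) - f x)\<^sup>2) \<longlonglongrightarrow> 0" "(\<lambda>n. LINT x|lborel. (Im (s n x) - g x)\<^sup>2) \<longlonglongrightarrow> 0" by auto
  define F where "F x = complex_of_real (f x) + \<i> * complex_of_real (g x)" for x
  have F: "L2 F" unfolding F_def using fg by (intro L2_add L2_scale) (simp_all only: sqint_iff_L2)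
  have "(LINT x|lborel. (cmod (s n x - F x))\<^sup>2) = (LINT x|lborel. (Re (s n x) - f x)\<^sup>2) + (LINT x|lborel. (Im (s n x) - g x)\<^sup>2)" for n
  proof -
    have "integrable lborel (\<lambda>x. (Re (s n x) - f x)\<^sup>2)" "integrable lborel (\<lambda>x. (Im (s n x) - g x)\<^sup>2)"
      using sqint_diff[OF part[of Re, OF _ s] fg(1)] sqint_diff[OF part[of Im, OF _ s] fg(2)] by (auto simp: sqint_def)
    then show ?thesis by (simp add: cmod_power2 F_def)
  qed
  moreover have "(\<lambda>n. (LINT x|lborel. (Re (s n x) - f x)\<^sup>2) + (LINT x|lborel. (Im (s n x) - g x)\<^sup>2)) \<longlonglongrightarrow> 0 + 0"
    by (intro tendsto_add fg)
  ultimately show ?thesis using F by auto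
qed

lemma L2_truncation_tendsto:
  assumes U: "L2 U"
  shows "(\<lambda>n. LINT x|lborel. (cmod (U x - U x * indicator {- real n..real n} x))\<^sup>2) \<longlonglongrightarrow> 0"
proof -
  note [measurable] = L2_D(1)[OF U]
  have "(\<lambda>n. LINT x|lborel. (cmod (U x - U x * indicator {- real n..real n} x))\<^sup>2) \<longlonglongrightarrow> (LINT x|(lborel :: real measure). 0)"
  proof (rule integral_dominated_convergence[where w = "\<lambda>x. (cmod (U x))\<^sup>2" and f = "\<lambda>_. 0::real"])
    show "AE x in lborel. (\<lambda>n. (cmod (U x - U x * indicator {- real n..real n} x))\<^sup>2) \<longlonglongrightarrow> 0"
    proof (intro AE_I2)
      fix x
      obtain N :: nat where N: "\<bar>x\<bar> < real N" using reals_Archimedean2 by blast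
      have "\<forall>\<^sub>F n in sequentially. (cmod (U x - U x * indicator {- real n..real n} x))\<^sup>2 = 0"
        using eventually_ge_at_top[of N] by eventually_elim (use N in \<open>auto simp: indicator_def abs_less_iff\<close>)
      then show "(\<lambda>n. (cmod (U x - U x * indicator {- real n..real n} x))\<^sup>2) \<longlonglongrightarrow> 0" by (rule tendsto_eventually)
    qed
  qed (use L2_D(2)[OF U] in \<open>auto simp: indicator_def\<close>)
  then show ?thesis by simp
qed

lemma L2_truncation_integrable:
  assumes U: "L2 U" shows "integrable lborel (\<lambda>x. U x * indicator {- real n..real n} x)" "L2 (\<lambda>x. U x * indicator {- real n..real n} x)"
proof -
  note [measurable] = L2_D(1)[OF U]
  have "L2 (\<lambda>x. indicator {- real n..real n} x)" unfolding L2_def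
  proof
    have "integrable lborel (indicat_real {- real n..real n})"
      by (intro integrable_real_indicator) (auto simp: emeasure_lborel_Icc_eq)
    moreover have "(cmod (indicator {- real n..real n} x))\<^sup>2 = indicat_real {- real n..real n} x" for x by (simp add: indicator_def)
    ultimately show "integrable lborel (\<lambda>x. (cmod (indicator {- real n..real n} x))\<^sup>2)" by simp
  qed measurable
  from L2_mult_integrable[OF U this] show "integrable lborel (\<lambda>x. U x * indicator {- real n..real n} x)" .
  show "L2 (\<lambda>x. U x * indicator {- real n..real n} x)"
    by (rule L2_bound[OF U, where C = 1]) (auto simp: indicator_def)
qed


lemma L2_product_tendsto:
  assumes w: "\<And>n. L2 (w n)" and u: "L2 u" and lim: "(\<lambda>n. LINT x|lborel. (cmod (w n x - u x))\<^sup>2) \<longlonglongrightarrow> 0" and g: "L2 g"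
  shows "(\<lambda>n. LINT x|lborel. w n x * g x) \<longlonglongrightarrow> (LINT x|lborel. u x * g x)"
proof -
  have "(\<lambda>n. LINT x|lborel. (w n x - u x) * g x) \<longlonglongrightarrow> 0"
  proof (rule Lim_null_comparison)
    show "\<forall>\<^sub>F n in sequentially. norm (LINT x|lborel. (w n x - u x) * g x)
       \<le> sqrt ((LINT x|lborel. (cmod (w n x - u x))\<^sup>2) * (LINT x|lborel. (cmod (g x))\<^sup>2))"
      by (intro always_eventually allI real_le_rsqrt L2_Cauchy_Schwarz L2_diff w u g)
    have "(\<lambda>n. sqrt ((LINT x|lborel. (cmod (w n x - u x))\<^sup>2) * (LINT x|lborel. (cmod (g x))\<^sup>2)))
       \<longlonglongrightarrow> sqrt (0 * (LINT x|lborel. (cmod (g x))\<^sup>2))"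
      by (intro tendsto_intros lim)
    then show "(\<lambda>n. sqrt ((LINT x|lborel. (cmod (w n x - u x))\<^sup>2) * (LINT x|lborel. (cmod (g x))\<^sup>2))) \<longlonglongrightarrow> 0" by simp
  qed
  moreover have "(LINT x|lborel. (w n x - u x) * g x) = (LINT x|lborel. w n x * g x) - (LINT x|lborel. u x * g x)" for n
    by (simp add: left_diff_distrib L2_mult_integrable w u g)
  ultimately show ?thesis by (subst Lim_null) simp
qed

text \<open>The inverse transforms of the truncations are classical integrals and form a Cauchy
  sequence by Plancherel. Passing to the limit in the pairings shows that their limit has weak
  transform U, and uniqueness identifies it with u.\<close>

lemma inv_fourier_truncation_tendsto:
  assumes F: "is_FT u U"
  shows "(\<lambda>n. LINT x|lborel. (cmod (inv_fourier (\<lambda>x. U x * indicator {- real n..real n} x) x - u x))\<^sup>2) \<longlonglongrightarrow> 0"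
proof -
  have U: "L2 U" by (rule is_FT_D(2)[OF F])
  define V where "V n x = U x * indicator {- real n..real n} x" for n x
  note V = L2_truncation_integrable[OF U, folded V_def]
  define w where "w n = inv_fourier (V n)" for n
  have w: "L2 (w n)" "is_FT (w n) (V n)" for n
    unfolding w_def by (intro inv_fourier_le is_FT_inv_fourier V)+
  have VU: "(\<lambda>n. LINT x|lborel. (cmod (V n x - U x))\<^sup>2) \<longlonglongrightarrow> 0"
    using L2_truncation_tendsto[OF U] by (simp add: V_def norm_minus_commute)
  have dw: "(LINT x|lborel. (cmod (w i x - w j x))\<^sup>2) \<le> 2 * (LINT x|lborel. (cmod (V i x - U x))\<^sup>2) + 2 * (LINT x|lborel. (cmod (V j x - U x))\<^sup>2)" for i j
  proof -
    have eq: "w i x - w j x = inv_fourier (\<lambda>x. V i x - V j x) x" for x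
      unfolding w_def inv_fourier_def fourier_def
      by (simp add: left_diff_distrib diff_divide_distrib Bochner_Integration.integral_diff integrable_fourier_kernel[of _ "- x", simplified] V)
    have "(LINT x|lborel. (cmod (w i x - w j x))\<^sup>2) \<le> (LINT x|lborel. (cmod (V i x - V j x))\<^sup>2)"
      unfolding eq by (intro inv_fourier_le Bochner_Integration.integrable_diff L2_diff V)
    also have "\<dots> = (LINT x|lborel. (cmod ((V i x - U x) + (U x - V j x)))\<^sup>2)" by simp
    also have "\<dots> \<le> 2 * (LINT x|lborel. (cmod (V i x - U x))\<^sup>2) + 2 * (LINT x|lborel. (cmod (U x - V j x))\<^sup>2)"
      by (intro L2_norm_triangle L2_diff V U)
    finally show ?thesis by (simp add: norm_minus_commute)
  qed
  have "\<exists>f. L2 f \<and> (\<lambda>n. LINT x|lborel. (cmod (w n x - f x))\<^sup>2) \<longlonglongrightarrow> 0"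
  proof (rule L2_complete[OF w(1)])
    fix e :: real assume "e > 0"
    then have "e / 4 > 0" by simp
    from LIMSEQ_D[OF VU this] obtain N where N: "\<And>n. n \<ge> N \<Longrightarrow> (LINT x|lborel. (cmod (V n x - U x))\<^sup>2) < e / 4" by auto
    show "\<exists>N. \<forall>i\<ge>N. \<forall>j\<ge>N. (LINT x|lborel. (cmod (w i x - w j x))\<^sup>2) < e"
    proof (intro exI allI impI)
      fix i j assume "i \<ge> N" "j \<ge> N"
      from N[OF this(1)] N[OF this(2)] dw[of i j]
      show "(LINT x|lborel. (cmod (w i x - w j x))\<^sup>2) < e" by linarith
    qed
  qed
  then obtain f where f: "L2 f" and lim: "(\<lambda>n. LINT x|lborel. (cmod (w n x - f x))\<^sup>2) \<longlonglongrightarrow> 0" by blast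
  have "is_FT f U"
    unfolding is_FT_def
  proof (intro conjI allI impI f U)
    fix \<phi> assume p: "test_fun \<phi>"
    have "(\<lambda>n. LINT x|lborel. w n x * fourier \<phi> x) \<longlonglongrightarrow> (LINT x|lborel. f x * fourier \<phi> x)"
      by (rule L2_product_tendsto[OF w(1) f lim test_fun_fourier_L2[OF p]])
    moreover have "(\<lambda>n. LINT x|lborel. V n x * \<phi> x) \<longlonglongrightarrow> (LINT x|lborel. U x * \<phi> x)"
      by (rule L2_product_tendsto[OF V(2) U VU test_fun_props(3)[OF p]])
    ultimately show "(LINT \<xi>|lborel. U \<xi> * \<phi> \<xi>) = (LINT x|lborel. f x * fourier \<phi> x)"
      using LIMSEQ_unique by (simp add: is_FT_D(3)[OF w(2) p])
  qed
  from is_FT_unique_left[OF this F] have ae: "AE x in lborel. f x = u x" .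
  note [measurable] = L2_D(1)[OF f] L2_D(1)[OF is_FT_D(1)[OF F]] L2_D(1)[OF w(1)]
  have "(LINT x|lborel. (cmod (w n x - f x))\<^sup>2) = (LINT x|lborel. (cmod (w n x - u x))\<^sup>2)" for n
    by (rule integral_cong_AE) (use ae in auto)
  with lim show ?thesis by (simp add: w_def V_def[abs_def])
qed

lemma fourier_translate:
  "fourier (\<lambda>y. \<phi> (y + t)) x = fourier \<phi> x * cis (t * x)"
proof -
  have "fourier \<phi> x = \<bar>1\<bar> *\<^sub>R (LINT y|lborel. \<phi> (t + 1 * y) * cis (- ((t + 1 * y) * x)))"
    unfolding fourier_def by (rule lborel_integral_real_affine) simp
  then have "fourier \<phi> x * cis (t * x) = (LINT y|lborel. \<phi> (y + t) * cis (- ((t + y) * x)) * cis (t * x))"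
    by (simp add: add.commute)
  also have "\<dots> = fourier (\<lambda>y. \<phi> (y + t)) x"
    unfolding fourier_def by (intro Bochner_Integration.integral_cong refl) (simp add: mult.assoc cis_mult algebra_simps)
  finally show ?thesis by simp
qed

text \<open>Both sides are the integral of U \<xi> V \<eta> \<phi> (\<xi> + \<eta>), in the
  variables \<xi>, \<eta> on the left and \<zeta> = \<xi> + \<eta>, \<eta> on the right. Absolute
  integrability in either set of variables reduces to \<open>integrable_schur\<close> with kernel
  \<phi>, after reflecting V.\<close>

lemma test_fun_conv_swap:
  assumes U: "L2 U" and V: "L2 V" and p: "integrable lborel \<phi>"
  shows "(LINT \<xi>|lborel. U \<xi> * (LINT \<eta>|lborel. V \<eta> * \<phi> (\<eta> + \<xi>))) = (LINT \<zeta>|lborel. conv U V \<zeta> * \<phi> \<zeta>)"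
    "integrable lborel (\<lambda>\<zeta>. conv U V \<zeta> * \<phi> \<zeta>)"
proof -
  note [measurable] = L2_D(1)[OF U] L2_D(1)[OF V]
  have [measurable]: "\<phi> \<in> borel_measurable borel" using p by auto
  have shift: "(LINT \<eta>|lborel. h (\<zeta> - \<eta>)) = (LINT \<eta>|lborel. h \<eta>)" for h :: "real \<Rightarrow> complex" and \<zeta>
    using lborel_integral_real_affine[of "-1" h \<zeta>] by simp
  have "integrable (lborel \<Otimes>\<^sub>M lborel) (\<lambda>(\<zeta>, \<eta>). \<phi> \<zeta> * V \<eta> * U (\<zeta> - \<eta>))"
  proof -
    have i: "integrable (lborel \<Otimes>\<^sub>M lborel) (\<lambda>(x, y). U x * V (- y) * \<phi> (x - y))"
      by (rule integrable_schur[OF U L2_uminus[OF V] p])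
    have m: "(\<lambda>(\<zeta>, \<eta>). \<phi> \<zeta> * V \<eta> * U (\<zeta> - \<eta>)) \<in> borel_measurable (lborel \<Otimes>\<^sub>M lborel)" by measurable
    have "(\<integral>\<^sup>+p. ennreal (norm (case p of (\<zeta>, \<eta>) \<Rightarrow> \<phi> \<zeta> * V \<eta> * U (\<zeta> - \<eta>))) \<partial>(lborel \<Otimes>\<^sub>M lborel))
      = (\<integral>\<^sup>+\<zeta>. \<integral>\<^sup>+\<eta>. ennreal (cmod (\<phi> \<zeta> * V \<eta> * U (\<zeta> - \<eta>))) \<partial>lborel \<partial>lborel)"
      by (subst lborel.nn_integral_fst[symmetric]) auto
    also have "\<dots> = (\<integral>\<^sup>+\<zeta>. \<integral>\<^sup>+x. ennreal (cmod (\<phi> \<zeta> * V (\<zeta> - x) * U x)) \<partial>lborel \<partial>lborel)"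
    proof (rule nn_integral_cong)
      fix \<zeta>
      show "(\<integral>\<^sup>+\<eta>. ennreal (cmod (\<phi> \<zeta> * V \<eta> * U (\<zeta> - \<eta>))) \<partial>lborel) = (\<integral>\<^sup>+x. ennreal (cmod (\<phi> \<zeta> * V (\<zeta> - x) * U x)) \<partial>lborel)"
        using nn_integral_lborel_shift(1)[of "\<lambda>\<eta>. ennreal (cmod (\<phi> \<zeta> * V \<eta> * U (\<zeta> - \<eta>)))" \<zeta>] by simp
    qed
    also have "\<dots> = (\<integral>\<^sup>+x. \<integral>\<^sup>+\<zeta>. ennreal (cmod (\<phi> \<zeta> * V (\<zeta> - x) * U x)) \<partial>lborel \<partial>lborel)"
      by (rule nn_integral_swap) measurable
    also have "\<dots> = (\<integral>\<^sup>+x. \<integral>\<^sup>+y. ennreal (cmod (U x * V (- y) * \<phi> (x - y))) \<partial>lborel \<partial>lborel)"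
    proof (rule nn_integral_cong)
      fix x
      show "(\<integral>\<^sup>+\<zeta>. ennreal (cmod (\<phi> \<zeta> * V (\<zeta> - x) * U x)) \<partial>lborel) = (\<integral>\<^sup>+y. ennreal (cmod (U x * V (- y) * \<phi> (x - y))) \<partial>lborel)"
        using nn_integral_lborel_shift(1)[of "\<lambda>\<zeta>. ennreal (cmod (\<phi> \<zeta> * V (\<zeta> - x) * U x))" x] by (simp add: mult_ac)
    qed
    also have "\<dots> = (\<integral>\<^sup>+p. ennreal (norm (case p of (x, y) \<Rightarrow> U x * V (- y) * \<phi> (x - y))) \<partial>(lborel \<Otimes>\<^sub>M lborel))"
      by (subst lborel.nn_integral_fst[symmetric]) auto
    also have "\<dots> < \<infinity>" using i by (simp add: integrable_iff_bounded)
    finally show ?thesis using m by (intro integrableI_bounded)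
  qed
  note i = this
  have c: "conv U V \<zeta> * \<phi> \<zeta> = (LINT \<eta>|lborel. \<phi> \<zeta> * V \<eta> * U (\<zeta> - \<eta>))" for \<zeta>
    unfolding conv_def by (subst integral_mult_left_zero[symmetric]) (simp add: mult_ac)
  show "integrable lborel (\<lambda>\<zeta>. conv U V \<zeta> * \<phi> \<zeta>)"
    unfolding c using lborel_pair.integrable_fst'[OF i] by simp
  have "(LINT \<zeta>|lborel. conv U V \<zeta> * \<phi> \<zeta>) = (LINT \<eta>|lborel. LINT \<zeta>|lborel. \<phi> \<zeta> * V \<eta> * U (\<zeta> - \<eta>))"
    unfolding c by (rule lborel_pair.Fubini_integral[symmetric, OF i])
  also have "\<dots> = (LINT \<eta>|lborel. LINT \<xi>|lborel. U \<xi> * V \<eta> * \<phi> (\<eta> + \<xi>))"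
  proof (rule Bochner_Integration.integral_cong[OF refl])
    fix \<eta>
    show "(LINT \<zeta>|lborel. \<phi> \<zeta> * V \<eta> * U (\<zeta> - \<eta>)) = (LINT \<xi>|lborel. U \<xi> * V \<eta> * \<phi> (\<eta> + \<xi>))"
      using lborel_integral_real_affine[of 1 "\<lambda>\<zeta>. \<phi> \<zeta> * V \<eta> * U (\<zeta> - \<eta>)" \<eta>] by (simp add: mult_ac)
  qed
  also have "\<dots> = (LINT \<xi>|lborel. LINT \<eta>|lborel. U \<xi> * V \<eta> * \<phi> (\<eta> + \<xi>))"
  proof (rule lborel_pair.Fubini_integral)
    have i0: "integrable (lborel \<Otimes>\<^sub>M lborel) (\<lambda>(x, y). U x * V (- y) * \<phi> (x - y))"
      by (rule integrable_schur[OF U L2_uminus[OF V] p])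
    have m: "(\<lambda>(\<xi>, \<eta>). U \<xi> * V \<eta> * \<phi> (\<eta> + \<xi>)) \<in> borel_measurable (lborel \<Otimes>\<^sub>M lborel)" by measurable
    have "(\<integral>\<^sup>+p. ennreal (norm (case p of (\<xi>, \<eta>) \<Rightarrow> U \<xi> * V \<eta> * \<phi> (\<eta> + \<xi>))) \<partial>(lborel \<Otimes>\<^sub>M lborel))
      = (\<integral>\<^sup>+x. \<integral>\<^sup>+y. ennreal (cmod (U x * V y * \<phi> (y + x))) \<partial>lborel \<partial>lborel)"
      by (subst lborel.nn_integral_fst[symmetric]) auto
    also have "\<dots> = (\<integral>\<^sup>+x. \<integral>\<^sup>+y. ennreal (cmod (U x * V (- y) * \<phi> (x - y))) \<partial>lborel \<partial>lborel)"
    proof (rule nn_integral_cong)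
      fix x
      show "(\<integral>\<^sup>+y. ennreal (cmod (U x * V y * \<phi> (y + x))) \<partial>lborel) = (\<integral>\<^sup>+y. ennreal (cmod (U x * V (- y) * \<phi> (x - y))) \<partial>lborel)"
        using nn_integral_lborel_shift(1)[of "\<lambda>y. ennreal (cmod (U x * V y * \<phi> (y + x)))" 0] by simp
    qed
    also have "\<dots> = (\<integral>\<^sup>+p. ennreal (norm (case p of (x, y) \<Rightarrow> U x * V (- y) * \<phi> (x - y))) \<partial>(lborel \<Otimes>\<^sub>M lborel))"
      by (subst lborel.nn_integral_fst[symmetric]) auto
    also have "\<dots> < \<infinity>" using i0 by (simp add: integrable_iff_bounded)
    finally show "integrable (lborel \<Otimes>\<^sub>M lborel) (\<lambda>(\<xi>, \<eta>). U \<xi> * V \<eta> * \<phi> (\<eta> + \<xi>))"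
      using m by (intro integrableI_bounded)
  qed
  also have "\<dots> = (LINT \<xi>|lborel. U \<xi> * (LINT \<eta>|lborel. V \<eta> * \<phi> (\<eta> + \<xi>)))"
    by (simp add: mult.assoc)
  finally show "(LINT \<xi>|lborel. U \<xi> * (LINT \<eta>|lborel. V \<eta> * \<phi> (\<eta> + \<xi>))) = (LINT \<zeta>|lborel. conv U V \<zeta> * \<phi> \<zeta>)" by simp
qed

text \<open>The product u u is only integrable and the convolution of U with itself only bounded, so
  the identity is proved against test functions. It holds for truncated transforms and passes to the
  limit in one factor at a time, the other factor being part of a fixed square integrable
  partner.\<close>

lemma fourier_square_eq_conv:
  assumes F: "is_FT u U"
  shows "AE \<zeta> in lborel. fourier (\<lambda>x. u x * u x) \<zeta> = conv U U \<zeta> / (2 * pi)"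
proof -
  have U: "L2 U" and u: "L2 u" by (rule is_FT_D[OF F])+
  note [measurable] = L2_D(1)[OF U] L2_D(1)[OF u]
  have u2: "integrable lborel (\<lambda>x. u x * u x)" by (rule L2_mult_integrable[OF u u])
  define V where "V n x = U x * indicator {- real n..real n} x" for n x
  note V = L2_truncation_integrable[OF U, folded V_def]
  define w where "w n = inv_fourier (V n)" for n
  have w: "L2 (w n)" "is_FT (w n) (V n)" for n
    unfolding w_def by (intro inv_fourier_le is_FT_inv_fourier V)+
  have lim: "(\<lambda>n. LINT x|lborel. (cmod (w n x - u x))\<^sup>2) \<longlonglongrightarrow> 0"
    using inv_fourier_truncation_tendsto[OF F] by (simp add: w_def V_def[abs_def])
  have VU: "(\<lambda>n. LINT x|lborel. (cmod (V n x - U x))\<^sup>2) \<longlonglongrightarrow> 0"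
    using L2_truncation_tendsto[OF U] by (simp add: V_def norm_minus_commute)
  have [measurable]: "fourier (\<lambda>x. u x * u x) \<in> borel_measurable borel" by (rule borel_measurable_fourier[OF u2])
  have cm[measurable]: "conv U U \<in> borel_measurable borel" by (rule conv_borel_measurable) auto
  have "AE \<zeta> in lborel. fourier (\<lambda>x. u x * u x) \<zeta> - conv U U \<zeta> / (2 * pi) = 0"
  proof (rule test_fun_zero)
    fix \<phi> assume p: "test_fun \<phi>"
    note pi = test_fun_props(2)[OF p]
    obtain C where C: "\<And>x. cmod (\<phi> x) \<le> C" using test_fun_props(4)[OF p] by blast
    note [measurable] = L2_D(1)[OF test_fun_props(3)[OF p]] L2_D(1)[OF test_fun_fourier_L2[OF p]]
    define P where "P = (LINT x|lborel. cmod (\<phi> x))"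
    have Pb: "cmod (fourier \<phi> x) \<le> P" for x unfolding P_def by (rule norm_fourier_le[OF pi])
    have i1: "integrable lborel (\<lambda>x. fourier (\<lambda>x. u x * u x) x * \<phi> x)"
      by (subst mult.commute, rule integrable_mult_bounded[OF pi _ norm_fourier_le[OF u2]]) auto
    note i2 = test_fun_conv_swap(2)[OF U U pi]
    show "integrable lborel (\<lambda>x. (fourier (\<lambda>x. u x * u x) x - conv U U x / (2 * pi)) * \<phi> x)"
      using i1 i2 by (simp add: left_diff_distrib)
    have L2p: "L2 (\<lambda>x. g x * fourier \<phi> x)" if "L2 g" for g
    proof (rule L2_bound[OF that])
      show "(\<lambda>x. g x * fourier \<phi> x) \<in> borel_measurable borel" using L2_D(1)[OF that] by measurable
      show "cmod (g x * fourier \<phi> x) \<le> P * cmod (g x)" for x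
        using mult_left_mono[OF Pb[of x], of "cmod (g x)"] by (simp add: norm_mult mult.commute)
    qed
    \<comment> \<open>The truncated transforms are integrable, so the product formula for them is Fubini.\<close>
    have fin: "(LINT x|lborel. w n x * (w m x * fourier \<phi> x)) = (LINT \<zeta>|lborel. conv (V n) (V m) \<zeta> * \<phi> \<zeta>) / (2 * pi)" for n m
    proof -
      let ?h = "\<lambda>x. w m (- x) * fourier \<phi> (- x)"
      have hi: "integrable lborel ?h"
        using lborel_integrable_uminus[OF L2_mult_integrable[OF w(1)[of m] test_fun_fourier_L2[OF p]]] .
      have "(LINT x|lborel. w n x * (w m x * fourier \<phi> x)) = (LINT x|lborel. w n (- x) * (w m (- x) * fourier \<phi> (- x)))"
        by (rule lborel_integral_uminus[symmetric])
      also have "\<dots> = (LINT x|lborel. fourier (V n) x * ?h x) / (2 * pi)"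
        by (simp add: w_def inv_fourier_def[of "V n"])
      also have "(LINT x|lborel. fourier (V n) x * ?h x) = (LINT \<xi>|lborel. V n \<xi> * fourier ?h \<xi>)"
        by (rule fourier_mult_formula[OF V(1) hi])
      also have "fourier ?h = (\<lambda>\<xi>. LINT \<eta>|lborel. V m \<eta> * \<phi> (\<eta> + \<xi>))"
      proof
        fix \<xi>
        have "fourier ?h \<xi> = (LINT x|lborel. w m x * fourier (\<lambda>y. \<phi> (y + \<xi>)) x)"
          unfolding fourier_def[of ?h] fourier_translate
          by (subst lborel_integral_uminus[symmetric]) (simp add: mult_ac)
        also have "\<dots> = (LINT \<eta>|lborel. V m \<eta> * \<phi> (\<eta> + \<xi>))"
          by (rule is_FT_D(3)[OF w(2) test_fun_shift[OF p], symmetric])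
        finally show "fourier ?h \<xi> = (LINT \<eta>|lborel. V m \<eta> * \<phi> (\<eta> + \<xi>))" .
      qed
      also have "(LINT \<xi>|lborel. V n \<xi> * (LINT \<eta>|lborel. V m \<eta> * \<phi> (\<eta> + \<xi>))) = (LINT \<zeta>|lborel. conv (V n) (V m) \<zeta> * \<phi> \<zeta>)"
        by (rule test_fun_conv_swap(1)[OF V(2) V(2) pi])
      finally show ?thesis .
    qed
    define S where "S f g = (LINT \<xi>|lborel. f \<xi> * (LINT \<eta>|lborel. g \<eta> * \<phi> (\<eta> + \<xi>)))" for f g :: "real \<Rightarrow> complex"
    have S: "S f g = (LINT \<zeta>|lborel. conv f g \<zeta> * \<phi> \<zeta>)" if "L2 f" "L2 g" for f g
      unfolding S_def by (rule test_fun_conv_swap(1)[OF that pi])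
    \<comment> \<open>The inner integral is, up to reflection, the transform of v times a bounded
      square integrable function, hence square integrable. This makes it an admissible partner in
      the limits below.\<close>
    have SL2: "L2 (\<lambda>\<xi>. LINT \<eta>|lborel. g \<eta> * \<phi> (\<eta> + \<xi>))" if "is_FT v g" for v g
    proof -
      have "(LINT \<eta>|lborel. g \<eta> * \<phi> (\<eta> + \<xi>)) = fourier (\<lambda>x. v x * fourier \<phi> x) (- \<xi>)" for \<xi>
        using is_FT_D(3)[OF that test_fun_shift[OF p, of \<xi>]] by (simp add: fourier_translate fourier_def[of "\<lambda>x. v x * fourier \<phi> x"] mult_ac)
      then show ?thesis
        using L2_uminus[OF plancherel_le(1)[OF L2_mult_integrable[OF is_FT_D(1)[OF that] test_fun_fourier_L2[OF p]] L2p[OF is_FT_D(1)[OF that]]]]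
        by simp
    qed
    have step: "(LINT x|lborel. u x * (w m x * fourier \<phi> x)) = S U (V m) / (2 * pi)" for m
    proof (rule LIMSEQ_unique)
      show "(\<lambda>n. LINT x|lborel. w n x * (w m x * fourier \<phi> x)) \<longlonglongrightarrow> (LINT x|lborel. u x * (w m x * fourier \<phi> x))"
        by (rule L2_product_tendsto[OF w(1) u lim L2p[OF w(1)]])
      have "(\<lambda>n. S (V n) (V m) / (2 * pi)) \<longlonglongrightarrow> S U (V m) / (2 * pi)"
        unfolding S_def by (intro tendsto_divide tendsto_const L2_product_tendsto[OF V(2) U VU SL2[OF w(2)]]) simp
      then show "(\<lambda>n. LINT x|lborel. w n x * (w m x * fourier \<phi> x)) \<longlonglongrightarrow> S U (V m) / (2 * pi)"
        by (simp add: fin S V)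
    qed
    have conv_comm: "conv U (V m) \<zeta> = conv (V m) U \<zeta>" for m \<zeta>
      using lborel_integral_real_affine[of "-1" "\<lambda>y. U (\<zeta> - y) * V m y" \<zeta>] by (simp add: conv_def mult.commute)
    \<comment> \<open>The limit in the second factor is brought into the form of the first one by
      commuting the convolution.\<close>
    have "(LINT x|lborel. u x * (u x * fourier \<phi> x)) = S U U / (2 * pi)"
    proof (rule LIMSEQ_unique)
      have "(\<lambda>m. LINT x|lborel. w m x * (u x * fourier \<phi> x)) \<longlonglongrightarrow> (LINT x|lborel. u x * (u x * fourier \<phi> x))"
        by (rule L2_product_tendsto[OF w(1) u lim L2p[OF u]])
      then show "(\<lambda>m. LINT x|lborel. u x * (w m x * fourier \<phi> x)) \<longlonglongrightarrow> (LINT x|lborel. u x * (u x * fourier \<phi> x))"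
        by (simp add: mult.left_commute)
      have "(\<lambda>m. S (V m) U / (2 * pi)) \<longlonglongrightarrow> S U U / (2 * pi)"
        unfolding S_def by (intro tendsto_divide tendsto_const L2_product_tendsto[OF V(2) U VU SL2[OF F]]) simp
      then show "(\<lambda>m. LINT x|lborel. u x * (w m x * fourier \<phi> x)) \<longlonglongrightarrow> S U U / (2 * pi)"
        unfolding step by (simp add: S V U conv_comm)
    qed
    then have key: "(LINT x|lborel. u x * u x * fourier \<phi> x) = (LINT \<zeta>|lborel. conv U U \<zeta> * \<phi> \<zeta>) / (2 * pi)"
      by (simp add: S U mult.assoc)
    have "(LINT x|lborel. fourier (\<lambda>x. u x * u x) x * \<phi> x) = (LINT x|lborel. u x * u x * fourier \<phi> x)"
      by (rule fourier_mult_formula[OF u2 pi])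
    then show "(LINT x|lborel. (fourier (\<lambda>x. u x * u x) x - conv U U x / (2 * pi)) * \<phi> x) = 0"
      using i1 i2 key by (simp add: left_diff_distrib)
  qed measurable
  then show ?thesis by simp
qed

lemma is_FT_eq_fourier:
  assumes F: "is_FT f W" and f: "integrable lborel f"
  shows "AE \<zeta> in lborel. W \<zeta> = fourier f \<zeta>"
proof -
  note [measurable] = L2_D(1)[OF is_FT_D(2)[OF F]] borel_measurable_fourier[OF f]
  have "AE \<zeta> in lborel. W \<zeta> - fourier f \<zeta> = 0"
  proof (rule test_fun_zero)
    fix \<phi> assume p: "test_fun \<phi>"
    note pi = test_fun_props(2)[OF p]
    have i: "integrable lborel (\<lambda>x. W x * \<phi> x)" by (intro L2_mult_integrable is_FT_D(2)[OF F] test_fun_props p)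
    have i1: "integrable lborel (\<lambda>x. fourier f x * \<phi> x)"
      by (subst mult.commute, rule integrable_mult_bounded[OF pi _ norm_fourier_le[OF f]]) auto
    show "integrable lborel (\<lambda>x. (W x - fourier f x) * \<phi> x)" using i i1 by (simp add: left_diff_distrib)
    show "(LINT x|lborel. (W x - fourier f x) * \<phi> x) = 0"
      using i i1 is_FT_D(3)[OF F p] fourier_mult_formula[OF f pi] by (simp add: left_diff_distrib)
  qed measurable
  then show ?thesis by simp
qed

section \<open>Rapidly decreasing functions and regularity\<close>

lemma integrable_powr_decay:
  fixes p :: real
  assumes p: "p > 1" shows "integrable lborel (\<lambda>x :: real. (1 + \<bar>x\<bar>) powr (- p))"
proof (rule integrableI_bounded)
  let ?f = "\<lambda>x :: real. (1 + x) powr (- p)"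
  have half: "(\<integral>\<^sup>+x. ennreal (?f x) * indicator {0..} x \<partial>lborel) = ennreal (0 - (1 + 0) powr (1 - p) / (1 - p))"
  proof (rule nn_integral_FTC_atLeast)
    show "((\<lambda>x. (1 + x) powr (1 - p) / (1 - p)) has_real_derivative ?f x) (at x)" if "0 \<le> x" for x
    proof -
      have "((\<lambda>x. (1 + x) powr (1 - p)) has_real_derivative (1 - p) * (1 + x) powr (1 - p - 1) * (0 + 1)) (at x)"
        by (rule DERIV_chain2[OF has_real_derivative_powr DERIV_add[OF DERIV_const DERIV_ident]]) (use that in simp)
      from DERIV_cdivide[OF this, of "1 - p"] show ?thesis using p by simp
    qed
    have "filterlim (\<lambda>x :: real. 1 + x) at_top at_top"
      by (rule filterlim_tendsto_add_at_top[OF tendsto_const filterlim_ident])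
    then have "((\<lambda>x. (1 + x) powr (1 - p)) \<longlongrightarrow> 0) at_top" using p by (intro tendsto_neg_powr) auto
    then show "((\<lambda>x. (1 + x) powr (1 - p) / (1 - p)) \<longlongrightarrow> 0) at_top"
      using tendsto_divide_zero by blast
  qed auto
  have "(\<integral>\<^sup>+x. ennreal (norm ((1 + \<bar>x\<bar>) powr (- p))) \<partial>lborel)
    \<le> (\<integral>\<^sup>+x. ennreal (?f x) * indicator {0..} x + ennreal (?f (0 - x)) * indicator {0..} (0 - x) \<partial>lborel)"
    by (rule nn_integral_mono) (auto simp: indicator_def)
  also have "\<dots> = (\<integral>\<^sup>+x. ennreal (?f x) * indicator {0..} x \<partial>lborel) + (\<integral>\<^sup>+x. ennreal (?f (0 - x)) * indicator {0..} (0 - x) \<partial>lborel)"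
    by (rule nn_integral_add) auto
  also have "(\<integral>\<^sup>+x. ennreal (?f (0 - x)) * indicator {0..} (0 - x) \<partial>lborel) = (\<integral>\<^sup>+x. ennreal (?f x) * indicator {0..} x \<partial>lborel)"
    by (rule nn_integral_lborel_shift(1)) measurable
  finally show "(\<integral>\<^sup>+x. ennreal (norm ((1 + \<bar>x\<bar>) powr (- p))) \<partial>lborel) < \<infinity>"
    unfolding half by (auto intro: le_less_trans)
qed measurable

section \<open>Polynomial weights and rapidly decreasing functions\<close>

lemma weight_triangle: "1 + \<bar>x\<bar> \<le> (1 + \<bar>x - y\<bar>) * (1 + \<bar>y :: real\<bar>)"
proof -
  have "\<bar>x\<bar> \<le> \<bar>x - y\<bar> + \<bar>y\<bar>" "0 \<le> \<bar>x - y\<bar> * \<bar>y\<bar>" by auto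
  then show ?thesis unfolding distrib_left distrib_right by linarith
qed

text \<open>Submultiplicativity distributes a weight over the two factors of a convolution. The
  decay estimates for convolutions rest on this and on the integer version
  \<open>weight_submult\<close>.\<close>

lemma powr_weight_submult:
  "b \<ge> 0 \<Longrightarrow> (1 + \<bar>x\<bar>) powr b \<le> (1 + \<bar>x - y\<bar>) powr b * (1 + \<bar>y :: real\<bar>) powr b"
proof -
  assume b: "b \<ge> 0"
  have "(1 + \<bar>x\<bar>) powr b \<le> ((1 + \<bar>x - y\<bar>) * (1 + \<bar>y\<bar>)) powr b" using b weight_triangle[of x y] by (intro powr_mono2) auto
  then show ?thesis by (simp add: powr_mult)
qed

lemma weight_submult: "(1 + \<bar>x\<bar>) ^ n \<le> (1 + \<bar>x - y\<bar>) ^ n * (1 + \<bar>y :: real\<bar>) ^ n"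
  unfolding power_mult_distrib[symmetric] by (intro power_mono weight_triangle) auto

lemma powr_weight_le: "a > 0 \<Longrightarrow> (1 + \<bar>x\<bar>) powr a \<le> 2 powr a * (1 + \<bar>x :: real\<bar> powr a)"
proof -
  assume a: "a > 0"
  have "(1 + \<bar>x\<bar>) powr a \<le> (2 * max 1 \<bar>x\<bar>) powr a" using a by (intro powr_mono2) auto
  also have "\<dots> = 2 powr a * max 1 \<bar>x\<bar> powr a" by (simp add: powr_mult)
  also have "\<dots> \<le> 2 powr a * (1 + \<bar>x\<bar> powr a)"
    by (intro mult_left_mono) (auto simp: max_def)
  finally show ?thesis .
qed

lemma powr_minus_two: "(1 + \<bar>x :: real\<bar>) powr - 2 = 1 / (1 + \<bar>x\<bar>)\<^sup>2"
proof -
  have "(1 + \<bar>x\<bar>) powr 2 = (1 + \<bar>x\<bar>)\<^sup>2" by (rule powr_numeral) simp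
  then show ?thesis by (simp only: powr_minus inverse_eq_divide)
qed

lemma continuous_abs_powr: "a > 0 \<Longrightarrow> continuous_on UNIV (\<lambda>x :: real. \<bar>x\<bar> powr a)"
  by (intro continuous_on_powr' continuous_intros) auto

lemma continuous_AE_eq:
  fixes f g :: "real \<Rightarrow> complex"
  assumes f: "continuous_on UNIV f" and g: "continuous_on UNIV g" and ae: "AE x in lborel. f x = g x"
  shows "f = g"
proof (rule ccontr)
  assume "f \<noteq> g"
  then obtain x where x: "f x \<noteq> g x" by blast
  have "open {x. f x \<noteq> g x}" by (rule open_Collect_neq[OF f g])
  then obtain e where e: "e > 0" "ball x e \<subseteq> {x. f x \<noteq> g x}" using x open_contains_ball by blast
  have "AE y in lborel. y \<notin> ball x e" using ae
  proof eventually_elim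
    case (elim y) then show ?case using e(2) by auto
  qed
  then have "emeasure lborel (ball x e) = 0" by (subst (asm) AE_iff_measurable[where N = "ball x e"]) auto
  then show False using e(1) by (simp add: ball_eq_greaterThanLessThan)
qed

lemma L2_of_integrable_bounded:
  assumes f: "integrable lborel f" and b: "\<And>x. cmod (f x) \<le> C" shows "L2 f"
  unfolding L2_def
proof
  show "f \<in> borel_measurable lborel" using f by auto
  have "integrable lborel (\<lambda>x. f x * cnj (f x))"
    by (rule integrable_mult_bounded[where C = C]) (use f b in auto)
  then have "integrable lborel (\<lambda>x. complex_of_real ((cmod (f x))\<^sup>2))" by (simp only: complex_norm_square)
  then show "integrable lborel (\<lambda>x. (cmod (f x))\<^sup>2)" by (simp only: complex_of_real_integrable_eq)
qed

text \<open>Derivatives are left out on purpose, in view of the multiplier |x| powr a at 0.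
  Continuity is included so that almost everywhere identities between such functions hold at every
  point.\<close>

definition rapid :: "(real \<Rightarrow> complex) \<Rightarrow> bool" where
  "rapid f \<longleftrightarrow> continuous_on UNIV f \<and> (\<forall>n. \<exists>C. \<forall>x. (1 + \<bar>x\<bar>) ^ n * cmod (f x) \<le> C)"

lemma rapid_continuous: "rapid f \<Longrightarrow> continuous_on UNIV f"
  by (simp add: rapid_def)

lemma rapid_borel: "rapid f \<Longrightarrow> f \<in> borel_measurable borel"
  by (intro borel_measurable_continuous_onI rapid_continuous)

lemma rapid_bounded: assumes "rapid f" obtains C where "\<And>x. cmod (f x) \<le> C"
proof -
  obtain C where "\<And>x. (1 + \<bar>x\<bar>) ^ 0 * cmod (f x) \<le> C" using assms unfolding rapid_def by meson
  then show ?thesis using that by auto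
qed

lemma rapid_integrable_weight:
  assumes f: "rapid f" shows "integrable lborel (\<lambda>x. (1 + \<bar>x\<bar>) ^ n * cmod (f x))"
proof -
  note [measurable] = rapid_borel[OF f]
  obtain C where C: "\<And>x. (1 + \<bar>x\<bar>) ^ (n + 2) * cmod (f x) \<le> C" using f unfolding rapid_def by blast
  show ?thesis
  proof (rule Bochner_Integration.integrable_bound)
    show "integrable lborel (\<lambda>x. C * (1 + \<bar>x\<bar>) powr (- 2))" using integrable_powr_decay[of 2] by auto
    show "AE x in lborel. norm ((1 + \<bar>x\<bar>) ^ n * cmod (f x)) \<le> norm (C * (1 + \<bar>x\<bar>) powr - 2)"
    proof (intro AE_I2)
      fix x :: real
      note p = powr_minus_two[of x]
      have "(1 + \<bar>x\<bar>) ^ n * cmod (f x) \<le> C / (1 + \<bar>x\<bar>)\<^sup>2"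
      proof -
        have "0 < (1 + \<bar>x\<bar>)\<^sup>2" by (intro zero_less_power) simp
        then show ?thesis using C[of x] by (simp only: pos_le_divide_eq power_add mult_ac)
      qed
      then show "norm ((1 + \<bar>x\<bar>) ^ n * cmod (f x)) \<le> norm (C * (1 + \<bar>x\<bar>) powr - 2)"
        using order_trans[OF _ C[of 0]] by (simp add: p abs_mult)
    qed
  qed measurable
qed

lemma rapid_integrable: assumes "rapid f" shows "integrable lborel f"
  using rapid_integrable_weight[OF assms, of 0] rapid_borel[OF assms] integrable_norm_iff[of f lborel] by simp

lemma rapid_L2: assumes "rapid f" shows "L2 f"
  using rapid_bounded[OF assms] L2_of_integrable_bounded[OF rapid_integrable[OF assms]] by metis

lemma rapid_mult:
  assumes f: "rapid f" and g: "continuous_on UNIV g" and b: "\<And>x. cmod (g x) \<le> K * (1 + \<bar>x\<bar>) ^ m"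
  shows "rapid (\<lambda>x. g x * f x)"
  unfolding rapid_def
proof (intro conjI allI)
  show "continuous_on UNIV (\<lambda>x. g x * f x)" by (intro continuous_intros g rapid_continuous[OF f])
  fix n
  obtain C where C: "\<And>x. (1 + \<bar>x\<bar>) ^ (n + m) * cmod (f x) \<le> C" using f unfolding rapid_def by blast
  have K: "K \<ge> 0" using order_trans[OF norm_ge_zero b[of 0]] by simp
  show "\<exists>C. \<forall>x. (1 + \<bar>x\<bar>) ^ n * cmod (g x * f x) \<le> C"
  proof (intro exI allI)
    fix x
    have "(1 + \<bar>x\<bar>) ^ n * cmod (g x * f x) \<le> (1 + \<bar>x\<bar>) ^ n * ((K * (1 + \<bar>x\<bar>) ^ m) * cmod (f x))"
      unfolding norm_mult by (intro mult_left_mono mult_right_mono b) auto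
    also have "\<dots> = K * ((1 + \<bar>x\<bar>) ^ (n + m) * cmod (f x))" by (simp add: power_add)
    also have "\<dots> \<le> K * C" by (intro mult_left_mono C K)
    finally show "(1 + \<bar>x\<bar>) ^ n * cmod (g x * f x) \<le> K * C" .
  qed
qed

lemma rapid_add: assumes f: "rapid f" and g: "rapid g" shows "rapid (\<lambda>x. f x + g x)"
  unfolding rapid_def
proof (intro conjI allI)
  show "continuous_on UNIV (\<lambda>x. f x + g x)" by (intro continuous_intros rapid_continuous f g)
  fix n
  obtain C D where C: "\<And>x. (1 + \<bar>x\<bar>) ^ n * cmod (f x) \<le> C" and D: "\<And>x. (1 + \<bar>x\<bar>) ^ n * cmod (g x) \<le> D"
    using f g unfolding rapid_def by meson
  show "\<exists>C. \<forall>x. (1 + \<bar>x\<bar>) ^ n * cmod (f x + g x) \<le> C"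
  proof (intro exI allI)
    fix x
    have "(1 + \<bar>x\<bar>) ^ n * cmod (f x + g x) \<le> (1 + \<bar>x\<bar>) ^ n * (cmod (f x) + cmod (g x))"
      by (intro mult_left_mono norm_triangle_ineq) auto
    also have "\<dots> \<le> C + D" using C[of x] D[of x] by (simp add: distrib_left)
    finally show "(1 + \<bar>x\<bar>) ^ n * cmod (f x + g x) \<le> C + D" .
  qed
qed

lemma rapid_scale: "rapid f \<Longrightarrow> rapid (\<lambda>x. c * f x)"
  by (rule rapid_mult[where K = "cmod c" and m = 0]) auto

lemma rapid_diff: "rapid f \<Longrightarrow> rapid g \<Longrightarrow> rapid (\<lambda>x. f x - g x)"
  using rapid_add[of f "\<lambda>x. -1 * g x"] rapid_scale[of g "-1"] by simp

lemma rapid_dilate: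
  assumes f: "rapid f" and s: "s \<noteq> 0" shows "rapid (\<lambda>x. f (s * x))"
  unfolding rapid_def
proof (intro conjI allI)
  show "continuous_on UNIV (\<lambda>x. f (s * x))"
    by (intro continuous_on_compose2[OF rapid_continuous[OF f]] continuous_intros) auto
  fix n
  obtain C where C: "\<And>x. (1 + \<bar>x\<bar>) ^ n * cmod (f x) \<le> C" using f unfolding rapid_def by meson
  define M where "M = 1 + 1 / \<bar>s\<bar>"
  show "\<exists>C. \<forall>x. (1 + \<bar>x\<bar>) ^ n * cmod (f (s * x)) \<le> C"
  proof (intro exI allI)
    fix x
    have "1 + \<bar>x\<bar> \<le> M * (1 + \<bar>s * x\<bar>)" using s by (simp add: M_def abs_mult algebra_simps)
    then have "(1 + \<bar>x\<bar>) ^ n \<le> M ^ n * (1 + \<bar>s * x\<bar>) ^ n"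
      unfolding power_mult_distrib[symmetric] by (intro power_mono) auto
    then have "(1 + \<bar>x\<bar>) ^ n * cmod (f (s * x)) \<le> (M ^ n * (1 + \<bar>s * x\<bar>) ^ n) * cmod (f (s * x))"
      by (intro mult_right_mono) auto
    also have "\<dots> \<le> M ^ n * C" using C[of "s * x"] by (auto simp: mult.assoc M_def intro!: mult_left_mono)
    finally show "(1 + \<bar>x\<bar>) ^ n * cmod (f (s * x)) \<le> M ^ n * C" .
  qed
qed

section \<open>Continuity of convolutions and bootstrapping of decay\<close>

lemma conv_commute: "conv f g x = conv g f x"
  using lborel_integral_real_affine[of "-1" "\<lambda>y. f (x - y) * g y" x] by (simp add: conv_def mult.commute)

lemma conv_continuous_bounded:
  assumes f: "continuous_on UNIV f" "\<And>x. cmod (f x) \<le> C" and g: "integrable lborel g"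
  shows "continuous_on UNIV (conv f g)"
  unfolding continuous_on_sequentially o_def
proof (intro allI ballI impI, elim conjE)
  fix y :: "nat \<Rightarrow> real" and x assume y: "y \<longlonglongrightarrow> x"
  have [measurable]: "f \<in> borel_measurable borel" using f(1) by (rule borel_measurable_continuous_onI)
  show "(\<lambda>n. conv f g (y n)) \<longlonglongrightarrow> conv f g x"
    unfolding conv_def
  proof (rule integral_dominated_convergence[where w = "\<lambda>t. C * cmod (g t)"])
    show "AE t in lborel. (\<lambda>n. f (y n - t) * g t) \<longlonglongrightarrow> f (x - t) * g t"
      by (intro AE_I2 tendsto_mult tendsto_const continuous_on_tendsto_compose[OF f(1)] tendsto_diff y) auto
    show "AE t in lborel. norm (f (y n - t) * g t) \<le> C * cmod (g t)" for n
      by (intro AE_I2) (auto simp: norm_mult intro!: mult_right_mono f)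
  qed (use g in auto)
qed

text \<open>Along a convergent sequence of points, bounded by B, the reflected translates of f have
  the common square integrable majorant C (1 + B)^2 (1 + |t|)^(-2), so dominated convergence applies
  although g is merely square integrable.\<close>

lemma conv_continuous_L2:
  assumes f: "rapid f" and g: "L2 g"
  shows "continuous_on UNIV (conv f g)"
  unfolding continuous_on_sequentially o_def
proof (intro allI ballI impI, elim conjE)
  fix y :: "nat \<Rightarrow> real" and x assume y: "y \<longlonglongrightarrow> x"
  note [measurable] = rapid_borel[OF f] L2_D(1)[OF g]
  obtain C where C: "\<And>x. (1 + \<bar>x\<bar>) ^ 2 * cmod (f x) \<le> C" using f unfolding rapid_def by blast
  obtain B where B: "\<And>n. \<bar>y n\<bar> \<le> B"
    using Bseq_conv_Bfun[of y] convergent_imp_Bseq[of y] y by (metis BseqE convergentI real_norm_def)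
  have bd: "cmod (f (y n - t)) \<le> C * (1 + B)\<^sup>2 * ((1 + \<bar>t\<bar>) powr - 2)" for n t
  proof -
    have "(1 + \<bar>t\<bar>)\<^sup>2 \<le> ((1 + \<bar>y n - t\<bar>) * (1 + B))\<^sup>2"
    proof (intro power_mono)
      have "1 + \<bar>t\<bar> \<le> 1 + \<bar>y n - t\<bar> + B" using B[of n] by linarith
      also have "\<dots> \<le> (1 + \<bar>y n - t\<bar>) * (1 + B)" using order_trans[OF abs_ge_zero B[of n]] by (simp add: algebra_simps)
      finally show "1 + \<bar>t\<bar> \<le> (1 + \<bar>y n - t\<bar>) * (1 + B)" .
    qed auto
    then have "(1 + \<bar>t\<bar>)\<^sup>2 * cmod (f (y n - t)) \<le> ((1 + \<bar>y n - t\<bar>) * (1 + B))\<^sup>2 * cmod (f (y n - t))"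
      by (intro mult_right_mono) auto
    also have "\<dots> \<le> C * (1 + B)\<^sup>2"
      using mult_right_mono[OF C[of "y n - t"], of "(1 + B)\<^sup>2"] by (simp add: power_mult_distrib mult_ac)
    finally have "cmod (f (y n - t)) \<le> C * (1 + B)\<^sup>2 / (1 + \<bar>t\<bar>)\<^sup>2" by (simp add: le_divide_eq mult.commute)
    also have "\<dots> = C * (1 + B)\<^sup>2 * ((1 + \<bar>t\<bar>) powr - 2)" by (simp add: powr_minus_two)
    finally show ?thesis .
  qed
  have L: "L2 (\<lambda>t. complex_of_real ((1 + \<bar>t\<bar>) powr - 2))"
  proof (rule L2_of_integrable_bounded[where C = 1])
    show "integrable lborel (\<lambda>t. complex_of_real ((1 + \<bar>t\<bar>) powr - 2))"
      using integrable_powr_decay[of 2] by (simp add: complex_of_real_integrable_eq)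
    show "cmod (complex_of_real ((1 + \<bar>t\<bar>) powr - 2)) \<le> 1" for t :: real
    proof -
      have "1 \<le> (1 + \<bar>t\<bar>)\<^sup>2" by (rule one_le_power) simp
      then have "(1 + \<bar>t\<bar>) powr - 2 \<le> 1" unfolding powr_minus_two by simp
      then show ?thesis unfolding norm_of_real by simp
    qed
  qed
  show "(\<lambda>n. conv f g (y n)) \<longlonglongrightarrow> conv f g x"
    unfolding conv_def
  proof (rule integral_dominated_convergence[where w = "\<lambda>t. C * (1 + B)\<^sup>2 * norm (complex_of_real ((1 + \<bar>t\<bar>) powr - 2) * g t)"])
    show "AE t in lborel. (\<lambda>n. f (y n - t) * g t) \<longlonglongrightarrow> f (x - t) * g t"
      by (intro AE_I2 tendsto_mult tendsto_const continuous_on_tendsto_compose[OF rapid_continuous[OF f]] tendsto_diff y) auto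
    show "AE t in lborel. norm (f (y n - t) * g t) \<le> C * (1 + B)\<^sup>2 * norm (complex_of_real ((1 + \<bar>t\<bar>) powr - 2) * g t)" for n
      using mult_right_mono[OF bd[of n], of "cmod (g _)"] by (intro AE_I2) (auto simp: norm_mult mult.assoc)
    show "integrable lborel (\<lambda>t. C * (1 + B)\<^sup>2 * norm (complex_of_real ((1 + \<bar>t\<bar>) powr - 2) * g t))"
      using L2_mult_integrable[OF L g] by auto
  qed auto
qed

text \<open>Each application of the inequality gains decay of order a: if f decays to order k a, the
  weight of that order is shared between f (x - y) and q y, the moments of q absorb their share, and
  the left side carries the additional order a. However small a is, iteration reaches every
  order.\<close>

lemma rapid_of_conv_inequality:
  assumes f: "continuous_on UNIV f" "\<And>x. cmod (f x) \<le> C0" and a: "a > 0"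
    and q[measurable]: "q \<in> borel_measurable borel" and qw: "\<And>n. integrable lborel (\<lambda>y. (1 + \<bar>y\<bar>) ^ n * cmod (q y))"
    and ineq: "\<And>x. (1 + \<bar>x\<bar>) powr a * cmod (f x) \<le> K * (LINT y|lborel. cmod (f (x - y)) * cmod (q y))" and K: "K \<ge> 0"
  shows "rapid f"
proof -
  have [measurable]: "f \<in> borel_measurable borel" using f(1) by (rule borel_measurable_continuous_onI)
  have decay: "\<exists>C. \<forall>x. (1 + \<bar>x\<bar>) powr (real k * a) * cmod (f x) \<le> C" for k
  proof (induction k)
    case 0 then show ?case using f(2) by auto
  next
    case (Suc k)
    then obtain C where C: "\<And>x. (1 + \<bar>x\<bar>) powr (real k * a) * cmod (f x) \<le> C" by blast
    \<comment> \<open>Moments of q are available for integer orders, so the real order k a is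
      rounded up.\<close>
    define N where "N = nat \<lceil>real k * a\<rceil>"
    have kN: "real k * a \<le> real N" unfolding N_def by linarith
    have ka: "0 \<le> real k * a" using a by simp
    define I where "I = (LINT y|lborel. (1 + \<bar>y\<bar>) ^ N * cmod (q y))"
    have C0: "C \<ge> 0" using order_trans[OF _ C[of 0]] by simp
    have "(1 + \<bar>x\<bar>) powr (real (Suc k) * a) * cmod (f x) \<le> K * (C * I)" for x
    proof -
      have "(1 + \<bar>x\<bar>) powr (real k * a) * (cmod (f (x - y)) * cmod (q y)) \<le> C * ((1 + \<bar>y\<bar>) ^ N * cmod (q y))" for y
      proof -
        have "(1 + \<bar>x\<bar>) powr (real k * a) * (cmod (f (x - y)) * cmod (q y))
          \<le> ((1 + \<bar>x - y\<bar>) powr (real k * a) * (1 + \<bar>y\<bar>) powr (real k * a)) * (cmod (f (x - y)) * cmod (q y))"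
          by (intro mult_right_mono powr_weight_submult ka) auto
        also have "\<dots> = ((1 + \<bar>x - y\<bar>) powr (real k * a) * cmod (f (x - y))) * ((1 + \<bar>y\<bar>) powr (real k * a) * cmod (q y))" by simp
        also have "\<dots> \<le> C * ((1 + \<bar>y\<bar>) ^ N * cmod (q y))"
        proof (intro mult_mono C mult_right_mono)
          have "(1 + \<bar>y\<bar>) powr (real k * a) \<le> (1 + \<bar>y\<bar>) powr (real N)" by (intro powr_mono kN) auto
          then show "(1 + \<bar>y\<bar>) powr (real k * a) \<le> (1 + \<bar>y\<bar>) ^ N" by (simp add: powr_realpow)
        qed (use C0 in auto)
        finally show ?thesis .
      qed
      note pw = this
      have "(1 + \<bar>x\<bar>) powr (real (Suc k) * a) * cmod (f x) = (1 + \<bar>x\<bar>) powr (real k * a) * ((1 + \<bar>x\<bar>) powr a * cmod (f x))"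
        by (simp add: powr_add distrib_right)
      also have "\<dots> \<le> (1 + \<bar>x\<bar>) powr (real k * a) * (K * (LINT y|lborel. cmod (f (x - y)) * cmod (q y)))"
        by (intro mult_left_mono ineq) auto
      also have "\<dots> = K * (LINT y|lborel. (1 + \<bar>x\<bar>) powr (real k * a) * (cmod (f (x - y)) * cmod (q y)))" by simp
      also have "\<dots> \<le> K * (LINT y|lborel. C * ((1 + \<bar>y\<bar>) ^ N * cmod (q y)))"
      proof (intro mult_left_mono K integral_mono)
        show i: "integrable lborel (\<lambda>y. C * ((1 + \<bar>y\<bar>) ^ N * cmod (q y)))" using qw by auto
        show "integrable lborel (\<lambda>y. (1 + \<bar>x\<bar>) powr (real k * a) * (cmod (f (x - y)) * cmod (q y)))"
          by (rule Bochner_Integration.integrable_bound[OF i]) (use pw C0 in \<open>auto intro!: AE_I2\<close>)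
      qed (rule pw)
      also have "\<dots> = K * (C * I)" by (simp add: I_def)
      finally show ?thesis .
    qed
    then show ?case by blast
  qed
  show ?thesis unfolding rapid_def
  proof (intro conjI allI f(1))
    fix n :: nat
    define k where "k = nat \<lceil>real n / a\<rceil>"
    have "real n / a \<le> real k" unfolding k_def by linarith
    then have nk: "real n \<le> real k * a" using a by (simp add: divide_le_eq)
    obtain C where C: "\<And>x. (1 + \<bar>x\<bar>) powr (real k * a) * cmod (f x) \<le> C" using decay by blast
    have "(1 + \<bar>x\<bar>) ^ n * cmod (f x) \<le> C" for x
    proof -
      have "(1 + \<bar>x\<bar>) powr (real n) \<le> (1 + \<bar>x\<bar>) powr (real k * a)" by (intro powr_mono nk) auto
      then have "(1 + \<bar>x\<bar>) ^ n * cmod (f x) \<le> (1 + \<bar>x\<bar>) powr (real k * a) * cmod (f x)"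
        by (intro mult_right_mono) (auto simp: powr_realpow)
      then show ?thesis using C[of x] by simp
    qed
    then show "\<exists>C. \<forall>x. (1 + \<bar>x\<bar>) ^ n * cmod (f x) \<le> C" by blast
  qed
qed

lemma rapid_conv: assumes f: "rapid f" and g: "rapid g" shows "rapid (conv f g)"
  unfolding rapid_def
proof (intro conjI allI)
  show "continuous_on UNIV (conv f g)" by (rule conv_continuous_L2[OF f rapid_L2[OF g]])
  fix n
  note [measurable] = rapid_borel[OF f] rapid_borel[OF g]
  obtain C where C: "\<And>x. (1 + \<bar>x\<bar>) ^ n * cmod (f x) \<le> C" using f unfolding rapid_def by blast
  have C0: "C \<ge> 0" using order_trans[OF _ C[of 0]] by simp
  show "\<exists>C. \<forall>x. (1 + \<bar>x\<bar>) ^ n * cmod (conv f g x) \<le> C"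
  proof (intro exI allI)
    fix x
    have pw: "(1 + \<bar>x\<bar>) ^ n * cmod (f (x - y) * g y) \<le> C * ((1 + \<bar>y\<bar>) ^ n * cmod (g y))" for y
    proof -
      have "(1 + \<bar>x\<bar>) ^ n * cmod (f (x - y) * g y) \<le> ((1 + \<bar>x - y\<bar>) ^ n * (1 + \<bar>y\<bar>) ^ n) * cmod (f (x - y) * g y)"
        by (intro mult_right_mono weight_submult) auto
      also have "\<dots> = ((1 + \<bar>x - y\<bar>) ^ n * cmod (f (x - y))) * ((1 + \<bar>y\<bar>) ^ n * cmod (g y))" by (simp add: norm_mult)
      also have "\<dots> \<le> C * ((1 + \<bar>y\<bar>) ^ n * cmod (g y))" by (intro mult_right_mono C) auto
      finally show ?thesis .
    qed
    have i: "integrable lborel (\<lambda>y. C * ((1 + \<bar>y\<bar>) ^ n * cmod (g y)))" using rapid_integrable_weight[OF g] by auto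
    have "(1 + \<bar>x\<bar>) ^ n * cmod (conv f g x) \<le> (1 + \<bar>x\<bar>) ^ n * (LINT y|lborel. cmod (f (x - y) * g y))"
      unfolding conv_def by (intro mult_left_mono integral_norm_bound) auto
    also have "\<dots> = (LINT y|lborel. (1 + \<bar>x\<bar>) ^ n * cmod (f (x - y) * g y))" by simp
    also have "\<dots> \<le> (LINT y|lborel. C * ((1 + \<bar>y\<bar>) ^ n * cmod (g y)))"
    proof (intro integral_mono i pw)
      show "integrable lborel (\<lambda>y. (1 + \<bar>x\<bar>) ^ n * cmod (f (x - y) * g y))"
      proof (rule Bochner_Integration.integrable_bound[OF i])
        show "AE y in lborel. norm ((1 + \<bar>x\<bar>) ^ n * cmod (f (x - y) * g y)) \<le> norm (C * ((1 + \<bar>y\<bar>) ^ n * cmod (g y)))"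
          using pw C0 by (intro AE_I2) (simp add: abs_mult)
      qed measurable
    qed
    finally show "(1 + \<bar>x\<bar>) ^ n * cmod (conv f g x) \<le> (LINT y|lborel. C * ((1 + \<bar>y\<bar>) ^ n * cmod (g y)))" .
  qed
qed

text \<open>With m = 1 / (1 + |x| powr a) one has q = m g for a square integrable g. Cauchy-Schwarz
  for this product alone would ask for 2 a > 1. Using the convolution equation once puts a third
  factor m under the integral, at the price of a second factor g.\<close>

lemma ground_integrable:
  assumes a: "a > 1/3" and q2: "L2 (\<lambda>x. complex_of_real (1 + \<bar>x\<bar> powr a) * q x)"
    and eq: "AE x in lborel. complex_of_real (1 + \<bar>x\<bar> powr a) * q x = conv q q x / (2 * pi)"
    and [measurable]: "q \<in> borel_measurable borel"
  shows "integrable lborel q"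
proof (rule integrableI_bounded)
  define m where "m x = 1 / (1 + \<bar>x\<bar> powr a)" for x :: real
  define g where "g x = (1 + \<bar>x\<bar> powr a) * cmod (q x)" for x
  have [measurable]: "m \<in> borel_measurable borel" "g \<in> borel_measurable borel" unfolding m_def[abs_def] g_def[abs_def] by measurable
  have m: "0 < m x" "m x \<le> 1" for x by (auto simp: m_def add_pos_nonneg)
  have qg: "cmod (q x) = m x * g x" for x
    using m(1)[of x] by (simp add: m_def g_def add_nonneg_eq_0_iff)
  have g0: "g x \<ge> 0" for x by (simp add: g_def)
  let ?M = "\<integral>\<^sup>+x. ennreal (m x ^ 3) \<partial>lborel" and ?G = "\<integral>\<^sup>+x. ennreal ((g x)\<^sup>2) \<partial>lborel"
  have Gfin: "?G < \<infinity>"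
    using L2_D(2)[OF q2] by (subst nn_integral_eq_integral) (auto simp: g_def norm_mult norm_of_real simp del: of_real_add)
  have Mfin: "?M < \<infinity>"
  proof -
    have "integrable lborel (\<lambda>x. m x ^ 3)"
    proof (rule Bochner_Integration.integrable_bound)
      show "integrable lborel (\<lambda>x :: real. (2 powr a) ^ 3 * (1 + \<bar>x\<bar>) powr (- (3 * a)))"
        using integrable_powr_decay[of "3 * a"] a by auto
      show "AE x in lborel. norm (m x ^ 3) \<le> norm ((2 powr a) ^ 3 * (1 + \<bar>x\<bar>) powr (- (3 * a)))"
      proof (intro AE_I2)
        fix x :: real
        have "m x \<le> 2 powr a * (1 + \<bar>x\<bar>) powr (- a)"
          using powr_weight_le[of a x] a by (simp add: m_def powr_minus field_simps add_nonneg_eq_0_iff add_pos_nonneg)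
        then have "m x ^ 3 \<le> (2 powr a * (1 + \<bar>x\<bar>) powr (- a)) ^ 3" using m by (intro power_mono) (auto simp: less_imp_le)
        also have "\<dots> = (2 powr a) ^ 3 * (1 + \<bar>x\<bar>) powr (- (3 * a))"
          by (simp add: power_mult_distrib powr_power mult.commute)
        finally show "norm (m x ^ 3) \<le> norm ((2 powr a) ^ 3 * (1 + \<bar>x\<bar>) powr (- (3 * a)))"
          using m(1)[of x] by (simp add: less_imp_le)
      qed
    qed measurable
    then show ?thesis using m(1) by (subst nn_integral_eq_integral) (auto simp: less_imp_le)
  qed
  have "(\<integral>\<^sup>+x. ennreal (norm (q x)) \<partial>lborel) = (\<integral>\<^sup>+x. ennreal (m x * cmod (conv q q x) / (2 * pi)) \<partial>lborel)"
  proof (rule nn_integral_cong_AE)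
    show "AE x in lborel. ennreal (norm (q x)) = ennreal (m x * cmod (conv q q x) / (2 * pi))"
      using eq
    proof eventually_elim
      case (elim x)
      have "cmod (complex_of_real (1 + \<bar>x\<bar> powr a) * q x) = cmod (conv q q x) / (2 * pi)" unfolding elim by (simp add: norm_divide norm_mult)
      moreover have "cmod (complex_of_real (1 + \<bar>x\<bar> powr a) * q x) = (1 + \<bar>x\<bar> powr a) * cmod (q x)"
        unfolding norm_mult norm_of_real by simp
      ultimately have "cmod (q x) = m x * (cmod (conv q q x) / (2 * pi))"
        using m(1)[of x] by (simp add: m_def field_simps add_nonneg_eq_0_iff)
      then show ?case by simp
    qed
  qed
  also have "\<dots> \<le> (\<integral>\<^sup>+x. ennreal (m x * cmod (conv q q x)) \<partial>lborel)"
  proof (intro nn_integral_mono ennreal_leI)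
    fix x
    have "m x * cmod (conv q q x) / (2 * pi) \<le> m x * cmod (conv q q x) / 1"
      using pi_gt3 m(1)[of x] by (intro divide_left_mono) (auto simp: less_imp_le)
    then show "m x * cmod (conv q q x) / (2 * pi) \<le> m x * cmod (conv q q x)" by simp
  qed
  also have "\<dots> \<le> (\<integral>\<^sup>+x. \<integral>\<^sup>+y. ennreal (m x * (cmod (q (x - y)) * cmod (q y))) \<partial>lborel \<partial>lborel)"
  proof (rule nn_integral_mono)
    fix x
    have "ennreal (m x * cmod (conv q q x)) \<le> ennreal (m x) * (\<integral>\<^sup>+y. ennreal (norm (q (x - y) * q y)) \<partial>lborel)"
      unfolding conv_def using m(1)[of x] by (simp add: ennreal_mult less_imp_le mult_left_mono norm_integral_le_nn_integral)
    also have "\<dots> = (\<integral>\<^sup>+y. ennreal (m x * (cmod (q (x - y)) * cmod (q y))) \<partial>lborel)"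
      using m(1)[of x] by (subst nn_integral_cmult[symmetric]) (auto simp: norm_mult ennreal_mult less_imp_le)
    finally show "ennreal (m x * cmod (conv q q x)) \<le> \<dots>" .
  qed
  \<comment> \<open>With \<open>z = m x\<close>, the triple product of decay factors splits by \<open>z u\<^sup>2 \<le> z\<^sup>3 + u\<^sup>3\<close>; this uses exactly \<open>3 a > 1\<close>.\<close>
  also have "\<dots> \<le> (\<integral>\<^sup>+x. \<integral>\<^sup>+y. (ennreal (m x ^ 3) * ennreal ((g (x - y))\<^sup>2) + ennreal (m y ^ 3) * ennreal ((g (x - y))\<^sup>2))
     + (ennreal ((g y)\<^sup>2) * ennreal (m (x - y) ^ 3) + ennreal (m x ^ 3) * ennreal ((g (x - (x - y)))\<^sup>2)) \<partial>lborel \<partial>lborel)"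
  proof (intro nn_integral_mono)
    fix x y
    have cube: "z * u\<^sup>2 \<le> z ^ 3 + u ^ 3" if "0 < z" "0 < u" for z u :: real
    proof (cases "z \<le> u")
      case True
      then have "z * u\<^sup>2 \<le> u * u\<^sup>2" by (intro mult_right_mono) auto
      then show ?thesis using that by (simp add: power3_eq_cube power2_eq_square add_increasing)
    next
      case False
      then have "z * u\<^sup>2 \<le> z * z\<^sup>2" using that by (intro mult_left_mono power_mono) auto
      then show ?thesis using that by (simp add: power3_eq_cube power2_eq_square add_increasing2)
    qed
    \<comment> \<open>The factors are paired crosswise so that each square carries one g squared and
      one m squared at different points. Together with m x this is the product treated by
      \<open>cube\<close>, and only integrals of m^3 against shifted g^2 remain.\<close>
    define A B where "A = m y * g (x - y)" and "B = m (x - y) * g y"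
    have "m x * (cmod (q (x - y)) * cmod (q y)) = m x * (A * B)" by (simp add: qg A_def B_def)
    also have "\<dots> \<le> m x * (A\<^sup>2 + B\<^sup>2)"
    proof (intro mult_left_mono)
      have "0 \<le> A * B" using m g0 by (simp add: A_def B_def less_imp_le)
      then show "A * B \<le> A\<^sup>2 + B\<^sup>2" using sum_squares_bound[of A B] by simp
    qed (use m(1)[of x] in simp)
    also have "\<dots> = (m x * (m y)\<^sup>2) * (g (x - y))\<^sup>2 + (m x * (m (x - y))\<^sup>2) * (g y)\<^sup>2"
      by (simp add: A_def B_def power_mult_distrib algebra_simps)
    also have "\<dots> \<le> (m x ^ 3 + m y ^ 3) * (g (x - y))\<^sup>2 + (m x ^ 3 + m (x - y) ^ 3) * (g y)\<^sup>2"
      by (intro add_mono mult_right_mono cube m) auto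
    finally have "m x * (cmod (q (x - y)) * cmod (q y)) \<le> (m x ^ 3 * (g (x - y))\<^sup>2 + m y ^ 3 * (g (x - y))\<^sup>2) + ((g y)\<^sup>2 * m (x - y) ^ 3 + m x ^ 3 * (g (x - (x - y)))\<^sup>2)"
      by (simp add: algebra_simps)
    then show "ennreal (m x * (cmod (q (x - y)) * cmod (q y))) \<le> (ennreal (m x ^ 3) * ennreal ((g (x - y))\<^sup>2) + ennreal (m y ^ 3) * ennreal ((g (x - y))\<^sup>2))
     + (ennreal ((g y)\<^sup>2) * ennreal (m (x - y) ^ 3) + ennreal (m x ^ 3) * ennreal ((g (x - (x - y)))\<^sup>2))"
      using m(1) g0 by (simp add: ennreal_mult[symmetric] ennreal_plus[symmetric] less_imp_le del: ennreal_plus)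
  qed
  also have "\<dots> = ((\<integral>\<^sup>+x. \<integral>\<^sup>+y. ennreal (m x ^ 3) * ennreal ((g (x - y))\<^sup>2) \<partial>lborel \<partial>lborel)
      + (\<integral>\<^sup>+x. \<integral>\<^sup>+y. ennreal (m y ^ 3) * ennreal ((g (x - y))\<^sup>2) \<partial>lborel \<partial>lborel))
      + ((\<integral>\<^sup>+x. \<integral>\<^sup>+y. ennreal ((g y)\<^sup>2) * ennreal (m (x - y) ^ 3) \<partial>lborel \<partial>lborel)
      + (\<integral>\<^sup>+x. \<integral>\<^sup>+y. ennreal (m x ^ 3) * ennreal ((g (x - (x - y)))\<^sup>2) \<partial>lborel \<partial>lborel))"
    by (subst nn_integral_add, measurable)+
  also have "(\<integral>\<^sup>+x. \<integral>\<^sup>+y. ennreal (m x ^ 3) * ennreal ((g (x - (x - y)))\<^sup>2) \<partial>lborel \<partial>lborel) = ?M * ?G"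
    by (simp add: nn_integral_cmult nn_integral_multc)
  also have "(\<integral>\<^sup>+x. \<integral>\<^sup>+y. ennreal (m x ^ 3) * ennreal ((g (x - y))\<^sup>2) \<partial>lborel \<partial>lborel) = ?M * ?G"
    by (rule nn_integral_conv_weight(1)[of "\<lambda>x. ennreal (m x ^ 3)" "\<lambda>x. ennreal ((g x)\<^sup>2)"]) measurable
  also have "(\<integral>\<^sup>+x. \<integral>\<^sup>+y. ennreal (m y ^ 3) * ennreal ((g (x - y))\<^sup>2) \<partial>lborel \<partial>lborel) = ?M * ?G"
    by (rule nn_integral_conv_weight(2)[of "\<lambda>x. ennreal (m x ^ 3)" "\<lambda>x. ennreal ((g x)\<^sup>2)"]) measurable
  also have "(\<integral>\<^sup>+x. \<integral>\<^sup>+y. ennreal ((g y)\<^sup>2) * ennreal (m (x - y) ^ 3) \<partial>lborel \<partial>lborel) = ?G * ?M"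
    by (rule nn_integral_conv_weight(2)[of "\<lambda>x. ennreal ((g x)\<^sup>2)" "\<lambda>x. ennreal (m x ^ 3)"]) measurable
  also have "(?M * ?G + ?M * ?G) + (?G * ?M + ?M * ?G) < \<infinity>"
    using Gfin Mfin by (simp add: ennreal_mult_less_top)
  finally show "(\<integral>\<^sup>+x. ennreal (norm (q x)) \<partial>lborel) < \<infinity>" .
qed measurable

text \<open>The pointwise bootstrap uses all moments of the kernel, and here the kernel is q itself.
  The moments come from the same gain in the mean: the weight of order k a splits over the
  convolution, so the weighted integral of order (k + 1) a is bounded by a constant times the square
  of that of order k a.\<close>

lemma ground_rapid:
  assumes a: "a > 1/3" and q2: "L2 (\<lambda>x. complex_of_real (1 + \<bar>x\<bar> powr a) * q x)" and ql: "L2 q"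
    and eq: "AE x in lborel. complex_of_real (1 + \<bar>x\<bar> powr a) * q x = conv q q x / (2 * pi)"
    and cont: "continuous_on UNIV q" and bdd: "\<And>x. cmod (q x) \<le> C0"
  shows "rapid q" "complex_of_real (1 + \<bar>x\<bar> powr a) * q x = conv q q x / (2 * pi)"
proof -
  have [measurable]: "q \<in> borel_measurable borel" using cont by (rule borel_measurable_continuous_onI)
  have a0: "a > 0" using a by simp
  have qi: "integrable lborel q" by (rule ground_integrable[OF a q2 eq]) measurable
  \<comment> \<open>Both sides are continuous, so the almost everywhere equation holds at every
    point.\<close>
  have eq': "(\<lambda>x. complex_of_real (1 + \<bar>x\<bar> powr a) * q x) = (\<lambda>x. conv q q x / (2 * pi))"
    by (intro continuous_AE_eq eq continuous_intros continuous_abs_powr a0 cont conv_continuous_bounded[OF cont bdd qi]) auto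
  then show "complex_of_real (1 + \<bar>x\<bar> powr a) * q x = conv q q x / (2 * pi)" by meson
  have ineq0: "(1 + \<bar>x\<bar>) powr a * cmod (q x) \<le> 2 powr a * cmod (conv q q x)" for x
  proof -
    have "(1 + \<bar>x\<bar>) powr a * cmod (q x) \<le> 2 powr a * (1 + \<bar>x\<bar> powr a) * cmod (q x)"
      by (intro mult_right_mono powr_weight_le a0) auto
    also have "\<dots> = 2 powr a * cmod (complex_of_real (1 + \<bar>x\<bar> powr a) * q x)"
      unfolding norm_mult norm_of_real by simp
    also have "\<dots> = 2 powr a * (cmod (conv q q x) / (2 * pi))"
      by (subst fun_cong[OF eq', of x]) (simp add: norm_divide norm_mult)
    also have "\<dots> \<le> 2 powr a * (cmod (conv q q x) / 1)"
      using pi_gt3 by (intro mult_left_mono divide_left_mono) auto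
    finally show ?thesis by simp
  qed
  have wfin: "(\<integral>\<^sup>+x. ennreal ((1 + \<bar>x\<bar>) powr (real k * a) * cmod (q x)) \<partial>lborel) < \<infinity>" for k
  proof (induction k)
    case 0
    have "(1 + \<bar>x\<bar>) powr (real 0 * a) = 1" for x :: real
      using abs_ge_zero[of x] by (auto simp: powr_def)
    then show ?case using qi by (simp add: integrable_iff_bounded)
  next
    case (Suc k)
    define w where "w x = (1 + \<bar>x\<bar>) powr (real k * a) * cmod (q x)" for x
    have [measurable]: "w \<in> borel_measurable borel" unfolding w_def[abs_def] by measurable
    have w0: "w x \<ge> 0" for x by (simp add: w_def)
    have ka: "0 \<le> real k * a" using a0 by simp
    have "(\<integral>\<^sup>+x. ennreal ((1 + \<bar>x\<bar>) powr (real (Suc k) * a) * cmod (q x)) \<partial>lborel)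
      \<le> (\<integral>\<^sup>+x. \<integral>\<^sup>+y. ennreal (2 powr a) * (ennreal (w y) * ennreal (w (x - y))) \<partial>lborel \<partial>lborel)"
    proof (rule nn_integral_mono)
      fix x
      have "(1 + \<bar>x\<bar>) powr (real (Suc k) * a) * cmod (q x) = (1 + \<bar>x\<bar>) powr (real k * a) * ((1 + \<bar>x\<bar>) powr a * cmod (q x))"
        by (simp add: powr_add distrib_right)
      also have "\<dots> \<le> (1 + \<bar>x\<bar>) powr (real k * a) * (2 powr a * cmod (conv q q x))" by (intro mult_left_mono ineq0) auto
      finally have "ennreal ((1 + \<bar>x\<bar>) powr (real (Suc k) * a) * cmod (q x)) \<le> ennreal ((1 + \<bar>x\<bar>) powr (real k * a) * 2 powr a) * ennreal (cmod (conv q q x))"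
        by (subst ennreal_mult[symmetric]) (auto simp: mult.assoc intro!: ennreal_leI)
      also have "\<dots> \<le> ennreal ((1 + \<bar>x\<bar>) powr (real k * a) * 2 powr a) * (\<integral>\<^sup>+y. ennreal (norm (q (x - y) * q y)) \<partial>lborel)"
        unfolding conv_def by (intro mult_left_mono norm_integral_le_nn_integral) auto
      also have "\<dots> = (\<integral>\<^sup>+y. ennreal ((1 + \<bar>x\<bar>) powr (real k * a) * 2 powr a * norm (q (x - y) * q y)) \<partial>lborel)"
        by (subst nn_integral_cmult[symmetric]) (auto simp: ennreal_mult)
      also have "\<dots> \<le> (\<integral>\<^sup>+y. ennreal (2 powr a) * (ennreal (w y) * ennreal (w (x - y))) \<partial>lborel)"
      proof (rule nn_integral_mono)
        fix y
        have "(1 + \<bar>x\<bar>) powr (real k * a) * 2 powr a * norm (q (x - y) * q y)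
          \<le> ((1 + \<bar>x - y\<bar>) powr (real k * a) * (1 + \<bar>y\<bar>) powr (real k * a)) * 2 powr a * norm (q (x - y) * q y)"
          by (intro mult_right_mono powr_weight_submult ka) auto
        also have "\<dots> = 2 powr a * (w y * w (x - y))" by (simp add: w_def norm_mult)
        finally show "ennreal ((1 + \<bar>x\<bar>) powr (real k * a) * 2 powr a * norm (q (x - y) * q y)) \<le> ennreal (2 powr a) * (ennreal (w y) * ennreal (w (x - y)))"
          using w0 by (simp add: ennreal_mult[symmetric] ennreal_leI)
      qed
      finally show "ennreal ((1 + \<bar>x\<bar>) powr (real (Suc k) * a) * cmod (q x)) \<le> \<dots>" .
    qed
    also have "\<dots> = ennreal (2 powr a) * (\<integral>\<^sup>+x. \<integral>\<^sup>+y. ennreal (w y) * ennreal (w (x - y)) \<partial>lborel \<partial>lborel)"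
      by (simp add: nn_integral_cmult)
    also have "\<dots> = ennreal (2 powr a) * (integral\<^sup>N lborel w * integral\<^sup>N lborel w)"
      by (subst nn_integral_conv_weight(2)[of "\<lambda>x. ennreal (w x)" "\<lambda>x. ennreal (w x)"]) auto
    also have "\<dots> < \<infinity>" using Suc by (simp add: ennreal_mult_less_top w_def)
    finally show ?case .
  qed
  show "rapid q"
  proof (rule rapid_of_conv_inequality[OF cont bdd a0])
    show "integrable lborel (\<lambda>y. (1 + \<bar>y\<bar>) ^ n * cmod (q y))" for n
    proof (rule integrableI_bounded)
      define k where "k = nat \<lceil>real n / a\<rceil>"
      have "real n / a \<le> real k" unfolding k_def by linarith
      then have nk: "real n \<le> real k * a" using a0 by (simp add: divide_le_eq)
      have "(\<integral>\<^sup>+x. ennreal (norm ((1 + \<bar>x\<bar>) ^ n * cmod (q x))) \<partial>lborel) \<le> (\<integral>\<^sup>+x. ennreal ((1 + \<bar>x\<bar>) powr (real k * a) * cmod (q x)) \<partial>lborel)"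
      proof (intro nn_integral_mono ennreal_leI)
        fix x :: real
        have "(1 + \<bar>x\<bar>) powr (real n) \<le> (1 + \<bar>x\<bar>) powr (real k * a)" by (intro powr_mono nk) auto
        then have "(1 + \<bar>x\<bar>) ^ n * cmod (q x) \<le> (1 + \<bar>x\<bar>) powr (real k * a) * cmod (q x)"
          by (intro mult_right_mono) (auto simp: powr_realpow)
        then show "norm ((1 + \<bar>x\<bar>) ^ n * cmod (q x)) \<le> (1 + \<bar>x\<bar>) powr (real k * a) * cmod (q x)" by (simp add: abs_mult)
      qed
      then show "(\<integral>\<^sup>+x. ennreal (norm ((1 + \<bar>x\<bar>) ^ n * cmod (q x))) \<partial>lborel) < \<infinity>" using wfin[of k] by (rule le_less_trans)
    qed measurable
    show "(1 + \<bar>x\<bar>) powr a * cmod (q x) \<le> 2 powr a * (LINT y|lborel. cmod (q (x - y)) * cmod (q y))" for x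
    proof (rule order_trans[OF ineq0])
      have "cmod (conv q q x) \<le> (LINT y|lborel. cmod (q (x - y) * q y))" unfolding conv_def by (rule integral_norm_bound)
      then show "2 powr a * cmod (conv q q x) \<le> 2 powr a * (LINT y|lborel. cmod (q (x - y)) * cmod (q y))"
        by (intro mult_left_mono) (auto simp: norm_mult)
    qed
  qed auto
qed

section \<open>Second variation of the Weinstein functional\<close>

lemma fourier_uminus: "fourier (\<lambda>x. f (- x)) \<xi> = fourier f (- \<xi>)"
  unfolding fourier_def using lborel_integral_uminus[of "\<lambda>x. f x * cis (- (x * - \<xi>))"] by simp

lemma fourier_conv:
  assumes f: "integrable lborel f" and g: "integrable lborel g"
  shows "fourier (conv f g) \<xi> = fourier f \<xi> * fourier g \<xi>"
proof -
  have [measurable]: "f \<in> borel_measurable borel" "g \<in> borel_measurable borel" using f g by auto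
  have i: "integrable (lborel \<Otimes>\<^sub>M lborel) (\<lambda>(x, y). f (x - y) * g y * cis (- (x * \<xi>)))"
  proof (rule integrableI_bounded)
    have "(\<integral>\<^sup>+p. ennreal (norm (case p of (x, y) \<Rightarrow> f (x - y) * g y * cis (- (x * \<xi>)))) \<partial>(lborel \<Otimes>\<^sub>M lborel))
      = (\<integral>\<^sup>+x. \<integral>\<^sup>+y. ennreal (cmod (g y)) * ennreal (cmod (f (x - y))) \<partial>lborel \<partial>lborel)"
      by (subst lborel.nn_integral_fst[symmetric]) (auto simp: norm_mult ennreal_mult mult.commute)
    also have "\<dots> = (\<integral>\<^sup>+x. ennreal (cmod (g x)) \<partial>lborel) * (\<integral>\<^sup>+x. ennreal (cmod (f x)) \<partial>lborel)"
      by (rule nn_integral_conv_weight(2)[of "\<lambda>x. ennreal (cmod (g x))" "\<lambda>x. ennreal (cmod (f x))"]) measurable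
    also have "\<dots> < \<infinity>" using f g by (simp add: integrable_iff_bounded ennreal_mult_less_top)
    finally show "(\<integral>\<^sup>+p. ennreal (norm (case p of (x, y) \<Rightarrow> f (x - y) * g y * cis (- (x * \<xi>)))) \<partial>(lborel \<Otimes>\<^sub>M lborel)) < \<infinity>" .
  qed measurable
  have "fourier (conv f g) \<xi> = (LINT x|lborel. LINT y|lborel. f (x - y) * g y * cis (- (x * \<xi>)))"
    unfolding fourier_def conv_def by simp
  also have "\<dots> = (LINT y|lborel. LINT x|lborel. f (x - y) * g y * cis (- (x * \<xi>)))"
    by (rule lborel_pair.Fubini_integral[symmetric, OF i])
  also have "\<dots> = (LINT y|lborel. fourier f \<xi> * (g y * cis (- (y * \<xi>))))"
  proof (rule Bochner_Integration.integral_cong[OF refl])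
    fix y
    have "(LINT x|lborel. f (x - y) * g y * cis (- (x * \<xi>))) = (LINT x|lborel. f x * g y * cis (- ((y + x) * \<xi>)))"
      using lborel_integral_real_affine[of 1 "\<lambda>x. f (x - y) * g y * cis (- (x * \<xi>))" y] by simp
    also have "\<dots> = (LINT x|lborel. (f x * cis (- (x * \<xi>))) * (g y * cis (- (y * \<xi>))))"
    proof (rule Bochner_Integration.integral_cong[OF refl])
      fix x
      have "cis (- ((y + x) * \<xi>)) = cis (- (x * \<xi>)) * cis (- (y * \<xi>))" by (simp add: cis_mult algebra_simps)
      then show "f x * g y * cis (- ((y + x) * \<xi>)) = (f x * cis (- (x * \<xi>))) * (g y * cis (- (y * \<xi>)))" by simp
    qed
    finally show "(LINT x|lborel. f (x - y) * g y * cis (- (x * \<xi>))) = fourier f \<xi> * (g y * cis (- (y * \<xi>)))"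
      by (simp add: fourier_def)
  qed
  also have "\<dots> = fourier f \<xi> * fourier g \<xi>" by (simp add: fourier_def)
  finally show ?thesis .
qed

lemma inv_fourier_mult:
  assumes f: "integrable lborel f" and g: "integrable lborel g"
  shows "inv_fourier f x * inv_fourier g x = inv_fourier (conv f g) x / (2 * pi)"
  by (simp add: inv_fourier_def fourier_conv[OF f g])

lemma inv_fourier_add:
  assumes "integrable lborel f" "integrable lborel g"
  shows "inv_fourier (\<lambda>x. f x + c * g x) x = inv_fourier f x + c * inv_fourier g x"
  using integrable_fourier_kernel[OF assms(1), of "- x"] integrable_fourier_kernel[OF assms(2), of "- x"]
  by (simp add: inv_fourier_def fourier_def distrib_right add_divide_distrib mult.assoc)

lemma inv_fourier_parseval:
  assumes f: "rapid f" and g: "rapid g"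
  shows "(LINT x|lborel. inv_fourier f x * inv_fourier g x) = (LINT \<xi>|lborel. f \<xi> * g (- \<xi>)) / (2 * pi)"
proof -
  have g': "rapid (\<lambda>x. g (- x))" using rapid_dilate[OF g, of "-1"] by simp
  obtain C where C: "\<And>x. cmod (g (- x)) \<le> C" using rapid_bounded[OF g'] by blast
  have "(LINT x|lborel. inv_fourier f x * inv_fourier g x) = (LINT x|lborel. fourier f (- x) * fourier g (- x)) / (2 * pi)\<^sup>2"
    by (simp add: inv_fourier_def power2_eq_square)
  also have "(LINT x|lborel. fourier f (- x) * fourier g (- x)) = (LINT x|lborel. fourier f x * fourier (\<lambda>x. g (- x)) (- x))"
    using lborel_integral_uminus[of "\<lambda>x. fourier f x * fourier g x"] by (simp add: fourier_uminus)
  also have "\<dots> = 2 * pi * (LINT x|lborel. f x * g (- x))"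
    by (rule parseval_continuous[OF rapid_integrable[OF f] rapid_L2[OF f] rapid_integrable[OF g'] rapid_L2[OF g'] rapid_continuous[OF g'] C])
  finally show ?thesis by (simp add: power2_eq_square)
qed

lemma inv_fourier_plancherel:
  assumes f: "rapid f"
  shows "(LINT x|lborel. (cmod (inv_fourier f x))\<^sup>2) = (LINT \<xi>|lborel. (cmod (f \<xi>))\<^sup>2) / (2 * pi)"
proof -
  obtain C where C: "\<And>x. cmod (f x) \<le> C" using rapid_bounded[OF f] by blast
  have "(LINT x|lborel. (cmod (inv_fourier f x))\<^sup>2) = (LINT x|lborel. (cmod (fourier f (- x)))\<^sup>2 / (2 * pi)\<^sup>2)"
    by (simp add: inv_fourier_def norm_divide power_divide norm_mult)
  also have "\<dots> = (LINT x|lborel. (cmod (fourier f x))\<^sup>2) / (2 * pi)\<^sup>2"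
    using lborel_integral_uminus[of "\<lambda>x. (cmod (fourier f x))\<^sup>2 / (2 * pi)\<^sup>2"] by simp
  also have "\<dots> = 2 * pi * (LINT x|lborel. (cmod (f x))\<^sup>2) / (2 * pi)\<^sup>2"
    by (simp only: plancherel_continuous[OF rapid_integrable[OF f] rapid_L2[OF f] rapid_continuous[OF f] C])
  finally show ?thesis by (simp add: power2_eq_square)
qed

lemma inv_fourier_bounded:
  assumes f: "integrable lborel f" shows "cmod (inv_fourier f x) \<le> (LINT x|lborel. cmod (f x)) / (2 * pi)"
  using norm_fourier_le[OF f, of "- x"] by (simp add: inv_fourier_def norm_divide norm_mult divide_right_mono)

lemma inv_fourier_continuous:
  assumes f: "integrable lborel f" shows "continuous_on UNIV (inv_fourier f)"
proof -
  have "continuous_on UNIV (\<lambda>x. fourier f (- x) / (2 * pi))"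
    by (intro continuous_intros continuous_on_compose2[OF continuous_fourier[OF f]]) auto
  then show ?thesis by (simp add: inv_fourier_def[abs_def])
qed

definition hermitian :: "(real \<Rightarrow> complex) \<Rightarrow> bool" where
  "hermitian V \<longleftrightarrow> (\<forall>x. V (- x) = cnj (V x))"

lemma inv_fourier_real:
  assumes "hermitian V" shows "inv_fourier V x = complex_of_real (Re (inv_fourier V x))"
proof -
  have "V = (\<lambda>x. cnj (V (- x)))" using assms by (auto simp: hermitian_def)
  then have "fourier V (- x) = fourier (\<lambda>x. cnj (V (- x))) (- x)" by simp
  also have "\<dots> = cnj (fourier V (- x))" by (simp add: fourier_cnj fourier_uminus)
  finally have "cnj (inv_fourier V x) = inv_fourier V x" by (simp add: inv_fourier_def)
  then show ?thesis by (simp add: complex_eq_iff)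
qed

lemma inv_fourier_Re:
  assumes V: "rapid V" "hermitian V"
  shows "sqint (\<lambda>x. Re (inv_fourier V x))" "(\<lambda>x. Re (inv_fourier V x)) \<in> borel_measurable borel"
    "\<bar>Re (inv_fourier V x)\<bar> \<le> (LINT x|lborel. cmod (V x)) / (2 * pi)"
proof -
  have "L2 (inv_fourier V)" by (intro inv_fourier_le rapid_integrable rapid_L2 V)
  then show s: "sqint (\<lambda>x. Re (inv_fourier V x))" unfolding sqint_iff_L2 inv_fourier_real[OF V(2), symmetric] .
  then show "(\<lambda>x. Re (inv_fourier V x)) \<in> borel_measurable borel" by (simp add: sqint_def)
  show "\<bar>Re (inv_fourier V x)\<bar> \<le> (LINT x|lborel. cmod (V x)) / (2 * pi)"
    using inv_fourier_bounded[OF rapid_integrable[OF V(1)], of x] abs_Re_le_cmod order_trans by blast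
qed

lemma sqint_mult3:
  assumes f: "sqint f" and g: "sqint g" and h: "h \<in> borel_measurable borel" "\<And>x. \<bar>h x\<bar> \<le> C"
  shows "integrable lborel (\<lambda>x. f x * g x * h x)"
proof -
  have "sqint (\<lambda>x. g x * h x)"
  proof (rule sqint_bound[OF g, where C = C])
    show "(\<lambda>x. g x * h x) \<in> borel_measurable borel" using g h(1) by (auto simp: sqint_def)
    show "\<bar>g x * h x\<bar> \<le> C * \<bar>g x\<bar>" for x using mult_left_mono[OF h(2)[of x], of "\<bar>g x\<bar>"] by (simp add: abs_mult mult.commute)
  qed
  from sqint_mult[OF f this] show ?thesis by (simp add: mult.assoc)
qed

lemma Dpow_rapid:
  assumes V: "rapid V" and b: "b > 0" shows "rapid (\<lambda>\<xi>. Dpow_sym b \<xi> * V \<xi>)"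
proof (rule rapid_mult[OF V, where K = 1 and m = "nat \<lceil>b\<rceil>"])
  show "continuous_on UNIV (Dpow_sym b)"
    unfolding Dpow_sym_def by (intro continuous_intros continuous_abs_powr b)
  fix x
  have "cmod (Dpow_sym b x) = \<bar>x\<bar> powr b" by (simp add: Dpow_sym_def)
  also have "\<dots> \<le> (1 + \<bar>x\<bar>) powr b" using b by (intro powr_mono2) auto
  also have "\<dots> \<le> (1 + \<bar>x\<bar>) powr (real (nat \<lceil>b\<rceil>))" by (intro powr_mono) (linarith, simp)
  also have "\<dots> = (1 + \<bar>x\<bar>) ^ nat \<lceil>b\<rceil>" by (rule powr_realpow) simp
  finally show "cmod (Dpow_sym b x) \<le> 1 * (1 + \<bar>x\<bar>) ^ nat \<lceil>b\<rceil>" by simp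
qed

lemma is_FT_rapid: "rapid V \<Longrightarrow> is_FT (inv_fourier V) V"
  by (intro is_FT_inv_fourier rapid_integrable rapid_L2)

lemma Hsob_rapid:
  assumes V: "rapid V" shows "Hsob s (inv_fourier V)"
  unfolding Hsob_def
proof (intro exI conjI)
  show "is_FT (inv_fourier V) V" by (rule is_FT_rapid[OF V])
  define m where "m = nat \<lceil>\<bar>s\<bar>\<rceil>"
  have "rapid (\<lambda>\<xi>. complex_of_real ((1 + \<xi>\<^sup>2) powr (s / 2)) * V \<xi>)"
  proof (rule rapid_mult[OF V, where K = 1 and m = m])
    have p: "1 + x\<^sup>2 > 0" for x :: real by (simp add: add_pos_nonneg)
    show "continuous_on UNIV (\<lambda>\<xi>. complex_of_real ((1 + \<xi>\<^sup>2) powr (s / 2)))"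
      by (intro continuous_intros) (use p in \<open>auto simp: less_imp_neq[symmetric]\<close>)
    fix x
    have "cmod (complex_of_real ((1 + x\<^sup>2) powr (s / 2))) = (1 + x\<^sup>2) powr (s / 2)" unfolding norm_of_real by simp
    also have "\<dots> \<le> (1 + x\<^sup>2) powr (\<bar>s\<bar> / 2)" by (intro powr_mono) auto
    also have "\<dots> \<le> ((1 + \<bar>x\<bar>) powr 2) powr (\<bar>s\<bar> / 2)"
    proof (intro powr_mono2)
      have "(1 + \<bar>x\<bar>) powr 2 = (1 + \<bar>x\<bar>)\<^sup>2" by (rule powr_numeral) simp
      then show "1 + x\<^sup>2 \<le> (1 + \<bar>x\<bar>) powr 2" by (simp add: power2_sum)
    qed auto
    also have "\<dots> = (1 + \<bar>x\<bar>) powr \<bar>s\<bar>" by (simp only: powr_powr) simp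
    also have "\<dots> \<le> (1 + \<bar>x\<bar>) powr (real m)" unfolding m_def by (intro powr_mono) (linarith, simp)
    also have "\<dots> = (1 + \<bar>x\<bar>) ^ m" by (rule powr_realpow) simp
    finally show "cmod (complex_of_real ((1 + x\<^sup>2) powr (s / 2))) \<le> 1 * (1 + \<bar>x\<bar>) ^ m" by simp
  qed
  then show "L2 (\<lambda>\<xi>. complex_of_real ((1 + \<xi>\<^sup>2) powr (s / 2)) * V \<xi>)" by (rule rapid_L2)
qed

text \<open>The functional picks some version of the derivative of order a / 2. By uniqueness of
  weak transforms every admissible choice agrees almost everywhere with the explicit inverse
  transform, so the value does not depend on it and Plancherel applies.\<close>

lemma weinstein_rapid:
  assumes V: "rapid V" and u: "cplx u = inv_fourier V" and a: "a > 0"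
  shows "weinstein a u = inverse (LINT x|lborel. \<bar>u x\<bar> ^ 3)
    * ((LINT \<xi>|lborel. \<bar>\<xi>\<bar> powr a * (cmod (V \<xi>))\<^sup>2) / (2 * pi)) powr (1 / (2 * a))
    * ((LINT \<xi>|lborel. (cmod (V \<xi>))\<^sup>2) / (2 * pi)) powr ((3 * a - 1) / (2 * a))"
proof -
  let ?D = "\<lambda>\<xi>. Dpow_sym (a / 2) \<xi> * V \<xi>"
  have D: "rapid ?D" using a by (intro Dpow_rapid V) simp
  define v where "v = (SOME v. mult_op (Dpow_sym (a / 2)) (cplx u) v)"
  have "mult_op (Dpow_sym (a / 2)) (cplx u) (inv_fourier ?D)"
    unfolding mult_op_def u using is_FT_rapid[OF V] is_FT_rapid[OF D] by blast
  then have "mult_op (Dpow_sym (a / 2)) (cplx u) v" unfolding v_def by (rule someI[where P = "mult_op (Dpow_sym (a / 2)) (cplx u)"])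
  then obtain U where U: "is_FT (cplx u) U" "is_FT v (\<lambda>\<xi>. Dpow_sym (a / 2) \<xi> * U \<xi>)" unfolding mult_op_def by blast
  have "AE \<xi> in lborel. U \<xi> = V \<xi>" by (rule is_FT_unique_right[OF U(1)]) (simp add: u is_FT_rapid[OF V])
  then have ae: "AE \<xi> in lborel. Dpow_sym (a / 2) \<xi> * U \<xi> = ?D \<xi>" by eventually_elim simp
  have "is_FT v ?D"
    by (rule is_FT_AE_cong[OF U(2) _ ae]) (use L2_D(1)[OF is_FT_D(1)[OF U(2)]] rapid_borel[OF D] in auto)
  from is_FT_unique_left[OF this is_FT_rapid[OF D]] have vae: "AE x in lborel. v x = inv_fourier ?D x" .
  have m: "v \<in> borel_measurable borel" "inv_fourier ?D \<in> borel_measurable borel"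
    using L2_D(1)[OF is_FT_D(1)[OF U(2)]] L2_D(1)[OF is_FT_D(1)[OF is_FT_rapid[OF D]]] by auto
  have "(LINT x|lborel. (cmod (v x))\<^sup>2) = (LINT x|lborel. (cmod (inv_fourier ?D x))\<^sup>2)"
    by (rule integral_cong_AE) (use vae m in auto)
  also have "\<dots> = (LINT \<xi>|lborel. (cmod (?D \<xi>))\<^sup>2) / (2 * pi)" by (rule inv_fourier_plancherel[OF D])
  also have "(\<lambda>\<xi>. (cmod (?D \<xi>))\<^sup>2) = (\<lambda>\<xi>. \<bar>\<xi>\<bar> powr a * (cmod (V \<xi>))\<^sup>2)"
  proof
    fix \<xi> :: real
    have "(\<bar>\<xi>\<bar> powr (a / 2))\<^sup>2 = \<bar>\<xi>\<bar> powr a" by (simp add: power2_eq_square powr_add[symmetric])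
    then show "(cmod (?D \<xi>))\<^sup>2 = \<bar>\<xi>\<bar> powr a * (cmod (V \<xi>))\<^sup>2" by (simp add: Dpow_sym_def norm_mult power_mult_distrib)
  qed
  finally have 1: "(LINT x|lborel. (cmod (v x))\<^sup>2) = (LINT \<xi>|lborel. \<bar>\<xi>\<bar> powr a * (cmod (V \<xi>))\<^sup>2) / (2 * pi)" .
  have "(LINT x|lborel. (u x)\<^sup>2) = (LINT x|lborel. (cmod (inv_fourier V x))\<^sup>2)"
    unfolding u[symmetric] by (simp add: cplx_def)
  then have 2: "(LINT x|lborel. (u x)\<^sup>2) = (LINT \<xi>|lborel. (cmod (V \<xi>))\<^sup>2) / (2 * pi)"
    by (simp only: inv_fourier_plancherel[OF V])
  show ?thesis unfolding weinstein_def v_def[symmetric] 1 2 by simp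
qed

text \<open>Both sides equal 1 at t = 0. Their difference is minimal there, which matches the linear
  coefficients; when these vanish, division by t^2 and t tending to 0 from the right compares the
  quadratic ones. Both variations of a functional can thus be read off from an inequality along a
  line, without differentiating the functional.\<close>

lemma exp_quadratic_comparison:
  fixes p1 p2 p3 b d :: real
  assumes le: "\<And>t. 1 + t * p1 + t\<^sup>2 * p2 + t ^ 3 * p3 \<le> exp (t * b + t\<^sup>2 * d)"
  shows "p1 = b" "b = 0 \<Longrightarrow> p2 \<le> d"
proof -
  let ?F = "\<lambda>t. exp (t * b + t\<^sup>2 * d) - (1 + t * p1 + t\<^sup>2 * p2 + t ^ 3 * p3)"
  have "(?F has_real_derivative (b - p1)) (at 0)" by (auto intro!: derivative_eq_intros)
  moreover have "?F 0 \<le> ?F y" for y using le[of y] by simp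
  ultimately have "b - p1 = 0" by (intro DERIV_local_min[of ?F "b - p1" 0 1]) auto
  then show "p1 = b" by simp
  then show "p2 \<le> d" if b: "b = 0"
  proof -
    have "((\<lambda>s. (exp (s * d) - 1) / s) \<longlongrightarrow> d) (at 0)"
    proof -
      have "((\<lambda>s. exp (s * d)) has_real_derivative d) (at 0)" by (auto intro!: derivative_eq_intros)
      then show ?thesis by (simp add: has_field_derivative_iff)
    qed
    moreover have "filterlim (\<lambda>t :: real. t\<^sup>2) (at 0) (at_right 0)"
      unfolding filterlim_at
    proof
      show "((\<lambda>t :: real. t\<^sup>2) \<longlongrightarrow> 0) (at_right 0)" by (rule tendsto_eq_intros tendsto_ident_at | simp)+
      show "\<forall>\<^sub>F t in at_right 0. t\<^sup>2 \<in> UNIV \<and> t\<^sup>2 \<noteq> (0 :: real)"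
        by (auto simp: eventually_at_right_field intro!: exI[of _ 1])
    qed
    ultimately have lim1: "((\<lambda>t. (exp (t\<^sup>2 * d) - 1) / t\<^sup>2) \<longlongrightarrow> d) (at_right 0)" by (rule filterlim_compose)
    have lim2: "((\<lambda>t. p2 + t * p3) \<longlongrightarrow> p2 + 0 * p3) (at_right 0)" by (intro tendsto_intros)
    have "\<forall>\<^sub>F t in at_right 0. p2 + t * p3 \<le> (exp (t\<^sup>2 * d) - 1) / t\<^sup>2"
      unfolding eventually_at_right_field
    proof (intro exI[of _ 1] conjI allI impI)
      fix t :: real assume t: "0 < t" "t < 1"
      have "t\<^sup>2 * (p2 + t * p3) \<le> exp (t\<^sup>2 * d) - 1"
        using le[of t] b \<open>p1 = b\<close> by (simp add: algebra_simps power2_eq_square power3_eq_cube)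
      then show "p2 + t * p3 \<le> (exp (t\<^sup>2 * d) - 1) / t\<^sup>2" using t by (simp add: pos_le_divide_eq mult.commute)
    qed simp
    from tendsto_le[OF _ lim1 lim2 this] show ?thesis by simp
  qed
qed

text \<open>Comparison of the logarithm with its tangent at 1. It replaces the powers in the
  functional by exponentials that agree to first order at r = 1 and otherwise only enlarge the upper
  bound.\<close>

lemma powr_le_exp: "r \<ge> 0 \<Longrightarrow> c \<ge> 0 \<Longrightarrow> r powr c \<le> exp (c * (r - 1 :: real))"
proof (cases "r = 0")
  case False
  assume "r \<ge> 0" "c \<ge> 0"
  then have "c * ln r \<le> c * (r - 1)" using False by (intro mult_left_mono ln_le_minus_one) auto
  then show ?thesis using False by (simp add: powr_def)
qed simp


section \<open>The ground state on the Fourier side\<close>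

lemma fourier_even: "(\<And>x. f (- x) = f x) \<Longrightarrow> fourier f (- \<xi>) = fourier f \<xi>"
  using fourier_uminus[of f \<xi>] by simp

lemma fourier_real_even:
  assumes "\<And>x. f (- x) = (f x :: real)"
  shows "fourier (\<lambda>x. complex_of_real (f x)) \<xi> = complex_of_real (Re (fourier (\<lambda>x. complex_of_real (f x)) \<xi>))"
proof -
  have "cnj (fourier (\<lambda>x. complex_of_real (f x)) \<xi>) = fourier (\<lambda>x. complex_of_real (f x)) \<xi>"
    using fourier_cnj[of "\<lambda>x. complex_of_real (f x)" \<xi>] fourier_even[of "\<lambda>x. complex_of_real (f x)" \<xi>] assms by simp
  then show ?thesis by (simp add: complex_eq_iff)
qed

text \<open>With q the transform of Q, the equation of the ground state has become a pointwise
  convolution equation for a real even function. At x = 0 this equation identifies q 0 with the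
  integral of Q^2, which is the source of \<open>q_0\<close>.\<close>

locale ground_wave =
  fixes a :: real and Q q :: "real \<Rightarrow> real"
  assumes a: "a > 1/3"
    and q_rapid: "rapid (cplx q)"
    and q_even: "\<And>x. q (- x) = q x"
    and Q_inv: "cplx Q = inv_fourier (cplx q)"
    and Q_pos: "\<And>x. 0 < Q x"
    and q_eq: "\<And>x. complex_of_real ((1 + \<bar>x\<bar> powr a) * q x) = conv (cplx q) (cplx q) x / (2 * pi)"
    and q_0: "q 0 \<noteq> 0"
    and minimal: "\<And>u. Hsob (a / 2) (cplx u) \<Longrightarrow> \<not> (AE x in lborel. u x = 0) \<Longrightarrow> weinstein a Q \<le> weinstein a u"

lemma ground_state_wave:
  assumes a: "1/3 < a" and gs: "ground_state a Q"
  shows "\<exists>q. ground_wave a Q q"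
proof -
  let ?Q = "cplx Q"
  have even: "Q (- x) = Q x" and pos: "0 < Q x" for x using gs by (auto simp: ground_state_def)
  have Qc: "continuous_on UNIV ?Q" using gs by (auto simp: ground_state_def cplx_def[abs_def] intro!: continuous_intros)
  obtain v where v: "mult_op (Dpow_sym a) ?Q v" "AE x in lborel. v x + ?Q x - (?Q x)\<^sup>2 = 0"
    using gs unfolding ground_state_def by blast
  then obtain U where U: "is_FT ?Q U" "is_FT v (\<lambda>\<xi>. Dpow_sym a \<xi> * U \<xi>)" unfolding mult_op_def by blast
  have Qb[measurable]: "?Q \<in> borel_measurable borel" and Ub[measurable]: "U \<in> borel_measurable borel"
    using is_FT_D(1,2)[OF U(1)] by (auto dest: L2_D)
  have Q2: "integrable lborel (\<lambda>x. ?Q x * ?Q x)" using L2_mult_integrable is_FT_D(1)[OF U(1)] by blast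
  have D[measurable]: "Dpow_sym a \<in> borel_measurable borel" unfolding Dpow_sym_def[abs_def] by measurable
  define F where "F = fourier (\<lambda>x. ?Q x * ?Q x)"
  have Fc: "continuous_on UNIV F" unfolding F_def by (rule continuous_fourier[OF Q2])
  have W: "is_FT (\<lambda>x. ?Q x * ?Q x) (\<lambda>\<xi>. complex_of_real (1 + \<bar>\<xi>\<bar> powr a) * U \<xi>)"
  proof (rule is_FT_AE_cong[OF is_FT_add_scale[OF U(2) U(1), of 1]])
    show "AE x in lborel. v x + 1 * ?Q x = ?Q x * ?Q x" using v(2) by eventually_elim (simp add: power2_eq_square)
    show "AE x in lborel. Dpow_sym a x * U x + 1 * U x = complex_of_real (1 + \<bar>x\<bar> powr a) * U x"
      by (simp add: Dpow_sym_def algebra_simps)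
  qed measurable
  have UF: "AE \<xi> in lborel. complex_of_real (1 + \<bar>\<xi>\<bar> powr a) * U \<xi> = F \<xi>"
    unfolding F_def by (rule is_FT_eq_fourier[OF W Q2])
  \<comment> \<open>Dividing the transform of the integrable function Q^2 by the symbol gives a
    continuous version of the weak transform U of Q. The real part loses nothing, since Q is real
    and even.\<close>
  define q where "q \<xi> = Re (F \<xi>) / (1 + \<bar>\<xi>\<bar> powr a)" for \<xi>
  have pp: "1 + \<bar>\<xi>\<bar> powr a > 0" for \<xi> by (simp add: add_pos_nonneg)
  have Freal: "F \<xi> = complex_of_real (Re (F \<xi>))" for \<xi>
    using fourier_real_even[of "\<lambda>x. Q x * Q x" \<xi>] even by (simp add: F_def cplx_def)
  have qF: "complex_of_real (1 + \<bar>\<xi>\<bar> powr a) * cplx q \<xi> = F \<xi>" for \<xi>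
  proof -
    have "(1 + \<bar>\<xi>\<bar> powr a) * q \<xi> = Re (F \<xi>)" using pp[of \<xi>] by (simp add: q_def)
    then have "complex_of_real ((1 + \<bar>\<xi>\<bar> powr a) * q \<xi>) = F \<xi>" using Freal[of \<xi>] by simp
    then show ?thesis by (simp add: cplx_def)
  qed
  have Uq: "AE \<xi> in lborel. U \<xi> = cplx q \<xi>"
    using UF
  proof eventually_elim
    case (elim \<xi>)
    then have "complex_of_real (1 + \<bar>\<xi>\<bar> powr a) * U \<xi> = complex_of_real (1 + \<bar>\<xi>\<bar> powr a) * cplx q \<xi>" by (simp only: qF)
    then show ?case using pp[of \<xi>] by (metis mult_cancel_left of_real_eq_0_iff less_irrefl)
  qed
  have qcont: "continuous_on UNIV (cplx q)"
  proof -
    have "continuous_on UNIV q" unfolding q_def[abs_def]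
      using a pp by (intro continuous_intros Fc continuous_abs_powr) (auto simp: less_imp_neq[symmetric])
    then show ?thesis unfolding cplx_def[abs_def] by (intro continuous_intros)
  qed
  then have qb[measurable]: "cplx q \<in> borel_measurable borel" by (rule borel_measurable_continuous_onI)
  have Fq: "is_FT ?Q (cplx q)" by (rule is_FT_AE_cong[OF U(1) _ Uq]) auto
  have bound: "cmod (cplx q \<xi>) \<le> (LINT x|lborel. cmod (?Q x * ?Q x))" for \<xi>
  proof -
    have "cmod (cplx q \<xi>) \<le> (1 + \<bar>\<xi>\<bar> powr a) * cmod (cplx q \<xi>)" by (simp add: mult_le_cancel_right1 distrib_right)
    also have "\<dots> = cmod (F \<xi>)" using pp[of \<xi>] unfolding qF[symmetric] norm_mult norm_of_real by simp
    also have "\<dots> \<le> (LINT x|lborel. cmod (?Q x * ?Q x))" unfolding F_def by (rule norm_fourier_le[OF Q2])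
    finally show ?thesis .
  qed
  have eq: "AE \<xi> in lborel. complex_of_real (1 + \<bar>\<xi>\<bar> powr a) * cplx q \<xi> = conv (cplx q) (cplx q) \<xi> / (2 * pi)"
    using fourier_square_eq_conv[OF Fq] unfolding qF F_def .
  have w2: "L2 (\<lambda>\<xi>. complex_of_real (1 + \<bar>\<xi>\<bar> powr a) * cplx q \<xi>)"
    by (rule L2_AE_cong[OF is_FT_D(2)[OF W]]) (use Uq in \<open>auto elim: AE_mp\<close>)
  note R = ground_rapid[OF a w2 is_FT_D(2)[OF Fq] eq qcont bound]
  have "?Q = inv_fourier (cplx q)"
    by (rule continuous_AE_eq[OF Qc inv_fourier_continuous[OF rapid_integrable[OF R(1)]]
      is_FT_unique_left[OF Fq is_FT_rapid[OF R(1)]]])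
  moreover have "q 0 \<noteq> 0"
  proof
    assume "q 0 = 0"
    then have "F 0 = 0" using qF[of 0] by (simp add: cplx_def)
    then have "complex_of_real (LINT x|lborel. Q x * Q x) = 0"
      by (simp add: F_def fourier_def cplx_def flip: integral_complex_of_real)
    then have "(LINT x|lborel. Q x * Q x) = 0" by simp
    moreover have "integrable lborel (\<lambda>x. Q x * Q x)"
      using Q2 by (simp add: cplx_def complex_of_real_integrable_eq flip: of_real_mult)
    ultimately have "AE x in lborel. Q x * Q x = 0" by (subst (asm) integral_nonneg_eq_0_iff_AE) auto
    then have "AE x in (lborel :: real measure). False"
    proof eventually_elim
      case (elim x) then show False using pos[of x] by simp
    qed
    then have "emeasure lborel (UNIV :: real set) = 0" by (subst (asm) AE_iff_measurable[where N = UNIV]) auto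
    then show False by simp
  qed
  moreover have "q (- x) = q x" for x
    using fourier_even[of "\<lambda>x. ?Q x * ?Q x" x] even by (simp add: q_def F_def cplx_def)
  ultimately have "ground_wave a Q q"
  proof (unfold_locales, goal_cases)
    case (6 x)
    show ?case using R(2)[of x] by (simp add: cplx_def[of q x])
  next
    case (8 u)
    then show ?case using gs unfolding ground_state_def by blast
  qed (use a pos R(1) in auto)
  then show ?thesis by blast
qed


section \<open>The Weinstein functional along lines through the ground state\<close>

lemma quadratic_integral:
  fixes w :: "real \<Rightarrow> real" and f g :: "real \<Rightarrow> complex"
  assumes "integrable lborel (\<lambda>x. w x * (cmod (f x))\<^sup>2)" "integrable lborel (\<lambda>x. w x * Re (f x * cnj (g x)))"
    "integrable lborel (\<lambda>x. w x * (cmod (g x))\<^sup>2)"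
  shows "(LINT x|lborel. w x * (cmod (f x + complex_of_real t * g x))\<^sup>2)
    = (LINT x|lborel. w x * (cmod (f x))\<^sup>2) + 2 * t * (LINT x|lborel. w x * Re (f x * cnj (g x))) + t\<^sup>2 * (LINT x|lborel. w x * (cmod (g x))\<^sup>2)"
proof -
  have "w x * (cmod (f x + complex_of_real t * g x))\<^sup>2
    = w x * (cmod (f x))\<^sup>2 + (2 * t) * (w x * Re (f x * cnj (g x))) + t\<^sup>2 * (w x * (cmod (g x))\<^sup>2)" for x
    unfolding cmod_power2 by (simp add: power2_eq_square algebra_simps)
  then show ?thesis using assms by simp
qed

lemma rapid_form_integrable:
  assumes f: "rapid f" and g: "rapid g"
  shows "integrable lborel (\<lambda>x. Re (f x * cnj (g x)))" "integrable lborel (\<lambda>x. (cmod (f x))\<^sup>2)"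
    "b > 0 \<Longrightarrow> integrable lborel (\<lambda>x. \<bar>x\<bar> powr b * Re (f x * cnj (g x)))"
    "b > 0 \<Longrightarrow> integrable lborel (\<lambda>x. \<bar>x\<bar> powr b * (cmod (f x))\<^sup>2)"
proof -
  have *: "integrable lborel (\<lambda>x. Re (f x * cnj (g x)))" if "rapid f" for f
    by (intro integrable_Re L2_mult_integrable rapid_L2 that L2_cnj g)
  show "integrable lborel (\<lambda>x. Re (f x * cnj (g x)))" by (rule *[OF f])
  have eq: "\<bar>x\<bar> powr b * Re (f x * cnj (h x)) = Re (Dpow_sym b x * f x * cnj (h x))" for x h
    by (simp add: Dpow_sym_def algebra_simps)
  show "integrable lborel (\<lambda>x. \<bar>x\<bar> powr b * Re (f x * cnj (g x)))" if "b > 0"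
    unfolding eq by (rule *[OF Dpow_rapid[OF f that]])
  show "integrable lborel (\<lambda>x. (cmod (f x))\<^sup>2)" using rapid_L2[OF f] by (rule L2_D)
  have eq2: "\<bar>x\<bar> powr b * (cmod (f x))\<^sup>2 = Re (Dpow_sym b x * f x * cnj (f x))" for x
    unfolding eq[symmetric] complex_norm_square[symmetric] by simp
  then show "integrable lborel (\<lambda>x. \<bar>x\<bar> powr b * (cmod (f x))\<^sup>2)" if "b > 0"
    unfolding eq2 by (intro integrable_Re L2_mult_integrable[OF rapid_L2[OF Dpow_rapid[OF f that]] L2_cnj[OF rapid_L2[OF f]]])
qed

lemma (in ground_wave) a_pos: "a > 0" using a by simp

lemma (in ground_wave) q_hermitian: "hermitian (cplx q)"
  by (simp add: hermitian_def cplx_def q_even)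

lemma (in ground_wave) q_continuous: "continuous_on UNIV q"
proof -
  have "continuous_on UNIV (\<lambda>x. Re (cplx q x))" by (intro continuous_intros rapid_continuous[OF q_rapid])
  then show ?thesis by (simp add: cplx_def)
qed

lemma (in ground_wave) q_nonzero_near_0: obtains e where "e > 0" "\<And>x. \<bar>x\<bar> < e \<Longrightarrow> q x \<noteq> 0"
proof -
  have "open {x. q x \<noteq> 0}" by (intro open_Collect_neq q_continuous continuous_intros)
  then obtain e where "e > 0" "ball 0 e \<subseteq> {x. q x \<noteq> 0}" using q_0 unfolding open_contains_ball by blast
  then show ?thesis using that by (auto simp: subset_iff dist_real_def)
qed

text \<open>One good point is enough: a continuous nonnegative integrand with vanishing integral is
  0 everywhere.\<close>

lemma (in ground_wave) weight_pos:
  assumes w: "continuous_on UNIV w" "\<And>x. w x \<ge> 0" "w x0 > 0" "q x0 \<noteq> 0" and i: "integrable lborel (\<lambda>x. w x * (q x)\<^sup>2)"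
  shows "(LINT x|lborel. w x * (q x)\<^sup>2) > 0"
proof (rule ccontr)
  assume "\<not> ?thesis"
  moreover have "(LINT x|lborel. w x * (q x)\<^sup>2) \<ge> 0" using w(2) by (intro integral_nonneg_AE) auto
  ultimately have "(LINT x|lborel. w x * (q x)\<^sup>2) = 0" by simp
  then have "AE x in lborel. w x * (q x)\<^sup>2 = 0" using w(2) by (subst (asm) integral_nonneg_eq_0_iff_AE[OF i]) auto
  then have "AE x in lborel. complex_of_real (w x * (q x)\<^sup>2) = 0" by eventually_elim simp
  moreover have "continuous_on UNIV (\<lambda>x. complex_of_real (w x * (q x)\<^sup>2))"
    by (intro continuous_intros w(1) q_continuous)
  ultimately have "(\<lambda>x. complex_of_real (w x * (q x)\<^sup>2)) = (\<lambda>x. 0)"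
    by (intro continuous_AE_eq continuous_on_const)
  from fun_cong[OF this, of x0] show False using w(3,4) by simp
qed

text \<open>With h the inverse transform of V, the kinetic part T(t), the mass M(t) and the integral
  P(t) of the cube of Q + t h are polynomials in t, and P(0) = (T0 + M0) / (2 pi). Minimality bounds
  P(t) / P(0) by the product of (T(t) / T0) powr \<open>al\<close> and (M(t) / M0) powr
  \<open>be\<close>; after \<open>powr_le_exp\<close> this has the shape of
  \<open>exp_quadratic_comparison\<close>.\<close>

lemma (in ground_wave) variation:
  assumes V: "rapid V" "hermitian V"
  defines "T0 \<equiv> LINT x|lborel. \<bar>x\<bar> powr a * (q x)\<^sup>2" and "M0 \<equiv> LINT x|lborel. (q x)\<^sup>2"
    and "\<tau> \<equiv> LINT x|lborel. \<bar>x\<bar> powr a * (q x * Re (V x))" and "\<mu> \<equiv> LINT x|lborel. q x * Re (V x)"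
    and "Th \<equiv> LINT x|lborel. \<bar>x\<bar> powr a * (cmod (V x))\<^sup>2" and "Mh \<equiv> LINT x|lborel. (cmod (V x))\<^sup>2"
    and "k \<equiv> Re (LINT x|lborel. conv (cplx q) V x * cnj (V x)) / (2 * pi)"
  shows "T0 > 0" "M0 > 0"
    "3 * (\<tau> + \<mu>) / (T0 + M0) = 2 * (1 / (2 * a) * (\<tau> / T0) + (3 * a - 1) / (2 * a) * (\<mu> / M0))"
    "\<tau> + \<mu> = 0 \<Longrightarrow> 3 * k / (T0 + M0) \<le> 1 / (2 * a) * (Th / T0) + (3 * a - 1) / (2 * a) * (Mh / M0)"
proof -
  note ap = a_pos
  define al be where "al = 1 / (2 * a)" and "be = (3 * a - 1) / (2 * a)"
  have albe: "al \<ge> 0" "be \<ge> 0" using a by (auto simp: al_def be_def)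
  have qq: "(cmod (cplx q x))\<^sup>2 = (q x)\<^sup>2" "Re (cplx q x * cnj (V x)) = q x * Re (V x)" for x by (simp_all add: cplx_def)
  note I = rapid_form_integrable[OF q_rapid V(1), unfolded qq] rapid_form_integrable[OF V(1) V(1)]
  obtain e where e: "e > 0" "\<And>x. \<bar>x\<bar> < e \<Longrightarrow> q x \<noteq> 0" using q_nonzero_near_0 by blast
  show T0: "T0 > 0" unfolding T0_def using e(1) I(4)[OF ap] e(2)[of "e / 2"] by (intro weight_pos[of _ "e / 2"] continuous_abs_powr ap) auto
  show M0: "M0 > 0" unfolding M0_def using weight_pos[of "\<lambda>_. 1" 0] I(2) q_0 by simp
  define h where "h x = Re (inv_fourier V x)" for x
  have hV: "cplx h = inv_fourier V" using inv_fourier_real[OF V(2)] by (auto simp: cplx_def h_def)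
  note hp = inv_fourier_Re[OF V, folded h_def]
  have Qh: "Q = (\<lambda>x. Re (inv_fourier (cplx q) x))" unfolding Q_inv[symmetric] by (simp add: cplx_def)
  note Qp = inv_fourier_Re[OF q_rapid q_hermitian, folded Qh]
  have Qb: "\<bar>Q x\<bar> \<le> (LINT x|lborel. cmod (cplx q x)) / (2 * pi)" for x
    using inv_fourier_Re(3)[OF q_rapid q_hermitian] by (subst Qh)
  note i3 = sqint_mult3[OF Qp(1) Qp(1) Qp(2) Qb] sqint_mult3[OF Qp(1) Qp(1) hp(2,3)]
     sqint_mult3[OF Qp(1) hp(1) hp(2,3)] sqint_mult3[OF hp(1) hp(1) hp(2,3)]
  define F where "F x = complex_of_real ((1 + \<bar>x\<bar> powr a) * q x)" for x
  have FQ: "F = (\<lambda>x. conv (cplx q) (cplx q) x / (2 * pi))" unfolding F_def using q_eq by blast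
  have Fr: "rapid F" unfolding FQ using rapid_scale[OF rapid_conv[OF q_rapid q_rapid], of "1 / (2 * pi)"] by simp
  have Q2: "complex_of_real (Q x * Q x) = inv_fourier F x" for x
  proof -
    have "complex_of_real (Q x * Q x) = inv_fourier (cplx q) x * inv_fourier (cplx q) x"
      unfolding Q_inv[symmetric] by (simp add: cplx_def)
    also have "\<dots> = inv_fourier (conv (cplx q) (cplx q)) x / (2 * pi)"
      by (intro inv_fourier_mult rapid_integrable q_rapid)
    also have "\<dots> = inv_fourier F x" unfolding FQ inv_fourier_def fourier_def by simp
    finally show ?thesis .
  qed
  \<comment> \<open>By the ground state equation Q^2 has transform (1 + |x| powr a) q, so an
    integral against Q^2 becomes a weighted pairing with q. This provides the coefficients of order
    0 and 1 of the cubic integral.\<close>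
  have triple: "(LINT x|lborel. Q x * Q x * Re (inv_fourier W x)) = (LINT x|lborel. (1 + \<bar>x\<bar> powr a) * (q x * Re (W x))) / (2 * pi)"
    if W: "rapid W" "hermitian W" for W
  proof -
    have "complex_of_real (LINT x|lborel. Q x * Q x * Re (inv_fourier W x)) = (LINT x|lborel. complex_of_real (Q x * Q x) * inv_fourier W x)"
      by (subst (2) inv_fourier_real[OF W(2)]) (simp flip: integral_complex_of_real of_real_mult)
    also have "\<dots> = (LINT x|lborel. F x * W (- x)) / (2 * pi)" unfolding Q2 by (rule inv_fourier_parseval[OF Fr W(1)])
    also have "\<dots> = (LINT x|lborel. F x * cnj (W x)) / (2 * pi)" using W(2) by (simp add: hermitian_def)
    finally have "(LINT x|lborel. Q x * Q x * Re (inv_fourier W x)) = Re ((LINT x|lborel. F x * cnj (W x)) / (2 * pi))"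
      by (metis Re_complex_of_real)
    also have "\<dots> = Re (LINT x|lborel. F x * cnj (W x)) / (2 * pi)" using Re_divide_of_real[of _ "2 * pi"] by simp
    also have "Re (LINT x|lborel. F x * cnj (W x)) = (LINT x|lborel. Re (F x * cnj (W x)))"
      by (intro integral_Re[symmetric] L2_mult_integrable rapid_L2 Fr L2_cnj W)
    also have "\<dots> = (LINT x|lborel. (1 + \<bar>x\<bar> powr a) * (q x * Re (W x)))" by (simp add: F_def mult.assoc)
    finally show ?thesis .
  qed
  have P0: "(LINT x|lborel. Q x * Q x * Q x) = (T0 + M0) / (2 * pi)"
    using triple[OF q_rapid q_hermitian] I(4)[OF ap] I(2)
    by (simp add: Qh[symmetric] cplx_def distrib_right T0_def M0_def power2_eq_square add.commute fun_cong[OF Qh, symmetric])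
  have P1: "(LINT x|lborel. Q x * Q x * h x) = (\<tau> + \<mu>) / (2 * pi)"
    using triple[OF V] I(3)[OF ap] I(1) by (simp add: h_def distrib_right \<tau>_def \<mu>_def add.commute)
  have P2: "(LINT x|lborel. Q x * h x * h x) = k / (2 * pi)"
  proof -
    have "complex_of_real (LINT x|lborel. Q x * h x * h x) = (LINT x|lborel. inv_fourier (cplx q) x * inv_fourier V x * inv_fourier V x)"
      unfolding Q_inv[symmetric] hV[symmetric] by (simp add: cplx_def flip: integral_complex_of_real)
    also have "\<dots> = (LINT x|lborel. inv_fourier (conv (cplx q) V) x * inv_fourier V x) / (2 * pi)"
      by (simp add: inv_fourier_mult rapid_integrable q_rapid V)
    also have "\<dots> = (LINT x|lborel. conv (cplx q) V x * V (- x)) / (2 * pi) / (2 * pi)"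
      by (simp add: inv_fourier_parseval[OF rapid_conv[OF q_rapid V(1)] V(1)])
    also have "\<dots> = (LINT x|lborel. conv (cplx q) V x * cnj (V x)) / (2 * pi) / (2 * pi)" using V(2) by (simp add: hermitian_def)
    finally have "(LINT x|lborel. Q x * h x * h x) = Re ((LINT x|lborel. conv (cplx q) V x * cnj (V x)) / (2 * pi) / (2 * pi))"
      by (metis Re_complex_of_real)
    then show ?thesis using Re_divide_of_real[of _ "2 * pi"] by (simp add: k_def)
  qed
  have cube_int: "integrable lborel (\<lambda>x. (Q x + t * h x) ^ 3)"
    and cube: "(LINT x|lborel. (Q x + t * h x) ^ 3) = ((T0 + M0) + 3 * t * (\<tau> + \<mu>) + 3 * t\<^sup>2 * k) / (2 * pi) + t ^ 3 * (LINT x|lborel. h x * h x * h x)" for t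
  proof -
    have eq: "(Q x + t * h x) ^ 3 = Q x * Q x * Q x + (3 * t) * (Q x * Q x * h x) + (3 * t\<^sup>2) * (Q x * h x * h x) + t ^ 3 * (h x * h x * h x)" for x
      by (simp add: power3_eq_cube power2_eq_square algebra_simps)
    show "integrable lborel (\<lambda>x. (Q x + t * h x) ^ 3)" unfolding eq using i3 by auto
    show "(LINT x|lborel. (Q x + t * h x) ^ 3) = ((T0 + M0) + 3 * t * (\<tau> + \<mu>) + 3 * t\<^sup>2 * k) / (2 * pi) + t ^ 3 * (LINT x|lborel. h x * h x * h x)"
      unfolding eq using i3 by (simp add: P0 P1 P2 add_divide_distrib distrib_left)
  qed
  have TM: "(LINT x|lborel. \<bar>x\<bar> powr a * (cmod (cplx q x + complex_of_real t * V x))\<^sup>2) = T0 + 2 * t * \<tau> + t\<^sup>2 * Th"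
    "(LINT x|lborel. (cmod (cplx q x + complex_of_real t * V x))\<^sup>2) = M0 + 2 * t * \<mu> + t\<^sup>2 * Mh" for t
    using quadratic_integral[of "\<lambda>x. \<bar>x\<bar> powr a" "cplx q" V t, unfolded qq]
      quadratic_integral[of "\<lambda>x. 1" "cplx q" V t, unfolded qq mult_1] I ap
    by (simp_all add: T0_def \<tau>_def Th_def M0_def \<mu>_def Mh_def)
  have main: "1 + t * (3 * (\<tau> + \<mu>) / (T0 + M0)) + t\<^sup>2 * (3 * k / (T0 + M0)) + t ^ 3 * ((LINT x|lborel. h x * h x * h x) * (2 * pi) / (T0 + M0))
    \<le> exp (t * (2 * (al * (\<tau> / T0) + be * (\<mu> / M0))) + t\<^sup>2 * (al * (Th / T0) + be * (Mh / M0)))" for t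
  proof -
    define u where "u x = Q x + t * h x" for x
    define G where "G x = cplx q x + complex_of_real t * V x" for x
    have G: "rapid G" unfolding G_def by (intro rapid_add rapid_scale q_rapid V)
    have uG: "cplx u = inv_fourier G"
    proof
      fix x
      have "cplx u x = cplx Q x + complex_of_real t * cplx h x" by (simp add: cplx_def u_def)
      then show "cplx u x = inv_fourier G x"
        unfolding G_def Q_inv hV by (subst inv_fourier_add) (auto intro!: rapid_integrable q_rapid V)
    qed
    define Pt Tt Mt where "Pt = (LINT x|lborel. \<bar>u x\<bar> ^ 3)" and "Tt = T0 + 2 * t * \<tau> + t\<^sup>2 * Th" and "Mt = M0 + 2 * t * \<mu> + t\<^sup>2 * Mh"
    have Tt0: "Tt \<ge> 0" unfolding Tt_def TM(1)[symmetric] by (intro integral_nonneg_AE) auto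
    have Mt0: "Mt \<ge> 0" unfolding Mt_def TM(2)[symmetric] by (intro integral_nonneg_AE) auto
    have Pt0: "Pt \<ge> 0" unfolding Pt_def by (intro integral_nonneg_AE) auto
    let ?P0 = "(T0 + M0) / (2 * pi)"
    have P0p: "?P0 > 0" using T0 M0 by simp
    have WQ: "weinstein a Q = inverse ?P0 * (T0 / (2 * pi)) powr al * (M0 / (2 * pi)) powr be"
      unfolding weinstein_rapid[OF q_rapid Q_inv ap] qq
      using P0 Q_pos by (simp add: T0_def M0_def al_def be_def power3_eq_cube abs_of_pos mult.assoc)
    have Wu: "weinstein a u = inverse Pt * (Tt / (2 * pi)) powr al * (Mt / (2 * pi)) powr be"
      unfolding weinstein_rapid[OF G uG ap] by (simp add: G_def TM Tt_def Mt_def Pt_def al_def be_def)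
    have key: "Pt / ?P0 \<le> (Tt / T0) powr al * (Mt / M0) powr be"
    \<comment> \<open>Minimality speaks only of functions that are not almost everywhere 0. A
      nonzero \<open>Pt\<close> guarantees this, and for \<open>Pt = 0\<close> the inequality is
      trivial.\<close>
    proof (cases "Pt = 0")
      case True then show ?thesis by simp
    next
      case False
      have "\<not> (AE x in lborel. u x = 0)"
      proof
        assume "AE x in lborel. u x = 0"
        then have "AE x in lborel. \<bar>u x\<bar> ^ 3 = 0" by eventually_elim simp
        then have "Pt = 0" unfolding Pt_def by (rule integral_eq_zero_AE)
        then show False using False by simp
      qed
      moreover have "Hsob (a / 2) (cplx u)" unfolding uG by (rule Hsob_rapid[OF G])
      ultimately have "inverse ?P0 * (T0 / (2 * pi)) powr al * (M0 / (2 * pi)) powr be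
         \<le> inverse Pt * (Tt / (2 * pi)) powr al * (Mt / (2 * pi)) powr be"
        using minimal WQ Wu by metis
      moreover define A0 At where "A0 = (T0 / (2 * pi)) powr al * (M0 / (2 * pi)) powr be" and "At = (Tt / (2 * pi)) powr al * (Mt / (2 * pi)) powr be"
      ultimately have "inverse ?P0 * A0 \<le> inverse Pt * At" by (simp add: mult.assoc)
      moreover have A0: "A0 > 0" using T0 M0 by (simp add: A0_def)
      ultimately have "Pt / ?P0 \<le> At / A0" using P0p Pt0 False by (simp add: field_simps)
      also have "At / A0 = (Tt / T0) powr al * (Mt / M0) powr be"
      proof -
        have 1: "(Tt / T0) powr al = (Tt / (2 * pi)) powr al / (T0 / (2 * pi)) powr al"
          using Tt0 T0 by (subst powr_divide[symmetric]) auto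
        have 2: "(Mt / M0) powr be = (Mt / (2 * pi)) powr be / (M0 / (2 * pi)) powr be"
          using Mt0 M0 by (subst powr_divide[symmetric]) auto
        show ?thesis unfolding 1 2 A0_def At_def by simp
      qed
      finally show ?thesis .
    qed
    \<comment> \<open>Q + t h may change sign while the functional contains its absolute value. Only
      an upper bound for the integral of the cube is wanted, so the comparison goes in the right
      direction.\<close>
    have "(LINT x|lborel. (Q x + t * h x) ^ 3) \<le> Pt"
      unfolding Pt_def u_def
    proof (rule integral_mono[OF cube_int])
      show "integrable lborel (\<lambda>x. \<bar>Q x + t * h x\<bar> ^ 3)"
        using integrable_abs[OF cube_int[of t]] by (simp add: power_abs)
      show "(Q x + t * h x) ^ 3 \<le> \<bar>Q x + t * h x\<bar> ^ 3" for x by (metis abs_ge_self power_abs)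
    qed
    then have "(LINT x|lborel. (Q x + t * h x) ^ 3) / ?P0 \<le> Pt / ?P0" using P0p by (intro divide_right_mono) auto
    also have "\<dots> \<le> (Tt / T0) powr al * (Mt / M0) powr be" by (rule key)
    also have "\<dots> \<le> exp (al * (Tt / T0 - 1)) * exp (be * (Mt / M0 - 1))"
      using Tt0 Mt0 T0 M0 albe by (intro mult_mono powr_le_exp) auto
    also have "\<dots> = exp (t * (2 * (al * (\<tau> / T0) + be * (\<mu> / M0))) + t\<^sup>2 * (al * (Th / T0) + be * (Mh / M0)))"
    proof -
      have "Tt / T0 - 1 = 2 * t * (\<tau> / T0) + t\<^sup>2 * (Th / T0)" "Mt / M0 - 1 = 2 * t * (\<mu> / M0) + t\<^sup>2 * (Mh / M0)"
        using T0 M0 by (simp_all add: Tt_def Mt_def field_simps)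
      then show ?thesis by (simp only: exp_add[symmetric]) (simp add: algebra_simps)
    qed
    also have "(LINT x|lborel. (Q x + t * h x) ^ 3) / ?P0
      = 1 + t * (3 * (\<tau> + \<mu>) / (T0 + M0)) + t\<^sup>2 * (3 * k / (T0 + M0)) + t ^ 3 * ((LINT x|lborel. h x * h x * h x) * (2 * pi) / (T0 + M0))"
    proof -
      have "((S + 3 * t * x + 3 * t\<^sup>2 * k) / (2 * pi) + t ^ 3 * c) / (S / (2 * pi)) = 1 + t * (3 * x / S) + t\<^sup>2 * (3 * k / S) + t ^ 3 * (c * (2 * pi) / S)"
        if "S > 0" for S x c :: real
        using that by (simp add: field_simps)
      then show ?thesis unfolding cube using T0 M0 by simp
    qed
    finally show ?thesis .
  qed
  from exp_quadratic_comparison[OF main]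
  show eq1: "3 * (\<tau> + \<mu>) / (T0 + M0) = 2 * (1 / (2 * a) * (\<tau> / T0) + (3 * a - 1) / (2 * a) * (\<mu> / M0))"
    unfolding al_def be_def by blast
  show "3 * k / (T0 + M0) \<le> 1 / (2 * a) * (Th / T0) + (3 * a - 1) / (2 * a) * (Mh / M0)" if "\<tau> + \<mu> = 0"
    using exp_quadratic_comparison(2)[OF main] eq1 that unfolding al_def be_def by simp
qed


text \<open>The first variation is linear in V, with density (A |x| powr a + B) q. Inserting this
  density for V makes the integral of its square vanish, and since q is nonzero near 0 both
  coefficients vanish. This takes the place of the usual scaling argument for identities of this
  type.\<close>

lemma (in ground_wave) pohozaev:
  defines "T0 \<equiv> LINT x|lborel. \<bar>x\<bar> powr a * (q x)\<^sup>2" and "M0 \<equiv> LINT x|lborel. (q x)\<^sup>2"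
  shows "1 / (2 * a) / T0 = 3 / (2 * (T0 + M0))" "(3 * a - 1) / (2 * a) / M0 = 3 / (2 * (T0 + M0))"
proof -
  \<comment> \<open>A and B are twice the defects in the two claimed identities; the first variation
    will read A \<tau> + B \<mu> = 0.\<close>
  define A B where "A = 3 / (T0 + M0) - 2 * (1 / (2 * a) / T0)" and "B = 3 / (T0 + M0) - 2 * ((3 * a - 1) / (2 * a) / M0)"
  define V where "V x = complex_of_real A * (Dpow_sym a x * cplx q x) + complex_of_real B * cplx q x" for x
  have V: "rapid V" unfolding V_def by (intro rapid_add rapid_scale Dpow_rapid q_rapid a_pos)
  have herm: "hermitian V" by (simp add: hermitian_def V_def Dpow_sym_def cplx_def q_even)
  have ReV: "Re (V x) = (A * \<bar>x\<bar> powr a + B) * q x" for x by (simp add: V_def Dpow_sym_def cplx_def algebra_simps)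
  define \<tau> \<mu> where "\<tau> = (LINT x|lborel. \<bar>x\<bar> powr a * (q x * Re (V x)))" and "\<mu> = (LINT x|lborel. q x * Re (V x))"
  have "3 * (\<tau> + \<mu>) / (T0 + M0) = 2 * (1 / (2 * a) * (\<tau> / T0) + (3 * a - 1) / (2 * a) * (\<mu> / M0))"
    unfolding T0_def M0_def \<tau>_def \<mu>_def by (rule variation(3)[OF V herm])
  then have "3 / (T0 + M0) * (\<tau> + \<mu>) = 2 * (1 / (2 * a) / T0 * \<tau> + (3 * a - 1) / (2 * a) / M0 * \<mu>)" by simp
  then have zero: "A * \<tau> + B * \<mu> = 0" unfolding A_def B_def left_diff_distrib distrib_left mult.assoc by linarith
  have qq: "Re (cplx q x * cnj (V x)) = q x * Re (V x)" for x by (simp add: cplx_def)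
  note I = rapid_form_integrable(1,3)[OF q_rapid V, unfolded qq]
  have eq: "(A * \<bar>x\<bar> powr a + B)\<^sup>2 * (q x)\<^sup>2 = A * (\<bar>x\<bar> powr a * (q x * Re (V x))) + B * (q x * Re (V x))" for x
    by (simp add: ReV power2_eq_square algebra_simps)
  have i: "integrable lborel (\<lambda>x. (A * \<bar>x\<bar> powr a + B)\<^sup>2 * (q x)\<^sup>2)" unfolding eq using I a_pos by auto
  have int0: "(LINT x|lborel. (A * \<bar>x\<bar> powr a + B)\<^sup>2 * (q x)\<^sup>2) = 0"
    unfolding eq using I a_pos zero by (simp add: \<tau>_def \<mu>_def)
  obtain e where e: "e > 0" "\<And>x. \<bar>x\<bar> < e \<Longrightarrow> q x \<noteq> 0" using q_nonzero_near_0 by blast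
  have root: "A * \<bar>x\<bar> powr a + B = 0" if "\<bar>x\<bar> < e" for x
  proof (rule ccontr)
    assume "\<not> ?thesis"
    then have "0 < (LINT x|lborel. (A * \<bar>x\<bar> powr a + B)\<^sup>2 * (q x)\<^sup>2)"
      by (intro weight_pos[of _ x] i e that continuous_intros continuous_abs_powr a_pos) auto
    then show False using int0 by simp
  qed
  \<comment> \<open>The point 0 isolates B because 0 powr a is 0; a second point near 0 isolates
    A.\<close>
  have B: "B = 0" using root[of 0] e(1) by simp
  have "A = 0" using root[of "e / 2"] e(1) B by simp
  have half: "x = s / 2" if "s - 2 * x = 0" for s x :: real using that by simp
  show "1 / (2 * a) / T0 = 3 / (2 * (T0 + M0))" using half[OF \<open>A = 0\<close>[unfolded A_def]] by simp
  show "(3 * a - 1) / (2 * a) / M0 = 3 / (2 * (T0 + M0))" using half[OF B[unfolded B_def]] by simp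
qed

text \<open>By \<open>pohozaev\<close> the kinetic and the mass term enter the second variation with
  the same coefficient, so they combine to one multiple of the integral weighted by the full symbol
  1 + |x| powr a. The constraint is the Fourier form of a vanishing integral of Q^2 h.\<close>

lemma (in ground_wave) second_variation:
  assumes V: "rapid V" "hermitian V" and orth: "(LINT x|lborel. (1 + \<bar>x\<bar> powr a) * (q x * Re (V x))) = 0"
  shows "Re (LINT x|lborel. conv (cplx q) V x * cnj (V x)) / pi \<le> (LINT x|lborel. (1 + \<bar>x\<bar> powr a) * (cmod (V x))\<^sup>2)"
proof -
  define T0 M0 where "T0 = (LINT x|lborel. \<bar>x\<bar> powr a * (q x)\<^sup>2)" and "M0 = (LINT x|lborel. (q x)\<^sup>2)"
  define Th Mh where "Th = (LINT x|lborel. \<bar>x\<bar> powr a * (cmod (V x))\<^sup>2)" and "Mh = (LINT x|lborel. (cmod (V x))\<^sup>2)"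
  define k where "k = Re (LINT x|lborel. conv (cplx q) V x * cnj (V x))"
  have qq: "Re (cplx q x * cnj (V x)) = q x * Re (V x)" for x by (simp add: cplx_def)
  note I = rapid_form_integrable(1,3)[OF q_rapid V(1), unfolded qq] rapid_form_integrable(2,4)[OF V(1) V(1)]
  have sum0: "(LINT x|lborel. \<bar>x\<bar> powr a * (q x * Re (V x))) + (LINT x|lborel. q x * Re (V x)) = 0"
    using orth I a_pos by (simp add: distrib_right)
  have pos: "T0 > 0" "M0 > 0" unfolding T0_def M0_def by (rule variation(1,2)[OF V])+
  have poh: "1 / (2 * a) / T0 = 3 / (2 * (T0 + M0))" "(3 * a - 1) / (2 * a) / M0 = 3 / (2 * (T0 + M0))"
    unfolding T0_def M0_def by (rule pohozaev)+
  have "3 * (k / (2 * pi)) / (T0 + M0) \<le> 1 / (2 * a) * (Th / T0) + (3 * a - 1) / (2 * a) * (Mh / M0)"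
    unfolding T0_def M0_def Th_def Mh_def k_def by (rule variation(4)[OF V sum0])
  also have "\<dots> = (1 / (2 * a) / T0) * Th + ((3 * a - 1) / (2 * a) / M0) * Mh" by simp
  also have "\<dots> = 3 / (2 * (T0 + M0)) * (Th + Mh)" unfolding poh by (simp add: distrib_left)
  also have "3 * (k / (2 * pi)) / (T0 + M0) = 3 / (2 * (T0 + M0)) * (k / pi)" by simp
  finally have "k / pi \<le> Th + Mh" using pos by (subst (asm) mult_le_cancel_left_pos) auto
  moreover have "(LINT x|lborel. (1 + \<bar>x\<bar> powr a) * (cmod (V x))\<^sup>2) = Th + Mh"
    using I a_pos by (simp add: distrib_right Th_def Mh_def)
  ultimately show ?thesis by (simp add: k_def)
qed

section \<open>Operators on the Hilbert space\<close>

lemma l2_operator: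
  assumes sq: "\<And>f. sqint f \<Longrightarrow> sqint (\<Phi> f)"
    and bd: "\<And>f. sqint f \<Longrightarrow> (LINT x|lborel. (\<Phi> f x)\<^sup>2) \<le> C\<^sup>2 * (LINT x|lborel. (f x)\<^sup>2)" and C: "C \<ge> 0"
    and add: "\<And>f g. sqint f \<Longrightarrow> sqint g \<Longrightarrow> AE x in lborel. \<Phi> (\<lambda>x. f x + g x) x = \<Phi> f x + \<Phi> g x"
    and scale: "\<And>f c. sqint f \<Longrightarrow> AE x in lborel. \<Phi> (\<lambda>x. c * f x) x = c * \<Phi> f x"
    and cong: "\<And>f g. sqint f \<Longrightarrow> sqint g \<Longrightarrow> AE x in lborel. f x = g x \<Longrightarrow> AE x in lborel. \<Phi> f x = \<Phi> g x"
  defines "T \<equiv> \<lambda>x. abs_l2 (\<Phi> (rep_l2 x))"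
  shows "bounded_linear T" "norm (T x) \<le> C * norm x" "AE t in lborel. rep_l2 (T x) t = \<Phi> (rep_l2 x) t"
proof -
  show rep: "AE t in lborel. rep_l2 (T x) t = \<Phi> (rep_l2 x) t" for x
    unfolding T_def by (rule rep_abs_l2[OF sq[OF sqint_rep]])
  show nb: "norm (T x) \<le> C * norm x" for x
  proof (rule power2_le_imp_le)
    show "(norm (T x))\<^sup>2 \<le> (C * norm x)\<^sup>2"
      unfolding T_def norm_l2_abs[OF sq[OF sqint_rep]] power_mult_distrib norm_l2_sq[of x] by (rule bd[OF sqint_rep])
  qed (use C in simp)
  show "bounded_linear T"
  proof (rule bounded_linear_intro[where K = C])
    fix x y c
    have e1: "AE t in lborel. \<Phi> (rep_l2 (x + y)) t = \<Phi> (\<lambda>t. rep_l2 x t + rep_l2 y t) t"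
      by (rule cong[OF sqint_rep sqint_add[OF sqint_rep sqint_rep] rep_plus])
    show "T (x + y) = T x + T y"
      by (rule l2_eqI, use e1 rep[of "x + y"] rep[of x] rep[of y] rep_plus[of "T x" "T y"] add[OF sqint_rep sqint_rep, of x y] in eventually_elim) simp
    have e2: "AE t in lborel. \<Phi> (rep_l2 (c *\<^sub>R x)) t = \<Phi> (\<lambda>t. c * rep_l2 x t) t"
      by (rule cong[OF sqint_rep sqint_scale[OF sqint_rep] rep_scaleR])
    show "T (c *\<^sub>R x) = c *\<^sub>R T x"
      by (rule l2_eqI, use e2 rep[of "c *\<^sub>R x"] rep[of x] rep_scaleR[of c "T x"] scale[OF sqint_rep, of c x] in eventually_elim) simp
    show "norm (T x) \<le> norm x * C" using nb[of x] by (simp add: mult.commute)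
  qed
qed

text \<open>Cauchy-Schwarz with |K| split into two square roots, one of them kept with f. The row
  bound estimates the first factor and, after exchanging the integrals, the column bound the
  second.\<close>

lemma schur_test:
  fixes K :: "real \<Rightarrow> real \<Rightarrow> real"
  assumes K[measurable]: "(\<lambda>(x, y). K x y) \<in> borel_measurable (borel \<Otimes>\<^sub>M borel)" and A: "A \<ge> 0"
    and row: "\<And>x. (\<integral>\<^sup>+y. ennreal \<bar>K x y\<bar> \<partial>lborel) \<le> ennreal A" and col: "\<And>y. (\<integral>\<^sup>+x. ennreal \<bar>K x y\<bar> \<partial>lborel) \<le> ennreal A"
    and f: "sqint f"
  shows "sqint (\<lambda>x. LINT y|lborel. K x y * f y)"
    "(LINT x|lborel. (LINT y|lborel. K x y * f y)\<^sup>2) \<le> A\<^sup>2 * (LINT x|lborel. (f x)\<^sup>2)"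
proof -
  have [measurable]: "f \<in> borel_measurable borel" using f by (simp add: sqint_def)
  have fi: "integrable lborel (\<lambda>x. (f x)\<^sup>2)" using f by (simp add: sqint_def)
  define g where "g x = (LINT y|lborel. K x y * f y)" for x
  have [measurable]: "g \<in> borel_measurable borel"
    unfolding g_def[abs_def] by (simp add: lborel.borel_measurable_lebesgue_integral)
  have pw: "ennreal ((g x)\<^sup>2) \<le> ennreal A * (\<integral>\<^sup>+y. ennreal (\<bar>K x y\<bar> * (f y)\<^sup>2) \<partial>lborel)" for x
  proof -
    have "ennreal \<bar>g x\<bar> \<le> (\<integral>\<^sup>+y. ennreal \<bar>K x y * f y\<bar> \<partial>lborel)"
    proof (cases "integrable lborel (\<lambda>y. K x y * f y)")
      case True then show ?thesis unfolding g_def using integral_norm_bound_ennreal[OF True] by simp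
    qed (simp add: g_def not_integrable_integral_eq)
    also have "\<dots> = (\<integral>\<^sup>+y. ennreal (sqrt \<bar>K x y\<bar>) * ennreal (sqrt \<bar>K x y\<bar> * \<bar>f y\<bar>) \<partial>lborel)"
      by (rule nn_integral_cong) (simp add: ennreal_mult[symmetric] abs_mult mult.assoc[symmetric])
    finally have "(ennreal \<bar>g x\<bar>)\<^sup>2 \<le> (\<integral>\<^sup>+y. ennreal (sqrt \<bar>K x y\<bar>) * ennreal (sqrt \<bar>K x y\<bar> * \<bar>f y\<bar>) \<partial>lborel)\<^sup>2"
      by (intro power_mono) auto
    also have "\<dots> \<le> (\<integral>\<^sup>+y. (ennreal (sqrt \<bar>K x y\<bar>))\<^sup>2 \<partial>lborel) * (\<integral>\<^sup>+y. (ennreal (sqrt \<bar>K x y\<bar> * \<bar>f y\<bar>))\<^sup>2 \<partial>lborel)"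
      by (rule Cauchy_Schwarz_nn_integral) measurable
    also have "\<dots> = (\<integral>\<^sup>+y. ennreal \<bar>K x y\<bar> \<partial>lborel) * (\<integral>\<^sup>+y. ennreal (\<bar>K x y\<bar> * (f y)\<^sup>2) \<partial>lborel)"
      by (simp add: ennreal_power power_mult_distrib)
    also have "\<dots> \<le> ennreal A * (\<integral>\<^sup>+y. ennreal (\<bar>K x y\<bar> * (f y)\<^sup>2) \<partial>lborel)" by (intro mult_right_mono row) simp
    finally show ?thesis by (simp add: ennreal_power)
  qed
  have "(\<integral>\<^sup>+x. ennreal ((g x)\<^sup>2) \<partial>lborel) \<le> (\<integral>\<^sup>+x. ennreal A * (\<integral>\<^sup>+y. ennreal (\<bar>K x y\<bar> * (f y)\<^sup>2) \<partial>lborel) \<partial>lborel)"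
    by (intro nn_integral_mono pw)
  also have "\<dots> = ennreal A * (\<integral>\<^sup>+x. \<integral>\<^sup>+y. ennreal (\<bar>K x y\<bar> * (f y)\<^sup>2) \<partial>lborel \<partial>lborel)"
    by (rule nn_integral_cmult) measurable
  also have "(\<integral>\<^sup>+x. \<integral>\<^sup>+y. ennreal (\<bar>K x y\<bar> * (f y)\<^sup>2) \<partial>lborel \<partial>lborel) = (\<integral>\<^sup>+y. \<integral>\<^sup>+x. ennreal (\<bar>K x y\<bar> * (f y)\<^sup>2) \<partial>lborel \<partial>lborel)"
    by (rule nn_integral_swap) measurable
  also have "\<dots> = (\<integral>\<^sup>+y. (\<integral>\<^sup>+x. ennreal \<bar>K x y\<bar> \<partial>lborel) * ennreal ((f y)\<^sup>2) \<partial>lborel)"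
    by (simp add: ennreal_mult nn_integral_multc)
  also have "ennreal A * \<dots> \<le> ennreal A * (\<integral>\<^sup>+y. ennreal A * ennreal ((f y)\<^sup>2) \<partial>lborel)"
    by (intro mult_left_mono nn_integral_mono mult_right_mono col) auto
  also have "\<dots> = ennreal (A\<^sup>2 * (LINT x|lborel. (f x)\<^sup>2))"
  proof -
    have "(\<integral>\<^sup>+y. ennreal ((f y)\<^sup>2) \<partial>lborel) = ennreal (LINT x|lborel. (f x)\<^sup>2)"
      by (rule nn_integral_eq_integral[OF fi]) simp
    then show ?thesis using A by (simp add: nn_integral_cmult ennreal_mult power2_eq_square[of A] mult.assoc)
  qed
  finally have le: "(\<integral>\<^sup>+x. ennreal ((g x)\<^sup>2) \<partial>lborel) \<le> ennreal (A\<^sup>2 * (LINT x|lborel. (f x)\<^sup>2))" .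
  have gi: "integrable lborel (\<lambda>x. (g x)\<^sup>2)"
    by (rule integrableI_bounded) (use le in \<open>auto intro: le_less_trans\<close>)
  then show "sqint (\<lambda>x. LINT y|lborel. K x y * f y)" by (simp add: sqint_def flip: g_def)
  show "(LINT x|lborel. (LINT y|lborel. K x y * f y)\<^sup>2) \<le> A\<^sup>2 * (LINT x|lborel. (f x)\<^sup>2)"
    using le unfolding nn_integral_eq_integral[OF gi, OF AE_I2, OF zero_le_power2] g_def[symmetric]
    by (subst (asm) ennreal_le_iff) auto
qed

lemma kernel_operator:
  fixes K :: "real \<Rightarrow> real \<Rightarrow> real"
  assumes K: "(\<lambda>(x, y). K x y) \<in> borel_measurable (borel \<Otimes>\<^sub>M borel)" and A: "A \<ge> 0"
    and row: "\<And>x. (\<integral>\<^sup>+y. ennreal \<bar>K x y\<bar> \<partial>lborel) \<le> ennreal A" and col: "\<And>y. (\<integral>\<^sup>+x. ennreal \<bar>K x y\<bar> \<partial>lborel) \<le> ennreal A"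
    and Ks: "\<And>x. sqint (K x)"
  defines "T \<equiv> \<lambda>x. abs_l2 (\<lambda>s. LINT t|lborel. K s t * rep_l2 x t)"
  shows "bounded_linear T" "norm (T x) \<le> A * norm x" "AE s in lborel. rep_l2 (T x) s = (LINT t|lborel. K s t * rep_l2 x t)"
proof -
  have *: "AE s in lborel. (LINT t|lborel. K s t * (f t + g t)) = (LINT t|lborel. K s t * f t) + (LINT t|lborel. K s t * g t)"
    "AE s in lborel. (LINT t|lborel. K s t * (c * f t)) = c * (LINT t|lborel. K s t * f t)"
    if "sqint f" "sqint g" for f g c
    using sqint_mult[OF Ks that(1)] sqint_mult[OF Ks that(2)]
    by (auto simp: distrib_left mult.left_commute)
  have cong: "AE s in lborel. (LINT t|lborel. K s t * f t) = (LINT t|lborel. K s t * g t)"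
    if "sqint f" "sqint g" "AE x in lborel. f x = g x" for f g
  proof (rule AE_I2)
    fix s
    have "K s \<in> borel_measurable borel" "f \<in> borel_measurable borel" "g \<in> borel_measurable borel" using Ks[of s] that by (auto simp: sqint_def)
    then show "(LINT t|lborel. K s t * f t) = (LINT t|lborel. K s t * g t)"
      by (intro integral_cong_AE) (use that(3) in auto)
  qed
  note L = l2_operator[where \<Phi> = "\<lambda>f s. LINT t|lborel. K s t * f t" and C = A, OF schur_test[OF K A row col] A *(1) *(2)[OF _ sqint_zero] cong]
  show "bounded_linear T" "norm (T x) \<le> A * norm x" "AE s in lborel. rep_l2 (T x) s = (LINT t|lborel. K s t * rep_l2 x t)"
    unfolding T_def by (rule L; assumption?)+
qed

text \<open>The sign c admits a reflection of the argument, which occurs in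
  \<open>opR\<close>.\<close>

lemma multiplication_operator:
  assumes m: "m \<in> borel_measurable borel" "\<And>x. \<bar>m x\<bar> \<le> C" and c: "c = 1 \<or> c = -1"
  defines "T \<equiv> \<lambda>x. abs_l2 (\<lambda>s. m s * rep_l2 x (c * s))"
  shows "bounded_linear T" "AE s in lborel. rep_l2 (T x) s = m s * rep_l2 x (c * s)"
proof -
  have refl: "sqint (\<lambda>s. f (c * s))" "(LINT x|lborel. (f (c * x))\<^sup>2) = (LINT x|lborel. (f x)\<^sup>2)" if "sqint f" for f
    using c sqint_uminus[OF that] that lborel_integral_uminus[of "\<lambda>x. (f x)\<^sup>2"] by auto
  have C: "C \<ge> 0" using order_trans[OF abs_ge_zero m(2)] .
  have bd: "\<bar>m x * y\<bar> \<le> C * \<bar>y\<bar>" for x y using mult_right_mono[OF m(2)[of x], of "\<bar>y\<bar>"] by (simp add: abs_mult)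
  have sq: "sqint (\<lambda>s. m s * f (c * s))" if "sqint f" for f
    by (rule sqint_bound[OF refl(1)[OF that], where C = C]) (use m(1) refl(1)[OF that] bd in \<open>auto simp: sqint_def\<close>)
  have le: "(LINT s|lborel. (m s * f (c * s))\<^sup>2) \<le> C\<^sup>2 * (LINT x|lborel. (f x)\<^sup>2)" if f: "sqint f" for f
  proof -
    have "(LINT s|lborel. (m s * f (c * s))\<^sup>2) \<le> (LINT s|lborel. C\<^sup>2 * (f (c * s))\<^sup>2)"
    proof (rule integral_mono)
      show "integrable lborel (\<lambda>s. (m s * f (c * s))\<^sup>2)" using sq[OF f] by (simp add: sqint_def)
      show "integrable lborel (\<lambda>s. C\<^sup>2 * (f (c * s))\<^sup>2)" using refl(1)[OF f] by (simp add: sqint_def)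
      show "(m s * f (c * s))\<^sup>2 \<le> C\<^sup>2 * (f (c * s))\<^sup>2" for s
        using power_mono[OF bd[of s "f (c * s)"], of 2] by (simp add: power_mult_distrib)
    qed
    then show ?thesis by (simp add: refl(2)[OF f])
  qed
  have cong: "AE s in lborel. m s * f (c * s) = m s * g (c * s)" if "sqint f" "sqint g" "AE x in lborel. f x = g x" for f g
  proof -
    have [measurable]: "f \<in> borel_measurable borel" "g \<in> borel_measurable borel" using that by (auto simp: sqint_def)
    have "AE x in lborel. f (0 + c * x) = g (0 + c * x)"
      by (rule AE_borel_affine[OF _ _ that(3)]) (use c in auto)
    then show ?thesis by eventually_elim simp
  qed
  note L = l2_operator[where \<Phi> = "\<lambda>f s. m s * f (c * s)" and C = C, OF sq le C _ _ cong]
  show "bounded_linear T" unfolding T_def by (rule L(1)) (auto simp: algebra_simps)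
  show "AE s in lborel. rep_l2 (T x) s = m s * rep_l2 x (c * s)" unfolding T_def by (rule L(3)) (auto simp: algebra_simps)
qed

section \<open>Compactness of the weighted convolution\<close>

lemma compact_bounded_combinations:
  fixes e :: "'i \<Rightarrow> 'a::real_normed_vector"
  assumes "finite J" shows "compact {\<Sum>j\<in>J. c j *\<^sub>R e j | c. \<forall>j\<in>J. \<bar>c j\<bar> \<le> B}"
  using assms
proof (induction J)
  case empty then show ?case by simp
next
  case (insert i J)
  define S where "S = {\<Sum>j\<in>J. c j *\<^sub>R e j | c. \<forall>j\<in>J. \<bar>c j\<bar> \<le> B}"
  define R where "R = {\<Sum>j\<in>insert i J. c j *\<^sub>R e j | c. \<forall>j\<in>insert i J. \<bar>c j\<bar> \<le> B}"
  let ?f = "\<lambda>p. fst p *\<^sub>R e i + snd p"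
  have "compact (?f ` ({-B..B} \<times> S))"
    by (intro compact_continuous_image compact_Times insert.IH[folded S_def] compact_Icc continuous_intros)
  also have "?f ` ({-B..B} \<times> S) = R"
  proof (intro equalityI subsetI)
    fix v assume "v \<in> ?f ` ({-B..B} \<times> S)"
    then obtain t u where t: "t \<in> {-B..B}" and u: "u \<in> S" and v: "v = t *\<^sub>R e i + u" by auto
    from u obtain c where c: "u = (\<Sum>j\<in>J. c j *\<^sub>R e j)" "\<forall>j\<in>J. \<bar>c j\<bar> \<le> B"
      unfolding S_def by blast
    have "(\<Sum>j\<in>J. (c(i := t)) j *\<^sub>R e j) = (\<Sum>j\<in>J. c j *\<^sub>R e j)" using insert.hyps by (intro sum.cong) auto
    then have "v = (\<Sum>j\<in>insert i J. (c(i := t)) j *\<^sub>R e j)" using insert.hyps v c(1) by simp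
    moreover have "\<forall>j\<in>insert i J. \<bar>(c(i := t)) j\<bar> \<le> B" using t c(2) insert.hyps by (auto simp: abs_le_iff)
    ultimately show "v \<in> R" unfolding R_def by blast
  next
    fix v assume "v \<in> R"
    then obtain c where c: "\<forall>j\<in>insert i J. \<bar>c j\<bar> \<le> B" "v = (\<Sum>j\<in>insert i J. c j *\<^sub>R e j)" unfolding R_def by blast
    then have "v = ?f (c i, \<Sum>j\<in>J. c j *\<^sub>R e j)" using insert.hyps by simp
    moreover have "(\<Sum>j\<in>J. c j *\<^sub>R e j) \<in> S" using c(1) unfolding S_def by blast
    moreover have "c i \<in> {-B..B}" using c(1) by (auto simp: abs_le_iff)
    ultimately show "v \<in> ?f ` ({-B..B} \<times> S)" by blast
  qed
  finally show ?case unfolding R_def .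
qed

text \<open>The approximants F only have to map bounded sets into compact sets; linearity is not
  asked of them. The closure of the image sequence is totally bounded and complete, hence
  compact.\<close>

lemma compact_operator_of_approximation:
  fixes T :: "'a::real_normed_vector \<Rightarrow> 'b::{real_normed_vector,complete_space}"
  assumes approx: "\<And>e. e > 0 \<Longrightarrow> \<exists>F. (\<forall>x. norm (T x - F x) \<le> e * norm x) \<and> (\<forall>M. \<exists>C. compact C \<and> (\<forall>x. norm x \<le> M \<longrightarrow> F x \<in> C))"
  shows "\<forall>x :: nat \<Rightarrow> 'a. bounded (range x) \<longrightarrow> (\<exists>r l. strict_mono r \<and> (\<lambda>n. T (x (r n))) \<longlonglongrightarrow> l)"
proof (intro allI impI)
  fix x :: "nat \<Rightarrow> 'a" assume "bounded (range x)"
  then obtain M where M: "M > 0" "\<And>n. norm (x n) \<le> M" by (auto simp: bounded_pos)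
  define S where "S = closure (range (\<lambda>n. T (x n)))"
  have "compact S"
    unfolding compact_eq_totally_bounded
  proof (intro conjI allI impI)
    show "Topological_Spaces.complete S" using complete_UNIV complete_Int_closed[of UNIV S] by (simp add: Int_commute S_def)
    fix \<epsilon> :: real assume \<epsilon>: "\<epsilon> > 0"
    then have "\<epsilon> / (4 * M) > 0" using M(1) by simp
    then obtain F where F: "\<And>x. norm (T x - F x) \<le> \<epsilon> / (4 * M) * norm x" "\<forall>M. \<exists>C. compact C \<and> (\<forall>x. norm x \<le> M \<longrightarrow> F x \<in> C)"
      using approx by blast
    then obtain C where C: "compact C" "\<And>x. norm x \<le> M \<Longrightarrow> F x \<in> C" by blast
    have "\<epsilon> / 4 > 0" using \<epsilon> by simp
    with C(1) obtain k where k: "finite k" "C \<subseteq> (\<Union>x\<in>k. ball x (\<epsilon> / 4))" unfolding compact_eq_totally_bounded by blast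
    have "range (\<lambda>n. T (x n)) \<subseteq> (\<Union>c\<in>k. cball c (\<epsilon> / 2))"
    proof safe
      fix n
      obtain c where c: "c \<in> k" "dist c (F (x n)) < \<epsilon> / 4" using k(2) C(2)[OF M(2)[of n]] by auto
      have "norm (T (x n) - F (x n)) \<le> \<epsilon> / (4 * M) * M"
        by (rule order_trans[OF F(1)]) (intro mult_left_mono M, use \<epsilon> M in simp)
      also have "\<dots> = \<epsilon> / 4" using M(1) by simp
      finally have "dist (F (x n)) (T (x n)) \<le> \<epsilon> / 4" by (simp add: dist_norm norm_minus_commute)
      then have "dist c (T (x n)) \<le> \<epsilon> / 2" using c(2) dist_triangle[of c "T (x n)" "F (x n)"] by linarith
      then show "T (x n) \<in> (\<Union>c\<in>k. cball c (\<epsilon> / 2))" using c(1) by auto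
    qed
    then have "S \<subseteq> (\<Union>c\<in>k. cball c (\<epsilon> / 2))"
      unfolding S_def by (intro closure_minimal closed_UN k) auto
    also have "\<dots> \<subseteq> (\<Union>c\<in>k. ball c \<epsilon>)" using \<epsilon> by (auto intro!: UN_mono)
    finally show "\<exists>k. finite k \<and> S \<subseteq> (\<Union>x\<in>k. ball x \<epsilon>)" using k(1) by blast
  qed
  moreover have "\<forall>n. T (x n) \<in> S" unfolding S_def using closure_subset[of "range (\<lambda>n. T (x n))"] by blast
  ultimately obtain l r where "strict_mono (r :: nat \<Rightarrow> nat)" "((\<lambda>n. T (x n)) \<circ> r) \<longlonglongrightarrow> l"
    using seq_compactE[OF compact_imp_seq_compact[OF \<open>compact S\<close>], of "\<lambda>n. T (x n)"] by metis
  then show "\<exists>r l. strict_mono r \<and> (\<lambda>n. T (x (r n))) \<longlonglongrightarrow> l" by (auto simp: o_def)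
qed

text \<open>Off a large square one of the two weights is small. On the square the kernel is
  uniformly continuous and can be replaced by a step function in s, which gives an operator of
  finite rank. The Schur test turns both kernel errors into one bound for the operator norm.\<close>

lemma conv_kernel_compact:
  fixes \<kappa> w :: "real \<Rightarrow> real"
  assumes \<kappa>: "continuous_on UNIV \<kappa>" "integrable lborel \<kappa>" "sqint \<kappa>"
    and w: "continuous_on UNIV w" "\<And>x. 0 \<le> w x" "\<And>x. w x \<le> 1"
    and decay: "\<And>\<tau>. \<tau> > 0 \<Longrightarrow> \<exists>R. \<forall>x. \<bar>x\<bar> > R \<longrightarrow> w x \<le> \<tau>"
  defines "T \<equiv> \<lambda>x. abs_l2 (\<lambda>s. LINT t|lborel. w s * \<kappa> (s - t) * w t * rep_l2 x t)"
  shows "bounded_linear T" "AE s in lborel. rep_l2 (T x) s = (LINT t|lborel. w s * \<kappa> (s - t) * w t * rep_l2 x t)"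
    "\<forall>x :: nat \<Rightarrow> l2. bounded (range x) \<longrightarrow> (\<exists>r l. strict_mono r \<and> (\<lambda>n. T (x (r n))) \<longlonglongrightarrow> l)"
proof -
  have [measurable]: "\<kappa> \<in> borel_measurable borel" "w \<in> borel_measurable borel"
    using \<kappa>(1) w(1) by (auto intro: borel_measurable_continuous_onI)
  define I where "I = (LINT x|lborel. \<bar>\<kappa> x\<bar>)"
  have I0: "I \<ge> 0" by (simp add: I_def)
  have I: "(\<integral>\<^sup>+x. ennreal \<bar>\<kappa> x\<bar> \<partial>lborel) = ennreal I"
    unfolding I_def by (rule nn_integral_eq_integral) (use \<kappa>(2) in auto)
  have Ish: "(\<integral>\<^sup>+y. ennreal \<bar>\<kappa> (x - y)\<bar> \<partial>lborel) = ennreal I" "(\<integral>\<^sup>+x. ennreal \<bar>\<kappa> (x - y)\<bar> \<partial>lborel) = ennreal I" for x y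
    using nn_integral_lborel_shift[of "\<lambda>x. ennreal \<bar>\<kappa> x\<bar>"] I by simp_all
  define K where "K s t = w s * \<kappa> (s - t) * w t" for s t
  have Km[measurable]: "(\<lambda>(s, t). K s t) \<in> borel_measurable (borel \<Otimes>\<^sub>M borel)" unfolding K_def by measurable
  \<comment> \<open>One small weight is enough, as the other is at most 1.\<close>
  have ww: "\<bar>w s * w t\<bar> \<le> \<tau>" if "w s \<le> \<tau> \<or> w t \<le> \<tau>" for s t \<tau>
  proof -
    have "w s * w t \<le> w s" "w s * w t \<le> w t" using w(2,3) by (auto simp: mult_left_le mult_left_le_one_le)
    then show ?thesis using that w(2) by (auto simp: abs_mult)
  qed
  have Kle: "\<bar>K s t\<bar> \<le> \<tau> * \<bar>\<kappa> (s - t)\<bar>" if "w s \<le> \<tau> \<or> w t \<le> \<tau>" for s t \<tau>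
    using mult_right_mono[OF ww[OF that], of "\<bar>\<kappa> (s - t)\<bar>"] by (simp add: K_def abs_mult mult_ac)
  have K1: "\<bar>K s t\<bar> \<le> \<bar>\<kappa> (s - t)\<bar>" for s t using Kle[of s 1 t] w(3) by simp
  have sh: "sqint (\<lambda>t. \<kappa> (s - t))" for s
    using L2_shift[of "\<lambda>x. complex_of_real (\<kappa> x)" s] \<kappa>(3) by (simp only: sqint_iff_L2)
  have Ks: "sqint (K s)" for s
    by (rule sqint_bound[OF sh[of s], where C = 1]) (use K1 in \<open>auto simp: K_def[abs_def]\<close>)
  have row: "(\<integral>\<^sup>+y. ennreal \<bar>K x y\<bar> \<partial>lborel) \<le> ennreal I" and col: "(\<integral>\<^sup>+x. ennreal \<bar>K x y\<bar> \<partial>lborel) \<le> ennreal I" for x y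
    by (rule order_trans[OF nn_integral_mono[OF ennreal_leI[OF K1]]]; simp add: Ish)+
  note ko = kernel_operator[OF Km I0 row col Ks]
  have TK: "T = (\<lambda>x. abs_l2 (\<lambda>s. LINT t|lborel. K s t * rep_l2 x t))" unfolding T_def K_def ..
  show "bounded_linear T" unfolding TK by (rule ko(1))
  show "AE s in lborel. rep_l2 (T x) s = (LINT t|lborel. w s * \<kappa> (s - t) * w t * rep_l2 x t)" for x
    using ko(3)[of x] unfolding TK by (simp add: K_def)
  show "\<forall>x :: nat \<Rightarrow> l2. bounded (range x) \<longrightarrow> (\<exists>r l. strict_mono r \<and> (\<lambda>n. T (x (r n))) \<longlonglongrightarrow> l)"
  proof (rule compact_operator_of_approximation)
    fix e :: real assume e: "e > 0"
    \<comment> \<open>\<tau> lets the tail contribute at most e / 2 to every row and column;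
      \<epsilon> below does the same for the square, whose rows and columns have length 2 R.\<close>
    define \<tau> where "\<tau> = e / (2 * (I + 1))"
    have \<tau>: "\<tau> > 0" "\<tau> * I \<le> e / 2" using e I0 by (auto simp: \<tau>_def field_simps add_pos_nonneg)
    obtain R0 where R0: "\<And>x. \<bar>x\<bar> > R0 \<Longrightarrow> w x \<le> \<tau>" using decay[OF \<tau>(1)] by blast
    define R where "R = max R0 1"
    have R: "R \<ge> 1" "\<And>x. \<bar>x\<bar> > R \<Longrightarrow> w x \<le> \<tau>" using R0 by (auto simp: R_def)
    define \<epsilon> where "\<epsilon> = e / (4 * R)"
    have \<epsilon>: "\<epsilon> > 0" using e R by (simp add: \<epsilon>_def)
    \<comment> \<open>The margin is for the grid point \<open>\<sigma> s\<close>, which lies below s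
      and may fall short of - R by less than h \<le> 1.\<close>
    let ?B = "{- R - 1..R + 1}"
    have "continuous_on (?B \<times> ?B) (\<lambda>p. K (fst p) (snd p))"
      unfolding K_def by (intro continuous_intros continuous_on_compose2[OF w(1)] continuous_on_compose2[OF \<kappa>(1)]) auto
    then have "uniformly_continuous_on (?B \<times> ?B) (\<lambda>p. K (fst p) (snd p))"
      by (intro compact_uniformly_continuous compact_Times compact_Icc)
    then obtain d where d: "d > 0" "\<And>p p'. p \<in> ?B \<times> ?B \<Longrightarrow> p' \<in> ?B \<times> ?B \<Longrightarrow> dist p' p < d \<Longrightarrow> dist (K (fst p') (snd p')) (K (fst p) (snd p)) < \<epsilon>"
      using \<epsilon> unfolding uniformly_continuous_on_def by metis
    define h where "h = min (d / 2) 1"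
    have h: "0 < h" "h < d" "h \<le> 1" using d(1) by (auto simp: h_def)
    define \<sigma> where "\<sigma> s = of_int \<lfloor>s / h\<rfloor> * h" for s
    have \<sigma>: "\<sigma> s \<le> s" "s < \<sigma> s + h" for s
    proof -
      have "of_int \<lfloor>s / h\<rfloor> \<le> s / h" "s / h < of_int \<lfloor>s / h\<rfloor> + 1" by linarith+
      then show "\<sigma> s \<le> s" "s < \<sigma> s + h" unfolding \<sigma>_def
        by (simp_all only: pos_le_divide_eq[OF h(1)] pos_divide_less_eq[OF h(1)] distrib_right mult_1)
    qed
    define cut where "cut = indicat_real {-R..R}"
    have [measurable]: "cut \<in> borel_measurable borel" "\<sigma> \<in> borel_measurable borel" unfolding cut_def \<sigma>_def by measurable
    define L where "L s t = cut s * cut t * K (\<sigma> s) t" for s t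
    have Lm[measurable]: "(\<lambda>(s, t). L s t) \<in> borel_measurable (borel \<Otimes>\<^sub>M borel)" unfolding L_def K_def by measurable
    have diff: "\<bar>K s t - L s t\<bar> \<le> \<epsilon> * (cut s * cut t) + \<tau> * \<bar>\<kappa> (s - t)\<bar>" for s t
    proof (cases "\<bar>s\<bar> \<le> R \<and> \<bar>t\<bar> \<le> R")
      case True
      then have "dist (K (fst (\<sigma> s, t)) (snd (\<sigma> s, t))) (K (fst (s, t)) (snd (s, t))) < \<epsilon>"
        using \<sigma>[of s] h by (intro d(2)) (auto simp: dist_Pair_Pair dist_real_def abs_le_iff)
      then show ?thesis using True \<tau>(1) by (auto simp: L_def cut_def dist_real_def abs_minus_commute abs_le_iff intro: add_increasing2)
    next
      case False
      then have "L s t = 0" by (auto simp: L_def cut_def indicator_def)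
      moreover have "w s \<le> \<tau> \<or> w t \<le> \<tau>" using False R(2) by (auto simp: not_le)
      moreover have "0 \<le> \<epsilon> * (cut s * cut t)" using \<epsilon> by (simp add: cut_def)
      ultimately show ?thesis using Kle[of s \<tau> t] by auto
    qed
    have cutint: "(\<integral>\<^sup>+x. ennreal (cut x) \<partial>lborel) = ennreal (2 * R)"
      using R(1) by (simp add: cut_def ennreal_indicator emeasure_lborel_Icc_eq)
    have cut01: "0 \<le> cut x" "cut x \<le> 1" for x by (auto simp: cut_def indicator_def)
    have rowcol: "(\<integral>\<^sup>+t. ennreal (\<epsilon> * (cut s * cut t) + \<tau> * \<bar>\<kappa> (s - t)\<bar>) \<partial>lborel) \<le> ennreal e"
       "(\<integral>\<^sup>+s. ennreal (\<epsilon> * (cut s * cut t) + \<tau> * \<bar>\<kappa> (s - t)\<bar>) \<partial>lborel) \<le> ennreal e" for s t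
    proof -
      have tot: "ennreal (\<epsilon> * (2 * R)) + ennreal (\<tau> * I) \<le> ennreal e"
      proof -
        have "\<epsilon> * (2 * R) = e / 2" using R by (simp add: \<epsilon>_def)
        then have "\<epsilon> * (2 * R) + \<tau> * I \<le> e" using \<tau> by simp
        then show ?thesis using \<tau> \<epsilon> R I0 by (subst ennreal_plus[symmetric]) (auto simp del: ennreal_plus intro!: ennreal_leI)
      qed
      have split: "ennreal (\<epsilon> * (cut s * cut t) + \<tau> * \<bar>\<kappa> (s - t)\<bar>) = ennreal (\<epsilon> * (cut s * cut t)) + ennreal \<tau> * ennreal \<bar>\<kappa> (s - t)\<bar>" for s t
        using \<epsilon> \<tau> cut01 by (simp add: ennreal_mult)
      have p: "ennreal (\<epsilon> * (cut s * cut t)) \<le> ennreal \<epsilon> * ennreal (cut t)" "ennreal (\<epsilon> * (cut s * cut t)) \<le> ennreal \<epsilon> * ennreal (cut s)" for s t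
        using \<epsilon> cut01 by (auto simp: ennreal_mult[symmetric] mult_left_le mult_left_le_one_le intro!: ennreal_leI mult_left_mono)
      have "(\<integral>\<^sup>+t. ennreal (\<epsilon> * (cut s * cut t) + \<tau> * \<bar>\<kappa> (s - t)\<bar>) \<partial>lborel) \<le> (\<integral>\<^sup>+t. ennreal \<epsilon> * ennreal (cut t) + ennreal \<tau> * ennreal \<bar>\<kappa> (s - t)\<bar> \<partial>lborel)"
        unfolding split by (intro nn_integral_mono add_mono p order_refl)
      also have "\<dots> = ennreal (\<epsilon> * (2 * R)) + ennreal (\<tau> * I)"
        using \<epsilon> \<tau> R I0 by (subst nn_integral_add) (auto simp: nn_integral_cmult Ish cutint ennreal_mult)
      finally show "(\<integral>\<^sup>+t. ennreal (\<epsilon> * (cut s * cut t) + \<tau> * \<bar>\<kappa> (s - t)\<bar>) \<partial>lborel) \<le> ennreal e" using tot by (rule order_trans)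
      have "(\<integral>\<^sup>+s. ennreal (\<epsilon> * (cut s * cut t) + \<tau> * \<bar>\<kappa> (s - t)\<bar>) \<partial>lborel) \<le> (\<integral>\<^sup>+s. ennreal \<epsilon> * ennreal (cut s) + ennreal \<tau> * ennreal \<bar>\<kappa> (s - t)\<bar> \<partial>lborel)"
        unfolding split by (intro nn_integral_mono add_mono p order_refl)
      also have "\<dots> = ennreal (\<epsilon> * (2 * R)) + ennreal (\<tau> * I)"
        using \<epsilon> \<tau> R I0 by (subst nn_integral_add) (auto simp: nn_integral_cmult Ish cutint ennreal_mult)
      finally show "(\<integral>\<^sup>+s. ennreal (\<epsilon> * (cut s * cut t) + \<tau> * \<bar>\<kappa> (s - t)\<bar>) \<partial>lborel) \<le> ennreal e" using tot by (rule order_trans)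
    qed
    define D where "D s t = K s t - L s t" for s t
    have Dm: "(\<lambda>(s, t). D s t) \<in> borel_measurable (borel \<Otimes>\<^sub>M borel)" unfolding D_def by measurable
    have Drow: "(\<integral>\<^sup>+t. ennreal \<bar>D s t\<bar> \<partial>lborel) \<le> ennreal e" and Dcol: "(\<integral>\<^sup>+s. ennreal \<bar>D s t\<bar> \<partial>lborel) \<le> ennreal e" for s t
      unfolding D_def by (rule order_trans[OF nn_integral_mono[OF ennreal_leI[OF diff]]]; rule rowcol)+
    have cutK: "sqint (\<lambda>t. cut t * K s t)" for s
    proof (rule sqint_bound[OF Ks[of s], where C = 1])
      show "(\<lambda>t. cut t * K s t) \<in> borel_measurable borel" unfolding K_def by measurable
      show "\<bar>cut t * K s t\<bar> \<le> 1 * \<bar>K s t\<bar>" for t using cut01[of t] by (simp add: abs_mult mult_left_le_one_le)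
    qed
    have Ls: "sqint (L s)" for s
      using sqint_scale[OF cutK[of "\<sigma> s"], of "cut s"] by (simp add: L_def[abs_def] mult.assoc)
    have Ds: "sqint (D s)" for s unfolding D_def by (intro sqint_diff Ks Ls)
    note kd = kernel_operator[OF Dm less_imp_le[OF e] Drow Dcol Ds]
    \<comment> \<open>Indices of the grid cells that meet the interval from - R to R. On each cell
      the factor \<open>K (\<sigma> s) t\<close> does not depend on s, so \<open>F\<close> is a
      combination of finitely many cell indicators \<open>g j\<close>.\<close>
    define J where "J = {\<lfloor>- R / h\<rfloor>..\<lfloor>R / h\<rfloor>}"
    define g where "g j s = cut s * indicat_real {s. \<lfloor>s / h\<rfloor> = j} s" for j :: int and s
    define c where "c x j = (LINT t|lborel. cut t * K (of_int j * h) t * rep_l2 x t)" for x and j :: int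
    have cutsq: "sqint cut"
    proof -
      have "integrable lborel cut" unfolding cut_def by (intro integrable_real_indicator) (auto simp: emeasure_lborel_Icc_eq)
      moreover have "(cut x)\<^sup>2 = cut x" for x by (simp add: cut_def indicator_def)
      ultimately show ?thesis by (simp add: sqint_def)
    qed
    have gs: "sqint (g j)" for j
      by (rule sqint_bound[OF cutsq, where C = 1]) (auto simp: g_def[abs_def] abs_mult indicator_def)
    define F where "F x = (\<Sum>j\<in>J. c x j *\<^sub>R abs_l2 (g j))" for x
    have Frep: "AE s in lborel. rep_l2 (F x) s = (LINT t|lborel. L s t * rep_l2 x t)" for x
    proof -
      have fin: "finite J" by (simp add: J_def)
      have "AE s in lborel. rep_l2 (\<Sum>j\<in>S. c x j *\<^sub>R abs_l2 (g j)) s = (\<Sum>j\<in>S. c x j * g j s)" if "finite S" for S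
        using that
      proof (induction S)
        case empty then show ?case using rep_zero by simp
      next
        case (insert i S)
        from insert.IH rep_plus[of "c x i *\<^sub>R abs_l2 (g i)" "\<Sum>j\<in>S. c x j *\<^sub>R abs_l2 (g j)"]
          rep_scaleR[of "c x i" "abs_l2 (g i)"] rep_abs_l2[OF gs[of i]]
        show ?case by eventually_elim (use insert.hyps in simp)
      qed
      from this[OF fin] show ?thesis
        unfolding F_def
      proof eventually_elim
        case (elim s)
        have "(\<Sum>j\<in>J. c x j * g j s) = (LINT t|lborel. L s t * rep_l2 x t)"
        proof (cases "\<bar>s\<bar> \<le> R")
          case True
          then have "- R / h \<le> s / h" "s / h \<le> R / h" using h(1) divide_right_mono[of "- R" s h] divide_right_mono[of s R h] by (auto simp: abs_le_iff)
          then have sJ: "\<lfloor>s / h\<rfloor> \<in> J" unfolding J_def by (auto intro: floor_mono)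
          have "(\<Sum>j\<in>J. c x j * g j s) = (\<Sum>j\<in>J. if \<lfloor>s / h\<rfloor> = j then c x j * cut s else 0)"
            by (intro sum.cong) (auto simp: g_def)
          also have "\<dots> = c x \<lfloor>s / h\<rfloor> * cut s" using sJ fin by simp
          also have "\<dots> = (LINT t|lborel. cut s * (cut t * K (\<sigma> s) t * rep_l2 x t))" by (simp add: c_def \<sigma>_def)
          finally show ?thesis by (simp add: L_def mult.assoc)
        next
          case False
          then have "cut s = 0" by (auto simp: cut_def indicator_def)
          then show ?thesis by (simp add: g_def L_def)
        qed
        then show ?case using elim by simp
      qed
    qed
    have TF: "norm (T x - F x) \<le> e * norm x" for x
    proof -
      have "T x - F x = abs_l2 (\<lambda>s. LINT t|lborel. D s t * rep_l2 x t)"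
      proof (rule l2_eqI)
        have "(LINT t|lborel. D s t * rep_l2 x t) = (LINT t|lborel. K s t * rep_l2 x t) - (LINT t|lborel. L s t * rep_l2 x t)" for s
          using sqint_mult[OF Ks[of s] sqint_rep] sqint_mult[OF Ls[of s] sqint_rep] by (simp add: D_def left_diff_distrib)
        then show "AE s in lborel. rep_l2 (T x - F x) s = rep_l2 (abs_l2 (\<lambda>s. LINT t|lborel. D s t * rep_l2 x t)) s"
          using rep_minus[of "T x" "F x"] ko(3)[of x] Frep[of x] kd(3)[of x] unfolding TK
          by (elim AE_mp) (auto intro!: AE_I2)
      qed
      then show ?thesis using kd(2)[of x] by simp
    qed
    have "\<exists>C. compact C \<and> (\<forall>x. norm x \<le> M \<longrightarrow> F x \<in> C)" for M
    proof -
      define b where "b j = norm (abs_l2 (\<lambda>t. cut t * K (of_int j * h) t))" for j :: int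
      define Bd where "Bd = (\<Sum>j\<in>J. b j) * \<bar>M\<bar>"
      have cb: "\<bar>c x j\<bar> \<le> b j * norm x" for x j
      proof -
        have "c x j = abs_l2 (\<lambda>t. cut t * K (of_int j * h) t) \<bullet> x"
          unfolding c_def inner_l2_def
          by (rule integral_cong_AE) (use rep_abs_l2[OF cutK[of "of_int j * h"]] in \<open>auto simp: K_def\<close>)
        then show ?thesis using Cauchy_Schwarz_ineq2 by (simp add: b_def)
      qed
      have "F x \<in> {\<Sum>j\<in>J. c j *\<^sub>R abs_l2 (g j) | c. \<forall>j\<in>J. \<bar>c j\<bar> \<le> Bd}" if x: "norm x \<le> M" for x
      proof -
        have "\<bar>c x j\<bar> \<le> Bd" if "j \<in> J" for j
        proof -
          have "\<bar>c x j\<bar> \<le> b j * norm x" by (rule cb)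
          also have "\<dots> \<le> (\<Sum>j\<in>J. b j) * \<bar>M\<bar>"
            using that x by (intro mult_mono member_le_sum sum_nonneg) (auto simp: b_def J_def)
          finally show ?thesis by (simp add: Bd_def)
        qed
        then show ?thesis unfolding F_def by blast
      qed
      moreover have "compact {\<Sum>j\<in>J. c j *\<^sub>R abs_l2 (g j) | c. \<forall>j\<in>J. \<bar>c j\<bar> \<le> Bd}"
        by (rule compact_bounded_combinations) (simp add: J_def)
      ultimately show ?thesis by blast
    qed
    then show "\<exists>F. (\<forall>x. norm (T x - F x) \<le> e * norm x) \<and> (\<forall>M. \<exists>C. compact C \<and> (\<forall>x. norm x \<le> M \<longrightarrow> F x \<in> C))"
      using TF by blast
  qed
qed

section \<open>The pencil of the linearized problem\<close>

text \<open>Evenness makes \<kappa> (s - t) a symmetric kernel; \<open>integrable_schur\<close>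
  justifies the exchange of the integrals for merely square integrable f and g.\<close>

lemma conv_form_symmetric:
  fixes \<kappa> f g :: "real \<Rightarrow> real"
  assumes \<kappa>: "integrable lborel \<kappa>" and even: "\<And>x. \<kappa> (- x) = \<kappa> x" and f: "sqint f" and g: "sqint g"
  shows "(LINT s|lborel. f s * (LINT t|lborel. \<kappa> (s - t) * g t)) = (LINT s|lborel. g s * (LINT t|lborel. \<kappa> (s - t) * f t))"
proof -
  have "integrable (lborel \<Otimes>\<^sub>M lborel) (\<lambda>(x, y). complex_of_real (f x) * complex_of_real (g y) * complex_of_real (\<kappa> (x - y)))"
    using integrable_schur[of "\<lambda>x. complex_of_real (f x)" "\<lambda>x. complex_of_real (g x)" "\<lambda>x. complex_of_real (\<kappa> x)"] \<kappa> f g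
    by (simp add: sqint_iff_L2[symmetric] complex_of_real_integrable_eq)
  then have "integrable (lborel \<Otimes>\<^sub>M lborel) (\<lambda>p. complex_of_real (case p of (x, y) \<Rightarrow> f x * g y * \<kappa> (x - y)))"
    by (simp add: case_prod_beta')
  then have i: "integrable (lborel \<Otimes>\<^sub>M lborel) (\<lambda>(x, y). f x * g y * \<kappa> (x - y))" by (simp only: complex_of_real_integrable_eq)
  have "(LINT s|lborel. f s * (LINT t|lborel. \<kappa> (s - t) * g t)) = (LINT s|lborel. LINT t|lborel. f s * g t * \<kappa> (s - t))"
    by (subst integral_mult_right_zero[symmetric]) (simp add: mult_ac)
  also have "\<dots> = (LINT t|lborel. LINT s|lborel. f s * g t * \<kappa> (s - t))"
    by (rule lborel_pair.Fubini_integral[symmetric, OF i])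
  also have "\<dots> = (LINT s|lborel. g s * (LINT t|lborel. \<kappa> (s - t) * f t))"
  proof (rule Bochner_Integration.integral_cong[OF refl])
    fix t
    have "\<kappa> (s - t) = \<kappa> (t - s)" for s using even[of "s - t"] by simp
    then show "(LINT s|lborel. f s * g t * \<kappa> (s - t)) = g t * (LINT s|lborel. \<kappa> (t - s) * f s)"
      by (subst integral_mult_right_zero[symmetric]) (simp add: mult_ac)
  qed
  finally show ?thesis .
qed

lemma conv_sqint:
  fixes \<kappa> f :: "real \<Rightarrow> real"
  assumes \<kappa>: "integrable lborel \<kappa>" and f: "sqint f"
  shows "sqint (\<lambda>s. LINT t|lborel. \<kappa> (s - t) * f t)"
    "(LINT s|lborel. (LINT t|lborel. \<kappa> (s - t) * f t)\<^sup>2) \<le> (LINT x|lborel. \<bar>\<kappa> x\<bar>)\<^sup>2 * (LINT x|lborel. (f x)\<^sup>2)"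
proof -
  have [measurable]: "\<kappa> \<in> borel_measurable borel" using \<kappa> by auto
  have I: "(\<integral>\<^sup>+x. ennreal \<bar>\<kappa> x\<bar> \<partial>lborel) = ennreal (LINT x|lborel. \<bar>\<kappa> x\<bar>)"
    by (rule nn_integral_eq_integral) (use \<kappa> in auto)
  have m: "(\<lambda>(s, t). \<kappa> (s - t)) \<in> borel_measurable (borel \<Otimes>\<^sub>M borel)" by measurable
  have r: "(\<integral>\<^sup>+y. ennreal \<bar>\<kappa> (x - y)\<bar> \<partial>lborel) \<le> ennreal (LINT x|lborel. \<bar>\<kappa> x\<bar>)" "(\<integral>\<^sup>+x. ennreal \<bar>\<kappa> (x - y)\<bar> \<partial>lborel) \<le> ennreal (LINT x|lborel. \<bar>\<kappa> x\<bar>)" for x y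
    using nn_integral_lborel_shift[of "\<lambda>x. ennreal \<bar>\<kappa> x\<bar>"] I by simp_all
  have I0: "(LINT x|lborel. \<bar>\<kappa> x\<bar>) \<ge> 0" by simp
  show "sqint (\<lambda>s. LINT t|lborel. \<kappa> (s - t) * f t)"
    "(LINT s|lborel. (LINT t|lborel. \<kappa> (s - t) * f t)\<^sup>2) \<le> (LINT x|lborel. \<bar>\<kappa> x\<bar>)\<^sup>2 * (LINT x|lborel. (f x)\<^sup>2)"
    by (rule schur_test[OF m I0 r f])+
qed

lemma sqint_Cauchy_Schwarz:
  assumes f: "sqint f" and g: "sqint g"
  shows "(LINT x|lborel. f x * g x)\<^sup>2 \<le> (LINT x|lborel. (f x)\<^sup>2) * (LINT x|lborel. (g x)\<^sup>2)"
proof -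
  have "complex_of_real (LINT x|lborel. f x * g x) = (LINT x|lborel. complex_of_real (f x) * complex_of_real (g x))"
    by (simp flip: integral_complex_of_real)
  then have "(cmod (LINT x|lborel. complex_of_real (f x) * complex_of_real (g x)))\<^sup>2 = (LINT x|lborel. f x * g x)\<^sup>2"
    by (metis norm_of_real power2_abs)
  then show ?thesis using L2_Cauchy_Schwarz[of "\<lambda>x. complex_of_real (f x)" "\<lambda>x. complex_of_real (g x)"] f g
    by (simp add: sqint_iff_L2)
qed

lemma conv_form_le:
  fixes \<kappa> f :: "real \<Rightarrow> real"
  assumes \<kappa>: "integrable lborel \<kappa>" and f: "sqint f"
  shows "(LINT s|lborel. f s * (LINT t|lborel. \<kappa> (s - t) * f t)) \<le> (LINT x|lborel. \<bar>\<kappa> x\<bar>) * (LINT x|lborel. (f x)\<^sup>2)"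
proof -
  let ?I = "LINT x|lborel. \<bar>\<kappa> x\<bar>" and ?F = "LINT x|lborel. (f x)\<^sup>2"
  have "(LINT s|lborel. f s * (LINT t|lborel. \<kappa> (s - t) * f t))\<^sup>2 \<le> ?F * (?I\<^sup>2 * ?F)"
    by (rule order_trans[OF sqint_Cauchy_Schwarz[OF f conv_sqint(1)[OF \<kappa> f]]])
      (intro mult_left_mono conv_sqint(2)[OF \<kappa> f], simp)
  also have "\<dots> = (?I * ?F)\<^sup>2" by (simp add: power2_eq_square)
  finally show ?thesis by (rule power2_le_imp_le) simp
qed

section \<open>The operators of the pencil and their quadratic form\<close>

context ground_wave
begin

definition den :: "real \<Rightarrow> real" where "den x = \<bar>x\<bar> powr a * x\<^sup>2 + x\<^sup>2 + 1"
\<comment> \<open>\<open>den / x\<^sup>2\<close> is the symbol \<open>\<bar>x\<bar> powr a + 1 + k / x\<^sup>2\<close> at \<open>k = 1\<close>; \<open>wt\<close> is its inverse square root.\<close>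
definition wt :: "real \<Rightarrow> real" where "wt x = \<bar>x\<bar> / sqrt (den x)"
text \<open>The factor 1 / pi combines the 2 from linearizing Q^2 with the 1 / (2 pi) that turns a
  product into a convolution.\<close>

definition ker :: "real \<Rightarrow> real" where "ker x = q x / pi"
definition opT :: "l2 \<Rightarrow> l2" where "opT x = abs_l2 (\<lambda>s. LINT t|lborel. wt s * ker (s - t) * wt t * rep_l2 x t)"
definition opN :: "l2 \<Rightarrow> l2" where "opN x = abs_l2 (\<lambda>s. 1 / den s * rep_l2 x (1 * s))"
text \<open>A Hermitian V is encoded by Z = Re V + Im V, so that Z (- s) = Re V - Im V.
  Multiplication of V by \<i> s sends Z to s Z (- s), which explains the reflection; the denominator
  comes from the conjugation by \<open>wt\<close>.\<close>

definition opR :: "l2 \<Rightarrow> l2" where "opR x = abs_l2 (\<lambda>s. s / den s * rep_l2 x (- 1 * s))"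

lemma den_ge: "den x \<ge> 1" "den x > 0" "x\<^sup>2 \<le> den x" "den (- x) = den x"
  by (auto simp: den_def add_nonneg_pos add_nonneg_nonneg add_increasing)

lemma den_continuous: "continuous_on UNIV den"
  unfolding den_def[abs_def] by (intro continuous_intros continuous_abs_powr a_pos)

lemma wt_props: "0 \<le> wt x" "wt x \<le> 1" "(wt x)\<^sup>2 = x\<^sup>2 / den x" "wt (- x) = wt x" "x \<noteq> 0 \<Longrightarrow> wt x > 0" "wt 0 = 0"
proof -
  show "0 \<le> wt x" "(wt x)\<^sup>2 = x\<^sup>2 / den x" "wt (- x) = wt x" "x \<noteq> 0 \<Longrightarrow> wt x > 0" "wt 0 = 0"
    using den_ge(2)[of x] den_ge(4)[of x] by (auto simp: wt_def power_divide)
  have "\<bar>x\<bar> \<le> sqrt (den x)" using den_ge(3)[of x] by (intro real_le_rsqrt) simp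
  then show "wt x \<le> 1" using den_ge(2)[of x] by (simp add: wt_def divide_le_eq)
qed

lemma wt_continuous: "continuous_on UNIV wt"
  unfolding wt_def[abs_def] using den_ge(2) by (intro continuous_intros den_continuous) (auto simp: less_imp_neq[symmetric])

lemma wt_decay: assumes "\<tau> > 0" shows "\<exists>R. \<forall>x. \<bar>x\<bar> > R \<longrightarrow> wt x \<le> \<tau>"
proof (intro exI allI impI)
  \<comment> \<open>Beyond this radius |x| powr a is at least 1 / \<tau>^2, which forces x^2 / den x
    below \<tau>^2.\<close>
  fix x assume x: "\<bar>x\<bar> > (1 / \<tau>\<^sup>2) powr (1 / a)"
  then have x0: "x \<noteq> 0" by auto
  have "((1 / \<tau>\<^sup>2) powr (1 / a)) powr a \<le> \<bar>x\<bar> powr a" using x a_pos by (intro powr_mono2) auto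
  then have xa: "1 / \<tau>\<^sup>2 \<le> \<bar>x\<bar> powr a" using a_pos assms by (simp add: powr_powr)
  have "x\<^sup>2 / \<tau>\<^sup>2 \<le> \<bar>x\<bar> powr a * x\<^sup>2" using mult_right_mono[OF xa, of "x\<^sup>2"] by simp
  also have "\<dots> \<le> den x" by (simp add: den_def)
  finally have "x\<^sup>2 / den x \<le> \<tau>\<^sup>2" using den_ge(2)[of x] assms by (simp add: field_simps)
  then have "(wt x)\<^sup>2 \<le> \<tau>\<^sup>2" by (simp add: wt_props)
  then show "wt x \<le> \<tau>" by (rule power2_le_imp_le) (use assms in simp)
qed

lemma ker_props: "continuous_on UNIV ker" "integrable lborel ker" "sqint ker" "ker (- x) = ker x"
proof -
  show "continuous_on UNIV ker" unfolding ker_def[abs_def] by (intro continuous_intros q_continuous) auto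
  have "integrable lborel q" using rapid_integrable[OF q_rapid] by (simp add: cplx_def[abs_def] complex_of_real_integrable_eq)
  then show "integrable lborel ker" unfolding ker_def[abs_def] by auto
  have "sqint q" using rapid_L2[OF q_rapid] by (simp add: sqint_iff_L2 cplx_def[abs_def])
  then show "sqint ker" using sqint_scale[of q "1 / pi"] by (simp add: ker_def[abs_def])
  show "ker (- x) = ker x" by (simp add: ker_def q_even)
qed

lemmas opT_props = conv_kernel_compact[OF ker_props(1,2,3) wt_continuous wt_props(1,2) wt_decay, folded opT_def]

lemma measurable_den_wt[measurable]: "den \<in> borel_measurable borel" "wt \<in> borel_measurable borel" "ker \<in> borel_measurable borel"
  by (intro borel_measurable_continuous_onI den_continuous wt_continuous ker_props)+

lemma opN_props: "bounded_linear opN" "AE s in lborel. rep_l2 (opN x) s = 1 / den s * rep_l2 x s"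
proof -
  have b: "\<bar>1 / den x\<bar> \<le> 1" for x using den_ge(1,2)[of x] by simp
  note M = multiplication_operator[where m = "\<lambda>x. 1 / den x" and C = 1 and c = 1, folded opN_def]
  show "bounded_linear opN" by (rule M) (use b in auto)
  show "AE s in lborel. rep_l2 (opN x) s = 1 / den s * rep_l2 x s" using M(2)[of x] b by simp
qed

lemma opR_props: "bounded_linear opR" "AE s in lborel. rep_l2 (opR x) s = s / den s * rep_l2 x (- s)"
proof -
  have b: "\<bar>x / den x\<bar> \<le> 1" for x
  proof -
    have "\<bar>x\<bar> \<le> den x"
    proof (cases "\<bar>x\<bar> \<le> 1")
      case True then show ?thesis using den_ge(1)[of x] by linarith
    next
      case False
      then have "\<bar>x\<bar> * 1 \<le> \<bar>x\<bar> * \<bar>x\<bar>" by (intro mult_left_mono) auto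
      then show ?thesis using den_ge(3)[of x] by (simp add: power2_eq_square)
    qed
    then show ?thesis using den_ge(2)[of x] by (simp add: abs_divide)
  qed
  note M = multiplication_operator[where m = "\<lambda>x. x / den x" and C = 1 and c = "-1", folded opR_def]
  show "bounded_linear opR" by (rule M) (use b in auto)
  show "AE s in lborel. rep_l2 (opR x) s = s / den s * rep_l2 x (- s)" using M(2)[of x] b by simp
qed

text \<open>This undoes the conjugation by the weight: \<open>zf x\<close> is the real encoding of V
  itself.\<close>

definition zf :: "l2 \<Rightarrow> real \<Rightarrow> real" where "zf x s = wt s * rep_l2 x s"

lemma zf_sqint: "sqint (zf x)"
proof (rule sqint_bound[OF sqint_rep[of x], where C = 1])
  show "zf x \<in> borel_measurable borel" unfolding zf_def[abs_def] by measurable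
  show "\<bar>zf x s\<bar> \<le> 1 * \<bar>rep_l2 x s\<bar>" for s using wt_props(1,2)[of s] by (simp add: zf_def abs_mult mult_left_le_one_le)
qed

lemma opT_rep: "AE s in lborel. rep_l2 (opT x) s = wt s * (LINT t|lborel. ker (s - t) * zf x t)"
proof -
  have "(LINT t|lborel. wt s * ker (s - t) * wt t * rep_l2 x t) = wt s * (LINT t|lborel. ker (s - t) * zf x t)" for s
    by (subst integral_mult_right_zero[symmetric]) (simp add: zf_def mult_ac)
  then show ?thesis using opT_props(2)[of x] by simp
qed

lemma opT_inner: "opT x \<bullet> y = (LINT s|lborel. zf y s * (LINT t|lborel. ker (s - t) * zf x t))"
proof -
  note [measurable] = conv_sqint(1)[OF ker_props(2) zf_sqint, of x, unfolded sqint_def, THEN conjunct1]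
  have [measurable]: "zf y \<in> borel_measurable borel" for y using zf_sqint by (simp add: sqint_def)
  show ?thesis unfolding inner_l2_def
    by (rule integral_cong_AE) (use opT_rep[of x] in \<open>auto simp: zf_def\<close>)
qed

lemma opT_symmetric: "opT x \<bullet> y = x \<bullet> opT y"
  unfolding inner_commute[of x "opT y"] opT_inner
  by (rule conv_form_symmetric[OF ker_props(2,4) zf_sqint zf_sqint])

lemma opN_inner: "opN x \<bullet> y = (LINT s|lborel. 1 / den s * (rep_l2 x s * rep_l2 y s))"
  unfolding inner_l2_def by (rule integral_cong_AE) (use opN_props(2)[of x] in auto)

lemma opN_symmetric: "opN x \<bullet> y = x \<bullet> opN y"
  unfolding inner_commute[of x "opN y"] opN_inner by (simp add: mult.commute)

lemma weighted_integrable: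
  assumes "m \<in> borel_measurable borel" "\<And>s. \<bar>m s\<bar> \<le> C" shows "integrable lborel (\<lambda>s. m s * (rep_l2 x s)\<^sup>2)"
  using sqint_mult3[OF sqint_rep sqint_rep assms, of x x] by (simp add: power2_eq_square mult_ac)

lemma inv_den_bound: "\<bar>1 / den x\<bar> \<le> 1" using den_ge(1,2)[of x] by simp

lemma opN_le: "opN x \<bullet> x \<le> x \<bullet> x"
proof -
  have "opN x \<bullet> x = (LINT s|lborel. 1 / den s * (rep_l2 x s)\<^sup>2)" by (simp add: opN_inner power2_eq_square)
  also have "\<dots> \<le> (LINT s|lborel. (rep_l2 x s)\<^sup>2)"
  proof (rule integral_mono)
    show "integrable lborel (\<lambda>s. 1 / den s * (rep_l2 x s)\<^sup>2)" by (rule weighted_integrable[OF _ inv_den_bound]) measurable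
    show "integrable lborel (\<lambda>s. (rep_l2 x s)\<^sup>2)" using sqint_rep by (simp add: sqint_def)
    show "1 / den s * (rep_l2 x s)\<^sup>2 \<le> (rep_l2 x s)\<^sup>2" for s
      using mult_right_mono[of "1 / den s" 1 "(rep_l2 x s)\<^sup>2"] den_ge(1,2)[of s] by simp
  qed
  finally show ?thesis by (simp add: inner_l2_def power2_eq_square)
qed

lemma opN_pos: assumes "x \<noteq> 0" shows "0 < opN x \<bullet> x"
proof (rule ccontr)
  have eq: "opN x \<bullet> x = (LINT s|lborel. 1 / den s * (rep_l2 x s)\<^sup>2)" by (simp add: opN_inner power2_eq_square)
  have i: "integrable lborel (\<lambda>s. 1 / den s * (rep_l2 x s)\<^sup>2)" by (rule weighted_integrable[OF _ inv_den_bound]) measurable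
  assume "\<not> ?thesis"
  moreover have "opN x \<bullet> x \<ge> 0" unfolding eq using den_ge(2) by (intro integral_nonneg_AE AE_I2) (simp add: less_imp_le)
  ultimately have "(LINT s|lborel. 1 / den s * (rep_l2 x s)\<^sup>2) = 0" using eq by simp
  then have z: "AE s in lborel. 1 / den s * (rep_l2 x s)\<^sup>2 = 0"
    using den_ge(2) by (subst (asm) integral_nonneg_eq_0_iff_AE[OF i]) (auto simp: less_imp_le)
  have "x = 0"
  proof (rule l2_eqI, use z rep_zero in eventually_elim)
    fix s assume "1 / den s * (rep_l2 x s)\<^sup>2 = 0" "rep_l2 0 s = 0"
    then show "rep_l2 x s = rep_l2 0 s" using den_ge(2)[of s] by simp
  qed
  then show False using assms by simp
qed

lemma form_eq: "(y - opN y + k *\<^sub>R opN y - opT y) \<bullet> y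
  = (LINT s|lborel. (1 - 1 / den s + k / den s) * (rep_l2 y s)\<^sup>2) - (LINT s|lborel. zf y s * (LINT t|lborel. ker (s - t) * zf y t))"
proof -
  have i: "integrable lborel (\<lambda>s. 1 / den s * (rep_l2 y s)\<^sup>2)" "integrable lborel (\<lambda>s. (rep_l2 y s)\<^sup>2)"
    using weighted_integrable[OF _ inv_den_bound, where x = y] sqint_rep[of y] by (auto simp: sqint_def)
  have N: "opN y \<bullet> y = (LINT s|lborel. 1 / den s * (rep_l2 y s)\<^sup>2)" by (simp add: opN_inner power2_eq_square)
  have Y: "y \<bullet> y = (LINT s|lborel. (rep_l2 y s)\<^sup>2)" by (simp add: inner_l2_def power2_eq_square)
  define g where "g s = 1 / den s * (rep_l2 y s)\<^sup>2" for s
  have eq: "(1 - 1 / den s + k / den s) * (rep_l2 y s)\<^sup>2 = (rep_l2 y s)\<^sup>2 - g s + k * g s" for s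
    by (simp add: g_def algebra_simps)
  have "(LINT s|lborel. (1 - 1 / den s + k / den s) * (rep_l2 y s)\<^sup>2) = y \<bullet> y - opN y \<bullet> y + k * (opN y \<bullet> y)"
    using i unfolding N Y eq g_def[symmetric] by simp
  then show ?thesis by (simp add: inner_add_left inner_diff_left opT_inner)
qed

lemma form_bounded_below: "\<exists>kb>0. \<forall>y. 0 \<le> (y - opN y + kb *\<^sub>R opN y - opT y) \<bullet> y"
proof -
  define I where "I = (LINT x|lborel. \<bar>ker x\<bar>)"
  have I0: "I \<ge> 0" by (simp add: I_def)
  \<comment> \<open>The convolution form is at most I times the squared norm. Where |s| powr a \<ge>
    I the symbol alone dominates it; elsewhere s^2 is at most (I powr (1 / a))^2, and the constant
    kb dominates I s^2.\<close>
  define kb where "kb = I * (I powr (1 / a))\<^sup>2 + 1"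
  have kb: "kb > 0" using I0 by (simp add: kb_def add_nonneg_pos)
  have pw: "0 \<le> 1 - 1 / den s + kb / den s - I * (s\<^sup>2 / den s)" for s
  proof -
    have "I * s\<^sup>2 \<le> \<bar>s\<bar> powr a * s\<^sup>2 + kb"
    proof (cases "I \<le> \<bar>s\<bar> powr a")
      case True
      then have "I * s\<^sup>2 \<le> \<bar>s\<bar> powr a * s\<^sup>2" by (intro mult_right_mono) auto
      then show ?thesis using kb by simp
    next
      case False
      then have "(\<bar>s\<bar> powr a) powr (1 / a) \<le> I powr (1 / a)" using a_pos by (intro powr_mono2) auto
      then have "\<bar>s\<bar> \<le> I powr (1 / a)" using a_pos by (simp add: powr_powr)
      then have "s\<^sup>2 \<le> (I powr (1 / a))\<^sup>2" using power_mono[of "\<bar>s\<bar>" "I powr (1 / a)" 2] by simp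
      then have "I * s\<^sup>2 \<le> I * (I powr (1 / a))\<^sup>2" using I0 by (intro mult_left_mono)
      then show ?thesis by (simp add: kb_def add_increasing)
    qed
    then have "0 \<le> den s - 1 + kb - I * s\<^sup>2" using zero_le_power2[of s] unfolding den_def by linarith
    then have "0 \<le> (den s - 1 + kb - I * s\<^sup>2) / den s" by (rule divide_nonneg_pos[OF _ den_ge(2)])
    also have "\<dots> = 1 - 1 / den s + kb / den s - I * (s\<^sup>2 / den s)"
      using den_ge(2)[of s] by (simp add: add_divide_distrib diff_divide_distrib)
    finally show ?thesis .
  qed
  have "0 \<le> (y - opN y + kb *\<^sub>R opN y - opT y) \<bullet> y" for y
  proof -
    have "(LINT s|lborel. zf y s * (LINT t|lborel. ker (s - t) * zf y t)) \<le> I * (LINT s|lborel. (zf y s)\<^sup>2)"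
      unfolding I_def by (rule conv_form_le[OF ker_props(2) zf_sqint])
    also have "\<dots> = (LINT s|lborel. I * (s\<^sup>2 / den s) * (rep_l2 y s)\<^sup>2)"
      by (simp only: zf_def power_mult_distrib wt_props(3) mult.assoc integral_mult_right_zero)
    also have "\<dots> \<le> (LINT s|lborel. (1 - 1 / den s + kb / den s) * (rep_l2 y s)\<^sup>2)"
    proof (rule integral_mono)
      show "integrable lborel (\<lambda>s. I * (s\<^sup>2 / den s) * (rep_l2 y s)\<^sup>2)"
      proof (rule weighted_integrable[where C = I])
        show "\<bar>I * (s\<^sup>2 / den s)\<bar> \<le> I" for s
        proof -
          have "s\<^sup>2 / den s \<le> 1" using den_ge(2,3)[of s] by simp
          then have "I * (s\<^sup>2 / den s) \<le> I * 1" using I0 by (rule mult_left_mono)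
          then show ?thesis using I0 den_ge(2)[of s] by (simp add: abs_mult)
        qed
      qed measurable
      show "integrable lborel (\<lambda>s. (1 - 1 / den s + kb / den s) * (rep_l2 y s)\<^sup>2)"
      proof (rule weighted_integrable[where C = "2 + kb"])
        show "\<bar>1 - 1 / den s + kb / den s\<bar> \<le> 2 + kb" for s
        proof -
          have "0 \<le> 1 / den s" "1 / den s \<le> 1" using den_ge(1,2)[of s] by auto
          moreover have "0 \<le> kb / den s" "kb / den s \<le> kb" using den_ge(1,2)[of s] kb by (auto simp: divide_le_eq less_imp_le mult_left_le)
          ultimately show ?thesis by linarith
        qed
      qed measurable
      show "I * (s\<^sup>2 / den s) * (rep_l2 y s)\<^sup>2 \<le> (1 - 1 / den s + kb / den s) * (rep_l2 y s)\<^sup>2" for s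
        using pw[of s] by (intro mult_right_mono) auto
    qed
    finally show ?thesis unfolding form_eq by simp
  qed
  then show ?thesis using kb by blast
qed

text \<open>For V = q the form at k = 0 would be E - 2 E, with E the weighted square integral of q,
  since convolving \<open>ker\<close> with q gives 2 (1 + |s| powr a) q. The corresponding vector q
  / \<open>wt\<close> is not square integrable near 0. The factors n |s| / (1 + n |s|) remove this
  singularity and tend to 1.\<close>

lemma negative_direction: "\<exists>y. (y - opN y - opT y) \<bullet> y < 0"
proof -
  define V where "V n s = q s * (real n * \<bar>s\<bar> / (1 + real n * \<bar>s\<bar>))" for n s
  define Y where "Y n s = q s * (real n * sqrt (den s) / (1 + real n * \<bar>s\<bar>))" for n s
  have frac: "0 \<le> real n * \<bar>s\<bar> / (1 + real n * \<bar>s\<bar>)" "real n * \<bar>s\<bar> / (1 + real n * \<bar>s\<bar>) \<le> 1" for n s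
    by (auto simp: divide_le_eq add_pos_nonneg)
  have Vle: "\<bar>V n s\<bar> \<le> \<bar>q s\<bar>" for n s
    using frac[of n s] mult_left_le[of "real n * \<bar>s\<bar> / (1 + real n * \<bar>s\<bar>)" "\<bar>q s\<bar>"] by (simp add: V_def abs_mult)
  have qc: "cplx q = (\<lambda>x. complex_of_real (q x))" by (simp add: cplx_def[abs_def])
  have qi: "integrable lborel q" using rapid_integrable[OF q_rapid] by (simp add: qc complex_of_real_integrable_eq)
  have [measurable]: "q \<in> borel_measurable borel" by (rule borel_measurable_continuous_onI[OF q_continuous])
  have [measurable]: "V n \<in> borel_measurable borel" "Y n \<in> borel_measurable borel" for n
    unfolding V_def[abs_def] Y_def[abs_def] by measurable
  have Yeq: "wt s * Y n s = V n s" for n s using den_ge(2)[of s] by (simp add: wt_def Y_def V_def)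
  have qw: "integrable lborel (\<lambda>s. (1 + \<bar>s\<bar> powr a) * (q s)\<^sup>2)"
    using rapid_form_integrable(2,4)[OF q_rapid q_rapid] a_pos by (simp add: distrib_right cplx_def)
  \<comment> \<open>1 - 1 / den is the symbol at k = 0 times the squared weight, so in terms of
    \<open>V n\<close> the multiplication part of the form carries the weight 1 + |s| powr a; it is
    bounded by the same expression for q.\<close>
  have Yq: "(1 - 1 / den s) * (Y n s)\<^sup>2 \<le> (1 + \<bar>s\<bar> powr a) * (q s)\<^sup>2" for n s
  proof -
    have "(1 - 1 / den s) = (1 + \<bar>s\<bar> powr a) * (wt s)\<^sup>2"
      using den_ge(2)[of s] by (simp add: wt_props(3) field_simps) (simp add: den_def algebra_simps)
    then have "(1 - 1 / den s) * (Y n s)\<^sup>2 = (1 + \<bar>s\<bar> powr a) * (V n s)\<^sup>2"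
      unfolding Yeq[symmetric] power_mult_distrib by simp
    also have "\<dots> \<le> (1 + \<bar>s\<bar> powr a) * (q s)\<^sup>2"
      using power_mono[OF Vle[of n s], of 2] by (intro mult_left_mono) (auto simp: add_nonneg_nonneg)
    finally show ?thesis .
  qed
  have Ysq: "sqint (Y n)" for n
  proof -
    have "integrable lborel (\<lambda>s. (real n)\<^sup>2 * (2 * ((1 + \<bar>s\<bar> powr a) * (q s)\<^sup>2)) + (real n)\<^sup>2 * (q s)\<^sup>2 + 2 * ((1 + \<bar>s\<bar> powr a) * (q s)\<^sup>2))"
      using qw rapid_form_integrable(2)[OF q_rapid q_rapid] by (auto simp: cplx_def)
    then have "integrable lborel (\<lambda>s. (Y n s)\<^sup>2)"
    proof (rule Bochner_Integration.integrable_bound)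
      show "AE s in lborel. norm ((Y n s)\<^sup>2) \<le> norm ((real n)\<^sup>2 * (2 * ((1 + \<bar>s\<bar> powr a) * (q s)\<^sup>2)) + (real n)\<^sup>2 * (q s)\<^sup>2 + 2 * ((1 + \<bar>s\<bar> powr a) * (q s)\<^sup>2))"
      proof (intro AE_I2)
        fix s
        let ?p = "(1 + \<bar>s\<bar> powr a) * (q s)\<^sup>2"
        have p: "?p \<ge> 0" by (simp add: add_nonneg_nonneg)
        have "(Y n s)\<^sup>2 = (1 - 1 / den s) * (Y n s)\<^sup>2 + (1 / den s) * (Y n s)\<^sup>2" by (simp add: algebra_simps)
        also have "(1 / den s) * (Y n s)\<^sup>2 = (real n)\<^sup>2 * (q s)\<^sup>2 / (1 + real n * \<bar>s\<bar>)\<^sup>2"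
          using den_ge(2)[of s] by (simp add: Y_def power_mult_distrib power_divide)
        also have "\<dots> \<le> (real n)\<^sup>2 * (q s)\<^sup>2 / 1"
        proof (rule divide_left_mono)
          show "1 \<le> (1 + real n * \<bar>s\<bar>)\<^sup>2" by (rule one_le_power) simp
          then show "0 < (1 + real n * \<bar>s\<bar>)\<^sup>2 * 1" by linarith
        qed simp
        finally have "(Y n s)\<^sup>2 \<le> ?p + (real n)\<^sup>2 * (q s)\<^sup>2" using Yq[of s n] by simp
        also have "\<dots> \<le> (real n)\<^sup>2 * (2 * ?p) + (real n)\<^sup>2 * (q s)\<^sup>2 + 2 * ?p" using p by (simp add: add_increasing)
        finally show "norm ((Y n s)\<^sup>2) \<le> norm ((real n)\<^sup>2 * (2 * ?p) + (real n)\<^sup>2 * (q s)\<^sup>2 + 2 * ?p)" by simp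
      qed
    qed measurable
    then show ?thesis by (simp add: sqint_def)
  qed
  obtain B where B: "\<And>x. \<bar>q x\<bar> \<le> B" using rapid_bounded[OF q_rapid] by (auto simp: qc)
  have B0: "B \<ge> 0" by (rule order_trans[OF abs_ge_zero B])
  define I where "I = (LINT x|lborel. \<bar>ker x\<bar>)"
  define E where "E = (LINT s|lborel. (1 + \<bar>s\<bar> powr a) * (q s)\<^sup>2)"
  have E: "E > 0" unfolding E_def
    by (rule weight_pos[of _ 0]) (use q_0 qw in \<open>auto intro!: continuous_intros continuous_abs_powr a_pos add_nonneg_nonneg\<close>)
  have kq: "(LINT t|lborel. ker (s - t) * q t) = 2 * ((1 + \<bar>s\<bar> powr a) * q s)" for s
  proof -
    have "complex_of_real (LINT t|lborel. ker (s - t) * q t) = (LINT t|lborel. cplx q (s - t) * cplx q t / pi)"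
      by (simp add: ker_def cplx_def flip: integral_complex_of_real)
    also have "\<dots> = 2 * (conv (cplx q) (cplx q) s / (2 * pi))" by (simp add: conv_def)
    also have "\<dots> = complex_of_real (2 * ((1 + \<bar>s\<bar> powr a) * q s))" unfolding q_eq[symmetric] by simp
    finally show ?thesis by (simp only: of_real_eq_iff)
  qed
  have kint: "integrable lborel (\<lambda>t. \<bar>ker (s - t)\<bar>)" for s
    using lborel_integrable_real_affine[of "\<lambda>x. \<bar>ker x\<bar>" "-1" s] ker_props(2) by simp
  have Ish: "(LINT t|lborel. \<bar>ker (s - t)\<bar>) = I" for s
    using lborel_integral_real_affine[of "-1" "\<lambda>x. \<bar>ker x\<bar>" s] by (simp add: I_def)
  have Vlim: "(\<lambda>n. V n s) \<longlonglongrightarrow> q s" if "s \<noteq> 0" for s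
  proof -
    have "(\<lambda>n. real n * \<bar>s\<bar> / (1 + real n * \<bar>s\<bar>)) \<longlonglongrightarrow> 1"
    proof (rule Lim_transform_eventually)
      have "(\<lambda>n. \<bar>s\<bar> / (inverse (real n) + \<bar>s\<bar>)) \<longlonglongrightarrow> \<bar>s\<bar> / (0 + \<bar>s\<bar>)"
        using that by (intro tendsto_intros lim_inverse_n) auto
      then show "(\<lambda>n. \<bar>s\<bar> / (inverse (real n) + \<bar>s\<bar>)) \<longlonglongrightarrow> 1" using that by simp
      show "\<forall>\<^sub>F n in sequentially. \<bar>s\<bar> / (inverse (real n) + \<bar>s\<bar>) = real n * \<bar>s\<bar> / (1 + real n * \<bar>s\<bar>)"
        using eventually_gt_at_top[of 0]
      proof eventually_elim
        case (elim n)
        have "inverse (real n) + \<bar>s\<bar> = (1 + real n * \<bar>s\<bar>) / real n" using elim by (simp add: field_simps)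
        then show ?case by simp
      qed
    qed
    from tendsto_mult[OF tendsto_const this, of "q s"] show ?thesis by (simp add: V_def)
  qed
  \<comment> \<open>Every \<open>V n\<close> vanishes at 0 while q does not, so the convergence
    excludes this point.\<close>
  have ne: "AE s in lborel. s \<noteq> (0 :: real)" by (rule AE_lborel_singleton)
  have inner: "(\<lambda>n. LINT t|lborel. ker (s - t) * V n t) \<longlonglongrightarrow> (LINT t|lborel. ker (s - t) * q t)" for s
  proof (rule integral_dominated_convergence[where w = "\<lambda>t. B * \<bar>ker (s - t)\<bar>"])
    show "AE t in lborel. (\<lambda>n. ker (s - t) * V n t) \<longlonglongrightarrow> ker (s - t) * q t"
      using ne by eventually_elim (intro tendsto_mult tendsto_const Vlim)
    show "AE t in lborel. norm (ker (s - t) * V n t) \<le> B * \<bar>ker (s - t)\<bar>" for n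
      using mult_right_mono[OF order_trans[OF Vle B]] by (intro AE_I2) (simp add: abs_mult mult.commute[of "\<bar>ker _\<bar>"])
  qed (use kint in auto)
  have "(\<lambda>n. LINT s|lborel. V n s * (LINT t|lborel. ker (s - t) * V n t)) \<longlonglongrightarrow> (LINT s|lborel. q s * (LINT t|lborel. ker (s - t) * q t))"
  proof (rule integral_dominated_convergence[where w = "\<lambda>s. \<bar>q s\<bar> * (B * I)"])
    show "AE s in lborel. (\<lambda>n. V n s * (LINT t|lborel. ker (s - t) * V n t)) \<longlonglongrightarrow> q s * (LINT t|lborel. ker (s - t) * q t)"
      using ne by eventually_elim (intro tendsto_mult inner Vlim)
    show "AE s in lborel. norm (V n s * (LINT t|lborel. ker (s - t) * V n t)) \<le> \<bar>q s\<bar> * (B * I)" for n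
    proof (intro AE_I2)
      fix s
      have "\<bar>LINT t|lborel. ker (s - t) * V n t\<bar> \<le> (LINT t|lborel. \<bar>ker (s - t) * V n t\<bar>)" by (rule integral_abs_bound)
      also have "\<dots> \<le> (LINT t|lborel. B * \<bar>ker (s - t)\<bar>)"
      proof (rule integral_mono')
        show "\<bar>ker (s - t) * V n t\<bar> \<le> B * \<bar>ker (s - t)\<bar>" for t
          using mult_right_mono[OF order_trans[OF Vle[of n t] B[of t]], of "\<bar>ker (s - t)\<bar>"] by (simp add: abs_mult mult.commute)
      qed (use kint B0 in auto)
      also have "\<dots> = B * I" by (simp add: Ish)
      finally show "norm (V n s * (LINT t|lborel. ker (s - t) * V n t)) \<le> \<bar>q s\<bar> * (B * I)"
        unfolding real_norm_def abs_mult by (intro mult_mono Vle) auto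
    qed
    show "(\<lambda>s. V n s * (LINT t|lborel. ker (s - t) * V n t)) \<in> borel_measurable lborel" for n
      by (simp add: lborel.borel_measurable_lebesgue_integral)
    show "(\<lambda>s. q s * (LINT t|lborel. ker (s - t) * q t)) \<in> borel_measurable lborel"
      by (simp add: lborel.borel_measurable_lebesgue_integral)
  qed (use qi in auto)
  also have "(LINT s|lborel. q s * (LINT t|lborel. ker (s - t) * q t)) = 2 * E"
    unfolding kq E_def by (subst integral_mult_right_zero[symmetric]) (simp add: power2_eq_square mult_ac)
  \<comment> \<open>The convolution part tends to 2 E while the multiplication part never exceeds E,
    so the form is negative from some n on.\<close>
  finally have "\<forall>\<^sub>F n in sequentially. (LINT s|lborel. V n s * (LINT t|lborel. ker (s - t) * V n t)) > E"
    by (rule order_tendstoD(1)) (use E in simp)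
  then obtain n where n: "(LINT s|lborel. V n s * (LINT t|lborel. ker (s - t) * V n t)) > E"
    by (auto simp: eventually_sequentially)
  define y where "y = abs_l2 (Y n)"
  have yr: "AE s in lborel. rep_l2 y s = Y n s" unfolding y_def by (rule rep_abs_l2[OF Ysq])
  have zy: "AE s in lborel. zf y s = V n s" using yr by eventually_elim (simp add: zf_def Yeq)
  have [measurable]: "zf y \<in> borel_measurable borel" using zf_sqint by (simp add: sqint_def)
  have "(LINT s|lborel. zf y s * (LINT t|lborel. ker (s - t) * zf y t)) = (LINT s|lborel. V n s * (LINT t|lborel. ker (s - t) * V n t))"
  proof -
    have "(LINT t|lborel. ker (s - t) * zf y t) = (LINT t|lborel. ker (s - t) * V n t)" for s
      by (rule integral_cong_AE) (use zy in auto)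
    then have "(LINT s|lborel. zf y s * (LINT t|lborel. ker (s - t) * zf y t)) = (LINT s|lborel. zf y s * (LINT t|lborel. ker (s - t) * V n t))" by simp
    also have "\<dots> = (LINT s|lborel. V n s * (LINT t|lborel. ker (s - t) * V n t))"
      by (rule integral_cong_AE) (use zy in \<open>auto simp: lborel.borel_measurable_lebesgue_integral\<close>)
    finally show ?thesis .
  qed
  moreover have "(LINT s|lborel. (1 - 1 / den s + 0 / den s) * (rep_l2 y s)\<^sup>2) \<le> E"
    unfolding E_def
  proof (rule integral_mono_AE[OF _ qw])
    show "integrable lborel (\<lambda>s. (1 - 1 / den s + 0 / den s) * (rep_l2 y s)\<^sup>2)"
    proof (rule weighted_integrable[where C = 1])
      show "\<bar>1 - 1 / den s + 0 / den s\<bar> \<le> 1" for s using den_ge(1,2)[of s] by simp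
    qed measurable
    show "AE s in lborel. (1 - 1 / den s + 0 / den s) * (rep_l2 y s)\<^sup>2 \<le> (1 + \<bar>s\<bar> powr a) * (q s)\<^sup>2"
      using yr by eventually_elim (use Yq in simp)
  qed
  ultimately have "(y - opN y + 0 *\<^sub>R opN y - opT y) \<bullet> y < 0" unfolding form_eq using n by linarith
  then show ?thesis by (intro exI[of _ y]) simp
qed


text \<open>A solution vector is turned back into a Hermitian V. Multiplied by s^2 the symbol
  becomes \<open>P\<close>, whose real part is at least k; positivity of k thus makes E = V / s^2
  continuous up to 0. Rapid decay is obtained for V from its convolution equation and handed on to
  E.\<close>

lemma pencil_kernel_rapid:
  assumes k: "k > 0" and eq: "x - opN x + k *\<^sub>R opN x + lam *\<^sub>R opR x = opT x"
  obtains E V where "rapid E" "rapid V" "hermitian V" "\<And>s. V s = complex_of_real (s\<^sup>2) * E s"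
    "\<And>s. (complex_of_real (\<bar>s\<bar> powr a * s\<^sup>2 + s\<^sup>2 + k) + \<i> * complex_of_real (lam * s)) * E s = conv (cplx q) V s / pi"
    "AE s in lborel. Re (V s) = (zf x s + zf x (- s)) / 2 \<and> Im (V s) = (zf x s - zf x (- s)) / 2"
proof -
  define Z where "Z = zf x"
  have Zs: "sqint Z" unfolding Z_def by (rule zf_sqint)
  then have [measurable]: "Z \<in> borel_measurable borel" by (simp add: sqint_def)
  have [measurable]: "cplx q \<in> borel_measurable borel" by (rule rapid_borel[OF q_rapid])
  define D where "D s = \<bar>s\<bar> powr a * s\<^sup>2 + s\<^sup>2 + k" for s
  define C where "C s = (LINT t|lborel. ker (s - t) * Z t)" for s
  have Dpos: "D s \<ge> k" for s by (simp add: D_def)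
  have De: "D (- s) = D s" for s by (simp add: D_def)
  \<comment> \<open>The pencil equation multiplied by den s and wt s, which clears all weights and
    leaves the encoded equation times s^2.\<close>
  have Zeq: "AE s in lborel. D s * Z s + lam * s * Z (- s) = s\<^sup>2 * C s"
    using opT_rep[of x] opN_props(2)[of x] opR_props(2)[of x] rep_plus[of "x - opN x + k *\<^sub>R opN x" "lam *\<^sub>R opR x"]
      rep_plus[of "x - opN x" "k *\<^sub>R opN x"] rep_minus[of x "opN x"] rep_scaleR[of k "opN x"] rep_scaleR[of lam "opR x"]
  proof eventually_elim
    case (elim s)
    let ?r = "rep_l2 x"
    have "?r s - 1 / den s * ?r s + k * (1 / den s * ?r s) + lam * (s / den s * ?r (- s)) = wt s * C s"
      using elim unfolding eq by (simp add: C_def Z_def)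
    then have "den s * wt s * (?r s - 1 / den s * ?r s + k * (1 / den s * ?r s) + lam * (s / den s * ?r (- s))) = den s * (wt s)\<^sup>2 * C s"
      by (simp add: power2_eq_square)
    moreover have "den s * (wt s)\<^sup>2 = s\<^sup>2" using den_ge(2)[of s] by (simp add: wt_props(3))
    moreover have "den s * wt s * (?r s - 1 / den s * ?r s + k * (1 / den s * ?r s) + lam * (s / den s * ?r (- s)))
       = (den s - 1 + k) * (wt s * ?r s) + lam * s * (wt s * ?r (- s))"
      using den_ge(2)[of s] by (simp add: field_simps)
    moreover have "den s - 1 + k = D s" by (simp add: D_def den_def)
    ultimately show ?case by (simp add: Z_def zf_def wt_props(4))
  qed
  have Cm[measurable]: "C \<in> borel_measurable borel" using conv_sqint(1)[OF ker_props(2) Zs] by (simp add: sqint_def C_def[abs_def])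
  have Dm[measurable]: "D \<in> borel_measurable borel" unfolding D_def[abs_def] by measurable
  \<comment> \<open>The reflected equation. Combined with coefficients (1 + \<i>) / 2 and (1 - \<i>)
    / 2, the two real equations become the complex one for \<open>V0\<close>.\<close>
  have "AE s in lborel. D (0 + - 1 * s) * Z (0 + - 1 * s) + lam * (0 + - 1 * s) * Z (- (0 + - 1 * s)) = (0 + - 1 * s)\<^sup>2 * C (0 + - 1 * s)"
    by (rule AE_borel_affine[OF _ _ Zeq]) auto
  then have Zeq': "AE s in lborel. D s * Z (- s) - lam * s * Z s = s\<^sup>2 * C (- s)"
    by eventually_elim (simp add: De)
  \<comment> \<open>Each real \<open>Z\<close> corresponds to exactly one such Hermitian function, so a real Hilbert space suffices
    although the term \<open>\<i> * lam / s\<close> of the pencil is not real.\<close>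
  define V0 where "V0 s = Complex ((Z s + Z (- s)) / 2) ((Z s - Z (- s)) / 2)" for s
  have V0_alt: "V0 s = complex_of_real (Z s) * ((1 + \<i>) / 2) + complex_of_real (Z (- s)) * ((1 - \<i>) / 2)" for s
    by (simp add: V0_def complex_eq_iff)
  have V0L: "L2 V0"
  proof -
    have "L2 (\<lambda>s. (1 + \<i>) / 2 * complex_of_real (Z s) + (1 - \<i>) / 2 * complex_of_real (Z (- s)))"
      using Zs sqint_uminus[OF Zs] unfolding sqint_iff_L2 by (intro L2_add L2_scale)
    also have "(\<lambda>s. (1 + \<i>) / 2 * complex_of_real (Z s) + (1 - \<i>) / 2 * complex_of_real (Z (- s))) = V0"
      unfolding V0_alt by (intro ext) (simp only: mult.commute)
    finally show ?thesis .
  qed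
  note [measurable] = L2_D(1)[OF V0L]
  have V0h: "V0 (- s) = cnj (V0 s)" for s by (simp add: V0_def complex_eq_iff field_simps)
  have ci: "integrable lborel (\<lambda>t. ker (s - t) * Z t)" "integrable lborel (\<lambda>t. ker (s - t) * Z (- t))" for s
  proof -
    have "sqint (\<lambda>t. ker (s - t))" using L2_shift[of "\<lambda>x. complex_of_real (ker x)" s] ker_props(3) by (simp add: sqint_iff_L2)
    then show "integrable lborel (\<lambda>t. ker (s - t) * Z t)" "integrable lborel (\<lambda>t. ker (s - t) * Z (- t))"
      by (intro sqint_mult Zs sqint_uminus; assumption)+
  qed
  have C': "(LINT t|lborel. ker (s - t) * Z (- t)) = C (- s)" for s
  proof -
    have "(LINT t|lborel. ker (s - t) * Z (- t)) = (LINT t|lborel. ker (s + t) * Z t)"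
      using lborel_integral_uminus[of "\<lambda>t. ker (s + t) * Z t"] by simp
    also have "\<dots> = C (- s)"
      unfolding C_def
    proof (rule Bochner_Integration.integral_cong[OF refl])
      fix t show "ker (s + t) * Z t = ker (- s - t) * Z t" using ker_props(4)[of "s + t"] by simp
    qed
    finally show ?thesis .
  qed
  have convV0: "conv (cplx q) V0 s / pi = complex_of_real (C s) * ((1 + \<i>) / 2) + complex_of_real (C (- s)) * ((1 - \<i>) / 2)" for s
  proof -
    have "conv (cplx q) V0 s / pi = (LINT t|lborel. complex_of_real (ker (s - t) * Z t) * ((1 + \<i>) / 2) + complex_of_real (ker (s - t) * Z (- t)) * ((1 - \<i>) / 2))"
      unfolding conv_def integral_divide_zero[symmetric]
      by (rule Bochner_Integration.integral_cong[OF refl]) (simp add: V0_alt ker_def cplx_def field_simps)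
    also have "\<dots> = (LINT t|lborel. complex_of_real (ker (s - t) * Z t)) * ((1 + \<i>) / 2) + (LINT t|lborel. complex_of_real (ker (s - t) * Z (- t))) * ((1 - \<i>) / 2)"
      using ci by (subst Bochner_Integration.integral_add)
        (auto intro!: integrable_mult_left simp: complex_of_real_integrable_eq simp del: of_real_mult)
    also have "\<dots> = complex_of_real (C s) * ((1 + \<i>) / 2) + complex_of_real (C (- s)) * ((1 - \<i>) / 2)"
      unfolding integral_complex_of_real C' by (simp add: C_def)
    finally show ?thesis .
  qed
  define P where "P s = complex_of_real (D s) + \<i> * complex_of_real (lam * s)" for s
  have Pne: "P s \<noteq> 0" and Pge: "cmod (P s) \<ge> D s" for s
  proof -
    show "cmod (P s) \<ge> D s" using complex_Re_le_cmod[of "P s"] by (simp add: P_def)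
    have "Re (P s) > 0" using Dpos[of s] k by (simp add: P_def)
    then show "P s \<noteq> 0" by auto
  qed
  \<comment> \<open>E and V are defined through the right side of the equation, which is continuous.
    V is thus a continuous version of \<open>V0\<close>, and the convolution may be formed with
    either.\<close>
  define E where "E s = conv (cplx q) V0 s / pi / P s" for s
  define V where "V s = complex_of_real (s\<^sup>2) * E s" for s
  have VV0: "AE s in lborel. V s = V0 s"
    using Zeq Zeq'
  proof eventually_elim
    case (elim s)
    have "P s * V0 s = complex_of_real (s\<^sup>2) * (complex_of_real (C s) * ((1 + \<i>) / 2) + complex_of_real (C (- s)) * ((1 - \<i>) / 2))"
    proof -
      have "P s * V0 s = complex_of_real (D s * Z s + lam * s * Z (- s)) * ((1 + \<i>) / 2) + complex_of_real (D s * Z (- s) - lam * s * Z s) * ((1 - \<i>) / 2)"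
        by (simp add: P_def V0_alt complex_eq_iff field_simps)
      then show ?thesis unfolding elim by (simp add: algebra_simps)
    qed
    then show ?case using Pne[of s] by (simp add: V_def E_def convV0 field_simps)
  qed
  have Dc: "continuous_on UNIV D" unfolding D_def[abs_def] by (intro continuous_intros continuous_abs_powr a_pos)
  have Pc: "continuous_on UNIV P" unfolding P_def[abs_def] by (intro continuous_intros Dc)
  have cc: "continuous_on UNIV (conv (cplx q) V0)" by (rule conv_continuous_L2[OF q_rapid V0L])
  have Vc: "continuous_on UNIV V"
    unfolding V_def[abs_def] E_def[abs_def] using Pne by (intro continuous_intros cc Pc) auto
  then have [measurable]: "V \<in> borel_measurable borel" by (rule borel_measurable_continuous_onI)
  have convV: "conv (cplx q) V = conv (cplx q) V0"
    unfolding conv_def by (intro ext integral_cong_AE) (use VV0 in auto)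
  \<comment> \<open>The constant k in D and the term with lam only increase |P|. Dropping them
    leaves (1 + |s| powr a) s^2, whose factor s^2 cancels the one in V.\<close>
  have Vb: "(1 + \<bar>s\<bar> powr a) * cmod (V s) \<le> cmod (conv (cplx q) V0 s)" for s
  proof -
    have "(1 + \<bar>s\<bar> powr a) * s\<^sup>2 \<le> cmod (P s)" using Pge[of s] k by (simp add: D_def algebra_simps)
    then have "(1 + \<bar>s\<bar> powr a) * s\<^sup>2 / cmod (P s) \<le> 1" using Pne[of s] by (simp add: divide_le_eq)
    then have "(1 + \<bar>s\<bar> powr a) * s\<^sup>2 / cmod (P s) * (cmod (conv (cplx q) V0 s) / pi) \<le> 1 * (cmod (conv (cplx q) V0 s) / pi)"
      by (intro mult_right_mono) auto
    also have "\<dots> \<le> cmod (conv (cplx q) V0 s) / 1" using pi_gt3 by (simp only: mult_1) (intro divide_left_mono, auto)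
    finally show ?thesis by (simp add: V_def E_def norm_mult norm_divide norm_power mult_ac)
  qed
  obtain B where B: "\<And>s. cmod (V s) \<le> B"
  proof -
    let ?B = "sqrt ((LINT x|lborel. (cmod (cplx q x))\<^sup>2) * (LINT x|lborel. (cmod (V0 x))\<^sup>2))"
    have "cmod (V s) \<le> ?B" for s
    proof -
      have "1 * cmod (V s) \<le> (1 + \<bar>s\<bar> powr a) * cmod (V s)" by (intro mult_right_mono) auto
      also note Vb
      also have "cmod (conv (cplx q) V0 s) \<le> ?B" by (intro real_le_rsqrt conv_bound rapid_L2 q_rapid V0L)
      finally show ?thesis by simp
    qed
    then show ?thesis using that by blast
  qed
  have Vr: "rapid V"
  proof (rule rapid_of_conv_inequality[OF Vc B a_pos, where q = "cplx q" and K = "2 powr a"])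
    show "integrable lborel (\<lambda>y. (1 + \<bar>y\<bar>) ^ n * cmod (cplx q y))" for n by (rule rapid_integrable_weight[OF q_rapid])
    fix s
    have "(1 + \<bar>s\<bar>) powr a * cmod (V s) \<le> (2 powr a * (1 + \<bar>s\<bar> powr a)) * cmod (V s)"
      by (intro mult_right_mono powr_weight_le a_pos) auto
    also have "\<dots> \<le> 2 powr a * cmod (conv (cplx q) V0 s)" unfolding mult.assoc by (intro mult_left_mono Vb) auto
    also have "cmod (conv (cplx q) V0 s) \<le> (LINT y|lborel. cmod (V (s - y)) * cmod (cplx q y))"
    proof -
      have "conv (cplx q) V0 s = (LINT y|lborel. V (s - y) * cplx q y)" 
        using conv_commute[of "cplx q" V s] unfolding convV by (simp only: conv_def[of V])
      then show ?thesis using integral_norm_bound[of lborel "\<lambda>y. V (s - y) * cplx q y"] by (simp add: norm_mult)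
    qed
    finally show "(1 + \<bar>s\<bar>) powr a * cmod (V s) \<le> 2 powr a * (LINT y|lborel. cmod (V (s - y)) * cmod (cplx q y))" by simp
  qed auto
  have Er: "rapid E"
  proof -
    have "rapid (\<lambda>s. (1 / (pi * P s)) * conv (cplx q) V s)"
    proof (rule rapid_mult[OF rapid_conv[OF q_rapid Vr], where K = "1 / k" and m = 0])
      show "continuous_on UNIV (\<lambda>s. 1 / (complex_of_real pi * P s))" using Pne by (intro continuous_intros Pc) auto
      fix s
      have "k \<le> cmod (P s)" using Pge[of s] Dpos[of s] by linarith
      also have "\<dots> \<le> pi * cmod (P s)" using pi_gt3 by (simp add: mult_le_cancel_right1)
      finally show "cmod (1 / (complex_of_real pi * P s)) \<le> 1 / k * (1 + \<bar>s\<bar>) ^ 0"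
        using k by (simp add: norm_divide norm_mult frac_le)
    qed
    then show ?thesis by (simp add: E_def[abs_def] convV divide_divide_eq_left)
  qed
  have Vh: "hermitian V"
    unfolding hermitian_def
  proof
    fix s
    have "cnj (P s) = P (- s)" by (simp add: P_def De)
    moreover have "cnj (conv (cplx q) V0 s / pi) = conv (cplx q) V0 (- s) / pi"
      unfolding convV0 by (simp add: complex_eq_iff)
    ultimately show "V (- s) = cnj (V s)" by (simp add: V_def E_def)
  qed
  show thesis
  proof (rule that[OF Er Vr Vh])
    show "V s = complex_of_real (s\<^sup>2) * E s" for s by (rule V_def)
    show "(complex_of_real (\<bar>s\<bar> powr a * s\<^sup>2 + s\<^sup>2 + k) + \<i> * complex_of_real (lam * s)) * E s = conv (cplx q) V s / pi" for s
      unfolding convV D_def[symmetric] P_def[symmetric] using Pne[of s] by (simp add: E_def)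
    show "AE s in lborel. Re (V s) = (zf x s + zf x (- s)) / 2 \<and> Im (V s) = (zf x s - zf x (- s)) / 2"
      using VV0 by eventually_elim (simp add: V0_def Z_def)
  qed
qed

text \<open>Re V + Im V recovers \<open>zf x\<close>, and the weight is positive away from
  0.\<close>

lemma kernel_nonzero:
  assumes ae: "AE s in lborel. Re (V s) = (zf x s + zf x (- s)) / 2 \<and> Im (V s) = (zf x s - zf x (- s)) / 2"
    and z: "AE s in lborel. V s = 0"
  shows "x = 0"
proof (rule l2_eqI, use ae z rep_zero AE_lborel_singleton[of "0 :: real"] in eventually_elim)
  fix s assume s: "Re (V s) = (zf x s + zf x (- s)) / 2 \<and> Im (V s) = (zf x s - zf x (- s)) / 2" "V s = 0" "rep_l2 0 s = 0" "s \<noteq> 0"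
  then have "zf x s = 0" by simp
  then show "rep_l2 x s = rep_l2 0 s" using s wt_props(5)[of s] by (simp add: zf_def)
qed

text \<open>The constraint of \<open>second_variation\<close> becomes an inner product with a fixed
  vector, so two independent kernel vectors have a combination satisfying it. Passing from Re V to
  \<open>zf x\<close> is harmless because the odd part integrates to 0 against the even function
  F.\<close>

lemma kernel_functional:
  obtains e where "\<And>x V. rapid V \<Longrightarrow> AE s in lborel. Re (V s) = (zf x s + zf x (- s)) / 2 \<and> Im (V s) = (zf x s - zf x (- s)) / 2
     \<Longrightarrow> (LINT s|lborel. (1 + \<bar>s\<bar> powr a) * (q s * Re (V s))) = e \<bullet> x"
proof -
  define F where "F s = (1 + \<bar>s\<bar> powr a) * q s" for s
  have "cplx F = (\<lambda>s. conv (cplx q) (cplx q) s / (2 * pi))" using q_eq by (auto simp: F_def cplx_def)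
  then have Fr: "rapid (cplx F)" using rapid_scale[OF rapid_conv[OF q_rapid q_rapid], of "1 / (2 * pi)"] by simp
  then have Fs: "sqint F" using rapid_L2[OF Fr] by (simp add: sqint_iff_L2 cplx_def[abs_def])
  have Fe: "F (- s) = F s" for s by (simp add: F_def q_even)
  have Gs: "sqint (\<lambda>s. wt s * F s)"
  proof (rule sqint_bound[OF Fs, where C = 1])
    show "(\<lambda>s. wt s * F s) \<in> borel_measurable borel" using Fs by (auto simp: sqint_def)
    show "\<bar>wt s * F s\<bar> \<le> 1 * \<bar>F s\<bar>" for s using wt_props(1,2)[of s] by (simp add: abs_mult mult_left_le_one_le)
  qed
  have [measurable]: "F \<in> borel_measurable borel" using Fs by (simp add: sqint_def)
  show thesis
  proof (rule that[of "abs_l2 (\<lambda>s. wt s * F s)"])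
    fix x V assume V: "rapid V" and ae: "AE s in lborel. Re (V s) = (zf x s + zf x (- s)) / 2 \<and> Im (V s) = (zf x s - zf x (- s)) / 2"
    note [measurable] = rapid_borel[OF V]
    have zm[measurable]: "zf x \<in> borel_measurable borel" using zf_sqint by (simp add: sqint_def)
    have i: "integrable lborel (\<lambda>s. F s * zf x s)" "integrable lborel (\<lambda>s. F s * zf x (- s))"
      by (intro sqint_mult Fs zf_sqint sqint_uminus)+
    have "(LINT s|lborel. (1 + \<bar>s\<bar> powr a) * (q s * Re (V s))) = (LINT s|lborel. F s * Re (V s))" by (simp add: F_def mult.assoc)
    also have "\<dots> = (LINT s|lborel. (F s * zf x s + F s * zf x (- s)) / 2)"
      by (rule integral_cong_AE) (use ae in \<open>auto simp: algebra_simps add_divide_distrib\<close>)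
    also have "\<dots> = ((LINT s|lborel. F s * zf x s) + (LINT s|lborel. F s * zf x (- s))) / 2" using i by simp
    also have "(LINT s|lborel. F s * zf x (- s)) = (LINT s|lborel. F s * zf x s)"
      using lborel_integral_uminus[of "\<lambda>s. F s * zf x s"] by (simp add: Fe)
    also have "((LINT s|lborel. F s * zf x s) + (LINT s|lborel. F s * zf x s)) / 2 = (LINT s|lborel. wt s * F s * rep_l2 x s)"
      by (simp add: zf_def mult_ac)
    also have "\<dots> = abs_l2 (\<lambda>s. wt s * F s) \<bullet> x"
      unfolding inner_l2_def by (rule integral_cong_AE) (use rep_abs_l2[OF Gs] in auto)
    finally show "(LINT s|lborel. (1 + \<bar>s\<bar> powr a) * (q s * Re (V s))) = abs_l2 (\<lambda>s. wt s * F s) \<bullet> x" .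
  qed
qed

lemma kernel_simple:
  assumes k: "k > 0" and x: "x - opN x + k *\<^sub>R opN x = opT x" and y: "y - opN y + k *\<^sub>R opN y = opT y"
    and orth: "x \<bullet> y = 0"
  shows "x = 0 \<or> y = 0"
proof -
  interpret N: bounded_linear opN by (rule opN_props(1))
  interpret T: bounded_linear opT by (rule opT_props(1))
  obtain e where e: "\<And>x V. rapid V \<Longrightarrow> AE s in lborel. Re (V s) = (zf x s + zf x (- s)) / 2 \<and> Im (V s) = (zf x s - zf x (- s)) / 2
     \<Longrightarrow> (LINT s|lborel. (1 + \<bar>s\<bar> powr a) * (q s * Re (V s))) = e \<bullet> x"
    using kernel_functional by blast
  have zero: "z = 0" if z: "z - opN z + k *\<^sub>R opN z = opT z" and ez: "e \<bullet> z = 0" for z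
  proof -
    have "z - opN z + k *\<^sub>R opN z + 0 *\<^sub>R opR z = opT z" using z by simp
    from pencil_kernel_rapid[OF k this] obtain E V where EV: "rapid E" "rapid V" "hermitian V" "\<And>s. V s = complex_of_real (s\<^sup>2) * E s"
      "\<And>s. (complex_of_real (\<bar>s\<bar> powr a * s\<^sup>2 + s\<^sup>2 + k) + \<i> * complex_of_real (0 * s)) * E s = conv (cplx q) V s / pi"
      "AE s in lborel. Re (V s) = (zf z s + zf z (- s)) / 2 \<and> Im (V s) = (zf z s - zf z (- s)) / 2" by blast
    have "(LINT s|lborel. (1 + \<bar>s\<bar> powr a) * (q s * Re (V s))) = 0" using e[OF EV(2,6)] ez by simp
    from second_variation[OF EV(2,3) this]
    have le: "Re (LINT s|lborel. conv (cplx q) V s * cnj (V s)) / pi \<le> (LINT s|lborel. (1 + \<bar>s\<bar> powr a) * (cmod (V s))\<^sup>2)" .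
    have ci: "integrable lborel (\<lambda>s. conv (cplx q) V s * cnj (V s))"
      by (intro L2_mult_integrable L2_cnj rapid_L2 rapid_conv q_rapid EV)
    have wi: "integrable lborel (\<lambda>s. (1 + \<bar>s\<bar> powr a) * (cmod (V s))\<^sup>2)"
      using rapid_form_integrable(2,4)[OF EV(2) EV(2)] a_pos by (simp add: distrib_right)
    \<comment> \<open>The kernel equation multiplied by cnj V. With V = s^2 E the term k E cnj V
      becomes k s^2 |E|^2, the surplus that contradicts the second variation unless E vanishes
      almost everywhere.\<close>
    have pw: "Re (conv (cplx q) V s * cnj (V s)) / pi = (1 + \<bar>s\<bar> powr a) * (cmod (V s))\<^sup>2 + k * s\<^sup>2 * (cmod (E s))\<^sup>2" for s
    proof -
      have "conv (cplx q) V s / pi * cnj (V s) = complex_of_real ((\<bar>s\<bar> powr a * s\<^sup>2 + s\<^sup>2 + k) * s\<^sup>2) * (E s * cnj (E s))"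
        unfolding EV(5)[symmetric] EV(4) by simp
      also have "E s * cnj (E s) = complex_of_real ((cmod (E s))\<^sup>2)" by (rule complex_norm_square[symmetric])
      finally have "Re (conv (cplx q) V s / pi * cnj (V s)) = (\<bar>s\<bar> powr a * s\<^sup>2 + s\<^sup>2 + k) * s\<^sup>2 * (cmod (E s))\<^sup>2"
        by (simp only: of_real_mult[symmetric] Re_complex_of_real)
      moreover have "(cmod (V s))\<^sup>2 = s\<^sup>2 * s\<^sup>2 * (cmod (E s))\<^sup>2" by (simp add: EV(4) norm_mult power_mult_distrib power2_eq_square)
      moreover have "Re (conv (cplx q) V s / pi * cnj (V s)) = Re (conv (cplx q) V s * cnj (V s)) / pi"
        using Re_divide_of_real[of "conv (cplx q) V s * cnj (V s)" pi] by simp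
      ultimately show ?thesis by (simp add: algebra_simps)
    qed
    have ki: "integrable lborel (\<lambda>s. k * s\<^sup>2 * (cmod (E s))\<^sup>2)"
    proof -
      have "integrable lborel (\<lambda>s. Re (conv (cplx q) V s * cnj (V s)) / pi - (1 + \<bar>s\<bar> powr a) * (cmod (V s))\<^sup>2)"
        using ci wi by (intro Bochner_Integration.integrable_diff integrable_divide_zero integrable_Re) auto
      then show ?thesis unfolding pw by simp
    qed
    have "Re (LINT s|lborel. conv (cplx q) V s * cnj (V s)) / pi = (LINT s|lborel. Re (conv (cplx q) V s * cnj (V s)) / pi)"
      by (simp only: integral_divide_zero integral_Re[OF ci])
    also have "\<dots> = (LINT s|lborel. (1 + \<bar>s\<bar> powr a) * (cmod (V s))\<^sup>2) + (LINT s|lborel. k * s\<^sup>2 * (cmod (E s))\<^sup>2)"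
      unfolding pw by (rule Bochner_Integration.integral_add[OF wi ki])
    finally have "(LINT s|lborel. k * s\<^sup>2 * (cmod (E s))\<^sup>2) \<le> 0" using le by simp
    moreover have "(LINT s|lborel. k * s\<^sup>2 * (cmod (E s))\<^sup>2) \<ge> 0" using k by (intro integral_nonneg_AE AE_I2) auto
    ultimately have "(LINT s|lborel. k * s\<^sup>2 * (cmod (E s))\<^sup>2) = 0" by simp
    then have "AE s in lborel. k * s\<^sup>2 * (cmod (E s))\<^sup>2 = 0"
      using k by (subst (asm) integral_nonneg_eq_0_iff_AE[OF ki]) auto
    then have "AE s in lborel. V s = 0" by eventually_elim (use k in \<open>auto simp: EV(4)\<close>)
    then show "z = 0" by (rule kernel_nonzero[OF EV(6)])
  qed
  \<comment> \<open>Coefficients, not both 0, of a combination orthogonal to e. Orthogonality of x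
    and y turns the vanishing of this combination into the vanishing of x or of y.\<close>
  define \<alpha> \<beta> where "\<alpha> = (if e \<bullet> x = 0 then 1 else - (e \<bullet> y))" and "\<beta> = (if e \<bullet> x = 0 then 0 else e \<bullet> x)"
  define z where "z = \<alpha> *\<^sub>R x + \<beta> *\<^sub>R y"
  have "z = 0"
  proof (rule zero)
    show "e \<bullet> z = 0" by (simp add: z_def \<alpha>_def \<beta>_def inner_add_right)
    have "z - opN z + k *\<^sub>R opN z = \<alpha> *\<^sub>R (x - opN x + k *\<^sub>R opN x) + \<beta> *\<^sub>R (y - opN y + k *\<^sub>R opN y)"
      by (simp add: z_def N.add N.scaleR algebra_simps)
    then show "z - opN z + k *\<^sub>R opN z = opT z" unfolding x y by (simp add: z_def T.add T.scaleR)
  qed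
  then have "z \<bullet> x = 0" "z \<bullet> y = 0" by auto
  then have "\<alpha> * (x \<bullet> x) = 0" "\<beta> * (y \<bullet> y) = 0" using orth by (auto simp: z_def inner_add_left inner_commute[of y x])
  moreover have "\<alpha> \<noteq> 0 \<or> \<beta> \<noteq> 0" by (auto simp: \<alpha>_def \<beta>_def)
  ultimately show ?thesis by auto
qed

lemma unstable_pencil:
  "\<exists>lam>0. \<exists>k>0. \<exists>x. x \<noteq> 0 \<and> x - opN x + k *\<^sub>R opN x + lam *\<^sub>R opR x = opT x"
proof -
  obtain y0 where y0: "(y0 - opN y0 - opT y0) \<bullet> y0 < 0" using negative_direction by blast
  obtain kb where kb: "kb > 0" "\<And>y. 0 \<le> (y - opN y + kb *\<^sub>R opN y - opT y) \<bullet> y" using form_bounded_below by blast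
  show ?thesis
    by (rule perturbed_pencil_kernel[OF opT_props(1) opN_props(1) opR_props(1) opT_props(3) opT_symmetric opN_symmetric
      opN_pos opN_le y0 kb kernel_simple])
qed

end


section \<open>Rescaling to speed c and construction of the eigenfunction\<close>

lemma inv_fourier_dilate:
  assumes s: "s > 0"
  shows "inv_fourier (\<lambda>\<xi>. f (\<xi> / s)) x = s * inv_fourier f (s * x)"
proof -
  have "fourier (\<lambda>\<xi>. f (\<xi> / s)) (- x) = \<bar>s\<bar> *\<^sub>R (LINT \<xi>|lborel. f ((0 + s * \<xi>) / s) * cis (- ((0 + s * \<xi>) * (- x))))"
    unfolding fourier_def by (rule lborel_integral_real_affine) (use s in simp)
  also have "\<dots> = s * fourier f (- (s * x))"
    using s by (simp add: fourier_def scaleR_conv_of_real mult_ac)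
  finally show ?thesis by (simp add: inv_fourier_def)
qed

lemma conv_dilate:
  assumes s: "s > 0"
  shows "conv (\<lambda>\<xi>. f (\<xi> / s)) (\<lambda>\<xi>. g (\<xi> / s)) x = s * conv f g (x / s)"
proof -
  have "conv (\<lambda>\<xi>. f (\<xi> / s)) (\<lambda>\<xi>. g (\<xi> / s)) x = \<bar>s\<bar> *\<^sub>R (LINT y|lborel. f ((x - (0 + s * y)) / s) * g ((0 + s * y) / s))"
    unfolding conv_def by (rule lborel_integral_real_affine) (use s in simp)
  then show ?thesis using s by (simp add: conv_def scaleR_conv_of_real diff_divide_distrib)
qed

lemma conv_scale: "conv (\<lambda>\<xi>. b * f \<xi>) (\<lambda>\<xi>. d * g \<xi>) x = b * d * conv f g x"
  unfolding conv_def by (subst integral_mult_right_zero[symmetric]) (simp add: mult_ac)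

lemma dx_rapid: "rapid V \<Longrightarrow> rapid (\<lambda>\<xi>. dx_sym \<xi> * V \<xi>)"
  by (rule rapid_mult[where K = 1 and m = 1]) (auto simp: dx_sym_def norm_mult intro!: continuous_intros)

lemma mult_op_inv_fourier: "rapid V \<Longrightarrow> rapid (\<lambda>\<xi>. m \<xi> * V \<xi>) \<Longrightarrow> mult_op m (inv_fourier V) (inv_fourier (\<lambda>\<xi>. m \<xi> * V \<xi>))"
  unfolding mult_op_def using is_FT_rapid by blast

lemma (in ground_wave) transverse_eig_exists:
  assumes c: "c > 0"
  shows "\<exists>lam :: complex. \<exists>k :: real. \<exists>w. 0 < Re lam \<and> k \<noteq> 0 \<and> \<not> (AE x in lborel. w x = 0) \<and> transverse_eig a Q c lam k w"
proof -
  obtain lam k x where lk: "lam > 0" "k > 0" "x \<noteq> 0" "x - opN x + k *\<^sub>R opN x + lam *\<^sub>R opR x = opT x"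
    using unstable_pencil by blast
  from pencil_kernel_rapid[OF lk(2,4)] obtain E V where EV: "rapid E" "rapid V" "hermitian V" "\<And>s. V s = complex_of_real (s\<^sup>2) * E s"
    "\<And>s. (complex_of_real (\<bar>s\<bar> powr a * s\<^sup>2 + s\<^sup>2 + k) + \<i> * complex_of_real (lam * s)) * E s = conv (cplx q) V s / pi"
    "AE s in lborel. Re (V s) = (zf x s + zf x (- s)) / 2 \<and> Im (V s) = (zf x s - zf x (- s)) / 2" by blast
  \<comment> \<open>Q_c is a multiple of Q dilated by s, so frequencies scale as \<xi> = s z and
    |\<xi>| powr a equals c |z| powr a.\<close>
  define s where "s = c powr (1 / a)"
  have s: "s > 0" "s powr a = c" using c a_pos by (auto simp: s_def powr_powr)
  define Es where "Es \<xi> = E (\<xi> / s)" for \<xi>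
  have Es: "rapid Es" using rapid_dilate[OF EV(1), of "1 / s"] s by (simp add: Es_def[abs_def])
  \<comment> \<open>The transform of w has to be that of its derivative divided by \<i> \<xi>. As V
    is s^2 E in its own variable, the quotient is a multiple of \<xi> E and has no singularity at
    0.\<close>
  define W where "W \<xi> = - \<i> * complex_of_real \<xi> * Es \<xi>" for \<xi>
  have W: "rapid W"
    using rapid_scale[OF dx_rapid[OF Es], of "- 1"] by (simp add: W_def[abs_def] dx_sym_def[abs_def])
  define V1 where "V1 \<xi> = dx_sym \<xi> * W \<xi>" for \<xi>
  have V1: "rapid V1" unfolding V1_def by (rule dx_rapid[OF W])
  have V1_eq: "V1 \<xi> = complex_of_real (s\<^sup>2) * V (\<xi> / s)" for \<xi>
    using s by (simp add: V1_def W_def dx_sym_def Es_def EV(4) power_divide power2_eq_square algebra_simps)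
  define V2 where "V2 \<xi> = Dpow_sym a \<xi> * V1 \<xi>" for \<xi>
  have V2: "rapid V2" unfolding V2_def by (rule Dpow_rapid[OF V1 a_pos])
  \<comment> \<open>The transform of \<open>Qc\<close>: amplitude 2 c, and 1 / s from the
    dilation.\<close>
  define qc where "qc \<xi> = complex_of_real (2 * c / s) * cplx q (\<xi> / s)" for \<xi>
  have qs: "rapid (\<lambda>\<xi>. cplx q (\<xi> / s))" using rapid_dilate[OF q_rapid, of "1 / s"] s by simp
  have qc: "rapid qc" unfolding qc_def by (rule rapid_scale[OF qs])
  have Qc: "cplx (Qc a Q c) y = inv_fourier qc y" for y
  proof -
    have "inv_fourier qc y = complex_of_real (2 * c / s) * inv_fourier (\<lambda>\<xi>. cplx q (\<xi> / s)) y"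
      by (simp add: qc_def inv_fourier_def fourier_def mult.assoc)
    also have "inv_fourier (\<lambda>\<xi>. cplx q (\<xi> / s)) y = s * cplx Q (s * y)" unfolding Q_inv by (rule inv_fourier_dilate[OF s(1)])
    finally show ?thesis using s by (simp add: Qc_def cplx_def s_def)
  qed
  define G where "G \<xi> = V2 \<xi> + complex_of_real c * V1 \<xi> - conv qc V1 \<xi> / (2 * pi)" for \<xi>
  have cv: "rapid (conv qc V1)" by (rule rapid_conv[OF qc V1])
  have G: "rapid G"
    unfolding G_def using rapid_diff[OF rapid_add[OF V2 rapid_scale[OF V1]] rapid_scale[OF cv, of "1 / (2 * pi)"]] by simp
  \<comment> \<open>The equation for E replaces the convolution. The contributions of |\<xi>| powr a
    + c cancel, and only the terms with k and lam are left.\<close>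
  have G_eq: "G \<xi> = - complex_of_real (c * s\<^sup>2) * (complex_of_real k + \<i> * complex_of_real (lam * \<xi> / s)) * Es \<xi>" for \<xi>
  proof -
    define z where "z = \<xi> / s"
    have xz: "\<xi> = s * z" using s by (simp add: z_def)
    have xa: "\<bar>\<xi>\<bar> powr a = c * \<bar>z\<bar> powr a" using s by (simp add: xz abs_mult powr_mult)
    have "conv qc V1 \<xi> = complex_of_real (2 * c / s) * complex_of_real (s\<^sup>2) * conv (\<lambda>\<xi>. cplx q (\<xi> / s)) (\<lambda>\<xi>. V (\<xi> / s)) \<xi>"
      unfolding qc_def[abs_def] V1_eq[abs_def] by (rule conv_scale)
    also have "\<dots> = complex_of_real (2 * c * s\<^sup>2) * conv (cplx q) V z"
      unfolding conv_dilate[OF s(1)] z_def using s by simp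
    finally have "conv qc V1 \<xi> / (2 * pi) = complex_of_real (c * s\<^sup>2) * (conv (cplx q) V z / pi)" by simp
    also have "conv (cplx q) V z / pi = (complex_of_real (\<bar>z\<bar> powr a * z\<^sup>2 + z\<^sup>2 + k) + \<i> * complex_of_real (lam * z)) * E z"
      by (rule EV(5)[symmetric])
    finally have 1: "conv qc V1 \<xi> / (2 * pi) = complex_of_real (c * s\<^sup>2) * ((complex_of_real (\<bar>z\<bar> powr a * z\<^sup>2 + z\<^sup>2 + k) + \<i> * complex_of_real (lam * z)) * E z)" .
    have 2: "V1 \<xi> = complex_of_real (s\<^sup>2 * z\<^sup>2) * E z" by (simp add: V1_eq EV(4) z_def)
    have 3: "V2 \<xi> = complex_of_real (c * \<bar>z\<bar> powr a) * V1 \<xi>" by (simp add: V2_def Dpow_sym_def xa)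
    have 4: "lam * \<xi> / s = lam * z" by (simp add: z_def)
    show ?thesis unfolding G_def 1 3 unfolding 2 4 Es_def z_def[symmetric] by (simp add: algebra_simps)
  qed
  define w w1 w2 g where "w = inv_fourier W" and "w1 = inv_fourier V1" and "w2 = inv_fourier V2"
    and "g = (\<lambda>x. w2 x + complex_of_real c * w1 x - cplx (Qc a Q c) x * w1 x)"
  have g: "g = inv_fourier G"
  proof
    fix y
    have i: "integrable lborel V1" "integrable lborel V2" "integrable lborel (conv qc V1)" "integrable lborel qc"
      by (intro rapid_integrable V1 V2 cv qc)+
    have "inv_fourier G y = inv_fourier (\<lambda>\<xi>. (V2 \<xi> + complex_of_real c * V1 \<xi>) + (- 1 / (2 * pi)) * conv qc V1 \<xi>) y"
      by (simp add: G_def[abs_def])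
    also have "\<dots> = inv_fourier V2 y + complex_of_real c * inv_fourier V1 y + (- 1 / (2 * pi)) * inv_fourier (conv qc V1) y"
      using i by (subst inv_fourier_add) (auto simp: inv_fourier_add)
    also have "(- 1 / (2 * pi)) * inv_fourier (conv qc V1) y = - (inv_fourier qc y * inv_fourier V1 y)"
      by (simp add: inv_fourier_mult[OF i(4,1)])
    finally show "g y = inv_fourier G y" by (simp add: g_def w1_def w2_def Qc)
  qed
  \<comment> \<open>Read off from \<open>G_eq\<close> after multiplication by \<i> \<xi>: the term
    with lam becomes c s lam times the transform of the derivative of w, the term with k becomes c
    s^2 k times the transform of w. Hence \<kappa> is the square root of c s^2 k.\<close>
  define \<Lambda> where "\<Lambda> = complex_of_real (c * s * lam)"
  define \<kappa> where "\<kappa> = s * sqrt (c * k)"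
  have \<kappa>: "\<kappa> \<noteq> 0" "\<kappa>\<^sup>2 = c * s\<^sup>2 * k" using s c lk by (auto simp: \<kappa>_def power_mult_distrib)
  define g' where "g' = inv_fourier (\<lambda>\<xi>. dx_sym \<xi> * G \<xi>)"
  have eqn: "\<Lambda> * (- w1 y) = - g' y + complex_of_real (\<kappa>\<^sup>2) * w y" for y
  proof -
    have i: "integrable lborel V1" "integrable lborel W" "integrable lborel (\<lambda>\<xi>. dx_sym \<xi> * G \<xi>)"
      by (intro rapid_integrable V1 W dx_rapid G)+
    have "\<Lambda> * V1 \<xi> + complex_of_real (\<kappa>\<^sup>2) * W \<xi> = dx_sym \<xi> * G \<xi>" for \<xi>
      using s(1) unfolding G_eq V1_def W_def \<Lambda>_def \<kappa>(2) dx_sym_def by (simp add: field_simps power2_eq_square)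
    then have "g' y = inv_fourier (\<lambda>\<xi>. \<Lambda> * V1 \<xi> + complex_of_real (\<kappa>\<^sup>2) * W \<xi>) y" by (simp add: g'_def)
    also have "\<dots> = inv_fourier (\<lambda>\<xi>. \<Lambda> * V1 \<xi>) y + complex_of_real (\<kappa>\<^sup>2) * inv_fourier W y"
      using i by (subst inv_fourier_add) auto
    also have "inv_fourier (\<lambda>\<xi>. \<Lambda> * V1 \<xi>) y = \<Lambda> * inv_fourier V1 y" by (simp add: inv_fourier_def fourier_def mult.assoc)
    finally show ?thesis by (simp add: w_def w1_def)
  qed
  have "transverse_eig a Q c \<Lambda> \<kappa> w"
    unfolding transverse_eig_def
  proof (intro conjI exI)
    show "Hsob (2 + a) w" unfolding w_def by (rule Hsob_rapid[OF W])
    show "mult_op dx_sym w w1"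
      unfolding w_def w1_def V1_def[abs_def] by (rule mult_op_inv_fourier[OF W dx_rapid[OF W]])
    show "mult_op (Dpow_sym a) w1 w2"
      unfolding w1_def w2_def V2_def[abs_def] by (rule mult_op_inv_fourier[OF V1 Dpow_rapid[OF V1 a_pos]])
    show "g = (\<lambda>x. w2 x + complex_of_real c * w1 x - cplx (Qc a Q c) x * w1 x)" by (rule g_def)
    show "mult_op dx_sym g g'" unfolding g g'_def by (rule mult_op_inv_fourier[OF G dx_rapid[OF G]])
    show "AE x in lborel. \<Lambda> * - w1 x = - g' x + complex_of_real (\<kappa>\<^sup>2) * w x" using eqn by simp
  qed
  moreover have "\<not> (AE x in lborel. w x = 0)"
  proof
    assume "AE x in lborel. w x = 0"
    then have "AE \<xi> in lborel. W \<xi> = 0" unfolding w_def by (rule is_FT_zero_right[OF is_FT_rapid[OF W]])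
    then have W0: "W = (\<lambda>_. 0)" by (intro continuous_AE_eq rapid_continuous W continuous_on_const)
    have "V \<xi> = 0" for \<xi>
      using fun_cong[OF W0, of "s * \<xi>"] s by (auto simp: W_def Es_def EV(4))
    then have "x = 0" by (intro kernel_nonzero[OF EV(6)]) simp
    then show False using lk(3) by simp
  qed
  moreover have "0 < Re \<Lambda>" using c s lk by (simp add: \<Lambda>_def)
  ultimately show ?thesis using \<kappa>(1) by blast
qed

theorem theorem1p2:
  fixes a c :: real and Q :: "real \<Rightarrow> real"
  assumes "1/3 < a" and "a < 2" and "0 < c"
    and "ground_state a Q"
  shows "\<exists>lam :: complex. \<exists>k :: real. \<exists>w :: real \<Rightarrow> complex.
           0 < Re lam \<and> k \<noteq> 0 \<and> \<not> (AE x in lborel. w x = 0) \<and>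
           transverse_eig a Q c lam k w"
proof -
  obtain q where "ground_wave a Q q" using ground_state_wave[OF assms(1,4)] by blast
  then show ?thesis using assms(3) by (rule ground_wave.transverse_eig_exists)
qed

end
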